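(* Let $n$ be a non-negative integer. If $F:\mathcal{J}^{\mathbf R}\to C_2\mathsf{Top}_*$ is a fibrant functor in the cofree model for calculus with Reality, then there is a levelwise weak equivalence of orthogonal functors $$c^*(T_n^{\mathbf R}F)^{C_2}\longrightarrow T_n^{\mathbf O}(c^*F^{C_2}).$$
   Context: Spaces are based compactly generated weak Hausdorff. $\mathcal{J}^{\mathbf O}$ is the topological category of finite-dimensional real inner product subspaces of $\mathbb{R}^\infty$ and linear isometries (disjoint basepoint added to morphism spaces); an orthogonal functor is a continuous functor $\mathcal{J}^{\mathbf O}\to\mathsf{Top}_*$. $\mathcal{J}^{\mathbf R}$ is the analogous category of finite-dimensional complex inner product subspaces of $\mathbb{C}\otimes\mathbb{R}^\infty$, enriched in based $C_2$-spaces with $C_2$ acting by complex conjugation; the inputs of calculus with Reality are the $C_2$-equivariant continuous functors $\mathcal{J}^{\mathbf R}\to C_2\mathsf{Top}_*$. Complexification gives a functor $c:\mathcal{J}^{\mathbf O}\to\mathcal{J}^{\mathbf R}$, $V\mapsto V_{\mathbb C}=\mathbb{C}\otimes V$, and $c^*F^{C_2}$ denotes the orthogonal functor $V\mapsto F(V_{\mathbb C})^{C_2}$. The cofree model structure on $C_2\mathsf{Top}_*$ has as weak equivalences the underlying weak equivalences and as cofibrations those of the fine model structure (weak equivalences and fibrations detected on all fixed points); its fibrant objects are the cofree $C_2$-spaces, those $X$ for which $X^{C_2}\to X^{hC_2}=\mathsf{Map}_*((EC_2)_+,X)^{C_2}$ is a weak equivalence. A fibrant functor in the cofree model is one that is fibrant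 in the projective model structure on functors into $C_2\mathsf{Top}_*^{\mathsf{cofree}}$, i.e. levelwise cofree. $\mathbf{O}_{\le n+1}$ is the topological poset of non-zero subspaces of $\mathbb{R}^{n+1}$; $\mathbf{R}_{\le n+1}$ is the topological poset of non-zero subspaces of $\mathbb{C}\otimes\mathbb{R}^{n+1}$ of the form $U_{\mathbb C}=\mathbb{C}\otimes U$ with $U\in\mathbf{O}_{\le n+1}$. Put $\tau_n^{\mathbf O}E(V)=\operatorname{holim}_{U\in\mathbf{O}_{\le n+1}}E(V\oplus U)$, $\tau_n^{\mathbf R}F(V)=\operatorname{holim}_{U_{\mathbb C}\in\mathbf{R}_{\le n+1}}F(V\oplus U_{\mathbb C})$, and let $T_n$ be the sequential homotopy colimit of $\mathrm{Id}\to\tau_n\to(\tau_n)^2\to\cdots$ (in either calculus). *)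

theory Defs
  imports "HOL-Homology.Simplices" "HOL-Library.Function_Algebras"
begin

section \<open>Spaces\<close>

text \<open>The final topology on the image of \<open>f\<close>. For injective \<open>f\<close> this is transport of structure.\<close>

definition final_topology :: "('a \<Rightarrow> 'b) \<Rightarrow> 'a topology \<Rightarrow> 'b topology" where
  "final_topology f X =
     topology (\<lambda>U. U \<subseteq> f ` topspace X \<and> openin X {x \<in> topspace X. f x \<in> U})"

lemma openin_final_topology:
  "openin (final_topology f X) U \<longleftrightarrow>
     U \<subseteq> f ` topspace X \<and> openin X {x \<in> topspace X. f x \<in> U}"
proof -
  have 1: "{x \<in> topspace X. f x \<in> S \<inter> T} = {x \<in> topspace X. f x \<in> S} \<inter> {x \<in> topspace X. f x \<in> T}" for S T
    by auto
  have 2: "{x \<in> topspace X. f x \<in> \<Union>\<K>} = (\<Union>K\<in>\<K>. {x \<in> topspace X. f x \<in> K})" for \<K>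
    by auto
  have "istopology (\<lambda>U. U \<subseteq> f ` topspace X \<and> openin X {x \<in> topspace X. f x \<in> U})"
    unfolding istopology_def 1 2 by (auto intro: openin_Union)
  then show ?thesis by (simp add: final_topology_def)
qed

text \<open>
  Weak Hausdorff: images of compact Hausdorff spaces are closed. HOL cannot quantify over all
  types here, but test spaces on \<open>'a set set\<close> suffice: given \<open>u : K \<rightarrow> X\<close>, choose one point of
  \<open>K\<close> over each point of \<open>u(K)\<close> and let \<open>L\<close> be the closure of the set of chosen points. Then \<open>L\<close>
  is compact Hausdorff with \<open>u(L) = u(K)\<close>, and \<open>L\<close> embeds in \<open>'a set set\<close> because a point of \<open>L\<close> is
  determined by the subsets of the dense set of chosen points having it in their closure.
\<close>

definition weak_Hausdorff :: "'a topology \<Rightarrow> bool" where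
  "weak_Hausdorff X \<longleftrightarrow>
     (\<forall>(K :: 'a set set topology) u.
        compact_space K \<and> Hausdorff_space K \<and> continuous_map K X u \<longrightarrow> closedin X (u ` topspace K))"

text \<open>
  The compactly generated refinement, only used for weak Hausdorff \<open>X\<close>. There the image of a test
  map is itself a compact Hausdorff subspace of \<open>X\<close>, so test spaces on \<open>'a set set\<close> again suffice.
  (The library's \<open>kification\<close> tests against all compact subspaces, Hausdorff or not, which
  is a different notion for weak Hausdorff spaces.)
\<close>

definition kify :: "'a topology \<Rightarrow> 'a topology" where
  "kify X = topology (\<lambda>U. U \<subseteq> topspace X \<and>
     (\<forall>(K :: 'a set set topology) u.
        compact_space K \<and> Hausdorff_space K \<and> continuous_map K X u \<longrightarrow>
          openin K {z \<in> topspace K. u z \<in> U}))"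

lemma openin_kify:
  fixes X :: "'a topology"
  shows "openin (kify X) U \<longleftrightarrow> U \<subseteq> topspace X \<and>
     (\<forall>(K :: 'a set set topology) u.
        compact_space K \<and> Hausdorff_space K \<and> continuous_map K X u \<longrightarrow>
          openin K {z \<in> topspace K. u z \<in> U})"
proof -
  have 1: "{x \<in> topspace K. f x \<in> S \<inter> T} = {x \<in> topspace K. f x \<in> S} \<inter> {x \<in> topspace K. f x \<in> T}"
    for S T :: "'a set" and K :: "'a set set topology" and f
    by auto
  have 2: "{x \<in> topspace K. f x \<in> \<Union>\<K>} = (\<Union>S\<in>\<K>. {x \<in> topspace K. f x \<in> S})"
    for \<K> :: "'a set set" and K :: "'a set set topology" and f
    by auto
  have "istopology (\<lambda>U. U \<subseteq> topspace X \<and>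
     (\<forall>(K :: 'a set set topology) u.
        compact_space K \<and> Hausdorff_space K \<and> continuous_map K X u \<longrightarrow>
          openin K {z \<in> topspace K. u z \<in> U}))"
    unfolding istopology_def 1 2 by (auto intro!: openin_Union)
  then show ?thesis by (simp add: kify_def)
qed

definition cgwh_space :: "'a topology \<Rightarrow> bool" where
  "cgwh_space X \<longleftrightarrow> weak_Hausdorff X \<and> kify X = X"

text \<open>The compact-open topology (for Hausdorff \<open>X\<close>) and the internal function space.\<close>

definition compact_open :: "'a topology \<Rightarrow> 'b topology \<Rightarrow> ('a \<Rightarrow> 'b) topology" where
  "compact_open X Y = topology_generated_by
     {{f \<in> extensional (topspace X). continuous_map X Y f \<and> f ` K \<subseteq> U} | K U.
        compactin X K \<and> openin Y U}"

definition mapping_space :: "'a topology \<Rightarrow> 'b topology \<Rightarrow> ('a \<Rightarrow> 'b) topology" where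
  "mapping_space X Y = kify (compact_open X Y)"

definition add_point :: "'a topology \<Rightarrow> 'a option topology" where
  "add_point X = topology (\<lambda>U. openin X {x. Some x \<in> U})"

lemma openin_add_point: "openin (add_point X) U \<longleftrightarrow> openin X {x. Some x \<in> U}"
proof -
  have 1: "{x. Some x \<in> S \<inter> T} = {x. Some x \<in> S} \<inter> {x. Some x \<in> T}" for S T
    by auto
  have 2: "{x. Some x \<in> \<Union>\<K>} = (\<Union>K\<in>\<K>. {x. Some x \<in> K})" for \<K>
    by auto
  have "istopology (\<lambda>U. openin X {x. Some x \<in> U})"
    unfolding istopology_def 1 2 by auto
  then show ?thesis by (simp add: add_point_def)
qed


subsection \<open>Homotopy groups and weak equivalences\<close>

definition cube :: "nat \<Rightarrow> (nat \<Rightarrow> real) topology" where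
  "cube n = product_topology (\<lambda>_. top_of_set {0..1}) {..<n}"

definition cube_boundary :: "nat \<Rightarrow> (nat \<Rightarrow> real) set" where
  "cube_boundary n = {t \<in> topspace (cube n). \<exists>i<n. t i = 0 \<or> t i = 1}"

definition spheroids :: "nat \<Rightarrow> 'a topology \<Rightarrow> 'a \<Rightarrow> ((nat \<Rightarrow> real) \<Rightarrow> 'a) set" where
  "spheroids n X x = {g. continuous_map (cube n) X g \<and> (\<forall>t \<in> cube_boundary n. g t = x)}"

definition spheroid_homotopic ::
    "nat \<Rightarrow> 'a topology \<Rightarrow> 'a \<Rightarrow> ((nat \<Rightarrow> real) \<Rightarrow> 'a) \<Rightarrow> ((nat \<Rightarrow> real) \<Rightarrow> 'a) \<Rightarrow> bool" where
  "spheroid_homotopic n X x =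
     homotopic_with (\<lambda>h. \<forall>t \<in> cube_boundary n. h t = x) (cube n) X"

text \<open>The underlying set of \<open>\<pi>\<^sub>n(X,x)\<close>; for \<open>n = 0\<close> the set of path components.\<close>

definition homotopy_classes :: "nat \<Rightarrow> 'a topology \<Rightarrow> 'a \<Rightarrow> ((nat \<Rightarrow> real) \<Rightarrow> 'a) set set" where
  "homotopy_classes n X x = spheroids n X x //
     {(g, h). g \<in> spheroids n X x \<and> h \<in> spheroids n X x \<and> spheroid_homotopic n X x g h}"

definition induced_map ::
    "nat \<Rightarrow> 'b topology \<Rightarrow> ('a \<Rightarrow> 'b) \<Rightarrow> 'a \<Rightarrow> ((nat \<Rightarrow> real) \<Rightarrow> 'a) set \<Rightarrow> ((nat \<Rightarrow> real) \<Rightarrow> 'b) set" where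
  "induced_map n Y f x c =
     {h \<in> spheroids n Y (f x). \<exists>g \<in> c. spheroid_homotopic n Y (f x) (f \<circ> g) h}"

text \<open>
  The induced maps on \<open>\<pi>\<^sub>n\<close>, \<open>n \<ge> 1\<close>, are automatically homomorphisms, so they are isomorphisms
  precisely when they are bijective.
\<close>

definition weak_equivalence :: "'a topology \<Rightarrow> 'b topology \<Rightarrow> ('a \<Rightarrow> 'b) \<Rightarrow> bool" where
  "weak_equivalence X Y f \<longleftrightarrow>
     continuous_map X Y f \<and> (topspace X = {} \<longrightarrow> topspace Y = {}) \<and>
     (\<forall>n. \<forall>x \<in> topspace X.
        bij_betw (induced_map n Y f x) (homotopy_classes n X x) (homotopy_classes n Y (f x)))"


subsection \<open>Spaces with involution\<close>

definition based_space :: "'a topology \<Rightarrow> 'a \<Rightarrow> bool" where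
  "based_space X b \<longleftrightarrow> cgwh_space X \<and> b \<in> topspace X"

definition C2_space :: "'a topology \<Rightarrow> 'a \<Rightarrow> ('a \<Rightarrow> 'a) \<Rightarrow> bool" where
  "C2_space X b \<sigma> \<longleftrightarrow> based_space X b \<and> continuous_map X X \<sigma> \<and>
     (\<forall>x \<in> topspace X. \<sigma> (\<sigma> x) = x) \<and> \<sigma> b = b"

definition fixed_points :: "'a topology \<Rightarrow> ('a \<Rightarrow> 'a) \<Rightarrow> 'a topology" where
  "fixed_points X \<sigma> = subtopology X {x. \<sigma> x = x}"

text \<open>\<open>std k\<close> is the coordinate subspace of dimension \<open>k\<close> of the countable-dimensional space.\<close>

definition std :: "nat \<Rightarrow> (nat \<Rightarrow> 'k::zero) set" where
  "std k = {x. \<forall>i\<ge>k. x i = 0}"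

text \<open>\<open>EC\<^sub>2\<close> is the infinite sphere, the union of the finite-dimensional unit spheres with the
  colimit topology, with the antipodal action.\<close>

definition EC2_points :: "(nat \<Rightarrow> real) set" where
  "EC2_points = {x. \<exists>k. x \<in> std k \<and> (\<Sum>i<k. (x i)\<^sup>2) = 1}"

definition EC2 :: "(nat \<Rightarrow> real) topology" where
  "EC2 = topology (\<lambda>U. U \<subseteq> EC2_points \<and>
     (\<forall>k. openin (top_of_set (EC2_points \<inter> std k)) (U \<inter> std k)))"

lemma openin_EC2:
  "openin EC2 U \<longleftrightarrow> U \<subseteq> EC2_points \<and>
     (\<forall>k. openin (top_of_set (EC2_points \<inter> std k)) (U \<inter> std k))"
proof -
  have 1: "S \<inter> T \<inter> std k = (S \<inter> std k) \<inter> (T \<inter> std k)" for S T :: "(nat \<Rightarrow> real) set" and k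
    by auto
  have 2: "\<Union>\<K> \<inter> std k = (\<Union>K\<in>\<K>. K \<inter> std k)" for \<K> :: "(nat \<Rightarrow> real) set set" and k
    by auto
  have "istopology (\<lambda>U. U \<subseteq> EC2_points \<and>
     (\<forall>k. openin (top_of_set (EC2_points \<inter> std k)) (U \<inter> std k)))"
    unfolding istopology_def
  proof (intro conjI allI impI)
    fix S T assume "S \<subseteq> EC2_points \<and> (\<forall>k. openin (top_of_set (EC2_points \<inter> std k)) (S \<inter> std k))"
      and "T \<subseteq> EC2_points \<and> (\<forall>k. openin (top_of_set (EC2_points \<inter> std k)) (T \<inter> std k))"
    then show "S \<inter> T \<subseteq> EC2_points"
      and "\<And>k. openin (top_of_set (EC2_points \<inter> std k)) (S \<inter> T \<inter> std k)"
      by (auto simp only: 1 intro: openin_Int)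
  next
    fix \<K> assume *: "\<forall>K\<in>\<K>. K \<subseteq> EC2_points \<and>
      (\<forall>k. openin (top_of_set (EC2_points \<inter> std k)) (K \<inter> std k))"
    then show "\<Union>\<K> \<subseteq> EC2_points" by auto
    show "\<And>k. openin (top_of_set (EC2_points \<inter> std k)) (\<Union>\<K> \<inter> std k)"
      unfolding 2 using * by (intro openin_Union) auto
  qed
  then show ?thesis by (simp add: EC2_def)
qed

text \<open>\<open>X\<^sup>h\<^sup>C\<^sup>2 = Map\<^sub>*((EC\<^sub>2)\<^sub>+, X)\<^sup>C\<^sup>2\<close>: based maps fixed under conjugation.\<close>

definition homotopy_fixed_points ::
    "'a topology \<Rightarrow> 'a \<Rightarrow> ('a \<Rightarrow> 'a) \<Rightarrow> ((nat \<Rightarrow> real) option \<Rightarrow> 'a) topology" where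
  "homotopy_fixed_points X b \<sigma> = subtopology (mapping_space (add_point EC2) X)
     {f. f None = b \<and> (\<forall>z \<in> EC2_points. \<sigma> (f (Some (\<lambda>i. - z i))) = f (Some z))}"

definition to_homotopy_fixed_points :: "'a \<Rightarrow> 'a \<Rightarrow> ((nat \<Rightarrow> real) option \<Rightarrow> 'a)" where
  "to_homotopy_fixed_points b x =
     restrict (\<lambda>z. case z of None \<Rightarrow> b | Some _ \<Rightarrow> x) (topspace (add_point EC2))"

definition cofree :: "'a topology \<Rightarrow> 'a \<Rightarrow> ('a \<Rightarrow> 'a) \<Rightarrow> bool" where
  "cofree X b \<sigma> \<longleftrightarrow>
     weak_equivalence (fixed_points X \<sigma>) (homotopy_fixed_points X b \<sigma>) (to_homotopy_fixed_points b)"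


section \<open>The indexing categories\<close>

text \<open>
  The real and the complex indexing category are treated uniformly: \<open>'k\<close> is either \<open>real\<close>,
  with trivial conjugation, or \<open>complex\<close>. The ambient space \<open>'k\<^sup>\<infinity>\<close> consists of
  the finitely supported functions in \<open>nat \<Rightarrow> 'k\<close>; for \<open>complex\<close> this is the complexification
  of the real one, with \<open>C\<^sub>2\<close> acting by coordinatewise conjugation.
\<close>

class rc_field = real_normed_field + heine_borel +
  fixes cconj :: "'a \<Rightarrow> 'a"
  assumes cconj_add: "cconj (x + y) = cconj x + cconj y"
    and cconj_mult: "cconj (x * y) = cconj x * cconj y"
    and cconj_cconj: "cconj (cconj x) = x"
    and cconj_mult_self: "cconj x * x = (norm x)\<^sup>2 *\<^sub>R 1"

instantiation real :: rc_field
begin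
definition cconj_real :: "real \<Rightarrow> real" where "cconj_real x = x"
instance by standard (auto simp: cconj_real_def power2_eq_square)
end

instantiation complex :: rc_field
begin
definition cconj_complex :: "complex \<Rightarrow> complex" where "cconj_complex = cnj"
instance
  by standard (auto simp: cconj_complex_def complex_norm_square scaleR_conv_of_real mult.commute
      simp flip: of_real_power)
end

definition scale_fun :: "'k::field \<Rightarrow> (nat \<Rightarrow> 'k) \<Rightarrow> (nat \<Rightarrow> 'k)" where
  "scale_fun c x = (\<lambda>i. c * x i)"

global_interpretation fs: vector_space "scale_fun :: 'k::field \<Rightarrow> _"
  by standard (auto simp: scale_fun_def algebra_simps fun_eq_iff)

definition hinner :: "(nat \<Rightarrow> 'k::rc_field) \<Rightarrow> (nat \<Rightarrow> 'k) \<Rightarrow> 'k" where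
  "hinner x y = (\<Sum>i | x i \<noteq> 0. cconj (x i) * y i)"

definition vconj :: "(nat \<Rightarrow> 'k::rc_field) \<Rightarrow> (nat \<Rightarrow> 'k)" where
  "vconj x = (\<lambda>i. cconj (x i))"

text \<open>
  Over \<open>complex\<close> the objects are the conjugation-stable subspaces, equivalently those of the form
  \<open>\<complex> \<otimes> U\<close>: this is what makes conjugation an involution of each morphism space.
\<close>

definition jobj :: "(nat \<Rightarrow> 'k::rc_field) set set" where
  "jobj = {V. fs.subspace V \<and> (\<exists>B. finite B \<and> V = fs.span B) \<and>
     (\<forall>x \<in> V. finite {i. x i \<noteq> 0}) \<and> (\<forall>x \<in> V. vconj x \<in> V)}"

definition jmor :: "(nat \<Rightarrow> 'k::rc_field) set \<Rightarrow> (nat \<Rightarrow> 'k) set \<Rightarrow> ((nat \<Rightarrow> 'k) \<Rightarrow> (nat \<Rightarrow> 'k)) set" where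
  "jmor V W = {f \<in> V \<rightarrow>\<^sub>E W.
     (\<forall>x \<in> V. \<forall>y \<in> V. f (x + y) = f x + f y) \<and>
     (\<forall>c. \<forall>x \<in> V. f (scale_fun c x) = scale_fun c (f x)) \<and>
     (\<forall>x \<in> V. \<forall>y \<in> V. hinner (f x) (f y) = hinner x y)}"

text \<open>
  For finite-dimensional \<open>V\<close> and \<open>W\<close>, the topology of pointwise, coordinatewise convergence is the
  usual (Stiefel) topology on the space of linear isometries; in particular it is compact Hausdorff.
\<close>

definition jmor_top ::
    "(nat \<Rightarrow> 'k::rc_field) set \<Rightarrow> (nat \<Rightarrow> 'k) set \<Rightarrow> ((nat \<Rightarrow> 'k) \<Rightarrow> (nat \<Rightarrow> 'k)) topology" where
  "jmor_top V W = subtopology (product_topology (\<lambda>_. euclidean) V) (jmor V W)"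

definition mor_conj ::
    "(nat \<Rightarrow> 'k::rc_field) set \<Rightarrow> ((nat \<Rightarrow> 'k) \<Rightarrow> (nat \<Rightarrow> 'k)) \<Rightarrow> ((nat \<Rightarrow> 'k) \<Rightarrow> (nat \<Rightarrow> 'k))" where
  "mor_conj V f = (\<lambda>x\<in>V. vconj (f (vconj x)))"

definition incl :: "(nat \<Rightarrow> 'k) set \<Rightarrow> ((nat \<Rightarrow> 'k) \<Rightarrow> (nat \<Rightarrow> 'k))" where
  "incl V = (\<lambda>x\<in>V. x)"


subsection \<open>Direct sums\<close>

text \<open>
  The sum \<open>V \<oplus> U\<close> of a subspace \<open>V\<close> of \<open>'k\<^sup>\<infinity>\<close> and a subspace \<open>U\<close> of \<open>'k\<^sup>m\<close> is external; it is
  realised inside \<open>'k\<^sup>\<infinity>\<close> along the isometry \<open>'k\<^sup>\<infinity> \<oplus> 'k\<^sup>m \<cong> 'k\<^sup>\<infinity>\<close> that puts the second summand in the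
  first \<open>m\<close> coordinates.
\<close>

definition join :: "nat \<Rightarrow> (nat \<Rightarrow> 'k) \<Rightarrow> (nat \<Rightarrow> 'k) \<Rightarrow> (nat \<Rightarrow> 'k)" where
  "join m v u = (\<lambda>i. if i < m then u i else v (i - m))"

definition head_part :: "nat \<Rightarrow> (nat \<Rightarrow> 'k::zero) \<Rightarrow> (nat \<Rightarrow> 'k)" where
  "head_part m x = (\<lambda>i. if i < m then x i else 0)"

definition tail_part :: "nat \<Rightarrow> (nat \<Rightarrow> 'k) \<Rightarrow> (nat \<Rightarrow> 'k)" where
  "tail_part m x = (\<lambda>i. x (i + m))"

definition dsum :: "nat \<Rightarrow> (nat \<Rightarrow> 'k) set \<Rightarrow> (nat \<Rightarrow> 'k) set \<Rightarrow> (nat \<Rightarrow> 'k) set" where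
  "dsum m V U = {join m v u | v u. v \<in> V \<and> u \<in> U}"

definition mor_sum :: "nat \<Rightarrow> (nat \<Rightarrow> 'k::zero) set \<Rightarrow> (nat \<Rightarrow> 'k) set \<Rightarrow>
    ((nat \<Rightarrow> 'k) \<Rightarrow> (nat \<Rightarrow> 'k)) \<Rightarrow> ((nat \<Rightarrow> 'k) \<Rightarrow> (nat \<Rightarrow> 'k)) \<Rightarrow> ((nat \<Rightarrow> 'k) \<Rightarrow> (nat \<Rightarrow> 'k))" where
  "mor_sum m V U f g = (\<lambda>x \<in> dsum m V U. join m (f (tail_part m x)) (g (head_part m x)))"

definition incl_sum :: "nat \<Rightarrow> (nat \<Rightarrow> 'k::zero) set \<Rightarrow> ((nat \<Rightarrow> 'k) \<Rightarrow> (nat \<Rightarrow> 'k))" where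
  "incl_sum m V = (\<lambda>v\<in>V. join m v (\<lambda>_. 0))"


subsection \<open>The topological posets of subspaces\<close>

text \<open>The non-zero subspaces of \<open>'k\<^sup>m\<close>, topologised as the disjoint union of the Grassmannians, each
  a quotient of the Stiefel manifold of \<open>k\<close>-frames.\<close>

definition Grassmannians :: "nat \<Rightarrow> (nat \<Rightarrow> 'k::rc_field) set topology" where
  "Grassmannians m = final_topology (\<lambda>(k, g). g ` std k)
     (sum_topology (\<lambda>k. jmor_top (std k) (std m)) {1..m})"

definition complexify :: "(nat \<Rightarrow> real) set \<Rightarrow> (nat \<Rightarrow> complex) set" where
  "complexify V = {\<lambda>i. Complex (x i) (y i) | x y. x \<in> V \<and> y \<in> V}"

definition mor_complexify ::
    "(nat \<Rightarrow> real) set \<Rightarrow> ((nat \<Rightarrow> real) \<Rightarrow> (nat \<Rightarrow> real)) \<Rightarrow> ((nat \<Rightarrow> complex) \<Rightarrow> (nat \<Rightarrow> complex))" where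
  "mor_complexify V f =
     (\<lambda>z \<in> complexify V. (\<lambda>i. Complex (f (\<lambda>j. Re (z j)) i) (f (\<lambda>j. Im (z j)) i)))"

definition O_poset :: "nat \<Rightarrow> (nat \<Rightarrow> real) set topology" where
  "O_poset m = Grassmannians m"

definition R_poset :: "nat \<Rightarrow> (nat \<Rightarrow> complex) set topology" where
  "R_poset m = subtopology (Grassmannians m) (complexify ` topspace (O_poset m))"


section \<open>Continuous functors\<close>

text \<open>
  All values of a functor live in one type \<open>'a\<close>; this is no restriction, since the objects form
  a set and a set-indexed family of spaces embeds in a single type.
\<close>

record ('k, 'a) tfun =
  fobj :: "(nat \<Rightarrow> 'k) set \<Rightarrow> 'a topology"
  fbase :: "(nat \<Rightarrow> 'k) set \<Rightarrow> 'a"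
  fmor :: "(nat \<Rightarrow> 'k) set \<Rightarrow> (nat \<Rightarrow> 'k) set \<Rightarrow> ((nat \<Rightarrow> 'k) \<Rightarrow> (nat \<Rightarrow> 'k)) \<Rightarrow> 'a \<Rightarrow> 'a"

record ('k, 'a) c2fun = "('k, 'a) tfun" +
  conj_act :: "(nat \<Rightarrow> 'k) set \<Rightarrow> 'a \<Rightarrow> 'a"

text \<open>
  Based maps out of \<open>J(V,W)\<^sub>+ \<and> F(V)\<close> are written as unbased maps out of \<open>J(V,W) \<times> F(V)\<close> that are
  based in the second variable. As \<open>J(V,W)\<close> is compact Hausdorff, the ordinary product with the
  compactly generated space \<open>F(V)\<close> is already compactly generated.
\<close>

definition continuous_functor :: "('k::rc_field, 'a, 'z) tfun_scheme \<Rightarrow> bool" where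
  "continuous_functor F \<longleftrightarrow>
     (\<forall>V \<in> jobj. based_space (fobj F V) (fbase F V)) \<and>
     (\<forall>V \<in> jobj. \<forall>W \<in> jobj.
        continuous_map (prod_topology (jmor_top V W) (fobj F V)) (fobj F W) (\<lambda>(f, x). fmor F V W f x) \<and>
        (\<forall>f \<in> jmor V W. fmor F V W f (fbase F V) = fbase F W)) \<and>
     (\<forall>V \<in> jobj. \<forall>x \<in> topspace (fobj F V). fmor F V V (incl V) x = x) \<and>
     (\<forall>U \<in> jobj. \<forall>V \<in> jobj. \<forall>W \<in> jobj. \<forall>f \<in> jmor U V. \<forall>g \<in> jmor V W.
        \<forall>x \<in> topspace (fobj F U).
          fmor F U W (compose U g f) x = fmor F V W g (fmor F U V f x))"

abbreviation orthogonal_functor :: "(real, 'a) tfun \<Rightarrow> bool" where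
  "orthogonal_functor \<equiv> continuous_functor"

definition reality_functor :: "(complex, 'a) c2fun \<Rightarrow> bool" where
  "reality_functor F \<longleftrightarrow> continuous_functor F \<and>
     (\<forall>V \<in> jobj. C2_space (fobj F V) (fbase F V) (conj_act F V)) \<and>
     (\<forall>V \<in> jobj. \<forall>W \<in> jobj. \<forall>f \<in> jmor V W. \<forall>x \<in> topspace (fobj F V).
        conj_act F W (fmor F V W f x) = fmor F V W (mor_conj V f) (conj_act F V x))"

definition cofree_fibrant :: "(complex, 'a) c2fun \<Rightarrow> bool" where
  "cofree_fibrant F \<longleftrightarrow> (\<forall>V \<in> jobj. cofree (fobj F V) (fbase F V) (conj_act F V))"

text \<open>The orthogonal functor \<open>V \<mapsto> F(V\<^sub>\<complex>)\<^sup>C\<^sup>2\<close>.\<close>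

definition real_fixed_points :: "(complex, 'a) c2fun \<Rightarrow> (real, 'a) tfun" where
  "real_fixed_points F =
     \<lparr>fobj = (\<lambda>V. fixed_points (fobj F (complexify V)) (conj_act F (complexify V))),
      fbase = (\<lambda>V. fbase F (complexify V)),
      fmor = (\<lambda>V W f. fmor F (complexify V) (complexify W) (mor_complexify V f))\<rparr>"

definition orthogonal_transformation ::
    "(real, 'a) tfun \<Rightarrow> (real, 'b) tfun \<Rightarrow> ((nat \<Rightarrow> real) set \<Rightarrow> 'a \<Rightarrow> 'b) \<Rightarrow> bool" where
  "orthogonal_transformation E E' \<eta> \<longleftrightarrow>
     orthogonal_functor E \<and> orthogonal_functor E' \<and>
     (\<forall>V \<in> jobj. continuous_map (fobj E V) (fobj E' V) (\<eta> V) \<and> \<eta> V (fbase E V) = fbase E' V) \<and>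
     (\<forall>V \<in> jobj. \<forall>W \<in> jobj. \<forall>f \<in> jmor V W. \<forall>x \<in> topspace (fobj E V).
        \<eta> W (fmor E V W f x) = fmor E' V W f (\<eta> V x))"

definition levelwise_weak_equivalence ::
    "(real, 'a) tfun \<Rightarrow> (real, 'b) tfun \<Rightarrow> ((nat \<Rightarrow> real) set \<Rightarrow> 'a \<Rightarrow> 'b) \<Rightarrow> bool" where
  "levelwise_weak_equivalence E E' \<eta> \<longleftrightarrow>
     orthogonal_transformation E E' \<eta> \<and>
     (\<forall>V \<in> jobj. weak_equivalence (fobj E V) (fobj E' V) (\<eta> V))"


section \<open>Homotopy limits over topological posets of subspaces\<close>

text \<open>
  Throughout, \<open>P\<close> is a topological poset of subspaces of \<open>'k\<^sup>m\<close>. The homotopy limit of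
  \<open>U \<mapsto> F(V \<oplus> U)\<close> is the totalization of the cosimplicial space of continuous sections over the
  nerve of \<open>P\<close>; all spaces of chains carry the topology coming from \<open>P\<close>.
\<close>

definition chains :: "(nat \<Rightarrow> 'k) set topology \<Rightarrow> nat \<Rightarrow> (nat \<Rightarrow> (nat \<Rightarrow> 'k) set) topology" where
  "chains P p = subtopology (product_topology (\<lambda>_. P) {..p}) {C. \<forall>i j. i \<le> j \<and> j \<le> p \<longrightarrow> C i \<subseteq> C j}"

type_synonym 'k nerve_pt = "nat \<times> (nat \<Rightarrow> (nat \<Rightarrow> 'k) set) \<times> (nat \<Rightarrow> real)"

definition nerve_space :: "(nat \<Rightarrow> 'k) set topology \<Rightarrow> 'k nerve_pt topology" where
  "nerve_space P = sum_topology (\<lambda>p. prod_topology (chains P p)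
     (subtopology (powertop_real UNIV) (standard_simplex p))) UNIV"

text \<open>
  The bundle over \<open>P\<close> with fibre \<open>F(V \<oplus> U)\<close> at \<open>U\<close>. On the component of \<open>k\<close>-dimensional
  subspaces it is the bundle with fibre \<open>F(V \<oplus> 'k\<^sup>k)\<close> associated to the principal bundle of
  \<open>k\<close>-frames: the frame \<open>g\<close> and the point \<open>y\<close> represent \<open>F(id \<oplus> g)(y)\<close> over the image of \<open>g\<close>.
\<close>

definition total_space ::
    "nat \<Rightarrow> (nat \<Rightarrow> 'k::rc_field) set topology \<Rightarrow> ('k, 'a, 'z) tfun_scheme \<Rightarrow> (nat \<Rightarrow> 'k) set \<Rightarrow>
     ((nat \<Rightarrow> 'k) set \<times> 'a) topology" where
  "total_space m P F V = final_topology
     (\<lambda>(k, g, y). (g ` std k,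
        fmor F (dsum m V (std k)) (dsum m V (g ` std k)) (mor_sum m V (std k) (incl V) g) y))
     (sum_topology (\<lambda>k. prod_topology
        (subtopology (jmor_top (std k) (std m)) {g. g ` std k \<in> topspace P})
        (fobj F (dsum m V (std k)))) {1..m})"

definition simplex_push :: "nat \<Rightarrow> (nat \<Rightarrow> nat) \<Rightarrow> (nat \<Rightarrow> real) \<Rightarrow> (nat \<Rightarrow> real)" where
  "simplex_push q \<theta> t = (\<lambda>j. \<Sum>i | i \<le> q \<and> \<theta> i = j. t i)"

text \<open>
  A point of the totalization is a section \<open>s\<close> assigning to a chain \<open>U\<^sub>0 \<subseteq> \<dots> \<subseteq> U\<^sub>p\<close> and
  \<open>t \<in> \<Delta>\<^sup>p\<close> a point over \<open>U\<^sub>p\<close>, compatible with every monotone \<open>\<theta> : [q] \<rightarrow> [p]\<close>.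
\<close>

definition sections ::
    "nat \<Rightarrow> (nat \<Rightarrow> 'k::rc_field) set topology \<Rightarrow> ('k, 'a, 'z) tfun_scheme \<Rightarrow> (nat \<Rightarrow> 'k) set \<Rightarrow>
     ('k nerve_pt \<Rightarrow> (nat \<Rightarrow> 'k) set \<times> 'a) set" where
  "sections m P F V = {s.
     (\<forall>(p, C, t) \<in> topspace (nerve_space P). fst (s (p, C, t)) = C p) \<and>
     (\<forall>p q. \<forall>\<theta> \<in> {..q} \<rightarrow> {..p}. mono_on {..q} \<theta> \<longrightarrow>
        (\<forall>C \<in> topspace (chains P p). \<forall>t \<in> standard_simplex q.
           snd (s (p, C, simplex_push q \<theta> t)) =
             fmor F (dsum m V (C (\<theta> q))) (dsum m V (C p)) (incl (dsum m V (C (\<theta> q))))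
               (snd (s (q, restrict (C \<circ> \<theta>) {..q}, t)))))}"

definition holim_functor ::
    "nat \<Rightarrow> (nat \<Rightarrow> 'k::rc_field) set topology \<Rightarrow> ('k, 'a, 'z) tfun_scheme \<Rightarrow>
     ('k, 'k nerve_pt \<Rightarrow> (nat \<Rightarrow> 'k) set \<times> 'a) tfun" where
  "holim_functor m P F =
     \<lparr>fobj = (\<lambda>V. kify (subtopology (compact_open (nerve_space P) (total_space m P F V))
                          (sections m P F V))),
      fbase = (\<lambda>V. \<lambda>(p, C, t) \<in> topspace (nerve_space P). (C p, fbase F (dsum m V (C p)))),
      fmor = (\<lambda>V W f s. \<lambda>d \<in> topspace (nerve_space P). case s d of (U, x) \<Rightarrow>
                (U, fmor F (dsum m V U) (dsum m W U) (mor_sum m V U f (incl U)) x))\<rparr>"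

text \<open>The natural map \<open>F(V) \<rightarrow> holim F(V \<oplus> U)\<close> induced by the inclusions \<open>V \<rightarrow> V \<oplus> U\<close>.\<close>

definition holim_unit ::
    "nat \<Rightarrow> (nat \<Rightarrow> 'k::rc_field) set topology \<Rightarrow> ('k, 'a, 'z) tfun_scheme \<Rightarrow> (nat \<Rightarrow> 'k) set \<Rightarrow>
     'a \<Rightarrow> 'k nerve_pt \<Rightarrow> (nat \<Rightarrow> 'k) set \<times> 'a" where
  "holim_unit m P F V y =
     (\<lambda>(p, C, t) \<in> topspace (nerve_space P). (C p, fmor F V (dsum m V (C p)) (incl_sum m V) y))"

definition tau_O :: "nat \<Rightarrow> (real, 'a) tfun \<Rightarrow> (real, real nerve_pt \<Rightarrow> (nat \<Rightarrow> real) set \<times> 'a) tfun" where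
  "tau_O n E = holim_functor (n + 1) (O_poset (n + 1)) E"

text \<open>Conjugation fixes every member of \<open>R_poset\<close>, so it acts on sections through the values only.\<close>

definition tau_R ::
    "nat \<Rightarrow> (complex, 'a) c2fun \<Rightarrow> (complex, complex nerve_pt \<Rightarrow> (nat \<Rightarrow> complex) set \<times> 'a) c2fun" where
  "tau_R n F = tfun.extend (holim_functor (n + 1) (R_poset (n + 1)) F)
     (c2fun.fields (\<lambda>V s. \<lambda>d \<in> topspace (nerve_space (R_poset (n + 1))). case s d of (U, x) \<Rightarrow>
        (U, conj_act F (dsum (n + 1) V U) x)))"


section \<open>Iteration and sequential homotopy colimits\<close>

text \<open>
  The values of the iterates of \<open>\<tau>\<^sub>n\<close> live in different types. They are transported along injections
  into a single type of well-founded trees: \<open>Base\<close> holds points of \<open>F(V)\<close>, and \<open>Node\<close> holds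
  sections whose values are points of the preceding iterate.
\<close>

datatype (dead 'k, 'a) tower =
  Base 'a
| Node "'k nerve_pt \<Rightarrow> (nat \<Rightarrow> 'k) set \<times> ('k, 'a) tower"

definition relabel :: "('a \<Rightarrow> 'b) \<Rightarrow> ('k, 'a, 'z) tfun_scheme \<Rightarrow> ('k, 'b) tfun" where
  "relabel e F =
     \<lparr>fobj = (\<lambda>V. final_topology e (fobj F V)),
      fbase = (\<lambda>V. e (fbase F V)),
      fmor = (\<lambda>V W f x. e (fmor F V W f (inv_into UNIV e x)))\<rparr>"

definition relabel_C2 :: "('a \<Rightarrow> 'b) \<Rightarrow> ('k, 'a) c2fun \<Rightarrow> ('k, 'b) c2fun" where
  "relabel_C2 e F = tfun.extend (relabel e F) (c2fun.fields (\<lambda>V x. e (conj_act F V (inv_into UNIV e x))))"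

primrec stage_O :: "nat \<Rightarrow> (real, 'a) tfun \<Rightarrow> nat \<Rightarrow> (real, (real, 'a) tower) tfun" where
  "stage_O n E 0 = relabel Base E"
| "stage_O n E (Suc k) = relabel Node (tau_O n (stage_O n E k))"

primrec stage_R :: "nat \<Rightarrow> (complex, 'a) c2fun \<Rightarrow> nat \<Rightarrow> (complex, (complex, 'a) tower) c2fun" where
  "stage_R n F 0 = relabel_C2 Base F"
| "stage_R n F (Suc k) = relabel_C2 Node (tau_R n (stage_R n F k))"

definition stage_map ::
    "nat \<Rightarrow> (nat \<Rightarrow> 'k::rc_field) set topology \<Rightarrow> (nat \<Rightarrow> ('k, ('k, 'a) tower, 'z) tfun_scheme) \<Rightarrow>
     (nat \<Rightarrow> 'k) set \<Rightarrow> nat \<Rightarrow> ('k, 'a) tower \<Rightarrow> ('k, 'a) tower" where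
  "stage_map m P S V k y = Node (holim_unit m P (S k) V y)"

text \<open>
  The based (reduced) mapping telescope of \<open>X 0 \<rightarrow> X 1 \<rightarrow> \<dots>\<close>: the quotient of the disjoint
  union of the \<open>[0,1] \<times> X k\<close> that identifies \<open>(k, 1, x)\<close> with \<open>(k + 1, 0, f k x)\<close> and all \<open>(k, s, b k)\<close>
  with each other. The quotient map \<open>telescope_pt\<close> picks the representative of a class that has
  \<open>s < 1\<close> and, for the class of the basepoints, is \<open>(0, 0, b 0)\<close>.
\<close>

definition telescope_base :: "(nat \<Rightarrow> 'a) \<Rightarrow> nat \<times> real \<times> 'a" where
  "telescope_base b = (0, 0, b 0)"

definition telescope_pt ::
    "(nat \<Rightarrow> 'a) \<Rightarrow> (nat \<Rightarrow> 'a \<Rightarrow> 'a) \<Rightarrow> nat \<times> real \<times> 'a \<Rightarrow> nat \<times> real \<times> 'a" where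
  "telescope_pt b f = (\<lambda>(k, s, x).
     let (k', s', x') = (if s = 1 then (k + 1, 0, f k x) else (k, s, x))
     in if x' = b k' then telescope_base b else (k', s', x'))"

definition telescope ::
    "(nat \<Rightarrow> 'a topology) \<Rightarrow> (nat \<Rightarrow> 'a) \<Rightarrow> (nat \<Rightarrow> 'a \<Rightarrow> 'a) \<Rightarrow> (nat \<times> real \<times> 'a) topology" where
  "telescope X b f = final_topology (telescope_pt b f)
     (sum_topology (\<lambda>k. prod_topology (top_of_set {0..1}) (X k)) UNIV)"

definition telescope_map ::
    "(nat \<Rightarrow> 'a) \<Rightarrow> (nat \<Rightarrow> 'a \<Rightarrow> 'a) \<Rightarrow> (nat \<Rightarrow> 'a \<Rightarrow> 'a) \<Rightarrow> nat \<times> real \<times> 'a \<Rightarrow> nat \<times> real \<times> 'a" where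
  "telescope_map b f h = (\<lambda>(k, s, x). telescope_pt b f (k, s, h k x))"

definition telescope_functor ::
    "(nat \<Rightarrow> ('k, 'a, 'z) tfun_scheme) \<Rightarrow> ((nat \<Rightarrow> 'k) set \<Rightarrow> nat \<Rightarrow> 'a \<Rightarrow> 'a) \<Rightarrow>
     ('k, nat \<times> real \<times> 'a) tfun" where
  "telescope_functor S r =
     \<lparr>fobj = (\<lambda>V. telescope (\<lambda>k. fobj (S k) V) (\<lambda>k. fbase (S k) V) (r V)),
      fbase = (\<lambda>V. telescope_base (\<lambda>k. fbase (S k) V)),
      fmor = (\<lambda>V W f. telescope_map (\<lambda>k. fbase (S k) W) (r W) (\<lambda>k. fmor (S k) V W f))\<rparr>"

definition T_O :: "nat \<Rightarrow> (real, 'a) tfun \<Rightarrow> (real, nat \<times> real \<times> (real, 'a) tower) tfun" where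
  "T_O n E = telescope_functor (stage_O n E) (stage_map (n + 1) (O_poset (n + 1)) (stage_O n E))"

definition T_R :: "nat \<Rightarrow> (complex, 'a) c2fun \<Rightarrow> (complex, nat \<times> real \<times> (complex, 'a) tower) c2fun" where
  "T_R n F = (let S = stage_R n F; r = stage_map (n + 1) (R_poset (n + 1)) S in
     tfun.extend (telescope_functor S r)
       (c2fun.fields (\<lambda>V. telescope_map (\<lambda>k. fbase (S k) V) (r V) (\<lambda>k. conj_act (S k) V))))"

end

theory Submission
  imports Defs "HOL-Analysis.Analysis"
begin

text \<open>
  Conjugation acts trivially on the poset \<open>R_poset\<close> and complexification identifies it with \<open>O_poset\<close>,
  so taking fixed points commutes with the homotopy limits on the nose: a section over the real
  nerve with values in \<open>F(V\<^sub>\<complex> \<oplus> U\<^sub>\<complex>)\<^sup>C\<^sup>2\<close> is the same as a fixed section over the complex nerve. The point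
  is that this bijection is a homeomorphism, and that it remains one after infinitely many
  iterations and in the telescope. For this one carries along that the map from the real to the
  complex side is a closed embedding onto the fixed points; closedness on total spaces follows from
  compactness of the spaces of frames. The inverse homeomorphism is the required transformation.
\<close>

section \<open>Compactly generated weak Hausdorff spaces\<close>

text \<open>Closed embeddings are forced by the topology: neither \<open>kify\<close> nor a quotient
  topology is compatible with passing to an arbitrary subspace, and each stage applies a quotient
  (\<open>total_space\<close>), then a function space with \<open>kify\<close>; the telescope adds
  one more quotient. The induction can start because fixed point sets are closed in compactly
  generated weak Hausdorff spaces. The second burden is that an orthogonal transformation runs
  between continuous functors, so the homotopy limits and telescopes must have compactly generated
  weak Hausdorff values. A quotient of a weak Hausdorff space need not be weak Hausdorff, so total
  spaces and telescopes each get their own argument: lifting test maps along compact spaces of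
  frames for the former, charts around points other than the base point for the latter. Conjugation
  enters the induction only through the set it fixes: the real stage embeds in the complex stage
  with image exactly the fixed points. That the fixed points of the complex approximation form a
  continuous functor is carried over at the end, along the homeomorphism, from the real
  side.\<close>

lemma topspace_final_topology [simp]: "topspace (final_topology f X) = f ` topspace X"
proof
  show "topspace (final_topology f X) \<subseteq> f ` topspace X"
    using openin_topspace[of "final_topology f X"] unfolding openin_final_topology by blast
  have "{x \<in> topspace X. f x \<in> f ` topspace X} = topspace X"
    by auto
  then have "openin (final_topology f X) (f ` topspace X)"
    by (simp add: openin_final_topology)
  then show "f ` topspace X \<subseteq> topspace (final_topology f X)"
    by (rule openin_subset)
qed

lemma quotient_map_final_topology: "quotient_map X (final_topology f X) f"
  by (simp add: quotient_map_def openin_final_topology)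

lemma homeomorphic_map_final_topology:
  "inj_on f (topspace X) \<Longrightarrow> homeomorphic_map X (final_topology f X) f"
  by (simp add: homeomorphic_map_def quotient_map_final_topology)

text \<open>Frees \<open>weak_Hausdorff\<close> from its fixed type of test spaces. A section
  \<open>r\<close> of \<open>u\<close> cuts \<open>K\<close> down to the closure \<open>L\<close> of
  the chosen points, which has the same image, and \<open>e\<close> transports \<open>L\<close> into
  \<open>'a set set\<close>.\<close>

lemma weak_Hausdorff_image_closedin:
  fixes X :: "'a topology" and K :: "'k topology"
  assumes wH: "weak_Hausdorff X" and K: "compact_space K" "Hausdorff_space K"
    and u: "continuous_map K X u"
  shows "closedin X (u ` topspace K)"
proof -
  define r where "r = inv_into (topspace K) u"
  have r: "r x \<in> topspace K" "u (r x) = x" if "x \<in> u ` topspace K" for x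
    using that by (auto simp: r_def inv_into_into f_inv_into_f)
  define D where "D = r ` u ` topspace K"
  define L where "L = K closure_of D"
  have DK: "D \<subseteq> topspace K"
    using r by (auto simp: D_def)
  have LK: "L \<subseteq> topspace K"
    by (simp add: L_def closure_of_subset_topspace)
  have DL: "D \<subseteq> L"
    by (simp add: L_def DK closure_of_subset)
  have cL: "compact_space (subtopology K L)"
    using K by (simp add: L_def closedin_compact_space compact_space_subtopology)
  have hL: "Hausdorff_space (subtopology K L)"
    using K by (simp add: Hausdorff_space_subtopology)
  define e where "e z = {A. A \<subseteq> u ` topspace K \<and> z \<in> K closure_of (r ` A)}" for z
  have inj: "inj_on e L"
  proof (rule inj_onI, rule ccontr)
    fix x y
    assume x: "x \<in> L" and y: "y \<in> L" and exy: "e x = e y" and ne: "x \<noteq> y"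
    obtain U V where UV: "openin K U" "openin K V" "x \<in> U" "y \<in> V" "disjnt U V"
      using K(2)[unfolded Hausdorff_space_def, rule_format, of x y] subsetD[OF LK x] subsetD[OF LK y] ne
      by blast
    \<comment> \<open>\<open>U\<close> separates \<open>x\<close> from \<open>y\<close>, so the
      chosen points inside \<open>U\<close> accumulate at \<open>x\<close> but not at
      \<open>y\<close>; their index set \<open>A\<close> therefore tells the two codes
      apart.\<close>
    define A where "A = {a \<in> u ` topspace K. r a \<in> U}"
    have rA: "r ` A = U \<inter> D"
      by (auto simp: A_def D_def)
    have "x \<in> K closure_of (U \<inter> D)"
      using openin_Int_closure_of_subset[OF UV(1), of D] x UV(3) by (auto simp: L_def)
    then have "A \<in> e x"
      using rA by (auto simp: e_def) (auto simp: A_def)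
    then have "y \<in> K closure_of (U \<inter> D)"
      using rA unfolding exy by (auto simp: e_def)
    then show False
      using UV by (auto simp: in_closure_of disjnt_iff)
  qed
  let ?M = "final_topology e (subtopology K L)"
  have top: "topspace (subtopology K L) = L"
    using LK by auto
  have hom: "homeomorphic_map (subtopology K L) ?M e"
    using inj by (intro homeomorphic_map_final_topology) (simp only: top)
  then obtain e' where e': "homeomorphic_maps (subtopology K L) ?M e e'"
    by (auto simp: homeomorphic_map_maps)
  have hs: "subtopology K L homeomorphic_space ?M"
    using e' homeomorphic_space_def by blast
  have "compact_space ?M" "Hausdorff_space ?M"
    using hs cL hL homeomorphic_compact_space homeomorphic_Hausdorff_space by blast+
  moreover have "continuous_map ?M X (u \<circ> e')"
    using e' u by (auto simp: homeomorphic_maps_def intro: continuous_map_compose continuous_map_from_subtopology)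
  ultimately have cl: "closedin X ((u \<circ> e') ` topspace ?M)"
    using wH unfolding weak_Hausdorff_def by blast
  have "(u \<circ> e') ` topspace ?M = u ` L"
    using e' unfolding homeomorphic_maps_def topspace_final_topology top
    by (simp add: image_image)
  moreover have "u ` L = u ` topspace K"
  proof
    show "u ` topspace K \<subseteq> u ` L"
    proof
      fix x assume "x \<in> u ` topspace K"
      then have "r x \<in> D" "u (r x) = x"
        using r by (auto simp: D_def)
      then show "x \<in> u ` L"
        using DL by force
    qed
  qed (use LK in auto)
  ultimately show ?thesis
    using cl by simp
qed

text \<open>In a weak Hausdorff space these are the images of test maps, so \<open>kify\<close> and
  the compactly generated condition can be tested on subsets instead of maps from spaces of a
  prescribed type.\<close>

definition compact_Hausdorff_in :: "'a topology \<Rightarrow> 'a set \<Rightarrow> bool" where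
  "compact_Hausdorff_in X C \<longleftrightarrow> compactin X C \<and> Hausdorff_space (subtopology X C)"

lemma compact_Hausdorff_in_subset: "compact_Hausdorff_in X C \<Longrightarrow> C \<subseteq> topspace X"
  by (simp add: compact_Hausdorff_in_def compactin_subset_topspace)

lemma compact_Hausdorff_in_space:
  assumes "compact_Hausdorff_in X C"
  shows "compact_space (subtopology X C)" "Hausdorff_space (subtopology X C)"
    "topspace (subtopology X C) = C"
  using assms by (auto simp: compact_Hausdorff_in_def compact_space_subtopology compactin_subset_topspace Int_absorb1)

lemma compact_Hausdorff_in_subtopology:
  "compact_Hausdorff_in (subtopology X S) C \<longleftrightarrow> compact_Hausdorff_in X C \<and> C \<subseteq> S"
  by (auto simp: compact_Hausdorff_in_def compactin_subtopology subtopology_subtopology Int_absorb1)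

lemma weak_Hausdorff_singleton:
  assumes "weak_Hausdorff X" "x \<in> topspace X"
  shows "closedin X {x}"
  using weak_Hausdorff_image_closedin[of X "discrete_topology {()}" "\<lambda>_. x"] assms
  by (simp add: compact_space_discrete_topology)

text \<open>By weak Hausdorffness \<open>u\<close> is a closed map onto its image. Normality of
  \<open>K\<close> passes along closed continuous surjections, and points are closed, so the image
  is normal and T1, hence Hausdorff.\<close>

lemma compact_Hausdorff_in_image:
  assumes wH: "weak_Hausdorff X" and K: "compact_space K" "Hausdorff_space K"
    and u: "continuous_map K X u"
  shows "compact_Hausdorff_in X (u ` topspace K)"
proof -
  let ?Y = "subtopology X (u ` topspace K)"
  have sub: "u ` topspace K \<subseteq> topspace X"
    using u continuous_map_image_subset_topspace by blast
  have top: "topspace ?Y = u ` topspace K"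
    using sub by auto
  have "closed_map K ?Y u"
    unfolding closed_map_def
  proof (intro allI impI)
    fix S assume S: "closedin K S"
    then have "compact_space (subtopology K S)" "Hausdorff_space (subtopology K S)"
      using K by (auto simp: closedin_compact_space compact_space_subtopology Hausdorff_space_subtopology)
    then have "closedin X (u ` topspace (subtopology K S))"
      using u by (intro weak_Hausdorff_image_closedin[OF wH] continuous_map_from_subtopology)
    moreover have "topspace (subtopology K S) = S"
      using S closedin_subset by fastforce
    ultimately show "closedin ?Y (u ` S)"
      using S closedin_subset[OF S] by (auto simp: closedin_subtopology)
  qed
  moreover have "continuous_map K ?Y u"
    using u by (simp add: continuous_map_in_subtopology)
  moreover have "normal_space K"
    using K compact_Hausdorff_or_regular_imp_normal_space by blast
  ultimately have "normal_space ?Y"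
    using normal_space_continuous_closed_map_image top by blast
  moreover have "t1_space ?Y"
  proof -
    have "closedin ?Y {x}" if "x \<in> topspace ?Y" for x
      using that weak_Hausdorff_singleton[OF wH, of x] unfolding closedin_subtopology
      by (metis Int_insert_left_if1 inf_bot_left topspace_subtopology IntE)
    then show ?thesis
      by (simp add: t1_space_closedin_singleton)
  qed
  ultimately have "Hausdorff_space ?Y"
    using normal_t1_imp_Hausdorff_space by blast
  moreover have "compactin X (u ` topspace K)"
    using K u image_compactin compact_space_def by blast
  ultimately show ?thesis
    by (simp add: compact_Hausdorff_in_def)
qed

lemma compact_Hausdorff_in_closedin:
  assumes "weak_Hausdorff X" "compact_Hausdorff_in X C"
  shows "closedin X C"
  using weak_Hausdorff_image_closedin[OF assms(1) compact_Hausdorff_in_space(1,2)[OF assms(2)], of id]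
    compact_Hausdorff_in_space(3)[OF assms(2)]
  by (simp add: continuous_map_from_subtopology)

lemma compact_Hausdorff_in_Int:
  assumes "compact_Hausdorff_in X C" "closedin X D"
  shows "compact_Hausdorff_in X (C \<inter> D)"
  using assms compact_Int_closedin Hausdorff_space_subtopology[of "subtopology X C" D]
  by (auto simp: compact_Hausdorff_in_def subtopology_subtopology)

lemma compact_Hausdorff_in_closedin_sub:
  assumes "compact_Hausdorff_in X C" "closedin (subtopology X C) D"
  shows "compact_Hausdorff_in X D"
  using compact_Hausdorff_in_Int[OF assms(1)] assms(2)
  by (metis closedin_subtopology inf_commute)

lemma closedin_Int_compact_Hausdorff_in:
  assumes "weak_Hausdorff X" "compact_Hausdorff_in X C" "closedin (subtopology X C) D"
  shows "closedin X D"
  using assms compact_Hausdorff_in_closedin closedin_trans_full by blast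

section \<open>The compactly generated refinement\<close>

lemma topspace_kify [simp]: "topspace (kify X) = topspace X"
proof
  show "topspace (kify X) \<subseteq> topspace X"
    using openin_topspace[of "kify X"] unfolding openin_kify by blast
  have "{z \<in> topspace K. u z \<in> topspace X} = topspace K" if "continuous_map K X u"
    for K :: "'a set set topology" and u
    using that by (auto simp: continuous_map_def)
  then have "openin (kify X) (topspace X)"
    by (simp add: openin_kify)
  then show "topspace X \<subseteq> topspace (kify X)"
    by (rule openin_subset)
qed

lemma openin_imp_openin_kify: "openin X U \<Longrightarrow> openin (kify X) U"
  by (auto simp: openin_kify openin_subset intro: openin_continuous_map_preimage)

lemma closedin_imp_closedin_kify: "closedin X U \<Longrightarrow> closedin (kify X) U"
  by (auto simp: closedin_def openin_imp_openin_kify)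

lemma continuous_map_kify_id: "continuous_map (kify X) X (\<lambda>x. x)"
proof -
  have "{x \<in> topspace X. x \<in> U} = U" if "openin X U" for U
    using openin_subset[OF that] by auto
  then show ?thesis
    by (auto simp: continuous_map_def openin_imp_openin_kify)
qed

lemma continuous_map_from_kify: "continuous_map X Y f \<Longrightarrow> continuous_map (kify X) Y f"
  using continuous_map_compose[OF continuous_map_kify_id, of X Y f] by (simp add: comp_def)

lemma closedin_kify_raw:
  fixes X :: "'a topology"
  shows "closedin (kify X) A \<longleftrightarrow> A \<subseteq> topspace X \<and>
     (\<forall>(K :: 'a set set topology) u.
        compact_space K \<and> Hausdorff_space K \<and> continuous_map K X u \<longrightarrow>
          closedin K {z \<in> topspace K. u z \<in> A})"
proof -
  have "{z \<in> topspace K. u z \<in> topspace X - A} = topspace K - {z \<in> topspace K. u z \<in> A}"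
    if "continuous_map K X u" for K :: "'a set set topology" and u
    using that by (auto simp: continuous_map_def)
  then show ?thesis
    by (auto simp: closedin_def openin_kify)
qed

text \<open>Extends the defining test of \<open>kify\<close> to spaces of another type, as long as
  their points inject into the type of \<open>X\<close>: the double singleton of \<open>e z\<close>
  then lives in \<open>'a set set\<close>.\<close>

lemma closedin_kify_preimage:
  fixes X :: "'a topology" and K :: "'k topology" and e :: "'k \<Rightarrow> 'a"
  assumes A: "closedin (kify X) A" and K: "compact_space K" "Hausdorff_space K"
    and u: "continuous_map K X u" and e: "inj_on e (topspace K)"
  shows "closedin K {z \<in> topspace K. u z \<in> A}"
proof -
  let ?e = "\<lambda>x. {{e x}}" and ?L = "final_topology (\<lambda>x. {{e x}}) K"
  have "homeomorphic_map K ?L ?e"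
    using e by (intro homeomorphic_map_final_topology) (auto simp: inj_on_def)
  then obtain g where g: "homeomorphic_maps K ?L ?e g"
    by (auto simp: homeomorphic_map_maps)
  have hs: "K homeomorphic_space ?L"
    using g homeomorphic_space_def by blast
  have "compact_space ?L" "Hausdorff_space ?L"
    using hs K homeomorphic_compact_space homeomorphic_Hausdorff_space by blast+
  moreover have "continuous_map ?L X (u \<circ> g)"
    using g u by (auto simp: homeomorphic_maps_def intro: continuous_map_compose)
  ultimately have "closedin ?L {z \<in> topspace ?L. (u \<circ> g) z \<in> A}"
    using A unfolding closedin_kify_raw by blast
  then have "closedin K {x \<in> topspace K. ?e x \<in> {z \<in> topspace ?L. (u \<circ> g) z \<in> A}}"
    using g by (intro closedin_continuous_map_preimage[of K ?L ?e]) (auto simp: homeomorphic_maps_def)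
  moreover have "{x \<in> topspace K. ?e x \<in> {z \<in> topspace ?L. (u \<circ> g) z \<in> A}} = {z \<in> topspace K. u z \<in> A}"
    using g by (auto simp: homeomorphic_maps_def)
  ultimately show ?thesis
    by simp
qed

text \<open>The working description of \<open>kify\<close>: the image of a test map is a compact
  Hausdorff subset, and the inclusion of a compact Hausdorff subset is a test map.\<close>

lemma closedin_kify_iff:
  fixes X :: "'a topology"
  assumes wH: "weak_Hausdorff X"
  shows "closedin (kify X) A \<longleftrightarrow>
    A \<subseteq> topspace X \<and> (\<forall>C. compact_Hausdorff_in X C \<longrightarrow> closedin X (A \<inter> C))"
proof (intro iffI conjI allI impI)
  assume A: "closedin (kify X) A"
  then show "A \<subseteq> topspace X"
    using closedin_subset by fastforce
  fix C assume C: "compact_Hausdorff_in X C"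
  have "closedin (subtopology X C) {z \<in> topspace (subtopology X C). id z \<in> A}"
    by (rule closedin_kify_preimage[OF A compact_Hausdorff_in_space(1,2)[OF C], where e = id])
      (simp_all add: continuous_map_from_subtopology)
  moreover have "{z \<in> topspace (subtopology X C). id z \<in> A} = A \<inter> C"
    using compact_Hausdorff_in_space(3)[OF C] by auto
  ultimately show "closedin X (A \<inter> C)"
    using closedin_Int_compact_Hausdorff_in[OF wH C] by simp
next
  assume A: "A \<subseteq> topspace X \<and> (\<forall>C. compact_Hausdorff_in X C \<longrightarrow> closedin X (A \<inter> C))"
  show "closedin (kify X) A"
    unfolding closedin_kify_raw
  proof (intro conjI allI impI)
    show "A \<subseteq> topspace X"
      using A by simp
    fix K :: "'a set set topology" and u
    assume K: "compact_space K \<and> Hausdorff_space K \<and> continuous_map K X u"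
    then have "closedin X (A \<inter> u ` topspace K)"
      using A compact_Hausdorff_in_image[OF wH] by blast
    then have "closedin K {z \<in> topspace K. u z \<in> A \<inter> u ` topspace K}"
      using K closedin_continuous_map_preimage by blast
    moreover have "{z \<in> topspace K. u z \<in> A \<inter> u ` topspace K} = {z \<in> topspace K. u z \<in> A}"
      by auto
    ultimately show "closedin K {z \<in> topspace K. u z \<in> A}"
      by simp
  qed
qed

lemma cgwh_closedin_iff:
  assumes "cgwh_space X"
  shows "closedin X A \<longleftrightarrow>
    A \<subseteq> topspace X \<and> (\<forall>C. compact_Hausdorff_in X C \<longrightarrow> closedin X (A \<inter> C))"
  using assms closedin_kify_iff[of X A] by (simp add: cgwh_space_def)

lemma kify_eqI:
  assumes "\<And>A. closedin (kify X) A \<Longrightarrow> closedin X A"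
  shows "kify X = X"
  using assms closedin_imp_closedin_kify by (metis topology_eq closedin_def openin_closedin_eq topspace_kify)

lemma cgwh_spaceI:
  assumes wH: "weak_Hausdorff X"
    and cg: "\<And>A. A \<subseteq> topspace X \<Longrightarrow> (\<And>C. compact_Hausdorff_in X C \<Longrightarrow> closedin X (A \<inter> C))
      \<Longrightarrow> closedin X A"
  shows "cgwh_space X"
  unfolding cgwh_space_def
proof
  show "kify X = X"
    using cg by (intro kify_eqI) (auto simp: closedin_kify_iff[OF wH])
qed (rule wH)

text \<open>Refining the topology does not change the continuous maps from compact Hausdorff test
  spaces, so \<open>kify\<close> is idempotent and images of test maps stay closed.\<close>

lemma cgwh_kify:
  fixes X :: "'a topology"
  assumes wH: "weak_Hausdorff X"
  shows "cgwh_space (kify X)"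
proof -
  have cont: "continuous_map K X u \<longleftrightarrow> continuous_map K (kify X) u"
    if "compact_space K" "Hausdorff_space K" for K :: "'a set set topology" and u
  proof
    assume u: "continuous_map K X u"
    then show "continuous_map K (kify X) u"
      using that unfolding continuous_map_closedin
      by (auto simp: closedin_kify_raw continuous_map_closedin)
  next
    assume "continuous_map K (kify X) u"
    then show "continuous_map K X u"
      using continuous_map_compose[OF _ continuous_map_kify_id, of K X u] by (simp add: comp_def)
  qed
  have "weak_Hausdorff (kify X)"
    using wH cont closedin_imp_closedin_kify unfolding weak_Hausdorff_def by blast
  moreover have "kify (kify X) = kify X"
  proof (rule kify_eqI)
    fix A assume "closedin (kify (kify X)) A"
    then show "closedin (kify X) A"
      unfolding closedin_kify_raw using cont by auto
  qed
  ultimately show ?thesis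
    by (simp add: cgwh_space_def)
qed

lemma continuous_map_compact_into_kify:
  assumes wH: "weak_Hausdorff X" and K: "compact_space K" "Hausdorff_space K"
    and u: "continuous_map K X u"
  shows "continuous_map K (kify X) u"
  unfolding continuous_map_closedin
proof (intro conjI allI impI)
  show "u \<in> topspace K \<rightarrow> topspace (kify X)"
    using u by (auto simp: continuous_map_def)
  fix A assume "closedin (kify X) A"
  then have "closedin X (A \<inter> u ` topspace K)"
    using compact_Hausdorff_in_image[OF assms] by (simp add: closedin_kify_iff[OF wH])
  then have "closedin K {z \<in> topspace K. u z \<in> A \<inter> u ` topspace K}"
    using u closedin_continuous_map_preimage by blast
  moreover have "{z \<in> topspace K. u z \<in> A \<inter> u ` topspace K} = {z \<in> topspace K. u z \<in> A}"
    by auto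
  ultimately show "closedin K {z \<in> topspace K. u z \<in> A}"
    by simp
qed

text \<open>The universal property of \<open>kify\<close>. Closedness of a preimage in the compactly
  generated source is checked on compact Hausdorff subsets, and on these the map already
  lifts.\<close>

lemma continuous_map_into_kify:
  assumes X: "cgwh_space X" and wH: "weak_Hausdorff Y" and f: "continuous_map X Y f"
  shows "continuous_map X (kify Y) f"
  unfolding continuous_map_closedin
proof (intro conjI allI impI)
  show "f \<in> topspace X \<rightarrow> topspace (kify Y)"
    using f by (auto simp: continuous_map_def)
  fix A assume A: "closedin (kify Y) A"
  have wX: "weak_Hausdorff X"
    using X by (simp add: cgwh_space_def)
  show "closedin X {x \<in> topspace X. f x \<in> A}"
  proof (subst cgwh_closedin_iff[OF X], intro conjI allI impI)
    fix C assume C: "compact_Hausdorff_in X C"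
    have "continuous_map (subtopology X C) (kify Y) f"
      using f by (intro continuous_map_compact_into_kify wH compact_Hausdorff_in_space[OF C]
        continuous_map_from_subtopology)
    then have "closedin (subtopology X C) {x \<in> topspace (subtopology X C). f x \<in> A}"
      using A closedin_continuous_map_preimage by blast
    moreover have "{x \<in> topspace (subtopology X C). f x \<in> A} = {x \<in> topspace X. f x \<in> A} \<inter> C"
      by auto
    ultimately show "closedin X ({x \<in> topspace X. f x \<in> A} \<inter> C)"
      using closedin_Int_compact_Hausdorff_in[OF wX C] by simp
  qed auto
qed

text \<open>
  Weak Hausdorffness is checked pointwise: near any point mapping to \<open>y\<close>, the image of
  a test map lies in a closed set missing \<open>x\<close>.
\<close>

definition kseparated :: "'a topology \<Rightarrow> 'a \<Rightarrow> 'a \<Rightarrow> bool" where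
  "kseparated X x y \<longleftrightarrow> (\<forall>(K :: 'a set set topology) u z.
     compact_space K \<and> Hausdorff_space K \<and> continuous_map K X u \<and> z \<in> topspace K \<and> u z = y \<longrightarrow>
       (\<exists>G B. openin K G \<and> z \<in> G \<and> closedin X B \<and> u ` G \<subseteq> B \<and> x \<notin> B))"

text \<open>A chart criterion. On a closed neighbourhood \<open>M\<close> of \<open>z\<close> inside
  the preimage of \<open>G\<close>, the map \<open>r\<close> after \<open>u\<close> has compact
  Hausdorff image \<open>?C\<close>. If \<open>x\<close> does not lie over \<open>?C\<close>, the
  preimage of \<open>?C\<close> is the closed set sought. Otherwise \<open>r x\<close> and
  \<open>r y\<close> are separated inside \<open>?C\<close>, and an open neighbourhood of
  \<open>r x\<close> is removed. The preimages in \<open>cl\<close> must be closed in all of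
  \<open>X\<close>, not only in the open set \<open>G\<close>.\<close>

lemma kseparated_local:
  fixes X :: "'a topology"
  assumes G: "openin X G" "y \<in> G" and r: "continuous_map (subtopology X G) Z r"
    and wZ: "weak_Hausdorff Z"
    and cl: "\<And>C. compact_Hausdorff_in Z C \<Longrightarrow> closedin X {p \<in> G. r p \<in> C}"
    and xy: "x \<notin> G \<or> r x \<noteq> r y"
  shows "kseparated X x y"
  unfolding kseparated_def
proof (intro allI impI)
  fix K :: "'a set set topology" and u z
  assume "compact_space K \<and> Hausdorff_space K \<and> continuous_map K X u \<and> z \<in> topspace K \<and> u z = y"
  then have K: "compact_space K" "Hausdorff_space K" and u: "continuous_map K X u"
    and z: "z \<in> topspace K" "u z = y"
    by auto
  have "regular_space K"
    using K compact_Hausdorff_imp_regular_space by blast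
  moreover have "openin K {w \<in> topspace K. u w \<in> G}"
    using u G openin_continuous_map_preimage by blast
  ultimately obtain H M where H: "openin K H" "closedin K M" "z \<in> H" "H \<subseteq> M"
    and M: "M \<subseteq> {w \<in> topspace K. u w \<in> G}"
    using z G(2) unfolding neighbourhood_base_of_closedin[symmetric] neighbourhood_base_of
    by (metis (mono_tags, lifting) mem_Collect_eq)
  have top: "topspace (subtopology K M) = M"
    using M by auto
  have KM: "compact_space (subtopology K M)" "Hausdorff_space (subtopology K M)"
    using K H by (auto simp: closedin_compact_space compact_space_subtopology Hausdorff_space_subtopology)
  have "continuous_map (subtopology K M) (subtopology X G) u"
    using u M by (auto simp: continuous_map_in_subtopology continuous_map_from_subtopology)
  then have ru: "continuous_map (subtopology K M) Z (r \<circ> u)"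
    using r continuous_map_compose by blast
  let ?C = "(r \<circ> u) ` M"
  have C: "compact_Hausdorff_in Z ?C"
    using compact_Hausdorff_in_image[OF wZ KM ru] by (simp only: top)
  show "\<exists>H B. openin K H \<and> z \<in> H \<and> closedin X B \<and> u ` H \<subseteq> B \<and> x \<notin> B"
  proof (cases "x \<in> G \<and> r x \<in> ?C")
    case False
    then show ?thesis
      using H M cl[OF C] by (intro exI[of _ H] exI[of _ "{p \<in> G. r p \<in> ?C}"]) auto
  next
    case True
    then have ne: "r x \<noteq> r y"
      using xy by auto
    have "r y \<in> ?C"
      using z H by auto
    then obtain A A' where A: "openin (subtopology Z ?C) A" "openin (subtopology Z ?C) A'"
        "r x \<in> A" "r y \<in> A'" "disjnt A A'"
      using True ne compact_Hausdorff_in_space[OF C] unfolding Hausdorff_space_def by metis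
    have "closedin (subtopology Z ?C) (?C - A)"
      using A(1) compact_Hausdorff_in_space(3)[OF C] by (metis closedin_diff closedin_topspace)
    then have C': "compact_Hausdorff_in Z (?C - A)"
      using compact_Hausdorff_in_closedin_sub[OF C] by blast
    have "continuous_map (subtopology K M) (subtopology Z ?C) (r \<circ> u)"
      using ru by (auto simp: continuous_map_in_subtopology)
    then have "openin (subtopology K M) {w \<in> topspace (subtopology K M). (r \<circ> u) w \<in> A'}"
      using A openin_continuous_map_preimage by blast
    then obtain N where N: "openin K N" "{w \<in> M. (r \<circ> u) w \<in> A'} = N \<inter> M"
      unfolding top by (auto simp: openin_subtopology)
    have "u ` (H \<inter> N) \<subseteq> {p \<in> G. r p \<in> ?C - A}"
      using N H M A(5) by (fastforce simp: disjnt_iff)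
    moreover have "z \<in> N"
    proof -
      have "z \<in> {w \<in> M. (r \<circ> u) w \<in> A'}"
        using z H A(4) by auto
      then show ?thesis
        using N by auto
    qed
    ultimately show ?thesis
      using H N cl[OF C'] A(3)
      by (intro exI[of _ "H \<inter> N"] exI[of _ "{p \<in> G. r p \<in> ?C - A}"]) auto
  qed
qed

lemma kseparated_map:
  assumes p: "continuous_map X Y p" and wY: "weak_Hausdorff Y"
    and y: "y \<in> topspace X" and ne: "p x \<noteq> p y"
  shows "kseparated X x y"
proof (rule kseparated_local[where G = "topspace X"])
  show "continuous_map (subtopology X (topspace X)) Y p"
    using p by simp
  show "closedin X {q \<in> topspace X. p q \<in> C}" if "compact_Hausdorff_in Y C" for C
    using closedin_continuous_map_preimage[OF p compact_Hausdorff_in_closedin[OF wY that]] .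
qed (use assms in auto)

text \<open>By compactness finitely many of the neighbourhoods \<open>G z\<close> cover
  \<open>K\<close>; the union of the corresponding sets \<open>B z\<close> is closed, contains the
  image and misses \<open>x\<close>.\<close>

lemma weak_Hausdorff_if_kseparated:
  fixes X :: "'a topology"
  assumes sep: "\<And>x y. x \<in> topspace X \<Longrightarrow> y \<in> topspace X \<Longrightarrow> x \<noteq> y \<Longrightarrow> kseparated X x y"
  shows "weak_Hausdorff X"
  unfolding weak_Hausdorff_def
proof (intro allI impI)
  fix K :: "'a set set topology" and u
  assume K: "compact_space K \<and> Hausdorff_space K \<and> continuous_map K X u"
  have sub: "u ` topspace K \<subseteq> topspace X"
    using K continuous_map_image_subset_topspace by blast
  have "\<exists>B. closedin X B \<and> u ` topspace K \<subseteq> B \<and> x \<notin> B"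
    if x: "x \<in> topspace X" "x \<notin> u ` topspace K" for x
  proof -
    have "\<exists>G B. openin K G \<and> z \<in> G \<and> closedin X B \<and> u ` G \<subseteq> B \<and> x \<notin> B" if "z \<in> topspace K" for z
    proof -
      have "kseparated X x (u z)"
        using that x sub by (intro sep) auto
      then show ?thesis
        using K that unfolding kseparated_def by blast
    qed
    then obtain G B where GB: "\<And>z. z \<in> topspace K \<Longrightarrow>
        openin K (G z) \<and> z \<in> G z \<and> closedin X (B z) \<and> u ` G z \<subseteq> B z \<and> x \<notin> B z"
      by metis
    have "\<forall>U\<in>G ` topspace K. openin K U" "topspace K \<subseteq> \<Union>(G ` topspace K)"
      using GB by blast+
    then have "\<exists>\<F>. finite \<F> \<and> \<F> \<subseteq> G ` topspace K \<and> topspace K \<subseteq> \<Union>\<F>"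
      using K unfolding compact_space_alt by presburger
    then obtain T where T: "finite T" "T \<subseteq> topspace K" "topspace K \<subseteq> \<Union>(G ` T)"
      by (metis finite_subset_image)
    show ?thesis
    proof (intro exI conjI)
      show "closedin X (\<Union>(B ` T))"
        using T GB by (intro closedin_Union) auto
      show "u ` topspace K \<subseteq> \<Union>(B ` T)"
        using T GB by (fastforce simp: subset_eq)
      show "x \<notin> \<Union>(B ` T)"
        using T GB by auto
    qed
  qed
  then obtain B where B: "\<And>x. x \<in> topspace X - u ` topspace K \<Longrightarrow>
      closedin X (B x) \<and> u ` topspace K \<subseteq> B x \<and> x \<notin> B x"
    by (metis DiffD1 DiffD2)
  have eq: "topspace X - u ` topspace K = (\<Union>x\<in>topspace X - u ` topspace K. topspace X - B x)"
    using B by auto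
  have "openin X (\<Union>x\<in>topspace X - u ` topspace K. topspace X - B x)"
    using B by (intro openin_Union) (auto simp: closedin_def)
  then have "openin X (topspace X - u ` topspace K)"
    using eq by simp
  then show "closedin X (u ` topspace K)"
    using sub by (simp add: closedin_def)
qed

text \<open>For test maps \<open>u\<close> and \<open>v\<close>, separation in either order makes
  the set of pairs with \<open>u z = v w\<close> closed in the product, and its projection along the
  compact factor \<open>K\<close> is the preimage of the image of \<open>u\<close> under
  \<open>v\<close>. This one-sided version serves the telescope, where only points other than the
  base point have charts.\<close>

lemma weak_Hausdorff_if_kseparated_either:
  fixes X :: "'a topology"
  assumes cg: "kify X = X"
    and sep: "\<And>x y. x \<in> topspace X \<Longrightarrow> y \<in> topspace X \<Longrightarrow> x \<noteq> y \<Longrightarrow>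
      kseparated X x y \<or> kseparated X y x"
  shows "weak_Hausdorff X"
  unfolding weak_Hausdorff_def
proof (intro allI impI)
  fix K :: "'a set set topology" and u
  assume K: "compact_space K \<and> Hausdorff_space K \<and> continuous_map K X u"
  have uK: "u z \<in> topspace X" if "z \<in> topspace K" for z
    using K that by (auto simp: continuous_map_def)
  have "closedin (kify X) (u ` topspace K)"
    unfolding closedin_kify_raw
  proof (intro conjI allI impI)
    show "u ` topspace K \<subseteq> topspace X"
      using uK by auto
    fix L :: "'a set set topology" and v
    assume L: "compact_space L \<and> Hausdorff_space L \<and> continuous_map L X v"
    have vL: "v w \<in> topspace X" if "w \<in> topspace L" for w
      using L that by (auto simp: continuous_map_def)
    let ?R = "{p \<in> topspace K \<times> topspace L. u (fst p) = v (snd p)}"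
    have "openin (prod_topology K L) (topspace (prod_topology K L) - ?R)"
    proof (subst openin_subopen, intro ballI)
      fix p assume p: "p \<in> topspace (prod_topology K L) - ?R"
      obtain z w where zw: "p = (z, w)" "z \<in> topspace K" "w \<in> topspace L" "u z \<noteq> v w"
        using p by (cases p) auto
      have "\<exists>G H. openin K G \<and> openin L H \<and> z \<in> G \<and> w \<in> H \<and> (\<forall>a\<in>G. \<forall>b\<in>H. u a \<noteq> v b)"
        using sep[OF vL[OF zw(3)] uK[OF zw(2)] zw(4)[symmetric]]
      proof
        assume "kseparated X (v w) (u z)"
        then obtain G B where GB: "openin K G" "z \<in> G" "closedin X B" "u ` G \<subseteq> B" "v w \<notin> B"
          using K[THEN conjunct1] K[THEN conjunct2] zw(2) unfolding kseparated_def by metis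
        have "openin L {b \<in> topspace L. v b \<in> topspace X - B}"
          using L GB by (intro openin_continuous_map_preimage[of L X v]) auto
        then show ?thesis
          using GB zw vL by (intro exI[of _ G] exI[of _ "{b \<in> topspace L. v b \<in> topspace X - B}"]) auto
      next
        assume "kseparated X (u z) (v w)"
        then obtain H B where GB: "openin L H" "w \<in> H" "closedin X B" "v ` H \<subseteq> B" "u z \<notin> B"
          using L[THEN conjunct1] L[THEN conjunct2] zw(3) unfolding kseparated_def by metis
        have "openin K {a \<in> topspace K. u a \<in> topspace X - B}"
          using K GB by (intro openin_continuous_map_preimage[of K X u]) auto
        then show ?thesis
          using GB zw uK by (intro exI[of _ "{a \<in> topspace K. u a \<in> topspace X - B}"] exI[of _ H]) auto
      qed
      then obtain G H where GH: "openin K G" "openin L H" "z \<in> G" "w \<in> H" "\<forall>a\<in>G. \<forall>b\<in>H. u a \<noteq> v b"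
        by blast
      have "openin (prod_topology K L) (G \<times> H)"
        using GH by (simp add: openin_prod_Times_iff)
      moreover have "G \<times> H \<subseteq> topspace (prod_topology K L) - ?R"
        using GH openin_subset[OF GH(1)] openin_subset[OF GH(2)] by auto
      ultimately show "\<exists>T. openin (prod_topology K L) T \<and> p \<in> T \<and> T \<subseteq> topspace (prod_topology K L) - ?R"
        using GH zw by blast
    qed
    then have "closedin (prod_topology K L) ?R"
      by (subst closedin_def) auto
    then have "closedin L (snd ` ?R)"
      using closed_map_snd[of K L] K by (auto simp: closed_map_def)
    moreover have "snd ` ?R = {w \<in> topspace L. v w \<in> u ` topspace K}"
      by force
    ultimately show "closedin L {w \<in> topspace L. v w \<in> u ` topspace K}"
      by simp
  qed
  then show "closedin X (u ` topspace K)"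
    by (simp add: cg)
qed

section \<open>Permanence of weak Hausdorff and compactly generated spaces\<close>

lemma weak_Hausdorff_injective_map:
  assumes "continuous_map X Y f" "inj_on f (topspace X)" "weak_Hausdorff Y"
  shows "weak_Hausdorff X"
proof (rule weak_Hausdorff_if_kseparated)
  fix x y assume "x \<in> topspace X" "y \<in> topspace X" "x \<noteq> y"
  then show "kseparated X x y"
    using assms by (intro kseparated_map[of X Y f]) (auto simp: inj_on_def)
qed

lemma weak_Hausdorff_subtopology: "weak_Hausdorff X \<Longrightarrow> weak_Hausdorff (subtopology X S)"
  by (rule weak_Hausdorff_injective_map[of _ X id])
    (auto simp: continuous_map_from_subtopology)

lemma Hausdorff_imp_weak_Hausdorff: "Hausdorff_space X \<Longrightarrow> weak_Hausdorff X"
  unfolding weak_Hausdorff_def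
  by (meson compact_space_def compactin_imp_closedin image_compactin)

lemma weak_Hausdorff_prod:
  assumes "weak_Hausdorff X" "weak_Hausdorff Y"
  shows "weak_Hausdorff (prod_topology X Y)"
proof (rule weak_Hausdorff_if_kseparated)
  fix p q assume "p \<in> topspace (prod_topology X Y)" and q: "q \<in> topspace (prod_topology X Y)" and "p \<noteq> q"
  then consider "fst p \<noteq> fst q" | "snd p \<noteq> snd q"
    by (auto simp: prod_eq_iff)
  then show "kseparated (prod_topology X Y) p q"
  proof cases
    case 1
    then show ?thesis
      using kseparated_map[OF continuous_map_fst assms(1) q] by simp
  next
    case 2
    then show ?thesis
      using kseparated_map[OF continuous_map_snd assms(2) q] by simp
  qed
qed

lemma cgwh_closed_subtopology:
  assumes X: "cgwh_space X" and A: "closedin X A"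
  shows "cgwh_space (subtopology X A)"
proof (rule cgwh_spaceI)
  show wH: "weak_Hausdorff (subtopology X A)"
    using X by (simp add: cgwh_space_def weak_Hausdorff_subtopology)
  have wX: "weak_Hausdorff X"
    using X by (simp add: cgwh_space_def)
  fix B assume B: "B \<subseteq> topspace (subtopology X A)"
    and cl: "\<And>C. compact_Hausdorff_in (subtopology X A) C \<Longrightarrow> closedin (subtopology X A) (B \<inter> C)"
  have "closedin X B"
  proof (subst cgwh_closedin_iff[OF X], intro conjI allI impI)
    show "B \<subseteq> topspace X"
      using B by auto
    fix C assume "compact_Hausdorff_in X C"
    then have "compact_Hausdorff_in (subtopology X A) (C \<inter> A)"
      using A compact_Hausdorff_in_Int by (auto simp: compact_Hausdorff_in_subtopology)
    then have "closedin X (B \<inter> (C \<inter> A))"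
      using cl A closedin_trans_full by blast
    moreover have "B \<inter> (C \<inter> A) = B \<inter> C"
      using B by auto
    ultimately show "closedin X (B \<inter> C)"
      by simp
  qed
  then show "closedin (subtopology X A) B"
    using B by (simp add: closedin_subset_topspace)
qed

lemma cgwh_homeomorphic:
  assumes X: "cgwh_space X" and f: "homeomorphic_map X Y f"
  shows "cgwh_space Y"
proof -
  obtain g where g: "homeomorphic_maps X Y f g"
    using f homeomorphic_map_maps by blast
  have wX: "weak_Hausdorff X"
    using X by (simp add: cgwh_space_def)
  have wY: "weak_Hausdorff Y"
    using g wX by (intro weak_Hausdorff_injective_map[of Y X g])
      (auto simp: homeomorphic_maps_def inj_on_def, metis)
  show ?thesis
  proof (rule cgwh_spaceI[OF wY])
    fix A assume A: "A \<subseteq> topspace Y"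
      and cl: "\<And>C. compact_Hausdorff_in Y C \<Longrightarrow> closedin Y (A \<inter> C)"
    have "closedin X {x \<in> topspace X. f x \<in> A}"
    proof (subst cgwh_closedin_iff[OF X], intro conjI allI impI)
      fix C assume C: "compact_Hausdorff_in X C"
      have "continuous_map (subtopology X C) Y f"
        using g by (simp add: homeomorphic_maps_def continuous_map_from_subtopology)
      then have "compact_Hausdorff_in Y (f ` C)"
        using compact_Hausdorff_in_image[OF wY compact_Hausdorff_in_space(1,2)[OF C]]
        by (simp only: compact_Hausdorff_in_space(3)[OF C])
      then have "closedin X {x \<in> topspace X. f x \<in> A \<inter> f ` C}"
        using cl g closedin_continuous_map_preimage unfolding homeomorphic_maps_def by blast
      moreover have "{x \<in> topspace X. f x \<in> A \<inter> f ` C} = {x \<in> topspace X. f x \<in> A} \<inter> C"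
        using g compact_Hausdorff_in_subset[OF C] unfolding homeomorphic_maps_def by auto (metis subsetD)
      ultimately show "closedin X ({x \<in> topspace X. f x \<in> A} \<inter> C)"
        by simp
    qed auto
    then have "closedin Y (f ` {x \<in> topspace X. f x \<in> A})"
      using f homeomorphic_imp_closed_map closed_map_def by blast
    moreover have "f ` {x \<in> topspace X. f x \<in> A} = A"
      using A homeomorphic_imp_surjective_map[OF f] by auto
    ultimately show "closedin Y A"
      by simp
  qed
qed

text \<open>A set \<open>A\<close> that is closed on all boxes over compact Hausdorff
  \<open>C\<close> has closed projections to \<open>X\<close> from each closed \<open>M\<close> in
  \<open>J\<close>. Given a point \<open>(j0, x0)\<close> outside \<open>A\<close>, regularity of
  \<open>J\<close> supplies a closed neighbourhood \<open>M\<close> of \<open>j0\<close> over which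
  \<open>A\<close> avoids \<open>x0\<close>; removing the projection of \<open>A\<close> from
  \<open>M\<close> leaves an open box around the point.\<close>

lemma cgwh_prod_compact:
  assumes J: "compact_space J" "Hausdorff_space J" and X: "cgwh_space X"
  shows "cgwh_space (prod_topology J X)"
proof -
  have wX: "weak_Hausdorff X"
    using X by (simp add: cgwh_space_def)
  have wP: "weak_Hausdorff (prod_topology J X)"
    using J wX by (simp add: weak_Hausdorff_prod Hausdorff_imp_weak_Hausdorff)
  have box: "compact_Hausdorff_in (prod_topology J X) (topspace J \<times> C)" if "compact_Hausdorff_in X C" for C
  proof -
    let ?K = "prod_topology J (subtopology X C)"
    have "compact_space ?K" "Hausdorff_space ?K"
      using J compact_Hausdorff_in_space[OF that]
      by (auto simp: compact_space_prod_topology Hausdorff_space_prod_topology)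
    moreover have "continuous_map ?K (prod_topology J X) id"
      by (simp add: prod_topology_subtopology continuous_map_from_subtopology)
    ultimately have "compact_Hausdorff_in (prod_topology J X) (id ` topspace ?K)"
      using compact_Hausdorff_in_image[OF wP] by blast
    then show ?thesis
      using compact_Hausdorff_in_subset[OF that] by (simp add: Int_absorb1)
  qed
  show ?thesis
  proof (rule cgwh_spaceI[OF wP])
    fix A assume A: "A \<subseteq> topspace (prod_topology J X)"
      and cl: "\<And>C. compact_Hausdorff_in (prod_topology J X) C \<Longrightarrow> closedin (prod_topology J X) (A \<inter> C)"
    have proj: "closedin X {x \<in> topspace X. \<exists>j\<in>M. (j, x) \<in> A}" if M: "closedin J M" for M
    proof (subst cgwh_closedin_iff[OF X], intro conjI allI impI)
      fix C assume C: "compact_Hausdorff_in X C"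
      let ?D = "A \<inter> (topspace J \<times> C) \<inter> (M \<times> topspace X)"
      have "closedin (prod_topology J X) ?D"
        using M by (intro closedin_Int cl[OF box[OF C]]) (simp add: closedin_prod_Times_iff)
      then have D: "compact_Hausdorff_in (prod_topology J X) ?D"
        using compact_Hausdorff_in_Int[OF box[OF C], of ?D] by (simp add: Int_absorb1 Int_commute Int_left_commute)
      have "continuous_map (subtopology (prod_topology J X) ?D) X snd"
        by (intro continuous_map_from_subtopology continuous_map_snd)
      then have "closedin X (snd ` ?D)"
        using weak_Hausdorff_image_closedin[OF wX compact_Hausdorff_in_space(1,2)[OF D]]
        by (simp only: compact_Hausdorff_in_space(3)[OF D])
      moreover have "snd ` ?D = {x \<in> topspace X. \<exists>j\<in>M. (j, x) \<in> A} \<inter> C"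
      proof (intro equalityI subsetI)
        fix x assume "x \<in> {x \<in> topspace X. \<exists>j\<in>M. (j, x) \<in> A} \<inter> C"
        then obtain j where "j \<in> M" "(j, x) \<in> A" "x \<in> C"
          by auto
        then have "(j, x) \<in> ?D"
          using A by auto
        then show "x \<in> snd ` ?D"
          by (metis image_eqI snd_conv)
      qed (use compact_Hausdorff_in_subset[OF C] in auto)
      ultimately show "closedin X ({x \<in> topspace X. \<exists>j\<in>M. (j, x) \<in> A} \<inter> C)"
        by simp
    qed auto
    have "openin (prod_topology J X) (topspace (prod_topology J X) - A)"
    proof (subst openin_subopen, intro ballI)
      fix p assume p: "p \<in> topspace (prod_topology J X) - A"
      obtain j0 x0 where jx: "p = (j0, x0)" "j0 \<in> topspace J" "x0 \<in> topspace X" "(j0, x0) \<notin> A"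
        using p by (cases p) auto
      have "continuous_map J (prod_topology J X) (\<lambda>j. (j, x0))"
        using jx by (simp add: continuous_map_pairwise comp_def)
      moreover have "compact_Hausdorff_in X {x0}"
        using jx compact_Hausdorff_in_image[OF wX, of "discrete_topology {()}" "\<lambda>_. x0"]
        by (simp add: compact_space_discrete_topology)
      ultimately have "closedin J {j \<in> topspace J. (j, x0) \<in> A \<inter> (topspace J \<times> {x0})}"
        using cl[OF box] closedin_continuous_map_preimage by blast
      then have "openin J (topspace J - {j \<in> topspace J. (j, x0) \<in> A})"
        by (simp add: closedin_def) (metis (no_types, lifting) Collect_cong mem_Sigma_iff IntI IntE singletonI)
      moreover have "regular_space J"
        using J compact_Hausdorff_imp_regular_space by blast
      ultimately obtain N M where N: "openin J N" "closedin J M" "j0 \<in> N" "N \<subseteq> M"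
        and M: "M \<subseteq> topspace J - {j \<in> topspace J. (j, x0) \<in> A}"
        using jx unfolding neighbourhood_base_of_closedin[symmetric] neighbourhood_base_of
        by (metis (no_types, lifting) DiffI mem_Collect_eq)
      let ?W = "topspace X - {x \<in> topspace X. \<exists>j\<in>M. (j, x) \<in> A}"
      have W: "openin X ?W"
        using proj[OF N(2)] by (simp add: closedin_def)
      have "openin (prod_topology J X) (N \<times> ?W)"
        using N W by (simp add: openin_prod_Times_iff)
      moreover have "N \<times> ?W \<subseteq> topspace (prod_topology J X) - A"
        using N openin_subset[OF N(1)] by auto
      moreover have "p \<in> N \<times> ?W"
        using jx N M by auto
      ultimately show "\<exists>T. openin (prod_topology J X) T \<and> p \<in> T \<and> T \<subseteq> topspace (prod_topology J X) - A"
        by blast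
    qed
    then show "closedin (prod_topology J X) A"
      using A by (simp add: closedin_def)
  qed
qed

text \<open>The fixed points in a compact Hausdorff \<open>C\<close> lie in \<open>C \<inter> s\<inverse>(C)\<close>, and there \<open>s\<close> and \<open>id\<close> are
  maps into a Hausdorff space.\<close>

lemma cgwh_closedin_fixed_points:
  assumes X: "cgwh_space X" and s: "continuous_map X X s"
  shows "closedin X {x \<in> topspace X. s x = x}"
proof (subst cgwh_closedin_iff[OF X], intro conjI allI impI)
  have wX: "weak_Hausdorff X"
    using X by (simp add: cgwh_space_def)
  fix C assume C: "compact_Hausdorff_in X C"
  have "closedin X (C \<inter> {x \<in> topspace X. s x \<in> C})"
    using C wX s by (intro closedin_Int closedin_continuous_map_preimage[OF s] compact_Hausdorff_in_closedin)
  moreover define D where "D = C \<inter> {x \<in> topspace X. s x \<in> C}"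
  ultimately have D: "closedin X D"
    by simp
  have "closedin (subtopology X D) {x \<in> topspace (subtopology X D). s x = id x}"
  proof (rule closedin_continuous_maps_eq[of "subtopology X C"])
    show "Hausdorff_space (subtopology X C)"
      using compact_Hausdorff_in_space[OF C] by blast
    show "continuous_map (subtopology X D) (subtopology X C) s"
      "continuous_map (subtopology X D) (subtopology X C) id"
      using s by (auto simp: continuous_map_in_subtopology continuous_map_from_subtopology D_def)
  qed
  moreover have "{x \<in> topspace (subtopology X D). s x = id x} = {x \<in> topspace X. s x = x} \<inter> C"
    by (auto simp: D_def)
  ultimately show "closedin X ({x \<in> topspace X. s x = x} \<inter> C)"
    using D closedin_trans_full by fastforce
qed auto

section \<open>Function spaces and closed embeddings\<close>

lemma continuous_map_prod_sum_topology:
  assumes f: "\<And>i. i \<in> I \<Longrightarrow> continuous_map (prod_topology Z (X i)) Y (\<lambda>(z, x). f (z, i, x))"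
  shows "continuous_map (prod_topology Z (sum_topology X I)) Y f"
  unfolding continuous_map_def
proof (intro conjI allI impI)
  show "f \<in> topspace (prod_topology Z (sum_topology X I)) \<rightarrow> topspace Y"
    using f by (force simp: continuous_map_def Pi_iff)
  fix U assume U: "openin Y U"
  let ?S = "{p \<in> topspace (prod_topology Z (sum_topology X I)). f p \<in> U}"
  show "openin (prod_topology Z (sum_topology X I)) ?S"
    unfolding openin_prod_topology_alt
  proof (intro allI impI)
    fix z w assume zw: "(z, w) \<in> ?S"
    obtain i x where w: "w = (i, x)" "i \<in> I" "x \<in> topspace (X i)"
      using zw by (cases w) auto
    let ?T = "{p \<in> topspace (prod_topology Z (X i)). (case p of (z, x) \<Rightarrow> f (z, i, x)) \<in> U}"
    have "openin (prod_topology Z (X i)) ?T"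
      by (rule openin_continuous_map_preimage[OF f[OF w(2)] U])
    moreover have "(z, x) \<in> ?T"
      using zw w by auto
    ultimately obtain A B where AB: "openin Z A" "openin (X i) B" "z \<in> A" "x \<in> B" "A \<times> B \<subseteq> ?T"
      unfolding openin_prod_topology_alt by meson
    have "openin (sum_topology X I) (Pair i ` B)"
      using open_map_component_injection[OF w(2), of X] AB by (simp add: open_map_def)
    moreover have "A \<times> Pair i ` B \<subseteq> ?S"
      using AB w openin_subset[OF AB(1)] openin_subset[OF AB(2)] by auto
    ultimately show "\<exists>A B. openin Z A \<and> openin (sum_topology X I) B \<and> z \<in> A \<and> w \<in> B \<and> A \<times> B \<subseteq> ?S"
      using AB w by blast
  qed
qed

lemma continuous_map_from_sum_topology:
  assumes f: "\<And>i. i \<in> I \<Longrightarrow> continuous_map (X i) Y (\<lambda>x. f (i, x))"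
  shows "continuous_map (sum_topology X I) Y f"
  unfolding continuous_map_def
proof (intro conjI allI impI)
  show "f \<in> topspace (sum_topology X I) \<rightarrow> topspace Y"
    using f by (force simp: continuous_map_def Pi_iff)
  fix U assume "openin Y U"
  then have "openin (X i) {x \<in> topspace (X i). f (i, x) \<in> U}" if "i \<in> I" for i
    using f[OF that] openin_continuous_map_preimage by blast
  moreover have "{x. (i, x) \<in> {p \<in> topspace (sum_topology X I). f p \<in> U}} = {x \<in> topspace (X i). f (i, x) \<in> U}"
    if "i \<in> I" for i
    using that by auto
  ultimately show "openin (sum_topology X I) {p \<in> topspace (sum_topology X I). f p \<in> U}"
    unfolding openin_sum_topology by auto
qed

section \<open>Continuity for the compact-open topology\<close>

lemma topspace_compact_open:
  "topspace (compact_open X Y) = {f \<in> extensional (topspace X). continuous_map X Y f}"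
proof -
  have "compactin X {}" "openin Y {}"
    by auto
  then show ?thesis
    unfolding compact_open_def topology_generated_by_topspace by blast
qed

lemma openin_compact_open_basic:
  assumes "compactin X K" "openin Y U"
  shows "openin (compact_open X Y)
    {f \<in> extensional (topspace X). continuous_map X Y f \<and> f ` K \<subseteq> U}"
  unfolding compact_open_def using assms by (intro topology_generated_by_Basis) blast

lemma continuous_map_into_compact_open:
  assumes "\<And>z. z \<in> topspace Z \<Longrightarrow> h z \<in> extensional (topspace X)"
    and "\<And>z. z \<in> topspace Z \<Longrightarrow> continuous_map X Y (h z)"
    and op: "\<And>K U. compactin X K \<Longrightarrow> openin Y U \<Longrightarrow> openin Z {z \<in> topspace Z. h z ` K \<subseteq> U}"
  shows "continuous_map Z (compact_open X Y) h"
  unfolding compact_open_def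
proof (rule continuous_on_generated_topo)
  fix S assume "S \<in> {{f \<in> extensional (topspace X). continuous_map X Y f \<and> f ` K \<subseteq> U} |K U.
        compactin X K \<and> openin Y U}"
  then obtain K U where KU: "compactin X K" "openin Y U"
      "S = {f \<in> extensional (topspace X). continuous_map X Y f \<and> f ` K \<subseteq> U}"
    by blast
  have "h -` S \<inter> topspace Z = {z \<in> topspace Z. h z ` K \<subseteq> U}"
    using assms(1,2) KU(3) by auto
  then show "openin Z (h -` S \<inter> topspace Z)"
    using op KU by simp
next
  have "h ` topspace Z \<subseteq> topspace (compact_open X Y)"
    using assms(1,2) by (auto simp: topspace_compact_open)
  then show "h ` topspace Z \<subseteq> \<Union>{{f \<in> extensional (topspace X). continuous_map X Y f \<and> f ` K \<subseteq> U} |K U.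
        compactin X K \<and> openin Y U}"
    by (simp only: compact_open_def topology_generated_by_topspace)
qed

lemma continuous_map_compact_open_eval:
  assumes x: "x \<in> topspace X"
  shows "continuous_map (compact_open X Y) Y (\<lambda>f. f x)"
  unfolding continuous_map_def
proof (intro conjI allI impI)
  show "(\<lambda>f. f x) \<in> topspace (compact_open X Y) \<rightarrow> topspace Y"
    using x by (auto simp: topspace_compact_open continuous_map_def)
  fix U assume U: "openin Y U"
  have "{f \<in> topspace (compact_open X Y). f x \<in> U}
    = {f \<in> extensional (topspace X). continuous_map X Y f \<and> f ` {x} \<subseteq> U}"
    by (auto simp: topspace_compact_open)
  then show "openin (compact_open X Y) {f \<in> topspace (compact_open X Y). f x \<in> U}"
    using x U openin_compact_open_basic[of X "{x}" Y U] by simp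
qed

text \<open>Different maps differ at some point \<open>x\<close>, and evaluation at \<open>x\<close>
  is continuous into the weak Hausdorff space \<open>Y\<close>.\<close>

lemma weak_Hausdorff_compact_open:
  assumes "weak_Hausdorff Y"
  shows "weak_Hausdorff (compact_open X Y)"
proof (rule weak_Hausdorff_if_kseparated)
  fix f g assume f: "f \<in> topspace (compact_open X Y)" and g: "g \<in> topspace (compact_open X Y)"
    and "f \<noteq> g"
  then obtain x where "x \<in> topspace X" "f x \<noteq> g x"
    using extensionalityI[of f "topspace X" g] by (auto simp: topspace_compact_open)
  then show "kseparated (compact_open X Y) f g"
    using kseparated_map[OF continuous_map_compact_open_eval assms g] by blast
qed

lemma continuous_map_compact_open_curry:
  assumes h: "continuous_map (prod_topology Z X) Y (\<lambda>(z, x). h z x)"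
    and ext: "\<And>z. z \<in> topspace Z \<Longrightarrow> h z \<in> extensional (topspace X)"
  shows "continuous_map Z (compact_open X Y) h"
proof (rule continuous_map_into_compact_open[OF ext])
  fix z assume "z \<in> topspace Z"
  then have "continuous_map X (prod_topology Z X) (\<lambda>x. (z, x))"
    by (simp add: continuous_map_pairwise comp_def)
  from continuous_map_compose[OF this h] show "continuous_map X Y (h z)"
    by (simp add: comp_def)
next
  fix K U assume KU: "compactin X K" "openin Y U"
  let ?W = "{p \<in> topspace (prod_topology Z X). (case p of (z, x) \<Rightarrow> h z x) \<in> U}"
  have W: "openin (prod_topology Z X) ?W"
    using openin_continuous_map_preimage[OF h KU(2)] .
  show "openin Z {z \<in> topspace Z. h z ` K \<subseteq> U}"
  proof (subst openin_subopen, intro ballI)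
    fix z assume z: "z \<in> {z \<in> topspace Z. h z ` K \<subseteq> U}"
    then have zW: "z \<in> topspace Z" "{z} \<times> K \<subseteq> ?W"
      using compactin_subset_topspace[OF KU(1)] by auto
    obtain A B where AB: "openin Z A" "openin X B" "z \<in> A" "K \<subseteq> B" "A \<times> B \<subseteq> ?W"
      using tube_lemma_right[OF W KU(1) zW] by blast
    have "A \<subseteq> {z \<in> topspace Z. h z ` K \<subseteq> U}"
    proof
      fix a assume a: "a \<in> A"
      have "(a, x) \<in> ?W" if "x \<in> K" for x
        using AB a that by blast
      then show "a \<in> {z \<in> topspace Z. h z ` K \<subseteq> U}"
        using openin_subset[OF AB(1)] a by auto
    qed
    then show "\<exists>T. openin Z T \<and> z \<in> T \<and> T \<subseteq> {z \<in> topspace Z. h z ` K \<subseteq> U}"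
      using AB by blast
  qed
qed

lemma continuous_map_compact_open_postcompose:
  assumes T: "continuous_map (prod_topology J Y) Y' T"
  shows "continuous_map (prod_topology J (compact_open X Y)) (compact_open X Y')
    (\<lambda>(j, s). \<lambda>x\<in>topspace X. T (j, s x))"
proof (rule continuous_map_into_compact_open)
  fix z assume z: "z \<in> topspace (prod_topology J (compact_open X Y))"
  obtain j s where js: "z = (j, s)" "j \<in> topspace J" "continuous_map X Y s"
    using z by (cases z) (auto simp: topspace_compact_open)
  have "continuous_map X (prod_topology J Y) (\<lambda>x. (j, s x))"
    using js by (simp add: continuous_map_pairwise comp_def)
  from continuous_map_compose[OF this T]
  show "continuous_map X Y' (case z of (j, s) \<Rightarrow> \<lambda>x\<in>topspace X. T (j, s x))"
    by (rule continuous_map_eq) (simp add: js)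
  show "(case z of (j, s) \<Rightarrow> \<lambda>x\<in>topspace X. T (j, s x)) \<in> extensional (topspace X)"
    by (simp add: js)
next
  fix K U assume KU: "compactin X K" "openin Y' U"
  let ?W = "{p \<in> topspace (prod_topology J Y). T p \<in> U}"
  have W: "openin (prod_topology J Y) ?W"
    using openin_continuous_map_preimage[OF T KU(2)] .
  have KX: "K \<subseteq> topspace X"
    using compactin_subset_topspace[OF KU(1)] .
  let ?P = "prod_topology J (compact_open X Y)"
  let ?S = "{z \<in> topspace ?P. (case z of (j, s) \<Rightarrow> \<lambda>x\<in>topspace X. T (j, s x)) ` K \<subseteq> U}"
  show "openin ?P ?S"
    unfolding openin_prod_topology_alt
  proof (intro allI impI)
    fix j s assume js: "(j, s) \<in> ?S"
    then have s: "continuous_map X Y s" and j: "j \<in> topspace J"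
      by (auto simp: topspace_compact_open)
    have "T (j, s x) \<in> U" if "x \<in> K" for x
    proof -
      have "(\<lambda>x\<in>topspace X. T (j, s x)) x \<in> U"
        using js that by auto
      then show ?thesis
        using that KX by auto
    qed
    moreover have "s x \<in> topspace Y" if "x \<in> K" for x
      using s KX that by (auto simp: continuous_map_def)
    ultimately have sK: "{j} \<times> s ` K \<subseteq> ?W"
      using j by auto
    obtain A B where AB: "openin J A" "openin Y B" "j \<in> A" "s ` K \<subseteq> B" "A \<times> B \<subseteq> ?W"
      using tube_lemma_right[OF W image_compactin[OF KU(1) s] j sK] by blast
    let ?B = "{f \<in> extensional (topspace X). continuous_map X Y f \<and> f ` K \<subseteq> B}"
    have "openin (compact_open X Y) ?B"
      using openin_compact_open_basic[OF KU(1) AB(2)] .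
    moreover have "s \<in> ?B"
      using js AB by (auto simp: topspace_compact_open)
    moreover have "A \<times> ?B \<subseteq> ?S"
    proof
      fix z assume z: "z \<in> A \<times> ?B"
      then obtain a g where ag: "z = (a, g)" "a \<in> A" "g \<in> ?B"
        by blast
      have "(a, g x) \<in> ?W" if "x \<in> K" for x
        using AB(5) ag that by blast
      then have "T (a, g x) \<in> U" if "x \<in> K" for x
        using that by blast
      then show "z \<in> ?S"
        using ag KX openin_subset[OF AB(1)] by (auto simp: topspace_compact_open)
    qed
    ultimately show "\<exists>U V. openin J U \<and> openin (compact_open X Y) V \<and> j \<in> U \<and> s \<in> V \<and> U \<times> V \<subseteq> ?S"
      using AB by blast
  qed
qed

text \<open>The map \<open>b\<close> is continuous only on a subspace \<open>A\<close> because it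
  will be the inverse of a closed embedding of total spaces; in this form the lemma gives the
  continuity of the inverse comparison of sections.\<close>

lemma continuous_map_compact_open_compose:
  assumes a: "continuous_map X' X a" and b: "continuous_map (subtopology Y A) Y' b"
  shows "continuous_map (subtopology (compact_open X Y) {s. s ` topspace X \<subseteq> A}) (compact_open X' Y')
    (\<lambda>s. \<lambda>x\<in>topspace X'. b (s (a x)))"
proof (rule continuous_map_into_compact_open)
  fix s assume "s \<in> topspace (subtopology (compact_open X Y) {s. s ` topspace X \<subseteq> A})"
  then have s: "continuous_map X (subtopology Y A) s"
    by (auto simp: topspace_compact_open continuous_map_in_subtopology)
  have "continuous_map X' Y' (b \<circ> (s \<circ> a))"
    by (rule continuous_map_compose[OF continuous_map_compose[OF a s] b])
  then show "continuous_map X' Y' (\<lambda>x\<in>topspace X'. b (s (a x)))"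
    by (rule continuous_map_eq) simp
next
  fix K U assume KU: "compactin X' K" "openin Y' U"
  let ?P = "subtopology (compact_open X Y) {s. s ` topspace X \<subseteq> A}"
  have "openin (subtopology Y A) {y \<in> topspace (subtopology Y A). b y \<in> U}"
    using openin_continuous_map_preimage[OF b KU(2)] .
  then obtain V where V: "openin Y V" "{y \<in> topspace (subtopology Y A). b y \<in> U} = V \<inter> A"
    by (auto simp: openin_subtopology)
  have aK: "compactin X (a ` K)"
    using image_compactin[OF KU(1) a] .
  have KX: "K \<subseteq> topspace X'" "a ` K \<subseteq> topspace X"
    using compactin_subset_topspace[OF KU(1)] compactin_subset_topspace[OF aK] by auto
  have "{s \<in> topspace ?P. (\<lambda>x\<in>topspace X'. b (s (a x))) ` K \<subseteq> U}
    = {f \<in> extensional (topspace X). continuous_map X Y f \<and> f ` a ` K \<subseteq> V} \<inter> {s. s ` topspace X \<subseteq> A}"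
    (is "?L = ?R")
  proof (intro equalityI subsetI)
    fix s assume s: "s \<in> ?L"
    then have sY: "continuous_map X Y s" "s ` topspace X \<subseteq> A" "s \<in> extensional (topspace X)"
      by (auto simp: topspace_compact_open)
    have "s (a x) \<in> V" if "x \<in> K" for x
    proof -
      have "(\<lambda>x\<in>topspace X'. b (s (a x))) x \<in> U"
        using s that by blast
      then have "b (s (a x)) \<in> U"
        using that KX by auto
      moreover have "a x \<in> topspace X"
        using KX that by auto
      then have "s (a x) \<in> topspace (subtopology Y A)"
        using sY(2) continuous_map_image_subset_topspace[OF sY(1)] by auto
      ultimately show ?thesis
        using V by auto
    qed
    then show "s \<in> ?R"
      using sY by auto
  next
    fix s assume s: "s \<in> ?R"
    have "b (s (a x)) \<in> U" if "x \<in> K" for x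
    proof -
      have "a x \<in> topspace X" "s (a x) \<in> V"
        using s KX that by auto
      then have "s (a x) \<in> {y \<in> topspace (subtopology Y A). b y \<in> U}"
        using s unfolding V(2) by auto
      then show ?thesis
        by simp
    qed
    then show "s \<in> ?L"
      using s KX by (auto simp: topspace_compact_open)
  qed
  then show "openin ?P {s \<in> topspace ?P. (\<lambda>x\<in>topspace X'. b (s (a x))) ` K \<subseteq> U}"
    using openin_compact_open_basic[OF aK V(1)] by (auto simp: openin_subtopology)
qed simp

section \<open>Closed embeddings\<close>

definition closed_embedding :: "'a topology \<Rightarrow> 'b topology \<Rightarrow> ('a \<Rightarrow> 'b) \<Rightarrow> bool" where
  "closed_embedding X Y f \<longleftrightarrow> continuous_map X Y f \<and> closed_map X Y f \<and> inj_on f (topspace X)"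

lemma closed_embedding_image_closedin: "closed_embedding X Y f \<Longrightarrow> closedin Y (f ` topspace X)"
  by (simp add: closed_embedding_def closed_map_def)

lemma closed_embedding_homeomorphic_map:
  assumes "closed_embedding X Y f"
  shows "homeomorphic_map X (subtopology Y (f ` topspace X)) f"
  using assms injective_closed_imp_embedding_map[of X Y f]
  by (simp add: closed_embedding_def embedding_map_def)

lemma closed_embedding_inverse:
  assumes "closed_embedding X Y f"
  obtains g where "continuous_map (subtopology Y (f ` topspace X)) X g"
    "\<And>x. x \<in> topspace X \<Longrightarrow> g (f x) = x"
  using closed_embedding_homeomorphic_map[OF assms]
  unfolding homeomorphic_map_maps homeomorphic_maps_def by blast

lemma closed_embeddingI:
  assumes f: "continuous_map X Y f" and g: "continuous_map (subtopology Y (f ` topspace X)) X g"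
    and gf: "\<And>x. x \<in> topspace X \<Longrightarrow> g (f x) = x" and cl: "closedin Y (f ` topspace X)"
  shows "closed_embedding X Y f"
  unfolding closed_embedding_def closed_map_def
proof (intro conjI allI impI f)
  show "inj_on f (topspace X)"
    using gf by (metis inj_onI)
  fix A assume A: "closedin X A"
  have "f ` topspace X \<subseteq> topspace Y"
    using f continuous_map_image_subset_topspace by blast
  then have "{y \<in> topspace (subtopology Y (f ` topspace X)). g y \<in> A} = f ` A"
    using closedin_subset[OF A] gf by (auto simp: image_iff)
  moreover have "closedin (subtopology Y (f ` topspace X)) {y \<in> topspace (subtopology Y (f ` topspace X)). g y \<in> A}"
    using closedin_continuous_map_preimage[OF g A] .
  ultimately show "closedin Y (f ` A)"
    using cl closedin_trans_full by metis
qed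

lemma closed_embedding_compose:
  "closed_embedding X Y f \<Longrightarrow> closed_embedding Y Z g \<Longrightarrow> closed_embedding X Z (g \<circ> f)"
  unfolding closed_embedding_def
  by (metis closed_map_compose comp_inj_on continuous_map_compose continuous_map_image_subset_topspace inj_on_subset)

lemma homeomorphic_map_closed_embedding: "homeomorphic_map X Y f \<Longrightarrow> closed_embedding X Y f"
  by (simp add: closed_embedding_def homeomorphic_eq_everything_map)

lemma closed_embedding_prod:
  assumes f: "closed_embedding X Y f"
  shows "closed_embedding (prod_topology Z X) (prod_topology Z Y) (\<lambda>q. (fst q, f (snd q)))"
proof -
  have fc: "continuous_map X Y f"
    using f by (simp add: closed_embedding_def)
  obtain g where g: "continuous_map (subtopology Y (f ` topspace X)) X g"
      and gf: "\<And>x. x \<in> topspace X \<Longrightarrow> g (f x) = x"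
    using closed_embedding_inverse[OF f] by metis
  have im: "(\<lambda>q. (fst q, f (snd q))) ` topspace (prod_topology Z X) = topspace Z \<times> f ` topspace X"
    by force
  show ?thesis
  proof (rule closed_embeddingI[where g = "\<lambda>q. (fst q, g (snd q))"])
    show "continuous_map (prod_topology Z X) (prod_topology Z Y) (\<lambda>q. (fst q, f (snd q)))"
      using continuous_map_compose[OF continuous_map_snd fc, of Z]
      by (simp add: continuous_map_pairwise comp_def continuous_map_fst)
    let ?S = "subtopology (prod_topology Z Y) (topspace Z \<times> f ` topspace X)"
    have "continuous_map ?S (subtopology Y (f ` topspace X)) snd"
      by (auto simp: continuous_map_in_subtopology continuous_map_from_subtopology continuous_map_snd)
    from continuous_map_compose[OF this g]
    show "continuous_map (subtopology (prod_topology Z Y) ((\<lambda>q. (fst q, f (snd q))) ` topspace (prod_topology Z X)))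
       (prod_topology Z X) (\<lambda>q. (fst q, g (snd q)))"
      unfolding im by (simp add: continuous_map_pairwise comp_def continuous_map_fst continuous_map_from_subtopology)
    show "closedin (prod_topology Z Y) ((\<lambda>q. (fst q, f (snd q))) ` topspace (prod_topology Z X))"
      unfolding im using closed_embedding_image_closedin[OF f] by (simp add: closedin_prod_Times_iff)
  qed (use gf in auto)
qed

text \<open>This is where closedness of the image is indispensable to the argument: a compact
  Hausdorff subset of \<open>Y\<close> meets the image in a compact Hausdorff set, whose preimage in
  \<open>X\<close> is again one. Hence both refinements are tested on matching subsets.\<close>

lemma closed_embedding_kify:
  assumes f: "closed_embedding X Y f" and wY: "weak_Hausdorff Y"
  shows "closed_embedding (kify X) (kify Y) f"
proof -
  have fc: "continuous_map X Y f" and inj: "inj_on f (topspace X)"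
    and cl: "\<And>A. closedin X A \<Longrightarrow> closedin Y (f ` A)"
    using f by (auto simp: closed_embedding_def closed_map_def)
  have wX: "weak_Hausdorff X"
    using weak_Hausdorff_injective_map[OF fc inj wY] .
  obtain g where g: "continuous_map (subtopology Y (f ` topspace X)) X g"
      and gf: "\<And>x. x \<in> topspace X \<Longrightarrow> g (f x) = x"
    using closed_embedding_inverse[OF f] by metis
  show ?thesis
    unfolding closed_embedding_def closed_map_def
  proof (intro conjI allI impI)
    show "continuous_map (kify X) (kify Y) f"
      using cgwh_kify[OF wX] wY fc by (intro continuous_map_into_kify continuous_map_from_kify)
    show "inj_on f (topspace (kify X))"
      using inj by simp
    fix A assume A: "closedin (kify X) A"
    then have AX: "A \<subseteq> topspace X" and
      AC: "\<And>C. compact_Hausdorff_in X C \<Longrightarrow> closedin X (A \<inter> C)"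
      by (auto simp: closedin_kify_iff[OF wX])
    show "closedin (kify Y) (f ` A)"
      unfolding closedin_kify_iff[OF wY]
    proof (intro conjI allI impI)
      show "f ` A \<subseteq> topspace Y"
        using AX fc continuous_map_image_subset_topspace by blast
      fix C assume "compact_Hausdorff_in Y C"
      then have C: "compact_Hausdorff_in Y (C \<inter> f ` topspace X)"
        using compact_Hausdorff_in_Int closed_embedding_image_closedin[OF f] by blast
      have "continuous_map (subtopology Y (C \<inter> f ` topspace X)) X g"
        using g by (metis continuous_map_from_subtopology inf_commute subtopology_subtopology)
      then have "compact_Hausdorff_in X (g ` (C \<inter> f ` topspace X))"
        using compact_Hausdorff_in_image[OF wX compact_Hausdorff_in_space(1,2)[OF C]]
        by (simp only: compact_Hausdorff_in_space(3)[OF C])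
      then have "closedin Y (f ` (A \<inter> g ` (C \<inter> f ` topspace X)))"
        using AC cl by blast
      moreover have "f ` (A \<inter> g ` (C \<inter> f ` topspace X)) = f ` A \<inter> C"
        using AX gf by (auto simp: image_iff) (metis IntI image_eqI subsetD)+
      ultimately show "closedin Y (f ` A \<inter> C)"
        by simp
    qed
  qed
qed

lemma cgwh_closed_embedding_domain:
  assumes f: "closed_embedding X Y f" and Y: "cgwh_space Y"
  shows "cgwh_space X"
proof -
  have "homeomorphic_map X (subtopology Y (f ` topspace X)) f"
    using closed_embedding_homeomorphic_map[OF f] .
  then obtain g where "homeomorphic_map (subtopology Y (f ` topspace X)) X g"
    using homeomorphic_map_maps homeomorphic_maps_map by metis
  then show ?thesis
    using cgwh_homeomorphic cgwh_closed_subtopology[OF Y closed_embedding_image_closedin[OF f]] by blast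
qed


section \<open>Homeomorphisms are weak equivalences\<close>

lemma equiv_spheroid_homotopic:
  "equiv (spheroids n X x)
    {(g, h). g \<in> spheroids n X x \<and> h \<in> spheroids n X x \<and> spheroid_homotopic n X x g h}"
  by (rule equivI) (auto simp: refl_on_def sym_def trans_def spheroids_def spheroid_homotopic_def
      intro: homotopic_with_symD homotopic_with_trans)

text \<open>Reduces \<open>induced_map\<close> to representatives: composing with \<open>f\<close>
  preserves homotopies relative to the boundary, so every member of the class of \<open>g\<close>
  contributes the same class.\<close>

lemma induced_map_class:
  assumes f: "continuous_map X Y f" and g: "g \<in> spheroids n X x"
  shows "induced_map n Y f x
      ({(g, h). g \<in> spheroids n X x \<and> h \<in> spheroids n X x \<and> spheroid_homotopic n X x g h} `` {g})
    = {(g, h). g \<in> spheroids n Y (f x) \<and> h \<in> spheroids n Y (f x) \<and> spheroid_homotopic n Y (f x) g h} `` {f \<circ> g}"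
    (is "?L = ?R")
proof
  have sph: "f \<circ> k \<in> spheroids n Y (f x)" if "k \<in> spheroids n X x" for k
    using that f by (auto simp: spheroids_def intro: continuous_map_compose)
  have hom: "spheroid_homotopic n Y (f x) (f \<circ> k) (f \<circ> k')" if "spheroid_homotopic n X x k k'" for k k'
    using that unfolding spheroid_homotopic_def
    by (rule homotopic_with_compose_continuous_map_left[OF _ f]) auto
  show "?L \<subseteq> ?R"
  proof
    fix h assume "h \<in> ?L"
    then obtain k where k: "h \<in> spheroids n Y (f x)" "spheroid_homotopic n X x g k"
        "spheroid_homotopic n Y (f x) (f \<circ> k) h"
      by (auto simp: induced_map_def)
    then have "spheroid_homotopic n Y (f x) (f \<circ> g) h"
      using hom[OF k(2)] unfolding spheroid_homotopic_def by (blast intro: homotopic_with_trans)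
    then show "h \<in> ?R"
      using k sph[OF g] by auto
  qed
  have "spheroid_homotopic n X x g g"
    using g by (auto simp: spheroids_def spheroid_homotopic_def)
  then show "?R \<subseteq> ?L"
    using g by (auto simp: induced_map_def)
qed

lemma homeomorphic_map_imp_weak_equivalence:
  assumes "homeomorphic_map X Y f"
  shows "weak_equivalence X Y f"
proof -
  obtain f' where hm: "homeomorphic_maps X Y f f'"
    using assms homeomorphic_map_maps by blast
  then have f: "continuous_map X Y f" and f': "continuous_map Y X f'"
    and f'f: "\<And>a. a \<in> topspace X \<Longrightarrow> f' (f a) = a" and ff': "\<And>c. c \<in> topspace Y \<Longrightarrow> f (f' c) = c"
    by (auto simp: homeomorphic_maps_def)
  have bij: "bij_betw (induced_map n Y f x) (homotopy_classes n X x) (homotopy_classes n Y (f x))"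
    if x: "x \<in> topspace X" for n x
  proof -
    let ?RX = "{(g, h). g \<in> spheroids n X x \<and> h \<in> spheroids n X x \<and> spheroid_homotopic n X x g h}"
    let ?RY = "{(g, h). g \<in> spheroids n Y (f x) \<and> h \<in> spheroids n Y (f x) \<and> spheroid_homotopic n Y (f x) g h}"
    have sX: "g \<in> topspace (cube n) \<rightarrow> topspace X" "continuous_map (cube n) X g" "\<forall>t \<in> cube_boundary n. g t = x"
      if "g \<in> spheroids n X x" for g
      using that by (auto simp: spheroids_def continuous_map_def)
    have sph: "f \<circ> k \<in> spheroids n Y (f x)" if "k \<in> spheroids n X x" for k
      using that f by (auto simp: spheroids_def intro: continuous_map_compose)
    have inj: "?RX `` {g} = ?RX `` {h}"
      if g: "g \<in> spheroids n X x" and h: "h \<in> spheroids n X x" and eq: "?RY `` {f \<circ> g} = ?RY `` {f \<circ> h}" for g h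
    proof -
      have "spheroid_homotopic n Y (f x) (f \<circ> g) (f \<circ> h)"
        using eq_equiv_class[OF eq equiv_spheroid_homotopic sph[OF h]] by auto
      then have "homotopic_with (\<lambda>k. \<forall>t \<in> cube_boundary n. k t = x) (cube n) X (f' \<circ> (f \<circ> g)) (f' \<circ> (f \<circ> h))"
        unfolding spheroid_homotopic_def
        by (rule homotopic_with_compose_continuous_map_left[OF _ f']) (auto simp: f'f x)
      \<comment> \<open>Going to \<open>Y\<close> and back agrees with \<open>k\<close> only on the
        cube, not off it, so the two functions are related by \<open>homotopic_with_equal\<close>
        and are not equal as HOL functions.\<close>
      moreover have "homotopic_with (\<lambda>k. \<forall>t \<in> cube_boundary n. k t = x) (cube n) X k (f' \<circ> (f \<circ> k))"
        if "k \<in> spheroids n X x" for k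
        using sX[OF that] by (intro homotopic_with_equal) (auto simp: f'f x Pi_iff)
      ultimately have "spheroid_homotopic n X x g h"
        unfolding spheroid_homotopic_def using g h
        by (meson homotopic_with_symD homotopic_with_trans)
      then show ?thesis
        using g h by (intro equiv_class_eq[OF equiv_spheroid_homotopic]) auto
    qed
    have surj: "\<exists>g \<in> spheroids n X x. ?RY `` {f \<circ> g} = ?RY `` {h}" if h: "h \<in> spheroids n Y (f x)" for h
    proof
      have ht: "h \<in> topspace (cube n) \<rightarrow> topspace Y" "continuous_map (cube n) Y h" "\<forall>t \<in> cube_boundary n. h t = f x"
        using h by (auto simp: spheroids_def continuous_map_def)
      show g: "f' \<circ> h \<in> spheroids n X x"
        using ht f' x by (auto simp: spheroids_def f'f intro: continuous_map_compose)
      have "homotopic_with (\<lambda>k. \<forall>t \<in> cube_boundary n. k t = f x) (cube n) Y (f \<circ> (f' \<circ> h)) h"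
        using ht continuous_map_compose[OF continuous_map_compose[OF ht(2) f'] f] x
        by (intro homotopic_with_equal) (auto simp: ff' f'f Pi_iff)
      then show "?RY `` {f \<circ> (f' \<circ> h)} = ?RY `` {h}"
        using h sph[OF g] by (intro equiv_class_eq[OF equiv_spheroid_homotopic]) (auto simp: spheroid_homotopic_def)
    qed
    show ?thesis
      unfolding bij_betw_def
    proof
      show "inj_on (induced_map n Y f x) (homotopy_classes n X x)"
      proof (rule inj_onI)
        fix c d assume "c \<in> homotopy_classes n X x" "d \<in> homotopy_classes n X x"
          and eq: "induced_map n Y f x c = induced_map n Y f x d"
        then obtain g h where "g \<in> spheroids n X x" "c = ?RX `` {g}" "h \<in> spheroids n X x" "d = ?RX `` {h}"
          unfolding homotopy_classes_def by (meson quotientE)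
        then show "c = d"
          using eq inj[of g h] induced_map_class[OF f, of g n x] induced_map_class[OF f, of h n x] by metis
      qed
      show "induced_map n Y f x ` homotopy_classes n X x = homotopy_classes n Y (f x)"
      proof
        show "induced_map n Y f x ` homotopy_classes n X x \<subseteq> homotopy_classes n Y (f x)"
        proof
          fix d assume "d \<in> induced_map n Y f x ` homotopy_classes n X x"
          then obtain g where g: "g \<in> spheroids n X x" "d = induced_map n Y f x (?RX `` {g})"
            unfolding homotopy_classes_def by (elim imageE quotientE) simp
          show "d \<in> homotopy_classes n Y (f x)"
            unfolding homotopy_classes_def g(2) induced_map_class[OF f g(1)] by (rule quotientI[OF sph[OF g(1)]])
        qed
        show "homotopy_classes n Y (f x) \<subseteq> induced_map n Y f x ` homotopy_classes n X x"
        proof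
          fix d assume "d \<in> homotopy_classes n Y (f x)"
          then obtain h where "h \<in> spheroids n Y (f x)" "d = ?RY `` {h}"
            unfolding homotopy_classes_def by (meson quotientE)
          then obtain g where g: "g \<in> spheroids n X x" "d = ?RY `` {f \<circ> g}"
            using surj[of h] by blast
          then have "d = induced_map n Y f x (?RX `` {g})"
            unfolding induced_map_class[OF f g(1)] by blast
          moreover have "?RX `` {g} \<in> homotopy_classes n X x"
            unfolding homotopy_classes_def using g by (intro quotientI)
          ultimately show "d \<in> induced_map n Y f x ` homotopy_classes n X x"
            by blast
        qed
      qed
    qed
  qed
  have "topspace X = {} \<longrightarrow> topspace Y = {}"
    using homeomorphic_imp_surjective_map[OF assms] by (metis image_is_empty)
  then show ?thesis
    using f bij by (simp add: weak_equivalence_def)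
qed


section \<open>Mapping telescopes\<close>

locale telescope_system =
  fixes X :: "nat \<Rightarrow> 'a topology" and b :: "nat \<Rightarrow> 'a" and f :: "nat \<Rightarrow> 'a \<Rightarrow> 'a"
  assumes cgwh: "cgwh_space (X k)" and base: "b k \<in> topspace (X k)"
    and cont: "continuous_map (X k) (X (Suc k)) (f k)" and f_base: "f k (b k) = b (Suc k)"
begin

abbreviation pt :: "nat \<times> real \<times> 'a \<Rightarrow> nat \<times> real \<times> 'a" where
  "pt \<equiv> telescope_pt b f"

abbreviation tel :: "(nat \<times> real \<times> 'a) topology" where
  "tel \<equiv> telescope X b f"

abbreviation cyl :: "nat \<Rightarrow> (real \<times> 'a) topology" where
  "cyl k \<equiv> prod_topology (top_of_set {0..1}) (X k)"

lemma pt_simp: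
  "pt (k, s, x) = (if s = 1 then (if f k x = b (Suc k) then telescope_base b else (Suc k, 0, f k x))
     else if x = b k then telescope_base b else (k, s, x))"
  by (simp add: telescope_pt_def)

lemma f_in: "x \<in> topspace (X k) \<Longrightarrow> f k x \<in> topspace (X (Suc k))"
  using cont[of k] by (auto simp: continuous_map_def)

lemma quotient_map_pt: "quotient_map (sum_topology cyl UNIV) tel pt"
  unfolding telescope_def by (rule quotient_map_final_topology)

lemma topspace_tel: "topspace tel = (\<Union>k. (\<lambda>q. pt (k, q)) ` topspace (cyl k))"
  unfolding telescope_def by force

lemma continuous_map_pt: "continuous_map (cyl k) tel (\<lambda>q. pt (k, q))"
  using continuous_map_compose[OF continuous_map_component_injection[of k UNIV cyl]
      quotient_imp_continuous_map[OF quotient_map_pt]]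
  by (simp add: comp_def)

lemma openin_tel:
  "openin tel U \<longleftrightarrow> U \<subseteq> topspace tel \<and> (\<forall>k. openin (cyl k) {q \<in> topspace (cyl k). pt (k, q) \<in> U})"
proof -
  have "{q. (k, q) \<in> {p \<in> topspace (sum_topology cyl UNIV). pt p \<in> U}}
    = {q \<in> topspace (cyl k). pt (k, q) \<in> U}" for k
    by auto
  moreover have "{p \<in> topspace (sum_topology cyl UNIV). pt p \<in> U} \<subseteq> Sigma UNIV (topspace \<circ> cyl)"
    by auto
  ultimately have "openin (sum_topology cyl UNIV) {p \<in> topspace (sum_topology cyl UNIV). pt p \<in> U}
     \<longleftrightarrow> (\<forall>k. openin (cyl k) {q \<in> topspace (cyl k). pt (k, q) \<in> U})"
    unfolding openin_sum_topology by simp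
  then show ?thesis
    using quotient_map_pt openin_subset[of tel U] unfolding quotient_map_def by blast
qed

lemma closedin_tel:
  "closedin tel A \<longleftrightarrow> A \<subseteq> topspace tel \<and> (\<forall>k. closedin (cyl k) {q \<in> topspace (cyl k). pt (k, q) \<in> A})"
proof -
  have "{q \<in> topspace (cyl k). pt (k, q) \<in> topspace tel - A}
    = topspace (cyl k) - {q \<in> topspace (cyl k). pt (k, q) \<in> A}" for k
    unfolding topspace_tel by auto
  then show ?thesis
    unfolding closedin_def[of tel] openin_tel closedin_def by auto
qed

lemma continuous_map_from_tel:
  assumes "\<And>k. continuous_map (cyl k) Y (\<lambda>q. g (pt (k, q)))"
  shows "continuous_map tel Y g"
proof -
  have "continuous_map (sum_topology cyl UNIV) Y (g \<circ> pt)"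
    using assms by (intro continuous_map_from_sum_topology) (simp add: comp_def)
  then show ?thesis
    using continuous_compose_quotient_map_eq[OF quotient_map_pt] by blast
qed

text \<open>The product of a quotient map with the identity of a locally compact Hausdorff space is
  again a quotient map. For \<open>J\<close> a space of isometries this makes maps of telescopes
  continuous in the isometry.\<close>

lemma continuous_map_from_prod_tel:
  assumes J: "compact_space J" "Hausdorff_space J"
    and "\<And>k. continuous_map (prod_topology J (cyl k)) Y (\<lambda>(j, q). g (j, pt (k, q)))"
  shows "continuous_map (prod_topology J tel) Y g"
proof -
  have "quotient_map (prod_topology J (sum_topology cyl UNIV)) (prod_topology J tel) (\<lambda>(j, p). (j, pt p))"
    using J by (intro quotient_map_prod_right quotient_map_pt) (auto simp: compact_imp_locally_compact_space)
  moreover have "continuous_map (prod_topology J (sum_topology cyl UNIV)) Y (g \<circ> (\<lambda>(j, p). (j, pt p)))"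
    using assms(3) by (intro continuous_map_prod_sum_topology) (simp add: comp_def case_prod_unfold)
  ultimately show ?thesis
    using continuous_compose_quotient_map_eq by blast
qed

lemma base_in_tel: "telescope_base b \<in> topspace tel"
proof -
  have "pt (0, 0, b 0) = telescope_base b"
    by (simp add: pt_simp)
  moreover have "(0, b 0) \<in> topspace (cyl 0)"
    using base by simp
  ultimately have "telescope_base b \<in> (\<lambda>q. pt (0, q)) ` topspace (cyl 0)"
    by (intro image_eqI[where x = "(0, b 0)"]) simp_all
  then show ?thesis
    unfolding topspace_tel by blast
qed

lemma mem_tel_iff:
  "p \<in> topspace tel \<longleftrightarrow> p = telescope_base b \<or>
     (\<exists>k s x. p = (k, s, x) \<and> 0 \<le> s \<and> s < 1 \<and> x \<in> topspace (X k) \<and> x \<noteq> b k)"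
proof
  assume "p \<in> topspace tel"
  then obtain k s x where "s \<in> {0..1}" "x \<in> topspace (X k)" "p = pt (k, s, x)"
    unfolding topspace_tel by auto
  then show "p = telescope_base b \<or>
     (\<exists>k s x. p = (k, s, x) \<and> 0 \<le> s \<and> s < 1 \<and> x \<in> topspace (X k) \<and> x \<noteq> b k)"
    by (auto simp: pt_simp f_in)
next
  assume "p = telescope_base b \<or>
     (\<exists>k s x. p = (k, s, x) \<and> 0 \<le> s \<and> s < 1 \<and> x \<in> topspace (X k) \<and> x \<noteq> b k)"
  then show "p \<in> topspace tel"
  proof (elim disjE exE conjE)
    fix k s x assume p: "p = (k, s, x)" "0 \<le> s" "s < 1" "x \<in> topspace (X k)" "x \<noteq> b k"
    then have "p = pt (k, s, x)" "(s, x) \<in> topspace (cyl k)"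
      by (auto simp: pt_simp)
    then show ?thesis
      unfolding topspace_tel by blast
  qed (simp add: base_in_tel)
qed

lemma tel_cases:
  assumes "p \<in> topspace tel"
  obtains k s x where "p = (k, s, x)" "0 \<le> s" "s < 1" "x \<in> topspace (X k)" "pt (k, s, x) = p"
proof (cases "p = telescope_base b")
  case True
  then show ?thesis
    using that[of 0 0 "b 0"] base by (simp add: telescope_base_def pt_simp)
next
  case False
  then obtain k s x where "p = (k, s, x)" "0 \<le> s" "s < 1" "x \<in> topspace (X k)" "x \<noteq> b k"
    using assms mem_tel_iff by auto
  then show ?thesis
    using that by (simp add: pt_simp)
qed

text \<open>Compact generation passes to quotients: a test map into a cylinder becomes a test map
  into the telescope after composing with \<open>pt\<close>, and the cylinders are compactly
  generated as products with a compact interval.\<close>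

lemma kify_tel: "kify tel = tel"
proof (rule kify_eqI)
  fix A assume A: "closedin (kify tel) A"
  show "closedin tel A"
    unfolding closedin_tel
  proof (intro conjI allI)
    show "A \<subseteq> topspace tel"
      using closedin_subset[OF A] by simp
    fix k
    have cyl: "cgwh_space (cyl k)"
      using cgwh by (intro cgwh_prod_compact)
        (auto simp: compact_space_subtopology Hausdorff_space_subtopology)
    show "closedin (cyl k) {q \<in> topspace (cyl k). pt (k, q) \<in> A}"
    proof (subst cgwh_closedin_iff[OF cyl], intro conjI allI impI)
      fix C assume C: "compact_Hausdorff_in (cyl k) C"
      let ?K = "subtopology (cyl k) C"
      have "closedin ?K {z \<in> topspace ?K. pt (k, z) \<in> A}"
        \<comment> \<open>\<open>Pair 0\<close> merely injects the points of a cylinder into the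
          type of the telescope; any level would serve as its constant.\<close>
        by (rule closedin_kify_preimage[OF A compact_Hausdorff_in_space(1,2)[OF C]
              continuous_map_from_subtopology[OF continuous_map_pt], where e = "Pair 0"])
          (auto simp: inj_on_def)
      moreover have "{z \<in> topspace ?K. pt (k, z) \<in> A} = {q \<in> topspace (cyl k). pt (k, q) \<in> A} \<inter> C"
        by auto
      ultimately show "closedin (cyl k) ({q \<in> topspace (cyl k). pt (k, q) \<in> A} \<inter> C)"
        using closedin_Int_compact_Hausdorff_in[OF _ C] cyl by (simp add: cgwh_space_def)
    qed auto
  qed
qed

text \<open>
  Around a point of \<open>X k\<close> away from the base point the telescope is a double mapping cylinder; it is
  mapped to \<open>(-1,1) \<times> X k\<close> by the height and the retraction onto \<open>X k\<close>, which is injective on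
  the part of nonnegative height.
\<close>

definition region :: "nat \<Rightarrow> (nat \<times> real \<times> 'a) set" where
  "region k = {p \<in> topspace tel. p \<noteq> telescope_base b \<and>
     (fst p = k \<or> Suc (fst p) = k \<and> 0 < fst (snd p) \<and> f (fst p) (snd (snd p)) \<noteq> b k)}"

definition chart :: "nat \<Rightarrow> nat \<times> real \<times> 'a \<Rightarrow> real \<times> 'a" where
  "chart k p = (if fst p = k then snd p else (fst (snd p) - 1, f (fst p) (snd (snd p))))"

text \<open>The heights 1 and -1 are left out: the first is glued into cylinder
  \<open>k + 1\<close>, the second is the bottom of cylinder \<open>k - 1\<close>. The base point is
  left out because its whole interval is collapsed.\<close>

definition chart_range :: "nat \<Rightarrow> (real \<times> 'a) set" where
  "chart_range k = {-1<..<1} \<times> (topspace (X k) - {b k})"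

text \<open>Only the cylinders \<open>k\<close> and \<open>k - 1\<close> can meet the chart. The
  assumption on \<open>C\<close> settles the ends: height 1 lies outside \<open>C\<close>, so the
  top of cylinder \<open>k\<close> contributes nothing, while the top of cylinder
  \<open>k - 1\<close> has height 0, where both descriptions of a glued point agree.\<close>

lemma chart_preimage:
  assumes C: "C \<subseteq> chart_range k"
  shows "{q \<in> topspace (cyl j). pt (j, q) \<in> {p \<in> region k. chart k p \<in> C}} =
    (if j = k then {q \<in> topspace (cyl j). q \<in> C}
     else if Suc j = k then {q \<in> topspace (cyl j). (fst q - 1, f j (snd q)) \<in> C} else {})"
proof (rule Set.set_eqI)
  fix q :: "real \<times> 'a"
  obtain s x where q: "q = (s, x)"
    by fastforce
  show "q \<in> {q \<in> topspace (cyl j). pt (j, q) \<in> {p \<in> region k. chart k p \<in> C}} \<longleftrightarrow>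
    q \<in> (if j = k then {q \<in> topspace (cyl j). q \<in> C}
     else if Suc j = k then {q \<in> topspace (cyl j). (fst q - 1, f j (snd q)) \<in> C} else {})"
  proof (cases "(s, x) \<in> topspace (cyl j)")
    case True
    then have sx: "0 \<le> s" "s \<le> 1" "x \<in> topspace (X j)"
      by auto
    have in_tel: "pt (j, s, x) \<in> topspace tel"
      using True unfolding topspace_tel by blast
    have nb: "(j, s, x) \<noteq> telescope_base b" if "x \<noteq> b j"
      using that by (auto simp: telescope_base_def)
    have nb': "(Suc j, 0, f j x) \<noteq> telescope_base b"
      by (simp add: telescope_base_def)
    have CD: "-1 < t \<and> t < 1 \<and> y \<noteq> b k" if "(t, y) \<in> C" for t y
      using that C by (auto simp: chart_range_def)
    have L: "q \<in> {q \<in> topspace (cyl j). pt (j, q) \<in> {p \<in> region k. chart k p \<in> C}} \<longleftrightarrow>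
        pt (j, s, x) \<in> region k \<and> chart k (pt (j, s, x)) \<in> C"
      using True by (simp only: q mem_Collect_eq simp_thms)
    have R: "q \<in> (if j = k then {q \<in> topspace (cyl j). q \<in> C}
       else if Suc j = k then {q \<in> topspace (cyl j). (fst q - 1, f j (snd q)) \<in> C} else {}) \<longleftrightarrow>
       (if j = k then (s, x) \<in> C else Suc j = k \<and> (s - 1, f j x) \<in> C)"
      using True by (simp only: q mem_Collect_eq fst_conv snd_conv empty_iff simp_thms split: if_splits) auto
    have reg: "pt (j, s, x) \<in> region k \<longleftrightarrow> pt (j, s, x) \<noteq> telescope_base b \<and>
        (fst (pt (j, s, x)) = k \<or> Suc (fst (pt (j, s, x))) = k \<and> 0 < fst (snd (pt (j, s, x)))
           \<and> f (fst (pt (j, s, x))) (snd (snd (pt (j, s, x)))) \<noteq> b k)"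
      using in_tel by (simp only: region_def mem_Collect_eq simp_thms)
    consider "s = 1" | "s \<noteq> 1" "x = b j" | "s \<noteq> 1" "x \<noteq> b j"
      by blast
    then have "(pt (j, s, x) \<noteq> telescope_base b \<and>
        (fst (pt (j, s, x)) = k \<or> Suc (fst (pt (j, s, x))) = k \<and> 0 < fst (snd (pt (j, s, x)))
         \<and> f (fst (pt (j, s, x))) (snd (snd (pt (j, s, x)))) \<noteq> b k)) \<and> chart k (pt (j, s, x)) \<in> C
        \<longleftrightarrow> (if j = k then (s, x) \<in> C else Suc j = k \<and> (s - 1, f j x) \<in> C)"
    proof cases
      case 1
      show ?thesis
      proof (cases "f j x = b (Suc j)")
        case True
        then have p: "pt (j, s, x) = telescope_base b"
          using 1 by (simp add: pt_simp)
        show ?thesis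
          unfolding p using 1 True CD[of 1 x] CD[of 0 "f j x"] by auto
      next
        case False
        then have p: "pt (j, s, x) = (Suc j, 0, f j x)"
          using 1 by (simp add: pt_simp)
        show ?thesis
          unfolding p chart_def using 1 nb' CD[of 1 x] by auto
      qed
    next
      case 2
      then have p: "pt (j, s, x) = telescope_base b"
        by (simp add: pt_simp)
      show ?thesis
        unfolding p using 2 CD[of s x] CD[of "s - 1" "f j x"] f_base[of j] by auto
    next
      case 3
      then show ?thesis
      proof -
        have p: "pt (j, s, x) = (j, s, x)" "(j, s, x) \<noteq> telescope_base b"
          using 3 nb by (auto simp: pt_simp)
        show ?thesis
          unfolding p(1) chart_def using p(2) CD[of "s - 1" "f j x"] by auto
      qed
    qed
    then show ?thesis
      by (simp only: L R reg)
  next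
    case False
    then show ?thesis
      by (auto simp: q)
  qed
qed

lemma continuous_map_chart_maps:
  "continuous_map (cyl k) (prod_topology euclideanreal (X k)) id"
  "continuous_map (cyl k) (prod_topology euclideanreal (X (Suc k))) (\<lambda>q. (fst q - 1, f k (snd q)))"
proof -
  have 1: "continuous_map (cyl k) euclideanreal fst"
    by (rule continuous_map_into_fulltopology[OF continuous_map_fst])
  then show "continuous_map (cyl k) (prod_topology euclideanreal (X k)) id"
    by (simp add: continuous_map_pairwise comp_def continuous_map_snd)
  show "continuous_map (cyl k) (prod_topology euclideanreal (X (Suc k))) (\<lambda>q. (fst q - 1, f k (snd q)))"
    using continuous_map_compose[OF continuous_map_snd cont, of "top_of_set {0..1}" k] 1
    by (simp add: continuous_map_pairwise comp_def continuous_map_diff)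
qed

lemma openin_chart_preimage:
  assumes "openin (prod_topology euclideanreal (X k)) C" "C \<subseteq> chart_range k"
  shows "openin tel {p \<in> region k. chart k p \<in> C}"
  unfolding openin_tel chart_preimage[OF assms(2)]
  using openin_continuous_map_preimage[OF continuous_map_chart_maps(1) assms(1)]
    openin_continuous_map_preimage[OF continuous_map_chart_maps(2), of "k - 1" C] assms(1)
  by (auto simp: region_def simp del: topspace_prod_topology)

text \<open>The preimage is closed in the whole telescope, although \<open>region k\<close> is open,
  because \<open>C\<close> is closed in the full product with the line and still avoids the excluded
  ends and base point. This is the closedness demanded by \<open>kseparated_local\<close>.\<close>

lemma closedin_chart_preimage:
  assumes "closedin (prod_topology euclideanreal (X k)) C" "C \<subseteq> chart_range k"
  shows "closedin tel {p \<in> region k. chart k p \<in> C}"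
  unfolding closedin_tel chart_preimage[OF assms(2)]
  using closedin_continuous_map_preimage[OF continuous_map_chart_maps(1) assms(1)]
    closedin_continuous_map_preimage[OF continuous_map_chart_maps(2), of "k - 1" C] assms(1)
  by (auto simp: region_def simp del: topspace_prod_topology)

lemma chart_in_range:
  assumes "p \<in> region k"
  shows "chart k p \<in> chart_range k"
proof -
  have "p \<in> topspace tel" "p \<noteq> telescope_base b"
    using assms by (auto simp: region_def)
  then obtain j s x where "p = (j, s, x)" "0 \<le> s" "s < 1" "x \<in> topspace (X j)" "x \<noteq> b j"
    by (auto simp: mem_tel_iff)
  then show ?thesis
    using assms f_in[of x j] by (auto simp: region_def chart_def chart_range_def)
qed

text \<open>Uses the chart of the cylinder containing \<open>q\<close>. Another point of the region
  has different coordinates on that cylinder, or lies on the preceding one, where representatives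
  have \<open>t < 1\<close> and so negative height. The base point is allowed for \<open>p\<close>,
  since it lies in no region.\<close>

lemma kseparated_tel:
  assumes p: "p \<in> topspace tel" and q: "q \<in> topspace tel" "q \<noteq> telescope_base b" and ne: "p \<noteq> q"
  shows "kseparated tel p q"
proof -
  obtain k s x where q': "q = (k, s, x)" "0 \<le> s" "s < 1" "x \<in> topspace (X k)" "x \<noteq> b k"
    using q by (auto simp: mem_tel_iff)
  let ?Z = "prod_topology euclideanreal (X k)"
  have wX: "weak_Hausdorff (X k)"
    using cgwh by (simp add: cgwh_space_def)
  have wZ: "weak_Hausdorff ?Z"
    by (rule weak_Hausdorff_prod[OF Hausdorff_imp_weak_Hausdorff wX]) simp
  have oW: "openin ?Z (chart_range k)"
    unfolding chart_range_def openin_prod_Times_iff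
    using weak_Hausdorff_singleton[OF wX base] by (auto simp: closedin_def)
  have cW: "openin tel {p \<in> region k. chart k p \<in> U}" if "openin ?Z U" for U
  proof -
    have "{p \<in> region k. chart k p \<in> U} = {p \<in> region k. chart k p \<in> U \<inter> chart_range k}"
      using chart_in_range by auto
    then show ?thesis
      using openin_chart_preimage[of k "U \<inter> chart_range k"] oW that by auto
  qed
  have topZ: "chart k p \<in> topspace ?Z" if "p \<in> region k" for p
    using chart_in_range[OF that] openin_subset[OF oW] by blast
  have oR: "openin tel (region k)"
    using cW[OF openin_topspace] topZ by (simp add: Collect_conj_eq Int_absorb2 subset_eq)
  show ?thesis
  proof (rule kseparated_local[OF oR])
    show "q \<in> region k"
      using q q' by (auto simp: region_def)
    let ?Z' = "subtopology ?Z (chart_range k)"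
    show "weak_Hausdorff ?Z'"
      using wZ by (rule weak_Hausdorff_subtopology)
    show "continuous_map (subtopology tel (region k)) ?Z' (chart k)"
      unfolding continuous_map_in_subtopology
    proof
      show "continuous_map (subtopology tel (region k)) ?Z (chart k)"
        unfolding continuous_map_def
      proof (intro conjI allI impI)
        show "chart k \<in> topspace (subtopology tel (region k)) \<rightarrow> topspace ?Z"
          using topZ by auto
        fix U assume "openin ?Z U"
        from cW[OF this] show "openin (subtopology tel (region k))
            {p \<in> topspace (subtopology tel (region k)). chart k p \<in> U}"
          using oR by (auto simp: openin_open_subtopology region_def elim!: back_subst[of "openin tel"])
      qed
      show "chart k \<in> topspace (subtopology tel (region k)) \<rightarrow> chart_range k"
        using chart_in_range by auto
    qed
    show "closedin tel {p \<in> region k. chart k p \<in> C}" if "compact_Hausdorff_in ?Z' C" for C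
      using that compact_Hausdorff_in_closedin[OF wZ]
      by (intro closedin_chart_preimage) (auto simp: compact_Hausdorff_in_subtopology)
    show "p \<notin> region k \<or> chart k p \<noteq> chart k q"
    proof (rule disjCI)
      assume "\<not> chart k p \<noteq> chart k q"
      moreover obtain j t y where p': "p = (j, t, y)" "t < 1"
        using p by (auto simp: mem_tel_iff telescope_base_def)
      ultimately show "p \<notin> region k"
        using q' ne by (auto simp: region_def chart_def split: if_splits)
    qed
  qed
qed

lemma cgwh_tel: "cgwh_space tel"
  unfolding cgwh_space_def
proof
  show "weak_Hausdorff tel"
    using kseparated_tel by (intro weak_Hausdorff_if_kseparated_either kify_tel) metis
qed (rule kify_tel)

text \<open>\<open>telescope_map\<close> is a formula on normal forms. For arbitrary
  representatives, preservation of base points takes care of the collapsed intervals, and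
  commutation with \<open>f\<close> of the points with \<open>s = 1\<close>.\<close>

lemma telescope_map_pt:
  assumes "\<And>k. h k (b k) = b' k" "\<And>k. f' k (b' k) = b' (Suc k)"
    and "h (Suc k) (f k x) = f' k (h k x)"
  shows "telescope_map b' f' h (pt (k, s, x)) = telescope_pt b' f' (k, s, h k x)"
  using assms(3) by (auto simp: telescope_map_def pt_simp telescope_pt_def telescope_base_def assms(1,2))

end

lemma continuous_map_telescope_map:
  assumes X: "telescope_system X b f" and Y: "telescope_system Y b' f'"
    and J: "compact_space J" "Hausdorff_space J"
    and h: "\<And>k. continuous_map (prod_topology J (X k)) (Y k) (\<lambda>(j, x). h j k x)"
    and hb: "\<And>j k. j \<in> topspace J \<Longrightarrow> h j k (b k) = b' k"
    and hf: "\<And>j k x. j \<in> topspace J \<Longrightarrow> x \<in> topspace (X k) \<Longrightarrow> h j (Suc k) (f k x) = f' k (h j k x)"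
  shows "continuous_map (prod_topology J (telescope X b f)) (telescope Y b' f')
    (\<lambda>(j, p). telescope_map b' f' (h j) p)"
proof -
  interpret X: telescope_system X b f by (rule X)
  interpret Y: telescope_system Y b' f' by (rule Y)
  show ?thesis
  proof (rule X.continuous_map_from_prod_tel[OF J])
    fix k
    let ?P = "prod_topology J (X.cyl k)"
    have fs: "continuous_map ?P (top_of_set {0..1}) (\<lambda>z. fst (snd z))"
      "continuous_map ?P (X k) (\<lambda>z. snd (snd z))" "continuous_map ?P J fst"
      using continuous_map_compose[OF continuous_map_snd continuous_map_fst, of J "top_of_set {0..1}" "X k"]
        continuous_map_compose[OF continuous_map_snd continuous_map_snd, of J "top_of_set {0..1}" "X k"]
      by (simp_all add: comp_def continuous_map_fst)
    have "continuous_map ?P (prod_topology J (X k)) (\<lambda>z. (fst z, snd (snd z)))"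
      using fs by (simp add: continuous_map_pairwise comp_def)
    from continuous_map_compose[OF this h] have "continuous_map ?P (Y k) (\<lambda>z. h (fst z) k (snd (snd z)))"
      by (simp add: comp_def)
    then have "continuous_map ?P (Y.cyl k) (\<lambda>z. (fst (snd z), h (fst z) k (snd (snd z))))"
      using fs by (simp add: continuous_map_pairwise comp_def)
    then have "continuous_map ?P Y.tel (\<lambda>z. Y.pt (k, fst (snd z), h (fst z) k (snd (snd z))))"
      using continuous_map_compose[OF _ Y.continuous_map_pt] by (simp add: comp_def)
    then show "continuous_map ?P Y.tel
        (\<lambda>(j, q). case (j, X.pt (k, q)) of (j, p) \<Rightarrow> telescope_map b' f' (h j) p)"
    proof (rule continuous_map_eq)
      fix z assume z: "z \<in> topspace ?P"
      then obtain j s x where "z = (j, s, x)" "j \<in> topspace J" "x \<in> topspace (X k)"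
        by auto
      then show "Y.pt (k, fst (snd z), h (fst z) k (snd (snd z))) =
          (case z of (j, q) \<Rightarrow> case (j, X.pt (k, q)) of (j, p) \<Rightarrow> telescope_map b' f' (h j) p)"
        using X.telescope_map_pt[of "h j" b' f' k x s] hb hf Y.f_base by simp
    qed
  qed
qed

lemma telescope_embedding_pt:
  assumes X: "telescope_system X b f" and Y: "telescope_system Y b' f'"
    and i: "\<And>k. inj_on (i k) (topspace (X k))" and ib: "\<And>k. i k (b k) = b' k"
    and nat: "\<And>k x. x \<in> topspace (X k) \<Longrightarrow> i (Suc k) (f k x) = f' k (i k x)" and x: "x \<in> topspace (X k)"
  shows "(\<lambda>(k, s, x). (k, s, i k x)) (telescope_pt b f (k, s, x)) = telescope_pt b' f' (k, s, i k x)"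
proof -
  interpret X: telescope_system X b f by (rule X)
  interpret Y: telescope_system Y b' f' by (rule Y)
  have i_base: "i k x = b' k \<longleftrightarrow> x = b k" if "x \<in> topspace (X k)" for k x
    using i[of k] that X.base[of k] ib[of k] by (auto simp: inj_on_def)
  have base_eq: "(\<lambda>(k, s, x). (k, s, i k x)) (telescope_base b) = telescope_base b'"
    by (simp add: telescope_base_def ib)
  show ?thesis
    using nat[OF x] i_base[OF x] i_base[OF X.f_in[OF x]] base_eq by (auto simp: X.pt_simp Y.pt_simp)
qed

text \<open>Injectivity and preservation of base points send normal forms to normal forms, so the
  embedding keeps level and height. For closedness, the preimage in each cylinder of the image of
  \<open>A\<close> is a union of two closed pieces: the image of the corresponding slice of
  \<open>A\<close>, and a piece at the top end.\<close>

lemma closed_embedding_telescope: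
  fixes X :: "nat \<Rightarrow> 'a topology" and Y :: "nat \<Rightarrow> 'b topology"
  assumes X: "telescope_system X b f" and Y: "telescope_system Y b' f'"
    and i: "\<And>k. closed_embedding (X k) (Y k) (i k)" and ib: "\<And>k. i k (b k) = b' k"
    and nat: "\<And>k x. x \<in> topspace (X k) \<Longrightarrow> i (Suc k) (f k x) = f' k (i k x)"
  shows "closed_embedding (telescope X b f) (telescope Y b' f') (\<lambda>(k, s, x). (k, s, i k x))"
    and "(\<lambda>(k, s, x). (k, s, i k x)) ` topspace (telescope X b f) = {p \<in> topspace (telescope Y b' f'). snd (snd p) \<in> i (fst p) ` topspace (X (fst p))}"
proof -
  let ?i = "\<lambda>(k, s, x). (k, s, i k x)"
  interpret X: telescope_system X b f by (rule X)
  interpret Y: telescope_system Y b' f' by (rule Y)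
  have ic: "continuous_map (X k) (Y k) (i k)" and icl: "closed_map (X k) (Y k) (i k)"
    and inj: "inj_on (i k) (topspace (X k))" for k
    using i[of k] by (auto simp: closed_embedding_def)
  have iY: "i k x \<in> topspace (Y k)" if "x \<in> topspace (X k)" for k x
    using ic[of k] that by (auto simp: continuous_map_def)
  have i_base: "i k x = b' k \<longleftrightarrow> x = b k" if "x \<in> topspace (X k)" for k x
    using inj[of k] that X.base[of k] ib[of k] by (auto simp: inj_on_def)
  have base_eq: "?i (telescope_base b) = telescope_base b'"
    by (simp add: telescope_base_def ib)
  have i_pt: "?i (X.pt (k, s, x)) = Y.pt (k, s, i k x)" if "x \<in> topspace (X k)" for k s x
    using telescope_embedding_pt[OF X Y inj ib nat that] .
  have cyl: "continuous_map (X.cyl k) (Y.cyl k) (\<lambda>q. (fst q, i k (snd q)))" for k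
    using continuous_map_compose[OF continuous_map_snd ic, of "top_of_set {0..1}"]
    by (simp add: continuous_map_pairwise comp_def continuous_map_fst)
  show im: "?i ` topspace X.tel = {p \<in> topspace Y.tel. snd (snd p) \<in> i (fst p) ` topspace (X (fst p))}"
  proof (intro equalityI subsetI)
    fix p assume "p \<in> ?i ` topspace X.tel"
    then obtain a where a: "a \<in> topspace X.tel" "p = ?i a"
      by blast
    obtain k s x where ksx: "a = (k, s, x)" "0 \<le> s" "s < 1" "x \<in> topspace (X k)" "X.pt (k, s, x) = a"
      using X.tel_cases[OF a(1)] by metis
    have "p = Y.pt (k, s, i k x)"
      using a i_pt[OF ksx(4), of s] ksx by simp
    moreover have "(s, i k x) \<in> topspace (Y.cyl k)"
      using ksx iY by simp
    ultimately have "p \<in> topspace Y.tel"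
      unfolding Y.topspace_tel by blast
    then show "p \<in> {p \<in> topspace Y.tel. snd (snd p) \<in> i (fst p) ` topspace (X (fst p))}"
      using a ksx by simp
  next
    fix p assume p: "p \<in> {p \<in> topspace Y.tel. snd (snd p) \<in> i (fst p) ` topspace (X (fst p))}"
    show "p \<in> ?i ` topspace X.tel"
    proof (cases "p = telescope_base b'")
      case True
      then show ?thesis
        using imageI[OF X.base_in_tel, of ?i] by (simp only: base_eq True)
    next
      case False
      then obtain k s y where y: "p = (k, s, y)" "0 \<le> s" "s < 1" "y \<noteq> b' k"
        using p by (auto simp: Y.mem_tel_iff)
      then obtain x where x: "x \<in> topspace (X k)" "y = i k x"
        using p by auto
      then have "(k, s, x) \<in> topspace X.tel"
        using y ib[of k] by (auto simp: X.mem_tel_iff)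
      then show ?thesis
        using x y by force
    qed
  qed
  show "closed_embedding X.tel Y.tel ?i"
    unfolding closed_embedding_def closed_map_def
  proof (intro conjI allI impI)
    show "continuous_map X.tel Y.tel ?i"
    proof (rule X.continuous_map_from_tel)
      fix k
      have "continuous_map (X.cyl k) Y.tel (\<lambda>q. Y.pt (k, fst q, i k (snd q)))"
        using continuous_map_compose[OF cyl Y.continuous_map_pt] by (simp add: comp_def)
      then show "continuous_map (X.cyl k) Y.tel (\<lambda>q. ?i (X.pt (k, q)))"
      proof (rule continuous_map_eq)
        fix q assume q: "q \<in> topspace (X.cyl k)"
        obtain s x where "q = (s, x)"
          by fastforce
        then show "Y.pt (k, fst q, i k (snd q)) = ?i (X.pt (k, q))"
          using q i_pt[of x k s] by simp
      qed
    qed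
    show "inj_on ?i (topspace X.tel)"
    proof (rule inj_onI)
      fix p q assume p: "p \<in> topspace X.tel" and q: "q \<in> topspace X.tel" and eq: "?i p = ?i q"
      obtain k s x where 1: "p = (k, s, x)" "x \<in> topspace (X k)"
        using X.tel_cases[OF p] by metis
      obtain l t y where 2: "q = (l, t, y)" "y \<in> topspace (X l)"
        using X.tel_cases[OF q] by metis
      show "p = q"
        using eq 1 2 inj[of k] by (auto simp: inj_on_def)
    qed
    fix A assume A: "closedin X.tel A"
    then have AX: "A \<subseteq> topspace X.tel"
      by (rule closedin_subset)
    let ?B = "\<lambda>k. {q \<in> topspace (X.cyl k). X.pt (k, q) \<in> A}"
    have B: "closedin (X.cyl k) (?B k)" for k
      using A by (simp add: X.closedin_tel)
    have Bpt: "(\<lambda>q. X.pt (k, q)) ` ?B k \<subseteq> A" for k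
      by auto
    show "closedin Y.tel (?i ` A)"
      unfolding Y.closedin_tel
    proof (intro conjI allI)
      show "?i ` A \<subseteq> topspace Y.tel"
        using im AX by blast
      fix k
      have "closed_map (X.cyl k) (Y.cyl k) (\<lambda>q. (fst q, i k (snd q)))"
        using closed_embedding_prod[OF i[of k], of "top_of_set {0..1}"] unfolding closed_embedding_def by blast
      then have 1: "closedin (Y.cyl k) ((\<lambda>q. (fst q, i k (snd q))) ` ?B k)"
        using B by (simp add: closed_map_def)
      \<comment> \<open>At \<open>s = 1\<close> a point \<open>(1, y)\<close> is identified with
        \<open>f' k y\<close>, which can come from \<open>A\<close> although \<open>y\<close> itself
        is not in the image of \<open>i k\<close>. These extra points are cut out by the bottom
        slice of \<open>A\<close> one level higher.\<close>
      let ?D = "{x \<in> topspace (X (Suc k)). (0, x) \<in> ?B (Suc k)}"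
      have "continuous_map (X (Suc k)) (X.cyl (Suc k)) (\<lambda>x. (0, x))"
        by (simp add: continuous_map_pairwise comp_def)
      from closedin_continuous_map_preimage[OF this B]
      have "closedin (Y (Suc k)) (i (Suc k) ` ?D)"
        using icl[of "Suc k"] by (simp add: closed_map_def)
      moreover have "continuous_map (Y.cyl k) (Y (Suc k)) (\<lambda>q. f' k (snd q))"
        using continuous_map_compose[OF continuous_map_snd Y.cont] by (simp add: comp_def)
      ultimately have "closedin (Y.cyl k) {q \<in> topspace (Y.cyl k). f' k (snd q) \<in> i (Suc k) ` ?D}"
        using closedin_continuous_map_preimage by blast
      moreover have "closedin (Y.cyl k) ({1} \<times> topspace (Y k))"
        by (simp add: closedin_prod_Times_iff)
      ultimately have 2: "closedin (Y.cyl k)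
          ({q \<in> topspace (Y.cyl k). f' k (snd q) \<in> i (Suc k) ` ?D} \<inter> ({1} \<times> topspace (Y k)))"
        by (rule closedin_Int)
      have "{q \<in> topspace (Y.cyl k). Y.pt (k, q) \<in> ?i ` A} = (\<lambda>q. (fst q, i k (snd q))) ` ?B k \<union>
          ({q \<in> topspace (Y.cyl k). f' k (snd q) \<in> i (Suc k) ` ?D} \<inter> ({1} \<times> topspace (Y k)))"
        (is "?L = ?R")
      proof (intro equalityI subsetI)
        fix q assume q: "q \<in> ?L"
        then obtain a where a: "a \<in> A" "Y.pt (k, q) = ?i a"
          by blast
        obtain l t x where ltx: "a = (l, t, x)" "0 \<le> t" "t < 1" "x \<in> topspace (X l)" "X.pt (l, t, x) = a"
          using X.tel_cases[OF subsetD[OF AX a(1)]] by metis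
        obtain s y where sy: "q = (s, y)" "0 \<le> s" "s \<le> 1" "y \<in> topspace (Y k)"
          using q by auto
        show "q \<in> ?R"
        proof (cases "s = 1")
          case True
          show ?thesis
          proof (cases "f' k y = b' (Suc k)")
            case fb: True
            then have "?i a = telescope_base b'"
              using a sy True by (simp add: Y.pt_simp)
            then have "l = 0" "t = 0" "i 0 x = b' 0"
              using ltx by (auto simp: telescope_base_def)
            then have "a = telescope_base b"
              using ltx i_base by (auto simp: telescope_base_def)
            then have "(0, b (Suc k)) \<in> ?B (Suc k)"
              using a X.base[of "Suc k"] by (simp add: X.pt_simp)
            then have "f' k y \<in> i (Suc k) ` ?D"
              using fb ib[of "Suc k"] X.base[of "Suc k"] by (metis (mono_tags, lifting) image_eqI mem_Collect_eq)
            then show ?thesis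
              using sy True by auto
          next
            case False
            then have "(l, t, i l x) = (Suc k, 0, f' k y)"
              using a sy True ltx by (simp add: Y.pt_simp)
            then have "x \<in> ?D" "f' k y = i (Suc k) x"
              using ltx a by auto
            then show ?thesis
              using sy True by auto
          qed
        next
          case False
          show ?thesis
          proof (cases "y = b' k")
            case True
            then have "?i a = telescope_base b'"
              using a sy False by (simp add: Y.pt_simp)
            then have "l = 0" "t = 0" "i 0 x = b' 0"
              using ltx by (auto simp: telescope_base_def)
            then have "a = telescope_base b"
              using ltx i_base by (auto simp: telescope_base_def)
            then have "(s, b k) \<in> ?B k"
              using a sy False X.base[of k] by (simp add: X.pt_simp)
            then have "(fst (s, b k), i k (snd (s, b k))) \<in> (\<lambda>q. (fst q, i k (snd q))) ` ?B k"
              by (rule imageI)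
            then show ?thesis
              using sy True ib[of k] by simp
          next
            case nb: False
            then have "(l, t, i l x) = (k, s, y)"
              using a sy False ltx by (simp add: Y.pt_simp)
            then have "(s, x) \<in> ?B k" "y = i k x"
              using ltx a by auto
            then have "(fst (s, x), i k (snd (s, x))) \<in> (\<lambda>q. (fst q, i k (snd q))) ` ?B k"
              by (intro imageI)
            then show ?thesis
              using sy \<open>y = i k x\<close> by simp
          qed
        qed
      next
        fix q assume "q \<in> ?R"
        then show "q \<in> ?L"
        proof
          assume "q \<in> (\<lambda>q. (fst q, i k (snd q))) ` ?B k"
          then obtain s x where sx: "(s, x) \<in> ?B k" "q = (s, i k x)"
            by auto
          then have "Y.pt (k, q) = ?i (X.pt (k, s, x))"
            using i_pt[of x k s] by simp
          then show ?thesis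
            using sx iY by auto
        next
          assume "q \<in> {q \<in> topspace (Y.cyl k). f' k (snd q) \<in> i (Suc k) ` ?D} \<inter> ({1} \<times> topspace (Y k))"
          then obtain y x where y: "q = (1, y)" "y \<in> topspace (Y k)" and x: "f' k y = i (Suc k) x" "(0, x) \<in> ?B (Suc k)"
            by auto
          have "Y.pt (k, q) = Y.pt (Suc k, 0, i (Suc k) x)"
            using y x by (simp add: Y.pt_simp)
          also have "\<dots> = ?i (X.pt (Suc k, 0, x))"
            using i_pt[of x "Suc k" 0] x by simp
          finally show ?thesis
            using x y by auto
        qed
      qed
      then show "closedin (Y.cyl k) {q \<in> topspace (Y.cyl k). Y.pt (k, q) \<in> ?i ` A}"
        using 1 2 by (simp add: closedin_Un)
    qed
  qed
qed

section \<open>Isometries of finite-dimensional subspaces\<close>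

subsection \<open>The Hermitian form\<close>

lemma cconj_zero [simp]: "cconj (0 :: 'k::rc_field) = 0"
  using cconj_add[of "0::'k" 0] by simp

lemma cconj_minus: "cconj (- x :: 'k::rc_field) = - cconj x"
  using cconj_add[of x "- x"] by (simp add: eq_neg_iff_add_eq_0 add.commute)

lemma cconj_diff: "cconj (x - y :: 'k::rc_field) = cconj x - cconj y"
  using cconj_add[of x "- y"] by (simp add: cconj_minus)

lemma cconj_sum: "cconj (sum f A :: 'k::rc_field) = (\<Sum>a\<in>A. cconj (f a))"
  by (induction A rule: infinite_finite_induct) (simp_all add: cconj_add)

lemma cconj_of_real [simp]: "cconj (of_real r :: 'k::rc_field) = of_real r"
proof (cases "r = 0")
  case False
  have "cconj (of_real r :: 'k) * of_real r = of_real r * of_real r"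
    using cconj_mult_self[of "of_real r :: 'k"] by (simp add: scaleR_conv_of_real power2_eq_square)
  then show ?thesis
    using False by simp
qed simp

lemma cconj_one [simp]: "cconj (1 :: 'k::rc_field) = 1"
  using cconj_of_real[of 1] by simp

lemma norm_cconj [simp]: "norm (cconj x :: 'k::rc_field) = norm x"
proof (cases "x = 0")
  case False
  have "norm (cconj x) * norm x = norm x * norm x"
    using cconj_mult_self[of x] by (metis norm_mult norm_of_real scaleR_conv_of_real mult.right_neutral
        abs_power2 power2_eq_square)
  then show ?thesis
    using False by simp
qed simp

lemma continuous_on_cconj: "continuous_on S (cconj :: 'k::rc_field \<Rightarrow> 'k)"
proof (rule lipschitz_on_continuous_on)
  show "1-lipschitz_on S (cconj :: 'k \<Rightarrow> 'k)"
    by (rule lipschitz_onI) (simp_all add: dist_norm flip: cconj_diff)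
qed

lemma continuous_map_cconj:
  "continuous_map X euclidean f \<Longrightarrow> continuous_map X euclidean (\<lambda>x. cconj (f x :: 'k::rc_field))"
  using continuous_map_compose[of X euclidean f euclidean cconj] continuous_on_cconj[of UNIV]
  by (simp add: comp_def)

lemma continuous_map_field_mult:
  fixes f g :: "'a \<Rightarrow> 'k::real_normed_field"
  assumes "continuous_map X euclidean f" "continuous_map X euclidean g"
  shows "continuous_map X euclidean (\<lambda>x. f x * g x)"
  using assms by (simp add: continuous_map_atin tendsto_mult)

text \<open>\<open>hinner\<close> sums over the support of its first argument, and a sum over an
  infinite set is 0. Conjugate symmetry, and the additivity in the first argument derived from it,
  are therefore stated for finitely supported vectors.\<close>

definition fin_supp :: "(nat \<Rightarrow> 'k::zero) \<Rightarrow> bool" where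
  "fin_supp x \<longleftrightarrow> finite {i. x i \<noteq> 0}"

lemma fin_supp_zero [simp]: "fin_supp 0"
  by (simp add: fin_supp_def)

lemma fin_supp_add: "fin_supp x \<Longrightarrow> fin_supp y \<Longrightarrow> fin_supp (x + y :: nat \<Rightarrow> 'k::monoid_add)"
  unfolding fin_supp_def by (rule finite_subset[of _ "{i. x i \<noteq> 0} \<union> {i. y i \<noteq> 0}"]) auto

lemma fin_supp_scale: "fin_supp x \<Longrightarrow> fin_supp (scale_fun c x)"
  unfolding fin_supp_def by (rule finite_subset[of _ "{i. x i \<noteq> 0}"]) (auto simp: scale_fun_def)

lemma fin_supp_diff: "fin_supp x \<Longrightarrow> fin_supp y \<Longrightarrow> fin_supp (x - y :: nat \<Rightarrow> 'k::group_add)"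
  unfolding fin_supp_def by (rule finite_subset[of _ "{i. x i \<noteq> 0} \<union> {i. y i \<noteq> 0}"]) auto

lemma hinner_on:
  assumes "finite S" "\<And>i. x i \<noteq> 0 \<Longrightarrow> i \<in> S"
  shows "hinner x y = (\<Sum>i\<in>S. cconj (x i) * y i)"
  unfolding hinner_def using assms by (intro sum.mono_neutral_left) auto

lemma hinner_add_right: "hinner x (y + z) = hinner x y + hinner x z"
  by (simp add: hinner_def distrib_left sum.distrib)

lemma hinner_diff_right: "hinner x (y - z) = hinner x y - hinner x z"
  by (simp add: hinner_def right_diff_distrib sum_subtractf)

lemma hinner_scale_right: "hinner x (scale_fun c y) = c * hinner x y"
  by (simp add: hinner_def scale_fun_def sum_distrib_left mult.left_commute)

lemma hinner_zero_right [simp]: "hinner x 0 = 0"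
  by (simp add: hinner_def)

lemma hinner_zero_left [simp]: "hinner 0 x = 0"
  by (simp add: hinner_def)

lemma hinner_cconj:
  assumes "fin_supp x" "fin_supp y"
  shows "cconj (hinner x y) = hinner y x"
proof -
  let ?S = "{i. x i \<noteq> 0} \<union> {i. y i \<noteq> 0}"
  have "finite ?S"
    using assms by (simp add: fin_supp_def)
  then show ?thesis
    using hinner_on[of ?S x y] hinner_on[of ?S y x]
    by (simp add: cconj_sum cconj_mult cconj_cconj mult.commute)
qed

lemma hinner_add_left: "fin_supp x \<Longrightarrow> fin_supp y \<Longrightarrow> fin_supp z \<Longrightarrow> hinner (x + y) z = hinner x z + hinner y z"
  using hinner_cconj[of z "x + y"] hinner_cconj[of z x] hinner_cconj[of z y]
  by (simp add: fin_supp_add hinner_add_right cconj_add)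

lemma hinner_scale_left: "fin_supp x \<Longrightarrow> fin_supp z \<Longrightarrow> hinner (scale_fun c x) z = cconj c * hinner x z"
  using hinner_cconj[of z "scale_fun c x"] hinner_cconj[of z x]
  by (simp add: fin_supp_scale hinner_scale_right cconj_mult)

lemma hinner_self: "hinner x x = of_real (\<Sum>i | x i \<noteq> 0. (norm (x i))\<^sup>2)"
  by (simp add: hinner_def cconj_mult_self scaleR_conv_of_real)

lemma hinner_self_eq_0:
  assumes "fin_supp x"
  shows "hinner x x = 0 \<longleftrightarrow> x = 0"
proof
  assume "hinner x x = 0"
  then have "(\<Sum>i | x i \<noteq> 0. (norm (x i))\<^sup>2) = 0"
    unfolding hinner_self of_real_eq_0_iff .
  then have "\<forall>i\<in>{i. x i \<noteq> 0}. (norm (x i))\<^sup>2 = 0"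
    using assms sum_nonneg_eq_0_iff[of "{i. x i \<noteq> 0}" "\<lambda>i. (norm (x i))\<^sup>2"] by (simp add: fin_supp_def)
  then show "x = 0"
    by (auto simp: fun_eq_iff)
qed simp

section \<open>Standard basis and coordinate subspaces\<close>

definition basis_vec :: "nat \<Rightarrow> nat \<Rightarrow> 'k::zero_neq_one" where
  "basis_vec i = (\<lambda>j. if j = i then 1 else 0)"

lemma hinner_basis_vec [simp]: "hinner (basis_vec i) x = x i"
proof -
  have "{j. basis_vec i j \<noteq> (0::'a)} = {i}"
    by (auto simp: basis_vec_def)
  then show ?thesis
    by (simp add: hinner_def basis_vec_def)
qed

lemma basis_vec_in_std: "i < k \<Longrightarrow> basis_vec i \<in> std k"
  by (auto simp: basis_vec_def std_def)

lemma fin_supp_std: "x \<in> std k \<Longrightarrow> fin_supp x"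
  unfolding fin_supp_def std_def by (rule finite_subset[of _ "{..<k}"]) (auto simp: not_le[symmetric])

lemma hinner_std: "x \<in> std k \<Longrightarrow> hinner x y = (\<Sum>i<k. cconj (x i) * y i)"
  by (rule hinner_on) (auto simp: std_def not_le[symmetric])

lemma subspace_std: "fs.subspace (std k)"
  by (auto simp: fs.subspace_def std_def scale_fun_def)

lemma head_part_in_std: "head_part m x \<in> std m"
  by (simp add: head_part_def std_def)

lemma head_part_Suc: "head_part (Suc j) x = head_part j x + scale_fun (x j) (basis_vec j :: nat \<Rightarrow> 'k::field)"
  by (auto simp: head_part_def scale_fun_def basis_vec_def fun_eq_iff less_Suc_eq)

lemma head_part_std: "x \<in> std k \<Longrightarrow> head_part k x = x"
  by (auto simp: head_part_def std_def fun_eq_iff)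

lemma span_basis_vec: "fs.span (basis_vec ` {..<k}) = (std k :: (nat \<Rightarrow> 'k::field) set)"
proof
  show "fs.span (basis_vec ` {..<k}) \<subseteq> (std k :: (nat \<Rightarrow> 'k) set)"
    using basis_vec_in_std by (intro fs.span_minimal subspace_std) auto
  show "(std k :: (nat \<Rightarrow> 'k) set) \<subseteq> fs.span (basis_vec ` {..<k})"
  proof
    fix x :: "nat \<Rightarrow> 'k" assume x: "x \<in> std k"
    have "head_part j x \<in> fs.span (basis_vec ` {..<k})" if "j \<le> k" for j
      using that
    proof (induction j)
      case 0
      have 0: "head_part 0 x = 0"
        by (simp add: head_part_def fun_eq_iff)
      show ?case
        unfolding 0 by (rule fs.span_zero)
    next
      case (Suc j)
      then show ?case
        unfolding head_part_Suc
        by (intro fs.span_add fs.span_scale) (auto intro: fs.span_base)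
    qed
    then show "x \<in> fs.span (basis_vec ` {..<k})"
      using head_part_std[OF x] by (metis order_refl)
  qed
qed

lemma vconj_std: "x \<in> std k \<Longrightarrow> vconj x \<in> std k"
  by (simp add: vconj_def std_def)

lemma std_jobj: "std k \<in> jobj"
  unfolding jobj_def
proof (intro CollectI conjI ballI exI)
  show "std k = fs.span (basis_vec ` {..<k})"
    by (rule span_basis_vec[symmetric])
qed (use fin_supp_std vconj_std subspace_std in \<open>auto simp: fin_supp_def\<close>)

lemma jobjD:
  assumes "V \<in> jobj"
  shows "fs.subspace V" "\<And>x. x \<in> V \<Longrightarrow> fin_supp x" "\<And>x. x \<in> V \<Longrightarrow> vconj x \<in> V"
    "\<exists>B. finite B \<and> V = fs.span B"
  using assms by (auto simp: jobj_def fin_supp_def)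

subsection \<open>Isometries\<close>

lemma jmorD:
  assumes "f \<in> jmor V W"
  shows "\<And>x. x \<in> V \<Longrightarrow> f x \<in> W" "f \<in> extensional V"
    "\<And>x y. x \<in> V \<Longrightarrow> y \<in> V \<Longrightarrow> f (x + y) = f x + f y"
    "\<And>c x. x \<in> V \<Longrightarrow> f (scale_fun c x) = scale_fun c (f x)"
    "\<And>x y. x \<in> V \<Longrightarrow> y \<in> V \<Longrightarrow> hinner (f x) (f y) = hinner x y"
  using assms by (auto simp: jmor_def PiE_def)

lemma jmorI:
  assumes "\<And>x. x \<in> V \<Longrightarrow> f x \<in> W" "f \<in> extensional V"
    "\<And>x y. x \<in> V \<Longrightarrow> y \<in> V \<Longrightarrow> f (x + y) = f x + f y"
    "\<And>c x. x \<in> V \<Longrightarrow> f (scale_fun c x) = scale_fun c (f x)"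
    "\<And>x y. x \<in> V \<Longrightarrow> y \<in> V \<Longrightarrow> hinner (f x) (f y) = hinner x y"
  shows "f \<in> jmor V W"
  using assms by (auto simp: jmor_def PiE_def)

lemma topspace_jmor_top: "topspace (jmor_top V W) = jmor V W"
  by (auto simp: jmor_top_def jmor_def)

lemma jmor_zero:
  assumes "f \<in> jmor V W" "fs.subspace V"
  shows "f 0 = 0"
proof -
  have "0 \<in> V"
    using assms(2) by (rule fs.subspace_0)
  then have "f (0 + 0) = f 0 + f 0"
    using jmorD(3)[OF assms(1)] by blast
  then show ?thesis
    by simp
qed

lemma jmor_diff:
  assumes f: "f \<in> jmor V W" and V: "fs.subspace V" and xy: "x \<in> V" "y \<in> V"
  shows "f (x - y) = f x - f y"
proof -
  have "x - y \<in> V"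
    using fs.subspace_diff[OF V xy] .
  then have "f (x - y + y) = f (x - y) + f y"
    using jmorD(3)[OF f] xy by blast
  then show ?thesis
    by simp
qed

lemma jmor_inj:
  assumes f: "f \<in> jmor V W" and V: "fs.subspace V" and fin: "\<And>x. x \<in> V \<Longrightarrow> fin_supp x"
  shows "inj_on f V"
proof (rule inj_onI)
  fix x y assume xy: "x \<in> V" "y \<in> V" "f x = f y"
  have d: "x - y \<in> V"
    using fs.subspace_diff[OF V xy(1,2)] .
  have "f (x - y) = 0"
    using jmor_diff[OF f V xy(1,2)] xy(3) by simp
  then have "hinner (x - y) (x - y) = 0"
    using jmorD(5)[OF f d d] by simp
  then show "x = y"
    using hinner_self_eq_0[OF fin[OF d]] by simp
qed

lemma jmor_compose:
  assumes "f \<in> jmor U V" "g \<in> jmor V W" "fs.subspace U"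
  shows "compose U g f \<in> jmor U W"
  using jmorD[OF assms(1)] jmorD[OF assms(2)]
  by (intro jmorI) (auto simp: compose_def fs.subspace_add[OF assms(3)] fs.subspace_scale[OF assms(3)])

lemma incl_jmor: "V \<subseteq> W \<Longrightarrow> fs.subspace V \<Longrightarrow> incl V \<in> jmor V W"
  by (intro jmorI) (auto simp: incl_def fs.subspace_add fs.subspace_scale)

lemma subspace_jmor_image:
  assumes f: "f \<in> jmor V W" and V: "fs.subspace V"
  shows "fs.subspace (f ` V)"
  unfolding fs.subspace_def
proof (intro conjI ballI allI)
  show "0 \<in> f ` V"
    using jmor_zero[OF f V] fs.subspace_0[OF V] by (metis image_eqI)
  fix x assume "x \<in> f ` V"
  then obtain a where a: "a \<in> V" "x = f a"
    by blast
  show "scale_fun c x \<in> f ` V" for c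
    using a jmorD(4)[OF f a(1), of c] fs.subspace_scale[OF V a(1), of c] by (metis image_eqI)
  fix y assume "y \<in> f ` V"
  then obtain b where b: "b \<in> V" "y = f b"
    by blast
  show "x + y \<in> f ` V"
    using a b jmorD(3)[OF f a(1) b(1)] fs.subspace_add[OF V a(1) b(1)] by (metis image_eqI)
qed

definition jinv :: "(nat \<Rightarrow> 'k) set \<Rightarrow> ((nat \<Rightarrow> 'k) \<Rightarrow> (nat \<Rightarrow> 'k)) \<Rightarrow> ((nat \<Rightarrow> 'k) \<Rightarrow> (nat \<Rightarrow> 'k))" where
  "jinv V f = (\<lambda>u\<in>f ` V. inv_into V f u)"

lemma jinv_simps:
  assumes f: "f \<in> jmor V W" and V: "fs.subspace V" and fin: "\<And>x. x \<in> V \<Longrightarrow> fin_supp x"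
  shows "x \<in> V \<Longrightarrow> jinv V f (f x) = x" "u \<in> f ` V \<Longrightarrow> jinv V f u \<in> V" "u \<in> f ` V \<Longrightarrow> f (jinv V f u) = u"
  using jmor_inj[OF f V fin] by (auto simp: jinv_def inv_into_into f_inv_into_f)

lemma jinv_jmor:
  assumes f: "f \<in> jmor V W" and V: "fs.subspace V" and fin: "\<And>x. x \<in> V \<Longrightarrow> fin_supp x"
  shows "jinv V f \<in> jmor (f ` V) V"
proof (rule jmorI)
  note simps = jinv_simps[OF f V fin]
  show "jinv V f \<in> extensional (f ` V)"
    by (simp add: jinv_def)
  fix x assume x: "x \<in> f ` V"
  then obtain a where a: "a \<in> V" "x = f a"
    by blast
  show "jinv V f x \<in> V"
    using simps x by blast
  show "jinv V f (scale_fun c x) = scale_fun c (jinv V f x)" for c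
    using a simps jmorD(4)[OF f a(1), of c] fs.subspace_scale[OF V a(1), of c] by metis
  fix y assume "y \<in> f ` V"
  then obtain b where b: "b \<in> V" "y = f b"
    by blast
  show "jinv V f (x + y) = jinv V f x + jinv V f y"
    using a b simps jmorD(3)[OF f a(1) b(1)] fs.subspace_add[OF V a(1) b(1)] by metis
  show "hinner (jinv V f x) (jinv V f y) = hinner x y"
    using a b simps jmorD(5)[OF f a(1) b(1)] by metis
qed

lemma compose_jinv:
  assumes f: "f \<in> jmor V W" and V: "fs.subspace V" and fin: "\<And>x. x \<in> V \<Longrightarrow> fin_supp x"
  shows "compose V (jinv V f) f = incl V" "compose (f ` V) f (jinv V f) = incl (f ` V)"
  using jinv_simps[OF f V fin] by (auto simp: compose_def incl_def fun_eq_iff)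

lemma jinv_std:
  assumes g: "g \<in> jmor (std k) W"
  shows "x \<in> std k \<Longrightarrow> jinv (std k) g (g x) = x"
    "u \<in> g ` std k \<Longrightarrow> jinv (std k) g u \<in> std k" "u \<in> g ` std k \<Longrightarrow> g (jinv (std k) g u) = u"
    "jinv (std k) g \<in> jmor (g ` std k) (std k)"
    "compose (std k) (jinv (std k) g) g = incl (std k)" "compose (g ` std k) g (jinv (std k) g) = incl (g ` std k)"
  by (rule jinv_simps[OF g subspace_std] jinv_jmor[OF g subspace_std] compose_jinv[OF g subspace_std];
      (rule fin_supp_std)?; assumption)+

lemma jmor_frame_expand:
  assumes g: "g \<in> jmor (std k) W" and x: "x \<in> std k"
  shows "g x i = (\<Sum>l<k. x l * g (basis_vec l) i)"
proof -
  have "g (head_part j x) i = (\<Sum>l<j. x l * g (basis_vec l) i)" if "j \<le> k" for j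
    using that
  proof (induction j)
    case 0
    have 0: "head_part 0 x = 0"
      by (simp add: head_part_def fun_eq_iff)
    show ?case
      unfolding 0 jmor_zero[OF g subspace_std] by simp
  next
    case (Suc j)
    have h: "head_part j x \<in> std k"
      using Suc.prems by (auto simp: head_part_def std_def)
    have e: "basis_vec j \<in> std k"
      using Suc.prems by (intro basis_vec_in_std) auto
    have "g (head_part (Suc j) x) = g (head_part j x) + scale_fun (x j) (g (basis_vec j))"
      unfolding head_part_Suc
      using jmorD(3)[OF g h fs.subspace_scale[OF subspace_std e]] jmorD(4)[OF g e] by simp
    then show ?case
      using Suc by (simp add: scale_fun_def)
  qed
  from this[of k] show ?thesis
    using head_part_std[OF x] by simp
qed

lemma jmor_coordinate:
  assumes g: "g \<in> jmor (std k) W" and x: "x \<in> std k" and i: "i < k"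
  shows "hinner (g (basis_vec i)) (g x) = x i"
  using jmorD(5)[OF g basis_vec_in_std[OF i] x] by simp

text \<open>The matrix of the orthogonal projection onto the image of the frame: the matrix with
  columns \<open>g (basis_vec l)\<close> times its adjoint. It turns statements about subspaces into
  statements about finitely many scalars.\<close>

definition frame_matrix :: "nat \<Rightarrow> ((nat \<Rightarrow> 'k::rc_field) \<Rightarrow> (nat \<Rightarrow> 'k)) \<Rightarrow> nat \<times> nat \<Rightarrow> 'k" where
  "frame_matrix k g = (\<lambda>(i, j). \<Sum>l<k. g (basis_vec l) i * cconj (g (basis_vec l) j))"

lemma frame_matrix_fixes:
  assumes g: "g \<in> jmor (std k) (std m)" and y: "y \<in> g ` std k"
  shows "(\<Sum>j<m. frame_matrix k g (i, j) * y j) = y i"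
proof -
  obtain x where x: "x \<in> std k" "y = g x"
    using y by blast
  have e: "g (basis_vec l) \<in> std m" if "l < k" for l
    using jmorD(1)[OF g basis_vec_in_std[OF that]] .
  have "(\<Sum>j<m. frame_matrix k g (i, j) * y j)
      = (\<Sum>j<m. \<Sum>l<k. g (basis_vec l) i * (cconj (g (basis_vec l) j) * y j))"
    by (simp add: frame_matrix_def sum_distrib_right mult.assoc)
  also have "\<dots> = (\<Sum>l<k. g (basis_vec l) i * (\<Sum>j<m. cconj (g (basis_vec l) j) * y j))"
    by (subst sum.swap) (simp add: sum_distrib_left)
  also have "\<dots> = (\<Sum>l<k. g (basis_vec l) i * hinner (g (basis_vec l)) y)"
    using e by (intro sum.cong) (auto simp: hinner_std[of _ m])
  also have "\<dots> = (\<Sum>l<k. x l * g (basis_vec l) i)"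
    using x jmor_coordinate[OF g x(1)] by (intro sum.cong) auto
  finally show ?thesis
    using jmor_frame_expand[OF g x(1)] x by simp
qed

text \<open>The image of an orthogonal projection is its space of fixed vectors. Conversely, the
  Hermitian products of a fixed vector \<open>y\<close> with the columns are its coordinates
  \<open>x\<close> in the frame.\<close>

lemma frame_matrix_image:
  assumes g: "g \<in> jmor (std k) (std m)"
  shows "g ` std k = {y \<in> std m. \<forall>i. (\<Sum>j<m. frame_matrix k g (i, j) * y j) = y i}"
proof (intro equalityI subsetI)
  fix y assume "y \<in> g ` std k"
  then show "y \<in> {y \<in> std m. \<forall>i. (\<Sum>j<m. frame_matrix k g (i, j) * y j) = y i}"
    using frame_matrix_fixes[OF g] jmorD(1)[OF g] by auto
next
  fix y assume "y \<in> {y \<in> std m. \<forall>i. (\<Sum>j<m. frame_matrix k g (i, j) * y j) = y i}"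
  then have y: "\<And>i. (\<Sum>j<m. frame_matrix k g (i, j) * y j) = y i"
    by auto
  define x where "x = (\<lambda>l. if l < k then \<Sum>j<m. cconj (g (basis_vec l) j) * y j else 0)"
  have x: "x \<in> std k"
    by (simp add: x_def std_def)
  have "y i = g x i" for i
  proof -
    have "y i = (\<Sum>j<m. \<Sum>l<k. g (basis_vec l) i * (cconj (g (basis_vec l) j) * y j))"
      using y[of i] by (simp add: frame_matrix_def sum_distrib_right mult.assoc)
    also have "\<dots> = (\<Sum>l<k. g (basis_vec l) i * (\<Sum>j<m. cconj (g (basis_vec l) j) * y j))"
      by (subst sum.swap) (simp add: sum_distrib_left)
    also have "\<dots> = (\<Sum>l<k. x l * g (basis_vec l) i)"
      by (simp add: x_def mult.commute)
    finally show ?thesis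
      using jmor_frame_expand[OF g x] by simp
  qed
  then have "y = g x"
    by (simp add: fun_eq_iff)
  then show "y \<in> g ` std k"
    using x by blast
qed

lemma frame_matrix_mult:
  assumes g: "g \<in> jmor (std k) (std m)" and h: "h \<in> jmor (std l) (std m)" and im: "h ` std l \<subseteq> g ` std k"
  shows "(\<Sum>j<m. frame_matrix k g (i, j) * frame_matrix l h (j, p)) = frame_matrix l h (i, p)"
proof -
  have fx: "(\<Sum>j<m. frame_matrix k g (i, j) * h (basis_vec a) j) = h (basis_vec a) i" if "a < l" for a
    using im basis_vec_in_std[OF that] by (intro frame_matrix_fixes[OF g]) blast
  have "(\<Sum>j<m. frame_matrix k g (i, j) * frame_matrix l h (j, p))
      = (\<Sum>j<m. \<Sum>a<l. (frame_matrix k g (i, j) * h (basis_vec a) j) * cconj (h (basis_vec a) p))"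
    by (simp add: frame_matrix_def[of l] sum_distrib_left mult.assoc)
  also have "\<dots> = (\<Sum>a<l. (\<Sum>j<m. frame_matrix k g (i, j) * h (basis_vec a) j) * cconj (h (basis_vec a) p))"
    by (subst sum.swap) (simp add: sum_distrib_right)
  also have "\<dots> = frame_matrix l h (i, p)"
    using fx by (simp add: frame_matrix_def)
  finally show ?thesis .
qed

lemma frame_matrix_hermitian: "cconj (frame_matrix k g (i, j)) = frame_matrix k g (j, i)"
  by (simp add: frame_matrix_def cconj_sum cconj_mult cconj_cconj mult.commute)

text \<open>If the images agree, each projection fixes the columns of the other. Taking the adjoint
  of one of the two resulting matrix identities gives equality.\<close>

lemma frame_matrix_eq_iff:
  assumes g: "g \<in> jmor (std k) (std m)" and h: "h \<in> jmor (std l) (std m)"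
  shows "frame_matrix k g = frame_matrix l h \<longleftrightarrow> g ` std k = h ` std l"
proof
  assume "frame_matrix k g = frame_matrix l h"
  then show "g ` std k = h ` std l"
    by (simp add: frame_matrix_image[OF g] frame_matrix_image[OF h])
next
  assume im: "g ` std k = h ` std l"
  show "frame_matrix k g = frame_matrix l h"
  proof
    fix ip :: "nat \<times> nat"
    obtain i p where ip: "ip = (i, p)"
      by fastforce
    have "frame_matrix k g (i, p) = cconj (\<Sum>j<m. frame_matrix l h (p, j) * frame_matrix k g (j, i))"
      using frame_matrix_mult[OF h g] im by (simp add: frame_matrix_hermitian)
    also have "\<dots> = (\<Sum>j<m. frame_matrix k g (i, j) * frame_matrix l h (j, p))"
      by (simp add: cconj_sum cconj_mult frame_matrix_hermitian mult.commute)
    also have "\<dots> = frame_matrix l h (i, p)"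
      using frame_matrix_mult[OF g h] im by simp
    finally show "frame_matrix k g ip = frame_matrix l h ip"
      by (simp add: ip)
  qed
qed

text \<open>The trace of a projection is its rank. It recovers the number of vectors of a frame from
  the image alone, and so keeps the components of the Grassmannian for different \<open>k\<close>
  disjoint.\<close>

lemma frame_matrix_trace:
  assumes g: "g \<in> jmor (std k) (std m)"
  shows "(\<Sum>i<m. frame_matrix k g (i, i)) = of_nat k"
proof -
  have "(\<Sum>i<m. frame_matrix k g (i, i)) = (\<Sum>l<k. \<Sum>i<m. cconj (g (basis_vec l) i) * g (basis_vec l) i)"
    unfolding frame_matrix_def by (simp, subst sum.swap) (simp add: mult.commute)
  also have "\<dots> = (\<Sum>l<k. hinner (g (basis_vec l)) (g (basis_vec l)))"
    using jmorD(1)[OF g basis_vec_in_std] by (intro sum.cong) (auto simp: hinner_std[of _ m])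
  also have "\<dots> = (\<Sum>l<k. 1)"
    using jmor_coordinate[OF g basis_vec_in_std] by (intro sum.cong) (auto simp: basis_vec_def)
  finally show ?thesis
    by simp
qed

lemma frame_rank_unique:
  assumes g: "g \<in> jmor (std k) (std m)" and h: "h \<in> jmor (std l) (std m)" and im: "g ` std k = h ` std l"
  shows "k = l"
  using frame_matrix_trace[OF g] frame_matrix_trace[OF h] im frame_matrix_eq_iff[OF g h]
  by (metis of_nat_eq_iff)

subsection \<open>Topology of spaces of isometries\<close>

lemma Hausdorff_space_euclidean_fun: "Hausdorff_space (euclidean :: ('i \<Rightarrow> 'b::metric_space) topology)"
  by (simp add: Hausdorff_space_product_topology flip: euclidean_product_topology)

lemma Hausdorff_jmor_top: "Hausdorff_space (jmor_top V W)"
  unfolding jmor_top_def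
  by (intro Hausdorff_space_subtopology) (simp add: Hausdorff_space_product_topology Hausdorff_space_euclidean_fun)

lemma continuous_map_into_euclidean_fun:
  "continuous_map X (euclidean :: ('i \<Rightarrow> 'b::topological_space) topology) f \<longleftrightarrow>
     (\<forall>i. continuous_map X euclidean (\<lambda>x. f x i))"
  using continuous_map_componentwise_UNIV[of X "\<lambda>_. euclidean" f] by (simp add: euclidean_product_topology)

lemma continuous_map_into_jmor_top:
  "continuous_map X (jmor_top V W) h \<longleftrightarrow>
     (\<forall>z \<in> topspace X. h z \<in> jmor V W) \<and> (\<forall>x \<in> V. \<forall>i. continuous_map X euclidean (\<lambda>z. h z x i))"
proof -
  have "h ` topspace X \<subseteq> extensional V" if "\<forall>z \<in> topspace X. h z \<in> jmor V W"
    using that jmorD(2) by blast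
  then show ?thesis
    unfolding jmor_top_def continuous_map_in_subtopology continuous_map_componentwise
      continuous_map_into_euclidean_fun by blast
qed

lemma continuous_map_jmor_coordinate:
  assumes "continuous_map X (jmor_top V W) h" "x \<in> V"
  shows "continuous_map X euclidean (\<lambda>z. h z x i)"
  using assms by (simp add: continuous_map_into_jmor_top)

lemma continuous_map_frame_matrix:
  assumes "continuous_map X (jmor_top (std k) W) h"
  shows "continuous_map X euclidean (\<lambda>z. frame_matrix k (h z))"
  unfolding continuous_map_into_euclidean_fun frame_matrix_def
proof
  fix ij :: "nat \<times> nat"
  show "continuous_map X euclidean
      (\<lambda>z. (case ij of (i, j) \<Rightarrow> \<Sum>l<k. h z (basis_vec l) i * cconj (h z (basis_vec l) j)))"
    using continuous_map_jmor_coordinate[OF assms basis_vec_in_std]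
    by (cases ij) (auto intro!: continuous_map_sum continuous_map_field_mult continuous_map_cconj)
qed

text \<open>The coordinates of \<open>g\<inverse> h\<close> are the Hermitian products of the columns of \<open>g\<close> and \<open>h\<close>.\<close>

lemma continuous_map_frame_change:
  fixes g h :: "'b \<Rightarrow> (nat \<Rightarrow> 'k::rc_field) \<Rightarrow> (nat \<Rightarrow> 'k)"
  assumes g: "continuous_map X (jmor_top (std k) (std m)) g" and h: "continuous_map X (jmor_top (std k) (std m)) h"
    and im: "\<And>z. z \<in> topspace X \<Longrightarrow> g z ` std k = h z ` std k"
  shows "continuous_map X (jmor_top (std k) (std k)) (\<lambda>z. compose (std k) (jinv (std k) (g z)) (h z))"
  unfolding continuous_map_into_jmor_top
proof (intro conjI ballI allI)
  have gz: "g z \<in> jmor (std k) (std m)" and hz: "h z \<in> jmor (std k) (std m)" if "z \<in> topspace X" for z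
    using g h that by (auto simp: continuous_map_into_jmor_top)
  have comp: "compose (std k) (jinv (std k) (g z)) (h z) \<in> jmor (std k) (std k)" if z: "z \<in> topspace X" for z
  proof -
    have "h z \<in> jmor (std k) (g z ` std k)"
      using hz[OF z] im[OF z] by (auto simp: jmor_def PiE_def)
    then show ?thesis
      using jinv_std(4)[OF gz[OF z]] jmor_compose subspace_std by blast
  qed
  then show "\<And>z. z \<in> topspace X \<Longrightarrow> compose (std k) (jinv (std k) (g z)) (h z) \<in> jmor (std k) (std k)" .
  fix x :: "nat \<Rightarrow> 'k" and i assume x: "x \<in> std k"
  have eq: "compose (std k) (jinv (std k) (g z)) (h z) x i
      = (if i < k then \<Sum>j<m. cconj (g z (basis_vec i) j) * h z x j else 0)" if z: "z \<in> topspace X" for z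
  proof (cases "i < k")
    case True
    let ?w = "jinv (std k) (g z) (h z x)"
    have "h z x \<in> g z ` std k"
      using x im[OF z] by blast
    then have w: "?w \<in> std k" "g z ?w = h z x"
      using jinv_std[OF gz[OF z]] by auto
    have "?w i = hinner (g z (basis_vec i)) (h z x)"
      using jmor_coordinate[OF gz[OF z] w(1) True] w(2) by simp
    also have "\<dots> = (\<Sum>j<m. cconj (g z (basis_vec i) j) * h z x j)"
      using jmorD(1)[OF gz[OF z] basis_vec_in_std[OF True]] by (rule hinner_std)
    finally show ?thesis
      using True x by (simp add: compose_def)
  next
    case False
    then show ?thesis
      using jmorD(1)[OF comp[OF z] x] by (simp add: std_def)
  qed
  have "continuous_map X euclidean (\<lambda>z. if i < k then \<Sum>j<m. cconj (g z (basis_vec i) j) * h z x j else 0)"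
    using continuous_map_jmor_coordinate[OF g basis_vec_in_std] continuous_map_jmor_coordinate[OF h x]
    by (cases "i < k") (auto intro!: continuous_map_sum continuous_map_field_mult continuous_map_cconj)
  then show "continuous_map X euclidean (\<lambda>z. compose (std k) (jinv (std k) (g z)) (h z) x i)"
    by (rule continuous_map_eq) (simp add: eq)
qed

section \<open>Gram-Schmidt and compactness of spaces of isometries\<close>

lemma sum_fun_apply: "(\<Sum>a\<in>A. f a) i = (\<Sum>a\<in>A. f a i :: 'b::comm_monoid_add)"
  by (induction A rule: infinite_finite_induct) simp_all

text \<open>Gram-Schmidt. From the new vector \<open>b\<close> its projection to the span so far is
  subtracted; the remainder \<open>w\<close> is zero, and then the span is unchanged, or it is
  normalised and added to the frame.\<close>

lemma span_orthonormal_frame: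
  fixes B :: "(nat \<Rightarrow> 'k::rc_field) set"
  assumes "finite B" "\<And>b. b \<in> B \<Longrightarrow> fin_supp b"
  shows "\<exists>k g. g \<in> jmor (std k) (fs.span B) \<and> g ` std k = fs.span B"
  using assms
proof (induction B rule: finite_induct)
  case empty
  have 0: "(std 0 :: (nat \<Rightarrow> 'k) set) = {0}"
    by (auto simp: std_def fun_eq_iff)
  have "incl (std 0) \<in> jmor (std 0) (std 0 :: (nat \<Rightarrow> 'k) set)"
    by (rule incl_jmor[OF order_refl subspace_std])
  moreover have "incl (std 0) ` std 0 = (std 0 :: (nat \<Rightarrow> 'k) set)"
    by (simp add: incl_def)
  ultimately show ?case
    unfolding fs.span_empty 0[symmetric] by blast
next
  case (insert b B)
  then obtain k g where g: "g \<in> jmor (std k) (fs.span B)" "g ` std k = fs.span B"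
    by auto
  have fin_span: "fin_supp x" if "x \<in> fs.span B" for x
    using that insert.prems by (induction rule: fs.span_induct_alt) (auto intro: fin_supp_add fin_supp_scale)
  have fb: "fin_supp b"
    using insert.prems by simp
  \<comment> \<open>\<open>p\<close> lists the Fourier coefficients of \<open>b\<close>, so that
    \<open>g p\<close> is its orthogonal projection to the span of \<open>B\<close>.\<close>
  define p where "p = (\<lambda>l. if l < k then hinner (g (basis_vec l)) b else 0)"
  have p: "p \<in> std k"
    by (simp add: p_def std_def)
  have gp: "g p \<in> fs.span B"
    using jmorD(1)[OF g(1) p] .
  define w where "w = b - g p"
  have fw: "fin_supp w"
    unfolding w_def by (intro fin_supp_diff fb fin_span gp)
  have fg: "fin_supp (g x)" if "x \<in> std k" for x
    using fin_span jmorD(1)[OF g(1) that] by blast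
  have gw_basis: "hinner (g (basis_vec l)) w = 0" if "l < k" for l
    using jmor_coordinate[OF g(1) p that] that by (simp add: w_def hinner_diff_right p_def)
  have gw: "hinner (g x) w = 0" "hinner w (g x) = 0" if x: "x \<in> std k" for x
  proof -
    have gx: "g x = (\<Sum>l<k. scale_fun (x l) (g (basis_vec l)))"
      using jmor_frame_expand[OF g(1) x] by (auto simp: fun_eq_iff scale_fun_def sum_fun_apply)
    have "hinner w (g x) = (\<Sum>l<k. x l * hinner w (g (basis_vec l)))"
    proof -
      have "hinner w (\<Sum>l\<in>A. scale_fun (x l) (g (basis_vec l))) = (\<Sum>l\<in>A. x l * hinner w (g (basis_vec l)))" for A
      proof (induction A rule: infinite_finite_induct)
        case (insert a A)
        then show ?case
          unfolding sum.insert[OF insert.hyps] hinner_add_right hinner_scale_right by simp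
      qed (simp_all only: sum.infinite sum.empty hinner_zero_right not_False_eq_True)
      then show ?thesis
        unfolding gx .
    qed
    also have "\<dots> = 0"
    proof (rule sum.neutral, rule ballI)
      fix l assume "l \<in> {..<k}"
      then have "hinner w (g (basis_vec l)) = cconj (hinner (g (basis_vec l)) w)"
        using hinner_cconj[OF fg[OF basis_vec_in_std] fw] by auto
      then show "x l * hinner w (g (basis_vec l)) = 0"
        using gw_basis \<open>l \<in> {..<k}\<close> by simp
    qed
    finally show "hinner w (g x) = 0" .
    then show "hinner (g x) w = 0"
      using hinner_cconj[OF fw fg[OF x]] by simp
  qed
  show ?case
  proof (cases "w = 0")
    case True
    then have "b \<in> fs.span B"
      using gp by (simp add: w_def)
    then have "fs.span (insert b B) = fs.span B"
      by (rule fs.span_redundant)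
    then show ?thesis
      using g by metis
  next
    case False
    define N where "N = (\<Sum>i | w i \<noteq> 0. (norm (w i))\<^sup>2)"
    have ww: "hinner w w = of_real N"
      by (simp add: N_def hinner_self)
    have "N \<ge> 0"
      unfolding N_def by (intro sum_nonneg) simp
    moreover have "N \<noteq> 0"
      using hinner_self_eq_0[OF fw] False ww by auto
    ultimately have N: "N > 0"
      by simp
    define c :: 'k where "c = of_real (1 / sqrt N)"
    have "1 / sqrt N * (1 / sqrt N) * N = 1"
      using N by (simp add: field_simps)
    then have c3: "c * c * of_real N = 1"
      unfolding c_def of_real_mult[symmetric] by (simp only: of_real_1)
    have c: "c \<noteq> 0" "cconj c = c" "c * c * of_real N = 1"
      using c3 by (auto simp: c_def simp del: of_real_divide)
    define v where "v = scale_fun c w"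
    have fv: "fin_supp v"
      unfolding v_def by (rule fin_supp_scale[OF fw])
    have vv: "hinner v v = 1"
      unfolding v_def hinner_scale_right hinner_scale_left[OF fw fw] ww using c by (simp add: mult.assoc)
    have gv: "hinner (g x) v = 0" "hinner v (g x) = 0" if "x \<in> std k" for x
      using gw[OF that] by (simp_all add: v_def hinner_scale_right hinner_scale_left fw fg that)
    define h where "h = (\<lambda>x\<in>std (Suc k). g (head_part k x) + scale_fun (x k) v)"
    have hp: "head_part k x \<in> std k" for x :: "nat \<Rightarrow> 'k"
      by (rule head_part_in_std)
    have bspan: "b \<in> fs.span (insert b B)"
      by (simp add: fs.span_base)
    have BB: "fs.span B \<subseteq> fs.span (insert b B)"
      by (intro fs.span_mono) auto
    have v_in: "v \<in> fs.span (insert b B)"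
      unfolding v_def w_def using gp BB bspan by (intro fs.span_scale fs.span_diff) auto
    have h_in: "h x \<in> fs.span (insert b B)" if "x \<in> std (Suc k)" for x
      using that jmorD(1)[OF g(1) hp] BB v_in by (auto simp: h_def intro!: fs.span_add fs.span_scale)
    have "h \<in> jmor (std (Suc k)) (fs.span (insert b B))"
    proof (rule jmorI)
      show "h \<in> extensional (std (Suc k))"
        by (simp add: h_def)
      fix x :: "nat \<Rightarrow> 'k" assume x: "x \<in> std (Suc k)"
      show "h x \<in> fs.span (insert b B)"
        using h_in[OF x] .
      have hx: "h x = g (head_part k x) + scale_fun (x k) v"
        using x by (simp add: h_def)
      show "h (scale_fun a x) = scale_fun a (h x)" for a
      proof -
        have "head_part k (scale_fun a x) = scale_fun a (head_part k x)"
          by (auto simp: head_part_def scale_fun_def)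
        moreover have "scale_fun a x \<in> std (Suc k)"
          using fs.subspace_scale[OF subspace_std x] .
        ultimately show ?thesis
          using jmorD(4)[OF g(1) hp] by (simp add: h_def x fs.scale_right_distrib) (simp add: scale_fun_def mult.assoc)
      qed
      fix y :: "nat \<Rightarrow> 'k" assume y: "y \<in> std (Suc k)"
      have hy: "h y = g (head_part k y) + scale_fun (y k) v"
        using y by (simp add: h_def)
      show "h (x + y) = h x + h y"
      proof -
        have "head_part k (x + y) = head_part k x + head_part k y"
          by (auto simp: head_part_def)
        moreover have "x + y \<in> std (Suc k)"
          using fs.subspace_add[OF subspace_std x y] .
        ultimately show ?thesis
          using jmorD(3)[OF g(1) hp hp] by (simp add: h_def x y fs.scale_left_distrib add.assoc add.left_commute)
      qed
      have "hinner (h x) (h y) = hinner (g (head_part k x)) (g (head_part k y)) + cconj (x k) * y k"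
        unfolding hx hy
        by (simp add: hinner_add_left hinner_add_right hinner_scale_left hinner_scale_right fg hp fv
            fin_supp_scale fin_supp_add gv vv)
      also have "hinner (g (head_part k x)) (g (head_part k y)) = (\<Sum>i<k. cconj (x i) * y i)"
        unfolding jmorD(5)[OF g(1) hp hp] hinner_std[OF hp] by (simp add: head_part_def)
      finally show "hinner (h x) (h y) = hinner x y"
        by (simp add: hinner_std[OF x])
    qed
    moreover have "h ` std (Suc k) = fs.span (insert b B)"
    proof (intro equalityI subsetI)
      fix y assume "y \<in> fs.span (insert b B)"
      then obtain s where s: "y - scale_fun s b \<in> fs.span B"
        by (auto simp: fs.span_breakdown_eq)
      have "y - scale_fun s b + scale_fun s (g p) \<in> fs.span B"
        using s gp by (intro fs.span_add fs.span_scale)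
      then obtain x where x: "x \<in> std k" "g x = y - scale_fun s b + scale_fun s (g p)"
        using g(2) by (metis imageE)
      \<comment> \<open>From \<open>b = w + g p\<close> and \<open>v = scale_fun c w\<close> one
        gets \<open>y = g x + scale_fun (s / c) v\<close>, which dictates the last coordinate
        \<open>s / c\<close>.\<close>
      define z where "z = x + scale_fun (s / c) (basis_vec k)"
      have "z \<in> std (Suc k)" "head_part k z = x" "z k = s / c"
        using x by (auto simp: z_def std_def head_part_def scale_fun_def basis_vec_def fun_eq_iff)
      then have "h z = g x + scale_fun (s / c) v"
        by (simp add: h_def)
      also have "\<dots> = y"
        using c by (simp add: x v_def w_def scale_fun_def fun_eq_iff right_diff_distrib)
      finally show "y \<in> h ` std (Suc k)"
        using \<open>z \<in> std (Suc k)\<close> by blast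
    qed (use h_in in auto)
    ultimately show ?thesis
      by blast
  qed
qed

lemma jobj_frame:
  assumes "V \<in> jobj"
  obtains k g where "g \<in> jmor (std k) V" "g ` std k = V"
proof -
  obtain B where B: "finite B" "V = fs.span B"
    using jobjD(4)[OF assms] by blast
  then have "fin_supp b" if "b \<in> B" for b
    using jobjD(2)[OF assms] that fs.span_base by blast
  then show ?thesis
    using span_orthonormal_frame[OF B(1)] B(2) that by metis
qed

lemma fin_supp_in_std:
  assumes "fin_supp x"
  obtains N where "x \<in> std N"
proof -
  obtain N where "\<forall>i\<in>{i. x i \<noteq> 0}. i < N"
    using assms finite_nat_set_iff_bounded unfolding fin_supp_def by blast
  then have "x \<in> std N"
    by (force simp: std_def)
  then show ?thesis
    using that by blast
qed

lemma std_mono: "k \<le> l \<Longrightarrow> std k \<subseteq> std l"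
  by (auto simp: std_def)

lemma jobj_subset_std:
  assumes V: "V \<in> jobj"
  obtains N where "V \<subseteq> std N"
proof -
  obtain B where B: "finite B" "V = fs.span B"
    using jobjD(4)[OF V] by blast
  have "\<exists>N. b \<in> std N" if "b \<in> B" for b
    using fin_supp_in_std[OF jobjD(2)[OF V]] that fs.span_base B by blast
  then obtain N where N: "\<And>b. b \<in> B \<Longrightarrow> b \<in> std (N b)"
    by metis
  have "b \<in> std (Max (N ` B))" if "b \<in> B" for b
  proof -
    have "N b \<le> Max (N ` B)"
      using B that by simp
    then show ?thesis
      using N[OF that] std_mono by blast
  qed
  then have "V \<subseteq> std (Max (N ` B))"
    unfolding B(2) by (intro fs.span_minimal subspace_std) auto
  then show ?thesis
    using that by blast
qed

lemma jmor_codomain_mono: "f \<in> jmor V W \<Longrightarrow> W \<subseteq> W' \<Longrightarrow> f \<in> jmor V W'"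
  by (auto simp: jmor_def PiE_def)

text \<open>A finite-dimensional subspace is the fixed space of its projection matrix, hence cut out
  by equations that are continuous in the coordinates.\<close>

lemma closed_jobj:
  fixes W :: "(nat \<Rightarrow> 'k::rc_field) set"
  assumes W: "W \<in> jobj"
  shows "closed W"
proof -
  obtain m where m: "W \<subseteq> std m"
    using jobj_subset_std[OF W] .
  obtain k g where g: "g \<in> jmor (std k) W" "g ` std k = W"
    using jobj_frame[OF W] .
  have gm: "g \<in> jmor (std k) (std m)"
    using jmor_codomain_mono[OF g(1) m] .
  have "W = {y \<in> std m. \<forall>i. (\<Sum>j<m. frame_matrix k g (i, j) * y j) = y i}"
    unfolding frame_matrix_image[OF gm, symmetric] g(2) by (rule refl)
  also have "\<dots> = (\<Inter>i\<in>{m..}. {y. y i = 0}) \<inter> (\<Inter>i. {y. (\<Sum>j<m. frame_matrix k g (i, j) * y j) = y i})"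
    by (auto simp: std_def)
  also have "closed \<dots>"
  proof (intro closed_Int closed_INT ballI)
    have c: "continuous_on UNIV (\<lambda>y :: nat \<Rightarrow> 'k. y i)" for i
      by (rule continuous_on_product_coordinates)
    show "closed {y :: nat \<Rightarrow> 'k. y i = 0}" for i
      by (rule closed_Collect_eq[OF c continuous_on_const])
    have "continuous_on UNIV (\<lambda>y. \<Sum>j<m. frame_matrix k g (i, j) * y j)" for i
      by (rule continuous_on_sum) (rule continuous_on_mult_left[OF c])
    then show "closed {y. (\<Sum>j<m. frame_matrix k g (i, j) * y j) = y i}" for i
      by (rule closed_Collect_eq[OF _ c])
  qed
  finally show ?thesis .
qed

lemma norm_le_hinner:
  assumes "fin_supp y" "hinner y y = of_real N"
  shows "norm (y i) \<le> sqrt N"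
proof (cases "y i = 0")
  case True
  have "of_real N = (of_real (\<Sum>i | y i \<noteq> 0. (norm (y i))\<^sup>2) :: 'a)"
    using assms(2) unfolding hinner_self by simp
  then have "N = (\<Sum>i | y i \<noteq> 0. (norm (y i))\<^sup>2)"
    by (simp only: of_real_eq_iff)
  then have "N \<ge> 0"
    by (simp add: sum_nonneg)
  then show ?thesis
    using True by simp
next
  case False
  have "of_real N = (of_real (\<Sum>i | y i \<noteq> 0. (norm (y i))\<^sup>2) :: 'a)"
    using assms(2) unfolding hinner_self by simp
  then have "N = (\<Sum>i | y i \<noteq> 0. (norm (y i))\<^sup>2)"
    by (simp only: of_real_eq_iff)
  moreover have "(norm (y i))\<^sup>2 \<le> (\<Sum>i | y i \<noteq> 0. (norm (y i))\<^sup>2)"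
    using assms(1) False by (intro member_le_sum) (auto simp: fin_supp_def)
  ultimately show ?thesis
    by (simp add: real_le_rsqrt)
qed

text \<open>The ambient space has infinitely many coordinates. Each coordinate is bounded by the
  norm, so the sphere is a closed subset of a product of balls, which is compact by Tychonoff and
  the Heine-Borel property of the scalars.\<close>

lemma compact_sphere_jobj:
  fixes W :: "(nat \<Rightarrow> 'k::rc_field) set"
  assumes W: "W \<in> jobj" and x: "fin_supp x"
  shows "compact {y \<in> W. hinner y y = hinner x x}"
proof -
  obtain m where m: "W \<subseteq> std m"
    using jobj_subset_std[OF W] .
  obtain N where N: "hinner x x = of_real N"
    using hinner_self by blast
  have "compactin (product_topology (\<lambda>_. euclidean) UNIV) (\<Pi>\<^sub>E i\<in>UNIV. cball (0::'k) (sqrt N))"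
    by (subst compactin_PiE) simp
  then have c: "compact (\<Pi>\<^sub>E i\<in>(UNIV :: nat set). cball (0::'k) (sqrt N))"
    by (simp add: euclidean_product_topology)
  have "closed {y :: nat \<Rightarrow> 'k. (\<Sum>i<m. cconj (y i) * y i) = hinner x x}"
    by (intro closed_Collect_eq continuous_on_sum continuous_on_mult continuous_on_const
        continuous_on_product_coordinates continuous_on_compose2[OF continuous_on_cconj[of UNIV]] subset_UNIV)
  then have "compact ((\<Pi>\<^sub>E i\<in>UNIV. cball 0 (sqrt N)) \<inter>
      (W \<inter> {y. (\<Sum>i<m. cconj (y i) * y i) = hinner x x}))"
    by (intro compact_Int_closed c closed_Int closed_jobj[OF W])
  moreover have "{y \<in> W. hinner y y = hinner x x} = (\<Pi>\<^sub>E i\<in>UNIV. cball 0 (sqrt N)) \<inter>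
      (W \<inter> {y. (\<Sum>i<m. cconj (y i) * y i) = hinner x x})"
  proof -
    have "hinner y y = (\<Sum>i<m. cconj (y i) * y i)" if "y \<in> W" for y
      using hinner_std m that by blast
    moreover have "norm (y i) \<le> sqrt N" if "y \<in> W" "hinner y y = of_real N" for y i
      using norm_le_hinner[OF jobjD(2)[OF W that(1)] that(2)] .
    ultimately show ?thesis
      using N by (auto simp: PiE_def)
  qed
  ultimately show ?thesis
    by simp
qed

text \<open>An isometry sends each \<open>x\<close> into the sphere of \<open>W\<close> with the
  same \<open>hinner\<close>, so \<open>jmor V W\<close> lies in a product of compact spheres.
  Additivity, homogeneity and preservation of the form are closed conditions there; \<open>m\<close>
  makes the form a finite sum of coordinates.\<close>

lemma compact_jmor_top:
  fixes V W :: "(nat \<Rightarrow> 'k::rc_field) set"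
  assumes V: "V \<in> jobj" and W: "W \<in> jobj"
  shows "compact_space (jmor_top V W)"
proof -
  let ?P = "product_topology (\<lambda>_. euclidean :: (nat \<Rightarrow> 'k) topology) V"
  let ?C = "\<Pi>\<^sub>E x\<in>V. {y \<in> W. hinner y y = hinner x x}"
  let ?Q = "subtopology ?P ?C"
  obtain m where m: "W \<subseteq> std m"
    using jobj_subset_std[OF W] .
  have C: "compactin ?P ?C"
    using compact_sphere_jobj[OF W jobjD(2)[OF V]] by (auto simp: compactin_PiE)
  have Q: "compact_space ?Q"
    using C compact_space_subtopology by blast
  have top: "topspace ?Q = ?C"
    using compactin_subset_topspace[OF C] by auto
  let ?A = "\<lambda>(x, y, c). {f \<in> topspace ?Q. f (x + y) = f x + f y \<and> f (scale_fun c x) = scale_fun c (f x)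
      \<and> (\<Sum>i<m. cconj (f x i) * f y i) = hinner x y}"
  have coord: "continuous_map ?Q euclidean (\<lambda>f. f x)" if "x \<in> V" for x
    using that by (intro continuous_map_from_subtopology continuous_map_product_coordinates)
  have coord2: "continuous_map ?Q euclidean (\<lambda>f. f x i)" if "x \<in> V" for x i
    using coord[OF that] unfolding continuous_map_into_euclidean_fun by blast
  have A: "closedin ?Q (?A (x, y, c))" if xy: "x \<in> V" "y \<in> V" for x y c
  proof -
    have V': "x + y \<in> V" "scale_fun c x \<in> V"
      using xy fs.subspace_add fs.subspace_scale jobjD(1)[OF V] by blast+
    have "closedin ?Q {f \<in> topspace ?Q. f (x + y) = f x + f y}"
    proof (rule closedin_continuous_maps_eq[OF Hausdorff_space_euclidean_fun coord[OF V'(1)]])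
      show "continuous_map ?Q euclidean (\<lambda>f. f x + f y)"
        using coord2[OF xy(1)] coord2[OF xy(2)]
        by (auto simp: continuous_map_into_euclidean_fun intro: continuous_map_add)
    qed
    moreover have "closedin ?Q {f \<in> topspace ?Q. f (scale_fun c x) = scale_fun c (f x)}"
    proof (rule closedin_continuous_maps_eq[OF Hausdorff_space_euclidean_fun coord[OF V'(2)]])
      show "continuous_map ?Q euclidean (\<lambda>f. scale_fun c (f x))"
        using coord2[OF xy(1)]
        by (auto simp: continuous_map_into_euclidean_fun scale_fun_def intro: continuous_map_field_mult)
    qed
    moreover have "closedin ?Q {f \<in> topspace ?Q. (\<Sum>i<m. cconj (f x i) * f y i) = hinner x y}"
    proof (rule closedin_continuous_maps_eq[where Y = euclidean])
      show "continuous_map ?Q euclidean (\<lambda>f. \<Sum>i<m. cconj (f x i) * f y i)"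
        using coord2[OF xy(1)] coord2[OF xy(2)]
        by (intro continuous_map_sum continuous_map_field_mult continuous_map_cconj) auto
    qed auto
    ultimately have "closedin ?Q ({f \<in> topspace ?Q. f (x + y) = f x + f y} \<inter>
        ({f \<in> topspace ?Q. f (scale_fun c x) = scale_fun c (f x)} \<inter>
         {f \<in> topspace ?Q. (\<Sum>i<m. cconj (f x i) * f y i) = hinner x y}))"
      by (intro closedin_Int)
    moreover have "\<dots> = ?A (x, y, c)"
      by auto
    ultimately show ?thesis
      by simp
  qed
  have "jmor V W = \<Inter> (?A ` (V \<times> V \<times> UNIV))"
  proof (intro equalityI subsetI)
    fix f assume f: "f \<in> jmor V W"
    have "f \<in> topspace ?Q"
      using jmorD[OF f] by (auto simp: top PiE_def extensional_def)
    moreover have "(\<Sum>i<m. cconj (f x i) * f y i) = hinner x y" if "x \<in> V" "y \<in> V" for x y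
      using jmorD(5)[OF f that] jmorD(1)[OF f that(1)] m hinner_std[of "f x" m "f y"] by auto
    ultimately show "f \<in> \<Inter> (?A ` (V \<times> V \<times> UNIV))"
      using jmorD[OF f] by auto
  next
    fix f assume "f \<in> \<Inter> (?A ` (V \<times> V \<times> UNIV))"
    then have fA: "f \<in> ?A (x, y, c)" if "x \<in> V" "y \<in> V" for x y c
      using that by blast
    \<comment> \<open>Membership in the ambient product can be read off from any one of the
      intersected sets, so some index is needed, and \<open>V\<close> always contains 0.\<close>
    have "0 \<in> V"
      using fs.subspace_0[OF jobjD(1)[OF V]] .
    then have fC: "f \<in> ?C"
      using fA[of 0 0 0] top by auto
    show "f \<in> jmor V W"
    proof (rule jmorI)
      show "\<And>x. x \<in> V \<Longrightarrow> f x \<in> W" "f \<in> extensional V"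
        using fC by (auto simp: PiE_def)
      show "f (x + y) = f x + f y" if "x \<in> V" "y \<in> V" for x y
        using fA[OF that] by auto
      show "f (scale_fun c x) = scale_fun c (f x)" if "x \<in> V" for c x
        using fA[OF that that, of c] by auto
      show "hinner (f x) (f y) = hinner x y" if "x \<in> V" "y \<in> V" for x y
      proof -
        have "f x \<in> std m"
          using fC that m by (auto simp: PiE_def)
        then show ?thesis
          using fA[OF that, of 0] hinner_std[of "f x" m "f y"] by auto
      qed
    qed
  qed
  moreover have "closedin ?Q (\<Inter> (?A ` (V \<times> V \<times> UNIV)))"
  proof (rule closedin_Inter)
    show "?A ` (V \<times> V \<times> UNIV) \<noteq> {}"
      using fs.subspace_0[OF jobjD(1)[OF V]] by auto
  qed (use A in auto)
  ultimately have "closedin ?Q (jmor V W)"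
    by (simp only:)
  then have "compactin ?Q (jmor V W)"
    by (rule closedin_compact_space[OF Q])
  then show ?thesis
    unfolding jmor_top_def by (intro compact_space_subtopology) (simp add: compactin_subtopology)
qed

subsection \<open>Grassmannians\<close>

lemma topspace_Grassmannians:
  "topspace (Grassmannians m) = {g ` std k | k g. k \<in> {1..m} \<and> g \<in> jmor (std k) (std m)}"
  unfolding Grassmannians_def by (force simp: topspace_jmor_top)

lemma continuous_map_Grassmannians:
  assumes "k \<in> {1..m}"
  shows "continuous_map (jmor_top (std k) (std m)) (Grassmannians m) (\<lambda>g. g ` std k)"
proof -
  have "continuous_map (sum_topology (\<lambda>k. jmor_top (std k) (std m)) {1..m}) (Grassmannians m) (\<lambda>(k, g). g ` std k)"
    unfolding Grassmannians_def by (intro quotient_imp_continuous_map quotient_map_final_topology)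
  from continuous_map_compose[OF continuous_map_component_injection[OF assms] this]
  show ?thesis
    by (simp add: comp_def)
qed

lemma continuous_map_from_Grassmannians:
  assumes "\<And>k. k \<in> {1..m} \<Longrightarrow> continuous_map (jmor_top (std k) (std m)) Y (\<lambda>g. f (g ` std k))"
  shows "continuous_map (Grassmannians m) Y f"
proof -
  let ?S = "sum_topology (\<lambda>k. jmor_top (std k) (std m)) {1..m}"
  have "continuous_map ?S Y (f \<circ> (\<lambda>(k, g). g ` std k))"
    using assms by (intro continuous_map_from_sum_topology) (simp add: comp_def)
  then show ?thesis
    unfolding Grassmannians_def
    using continuous_compose_quotient_map_eq[OF quotient_map_final_topology] by blast
qed

text \<open>The projection matrix is a continuous injection into a Hausdorff space. It is chosen by
  \<open>SOME\<close> as a function of the subspace; independence of the frame is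
  \<open>frame_matrix_eq_iff\<close>, and continuity is tested on frames.\<close>

lemma Hausdorff_Grassmannians: "Hausdorff_space (Grassmannians m :: (nat \<Rightarrow> 'k::rc_field) set topology)"
proof -
  define M :: "(nat \<Rightarrow> 'k) set \<Rightarrow> nat \<times> nat \<Rightarrow> 'k" where
    "M U = (SOME A. \<exists>k g. k \<in> {1..m} \<and> g \<in> jmor (std k) (std m) \<and> U = g ` std k \<and> A = frame_matrix k g)" for U
  have M: "M (g ` std k) = frame_matrix k g" if "k \<in> {1..m}" "g \<in> jmor (std k) (std m)" for k g
    unfolding M_def
  proof (rule some_equality)
    fix A assume "\<exists>l h. l \<in> {1..m} \<and> h \<in> jmor (std l) (std m) \<and> g ` std k = h ` std l \<and> A = frame_matrix l h"
    then obtain l h where "h \<in> jmor (std l) (std m)" "g ` std k = h ` std l" "A = frame_matrix l h"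
      by blast
    then show "A = frame_matrix k g"
      using frame_matrix_eq_iff[OF that(2)] by metis
  qed (use that in blast)
  have "continuous_map (Grassmannians m) euclidean M"
  proof (rule continuous_map_from_Grassmannians)
    fix k assume k: "k \<in> {1..m}"
    have "continuous_map (jmor_top (std k) (std m)) euclidean (\<lambda>g. frame_matrix k g :: nat \<times> nat \<Rightarrow> 'k)"
      by (rule continuous_map_frame_matrix[of _ _ "std m"]) simp
    then show "continuous_map (jmor_top (std k) (std m)) euclidean (\<lambda>g. M (g ` std k))"
      by (rule continuous_map_eq) (simp only: M[OF k] topspace_jmor_top)
  qed
  moreover have "inj_on M (topspace (Grassmannians m))"
  proof (rule inj_onI)
    fix U U' assume U: "U \<in> topspace (Grassmannians m)" and U': "U' \<in> topspace (Grassmannians m)" and eq: "M U = M U'"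
    obtain k g where g: "k \<in> {1..m}" "g \<in> jmor (std k) (std m)" "U = g ` std k"
      using U unfolding topspace_Grassmannians by blast
    obtain l h where h: "l \<in> {1..m}" "h \<in> jmor (std l) (std m)" "U' = h ` std l"
      using U' unfolding topspace_Grassmannians by blast
    show "U = U'"
      using eq M[OF g(1,2)] M[OF h(1,2)] frame_matrix_eq_iff[OF g(2) h(2)] g(3) h(3) by simp
  qed
  ultimately show ?thesis
    using Hausdorff_space_injective_preimage Hausdorff_space_euclidean_fun by blast
qed

lemma compact_Grassmannians: "compact_space (Grassmannians m :: (nat \<Rightarrow> 'k::rc_field) set topology)"
proof -
  let ?G = "Grassmannians m :: (nat \<Rightarrow> 'k) set topology"
  have "compactin ?G ((\<lambda>g. g ` std k) ` jmor (std k) (std m))" if "k \<in> {1..m}" for k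
    using image_compactin[OF _ continuous_map_Grassmannians[OF that]] compact_jmor_top[OF std_jobj std_jobj]
    unfolding compact_space_def topspace_jmor_top by blast
  then have "compactin ?G (\<Union>k\<in>{1..m}. (\<lambda>g. g ` std k) ` jmor (std k) (std m))"
    by (intro compactin_Union) blast+
  moreover have "(\<Union>k\<in>{1..m}. (\<lambda>g. g ` std k) ` jmor (std k) (std m)) = topspace ?G"
    unfolding topspace_Grassmannians by blast
  ultimately show ?thesis
    by (simp only: compact_space_def)
qed

lemma openin_Grassmannians:
  "openin (Grassmannians m) S \<longleftrightarrow> S \<subseteq> topspace (Grassmannians m) \<and>
     (\<forall>k\<in>{1..m}. openin (jmor_top (std k) (std m)) {g \<in> jmor (std k) (std m). g ` std k \<in> S})"
proof -
  let ?S = "sum_topology (\<lambda>k. jmor_top (std k) (std m)) {1..m}"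
  let ?R = "{p \<in> topspace ?S. (case p of (k, g) \<Rightarrow> g ` std k) \<in> S}"
  have "{g. (k, g) \<in> ?R} = {g \<in> jmor (std k) (std m). g ` std k \<in> S}" if "k \<in> {1..m}" for k
    using that by (auto simp: topspace_jmor_top)
  moreover have "?R \<subseteq> Sigma {1..m} (topspace \<circ> (\<lambda>k. jmor_top (std k) (std m)))"
    by auto
  ultimately have "openin ?S ?R \<longleftrightarrow>
      (\<forall>k\<in>{1..m}. openin (jmor_top (std k) (std m)) {g \<in> jmor (std k) (std m). g ` std k \<in> S})"
    unfolding openin_sum_topology by simp
  then show ?thesis
    unfolding Grassmannians_def openin_final_topology topspace_final_topology by simp
qed

lemma continuous_map_precompose:
  assumes a: "a \<in> jmor U V" and U: "fs.subspace U"
  shows "continuous_map (jmor_top V W) (jmor_top U W) (\<lambda>g. compose U g a)"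
  unfolding continuous_map_into_jmor_top
proof (intro conjI ballI allI)
  show "compose U g a \<in> jmor U W" if "g \<in> topspace (jmor_top V W)" for g
    using jmor_compose[OF a _ U] that by (simp add: topspace_jmor_top)
  show "continuous_map (jmor_top V W) euclidean (\<lambda>g. compose U g a x i)" if "x \<in> U" for x i
    using continuous_map_jmor_coordinate[of "jmor_top V W" V W "\<lambda>g. g" "a x" i] jmorD(1)[OF a that] that
    by (simp add: compose_def)
qed

text \<open>Two frames of the same subspace differ by an isometry of \<open>std k\<close>; this is
  the structure group acting on frames, and the source of the openness results below.\<close>

lemma frame_compose_jinv:
  assumes g: "g \<in> jmor (std k) (std m)" and h: "h \<in> jmor (std k) (std m)" and im: "g ` std k = h ` std k"
  shows "compose (std k) (jinv (std k) g) h \<in> jmor (std k) (std k)"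
    "compose (std k) g (compose (std k) (jinv (std k) g) h) = h"
    "compose (std k) (jinv (std k) g) h ` std k = std k"
proof -
  note s = jinv_std[OF g]
  have h': "h \<in> jmor (std k) (g ` std k)"
    using h im by (auto simp: jmor_def PiE_def)
  then show "compose (std k) (jinv (std k) g) h \<in> jmor (std k) (std k)"
    using jinv_std(4)[OF g] jmor_compose subspace_std by blast
  show "compose (std k) g (compose (std k) (jinv (std k) g) h) = h"
    using s(3) jmorD(1)[OF h'] jmorD(2)[OF h] by (auto simp: compose_def fun_eq_iff extensional_def)
  show "compose (std k) (jinv (std k) g) h ` std k = std k"
  proof (intro equalityI subsetI)
    fix x :: "nat \<Rightarrow> 'a" assume x: "x \<in> std k"
    then obtain w where "w \<in> std k" "g x = h w"
      using im by blast
    then show "x \<in> compose (std k) (jinv (std k) g) h ` std k"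
      using s(1)[OF x] by (force simp: compose_def)
  qed (use jmorD(1)[OF h'] s(2) in \<open>auto simp: compose_def\<close>)
qed

text \<open>The frames with the same image as a frame in \<open>B\<close> are the translates of
  \<open>B\<close> under isometries of \<open>std k\<close>. Precomposition is continuous, so this
  saturation is a union of open sets.\<close>

lemma openin_frame_image:
  assumes B: "openin (jmor_top (std k) (std m)) B" and k: "k \<in> {1..m}"
  shows "openin (Grassmannians m) ((\<lambda>g. g ` std k) ` B)"
  unfolding openin_Grassmannians
proof (intro conjI ballI)
  have BJ: "B \<subseteq> jmor (std k) (std m)"
    using openin_subset[OF B] by (simp add: topspace_jmor_top)
  then show "(\<lambda>g. g ` std k) ` B \<subseteq> topspace (Grassmannians m)"
    using k unfolding topspace_Grassmannians by blast
  fix l assume "l \<in> {1..m}"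
  show "openin (jmor_top (std l) (std m)) {g \<in> jmor (std l) (std m). g ` std l \<in> (\<lambda>g. g ` std k) ` B}"
  proof (cases "l = k")
    case False
    then have "{g \<in> jmor (std l) (std m). g ` std l \<in> (\<lambda>g. g ` std k) ` B} = {}"
      using frame_rank_unique BJ by blast
    then show ?thesis
      by (simp only: openin_empty)
  next
    case True
    let ?A = "{a \<in> jmor (std k) (std k). a ` std k = std k}"
    let ?Q = "\<lambda>a. {g \<in> topspace (jmor_top (std k) (std m)). compose (std k) g a \<in> B}"
    have "{g \<in> jmor (std k) (std m). g ` std k \<in> (\<lambda>g. g ` std k) ` B} = (\<Union>a\<in>?A. ?Q a)"
    proof (intro equalityI subsetI)
      fix g assume "g \<in> {g \<in> jmor (std k) (std m). g ` std k \<in> (\<lambda>g. g ` std k) ` B}"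
      then obtain h where g: "g \<in> jmor (std k) (std m)" and h: "h \<in> B" "g ` std k = h ` std k"
        by auto
      note c = frame_compose_jinv[OF g _ h(2)]
      have "compose (std k) (jinv (std k) g) h \<in> ?A"
        using c h BJ by blast
      moreover have "g \<in> ?Q (compose (std k) (jinv (std k) g) h)"
        using c(2) h BJ g by (auto simp: topspace_jmor_top)
      ultimately show "g \<in> (\<Union>a\<in>?A. ?Q a)"
        by blast
    next
      fix g assume "g \<in> (\<Union>a\<in>?A. ?Q a)"
      then obtain a where a: "a ` std k = std k" "g \<in> jmor (std k) (std m)" "compose (std k) g a \<in> B"
        by (auto simp: topspace_jmor_top)
      have "compose (std k) g a ` std k = g ` a ` std k"
        by (auto simp: compose_def image_iff)
      then show "g \<in> {g \<in> jmor (std k) (std m). g ` std k \<in> (\<lambda>g. g ` std k) ` B}"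
        using a by (auto intro!: image_eqI[where x = "compose (std k) g a"])
    qed
    moreover have "openin (jmor_top (std k) (std m)) (\<Union>a\<in>?A. ?Q a)"
      using openin_continuous_map_preimage[OF continuous_map_precompose[OF _ subspace_std] B]
      by (intro openin_Union) auto
    ultimately show ?thesis
      using True by simp
  qed
qed

subsection \<open>Direct sums\<close>

lemma tail_part_join [simp]: "tail_part m (join m v u) = v"
  by (simp add: tail_part_def join_def)

lemma head_part_join: "u \<in> std m \<Longrightarrow> head_part m (join m v u) = u"
  by (auto simp: head_part_def join_def std_def)

lemma join_parts [simp]: "join m (tail_part m x) (head_part m x) = x"
  by (auto simp: tail_part_def head_part_def join_def)

lemma join_add: "join m (v + v') (u + u') = join m v u + join m v' u'"
  by (auto simp: join_def)

lemma join_scale: "join m (scale_fun c v) (scale_fun c u) = scale_fun c (join m v u)"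
  by (auto simp: join_def scale_fun_def)

lemma mem_dsum_iff:
  assumes "U \<subseteq> std m"
  shows "x \<in> dsum m V U \<longleftrightarrow> tail_part m x \<in> V \<and> head_part m x \<in> U"
proof
  assume "x \<in> dsum m V U"
  then obtain v u where "x = join m v u" "v \<in> V" "u \<in> U"
    by (auto simp: dsum_def)
  then show "tail_part m x \<in> V \<and> head_part m x \<in> U"
    using assms by (auto simp: head_part_join subset_eq)
next
  assume "tail_part m x \<in> V \<and> head_part m x \<in> U"
  then show "x \<in> dsum m V U"
    unfolding dsum_def by (metis (mono_tags, lifting) CollectI join_parts)
qed

lemma join_in_dsum: "v \<in> V \<Longrightarrow> u \<in> U \<Longrightarrow> join m v u \<in> dsum m V U"
  by (auto simp: dsum_def)

lemma dsumE:
  assumes "x \<in> dsum m V U"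
  obtains v u where "x = join m v u" "v \<in> V" "u \<in> U"
  using assms by (auto simp: dsum_def)

lemma join_in_std: "v \<in> std N \<Longrightarrow> join m v u \<in> std (m + N)"
  by (auto simp: join_def std_def)

lemma sum_lessThan_add: "(\<Sum>i<m + N :: nat. f i) = (\<Sum>i<m. f i) + (\<Sum>i<N. f (i + m) :: 'b::comm_monoid_add)"
  by (induction N) (simp_all add: ac_simps)

lemma hinner_join:
  assumes v: "fin_supp v" and u: "u \<in> std m"
  shows "hinner (join m v u) (join m v' u') = hinner v v' + hinner u u'"
proof -
  obtain N where N: "v \<in> std N"
    using fin_supp_in_std[OF v] .
  show ?thesis
    unfolding hinner_std[OF join_in_std[OF N]] sum_lessThan_add hinner_std[OF N] hinner_std[OF u]
    by (simp add: join_def add.commute)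
qed

lemma fin_supp_dsum:
  assumes V: "\<And>v. v \<in> V \<Longrightarrow> fin_supp v" and x: "x \<in> dsum m V U"
  shows "fin_supp x"
  using x
proof (rule dsumE)
  fix v u assume "x = join m v u" "v \<in> V"
  then show "fin_supp x"
    using fin_supp_in_std[OF V] join_in_std fin_supp_std by metis
qed

lemma subspace_dsum:
  assumes V: "fs.subspace V" and U: "fs.subspace U"
  shows "fs.subspace (dsum m V U)"
  unfolding fs.subspace_def
proof (intro conjI ballI allI)
  have "join m 0 0 \<in> dsum m V U"
    using fs.subspace_0[OF V] fs.subspace_0[OF U] by (rule join_in_dsum)
  moreover have "join m 0 0 = (0 :: nat \<Rightarrow> 'a)"
    by (auto simp: join_def)
  ultimately show "0 \<in> dsum m V U"
    by simp
  fix x assume "x \<in> dsum m V U"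
  then obtain v u where x: "x = join m v u" "v \<in> V" "u \<in> U"
    by (rule dsumE)
  show "scale_fun c x \<in> dsum m V U" for c
    unfolding x(1) join_scale[symmetric] using x V U by (intro join_in_dsum fs.subspace_scale)
  fix y assume "y \<in> dsum m V U"
  then obtain v' u' where y: "y = join m v' u'" "v' \<in> V" "u' \<in> U"
    by (rule dsumE)
  show "x + y \<in> dsum m V U"
    unfolding x(1) y(1) join_add[symmetric] using x y V U by (intro join_in_dsum fs.subspace_add)
qed

lemma dsum_jobj:
  assumes V: "V \<in> jobj" and U: "U \<in> jobj"
  shows "dsum m V U \<in> jobj"
proof -
  obtain B C where B: "finite B" "V = fs.span B" and C: "finite C" "U = fs.span C"
    using jobjD(4)[OF V] jobjD(4)[OF U] by blast
  let ?D = "(\<lambda>v. join m v 0) ` B \<union> join m 0 ` C"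
  have 1: "join m v 0 \<in> fs.span ?D" if "v \<in> fs.span B" for v
    using that
  proof (induction rule: fs.span_induct_alt)
    case base
    have "join m 0 0 = (0 :: nat \<Rightarrow> 'a)"
      by (auto simp: join_def)
    then show ?case
      by (simp only: fs.span_zero)
  next
    case (step c x y)
    have "join m (scale_fun c x + y) 0 = scale_fun c (join m x 0) + join m y 0"
      by (auto simp: join_def scale_fun_def)
    moreover have "join m x 0 \<in> fs.span ?D"
      using step by (intro fs.span_base) auto
    ultimately show ?case
      using step by (simp only: fs.span_add fs.span_scale)
  qed
  have 2: "join m 0 u \<in> fs.span ?D" if "u \<in> fs.span C" for u
    using that
  proof (induction rule: fs.span_induct_alt)
    case base
    have "join m 0 0 = (0 :: nat \<Rightarrow> 'a)"
      by (auto simp: join_def)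
    then show ?case
      by (simp only: fs.span_zero)
  next
    case (step c x y)
    have "join m 0 (scale_fun c x + y) = scale_fun c (join m 0 x) + join m 0 y"
      by (auto simp: join_def scale_fun_def)
    moreover have "join m 0 x \<in> fs.span ?D"
      using step by (intro fs.span_base) auto
    ultimately show ?case
      using step by (simp only: fs.span_add fs.span_scale)
  qed
  have sub: "fs.subspace (dsum m V U)"
    using jobjD(1)[OF V] jobjD(1)[OF U] by (rule subspace_dsum)
  have "dsum m V U = fs.span ?D"
  proof
    show "dsum m V U \<subseteq> fs.span ?D"
    proof
      fix x assume "x \<in> dsum m V U"
      then obtain v u where x: "x = join m v u" "v \<in> V" "u \<in> U"
        by (rule dsumE)
      have "join m v u = join m v 0 + join m 0 u"
        by (auto simp: join_def)
      then show "x \<in> fs.span ?D"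
        using 1[of v] 2[of u] x B C by (simp only: fs.span_add)
    qed
    have "0 \<in> V" "0 \<in> U" "B \<subseteq> V" "C \<subseteq> U"
      using fs.subspace_0 jobjD(1)[OF V] jobjD(1)[OF U] B C fs.span_superset by blast+
    then show "fs.span ?D \<subseteq> dsum m V U"
      using sub by (intro fs.span_minimal) (auto intro: join_in_dsum)
  qed
  moreover have "finite ?D"
    using B C by simp
  moreover have "vconj x \<in> dsum m V U" if "x \<in> dsum m V U" for x
    using that
  proof (rule dsumE)
    fix v u assume x: "x = join m v u" "v \<in> V" "u \<in> U"
    have "vconj x = join m (vconj v) (vconj u)"
      by (auto simp: x(1) vconj_def join_def)
    then show "vconj x \<in> dsum m V U"
      using x jobjD(3)[OF V] jobjD(3)[OF U] by (simp add: join_in_dsum)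
  qed
  moreover have "finite {i. x i \<noteq> 0}" if "x \<in> dsum m V U" for x
    using fin_supp_dsum[OF jobjD(2)[OF V] that] by (simp add: fin_supp_def)
  ultimately show ?thesis
    using sub unfolding jobj_def by blast
qed

lemma mor_sum_join:
  assumes "v \<in> V" "u \<in> U" "U \<subseteq> std m"
  shows "mor_sum m V U f g (join m v u) = join m (f v) (g u)"
  using assms by (simp add: mor_sum_def join_in_dsum head_part_join subset_eq)

lemma mor_sum_jmor:
  assumes f: "f \<in> jmor V W" and g: "g \<in> jmor U U'"
    and V: "fs.subspace V" and U: "fs.subspace U" and Um: "U \<subseteq> std m" "U' \<subseteq> std m"
    and fin: "\<And>v. v \<in> V \<Longrightarrow> fin_supp v" "\<And>w. w \<in> W \<Longrightarrow> fin_supp w"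
  shows "mor_sum m V U f g \<in> jmor (dsum m V U) (dsum m W U')"
proof (rule jmorI)
  show "mor_sum m V U f g \<in> extensional (dsum m V U)"
    by (simp add: mor_sum_def)
  fix x assume "x \<in> dsum m V U"
  then obtain v u where x: "x = join m v u" "v \<in> V" "u \<in> U"
    by (rule dsumE)
  show "mor_sum m V U f g x \<in> dsum m W U'"
    using x jmorD(1)[OF f] jmorD(1)[OF g] Um by (simp add: mor_sum_join join_in_dsum)
  show "mor_sum m V U f g (scale_fun c x) = scale_fun c (mor_sum m V U f g x)" for c
    unfolding x(1) join_scale[symmetric]
      mor_sum_join[OF fs.subspace_scale[OF V x(2)] fs.subspace_scale[OF U x(3)] Um(1)]
      mor_sum_join[OF x(2,3) Um(1)] jmorD(4)[OF f x(2)] jmorD(4)[OF g x(3)] by (rule refl)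
  fix y assume "y \<in> dsum m V U"
  then obtain v' u' where y: "y = join m v' u'" "v' \<in> V" "u' \<in> U"
    by (rule dsumE)
  show "mor_sum m V U f g (x + y) = mor_sum m V U f g x + mor_sum m V U f g y"
    unfolding x(1) y(1) join_add[symmetric]
      mor_sum_join[OF fs.subspace_add[OF V x(2) y(2)] fs.subspace_add[OF U x(3) y(3)] Um(1)]
      mor_sum_join[OF x(2,3) Um(1)] mor_sum_join[OF y(2,3) Um(1)]
      jmorD(3)[OF f x(2) y(2)] jmorD(3)[OF g x(3) y(3)] by (rule refl)
  have "f v \<in> W" "g u \<in> std m" "u \<in> std m"
    using x jmorD(1)[OF f] jmorD(1)[OF g] Um by auto
  then show "hinner (mor_sum m V U f g x) (mor_sum m V U f g y) = hinner x y"
    using x y Um by (simp add: mor_sum_join hinner_join fin jmorD(5)[OF f] jmorD(5)[OF g])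
qed

lemma compose_mor_sum:
  assumes f: "f \<in> jmor V V'" and g: "g \<in> jmor U U'" and Um: "U \<subseteq> std m" "U' \<subseteq> std m"
  shows "compose (dsum m V U) (mor_sum m V' U' f' g') (mor_sum m V U f g)
    = mor_sum m V U (compose V f' f) (compose U g' g)"
proof
  fix x
  show "compose (dsum m V U) (mor_sum m V' U' f' g') (mor_sum m V U f g) x
    = mor_sum m V U (compose V f' f) (compose U g' g) x"
  proof (cases "x \<in> dsum m V U")
    case True
    then obtain v u where x: "x = join m v u" "v \<in> V" "u \<in> U"
      by (rule dsumE)
    then show ?thesis
      using True jmorD(1)[OF f] jmorD(1)[OF g] Um by (simp add: compose_def mor_sum_join)
  next
    case False
    then show ?thesis
      by (simp add: compose_def mor_sum_def)
  qed
qed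

lemma mor_sum_incl:
  assumes "U \<subseteq> std m"
  shows "mor_sum m V U (incl V) (incl U) = incl (dsum m V U)"
  using assms by (auto simp: mor_sum_def incl_def fun_eq_iff mem_dsum_iff)

lemma incl_sum_jmor:
  assumes V: "fs.subspace V" "\<And>v. v \<in> V \<Longrightarrow> fin_supp v" and U: "fs.subspace U"
  shows "incl_sum m V \<in> jmor V (dsum m V U)"
proof (rule jmorI)
  show "incl_sum m V \<in> extensional V"
    by (simp add: incl_sum_def)
  fix x assume x: "x \<in> V"
  have 0: "(\<lambda>_. 0) = (0 :: nat \<Rightarrow> 'a)"
    by auto
  show "incl_sum m V x \<in> dsum m V U"
    using x fs.subspace_0[OF U] unfolding incl_sum_def 0 by (auto intro: join_in_dsum)
  show "incl_sum m V (scale_fun c x) = scale_fun c (incl_sum m V x)" for c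
    using x fs.subspace_scale[OF V(1)] by (auto simp: incl_sum_def join_def scale_fun_def)
  fix y assume y: "y \<in> V"
  show "incl_sum m V (x + y) = incl_sum m V x + incl_sum m V y"
    using x y fs.subspace_add[OF V(1) x y] by (auto simp: incl_sum_def join_def)
  have "(0 :: nat \<Rightarrow> 'a) \<in> std m"
    by (simp add: std_def)
  then show "hinner (incl_sum m V x) (incl_sum m V y) = hinner x y"
    using x y V(2)[OF x] hinner_join[of x 0 m y 0] unfolding incl_sum_def 0 by simp
qed

lemma compose_mor_sum_incl_sum:
  assumes f: "f \<in> jmor V W" and g: "g \<in> jmor U U'" and U: "fs.subspace U" "U \<subseteq> std m"
  shows "compose V (mor_sum m V U f g) (incl_sum m V) = compose V (incl_sum m W) f"
proof
  fix x
  have 0: "(\<lambda>_. 0) = (0 :: nat \<Rightarrow> 'a)"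
    by auto
  show "compose V (mor_sum m V U f g) (incl_sum m V) x = compose V (incl_sum m W) f x"
    using jmorD(1)[OF f] jmor_zero[OF g U(1)] fs.subspace_0[OF U(1)] U(2)
    unfolding compose_def incl_sum_def 0 by (auto simp: mor_sum_join)
qed

lemma continuous_map_mor_sum:
  assumes f: "continuous_map X (jmor_top V W) f" and g: "continuous_map X (jmor_top U U') g"
    and V: "fs.subspace V" and U: "fs.subspace U" and Um: "U \<subseteq> std m" "U' \<subseteq> std m"
    and fin: "\<And>v. v \<in> V \<Longrightarrow> fin_supp v" "\<And>w. w \<in> W \<Longrightarrow> fin_supp w"
  shows "continuous_map X (jmor_top (dsum m V U) (dsum m W U')) (\<lambda>z. mor_sum m V U (f z) (g z))"
  unfolding continuous_map_into_jmor_top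
proof (intro conjI ballI allI)
  fix z assume "z \<in> topspace X"
  then have "f z \<in> jmor V W" "g z \<in> jmor U U'"
    using f g by (auto simp: continuous_map_into_jmor_top)
  then show "mor_sum m V U (f z) (g z) \<in> jmor (dsum m V U) (dsum m W U')"
    using mor_sum_jmor V U Um fin by blast
next
  fix x i assume "x \<in> dsum m V U"
  then obtain v u where x: "x = join m v u" "v \<in> V" "u \<in> U"
    by (rule dsumE)
  show "continuous_map X euclidean (\<lambda>z. mor_sum m V U (f z) (g z) x i)"
    unfolding x(1) mor_sum_join[OF x(2,3) Um(1)]
    unfolding join_def
    using continuous_map_jmor_coordinate[OF f x(2)] continuous_map_jmor_coordinate[OF g x(3)]
    by (cases "i < m") auto
qed

section \<open>The homotopy limit functor\<close>

subsection \<open>Continuous functors\<close>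

lemma continuous_functorD:
  assumes "continuous_functor F"
  shows "V \<in> jobj \<Longrightarrow> cgwh_space (fobj F V)"
    "V \<in> jobj \<Longrightarrow> fbase F V \<in> topspace (fobj F V)"
    "V \<in> jobj \<Longrightarrow> W \<in> jobj \<Longrightarrow>
       continuous_map (prod_topology (jmor_top V W) (fobj F V)) (fobj F W) (\<lambda>(f, x). fmor F V W f x)"
    "V \<in> jobj \<Longrightarrow> W \<in> jobj \<Longrightarrow> f \<in> jmor V W \<Longrightarrow> fmor F V W f (fbase F V) = fbase F W"
    "V \<in> jobj \<Longrightarrow> x \<in> topspace (fobj F V) \<Longrightarrow> fmor F V V (incl V) x = x"
    "U \<in> jobj \<Longrightarrow> V \<in> jobj \<Longrightarrow> W \<in> jobj \<Longrightarrow> f \<in> jmor U V \<Longrightarrow> g \<in> jmor V W \<Longrightarrow> x \<in> topspace (fobj F U) \<Longrightarrow>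
       fmor F V W g (fmor F U V f x) = fmor F U W (compose U g f) x"
  using assms by (auto simp: continuous_functor_def based_space_def)

lemma continuous_map_fmor:
  assumes F: "continuous_functor F" and V: "V \<in> jobj" and W: "W \<in> jobj"
    and f: "continuous_map Z (jmor_top V W) f" and x: "continuous_map Z (fobj F V) x"
  shows "continuous_map Z (fobj F W) (\<lambda>z. fmor F V W (f z) (x z))"
proof -
  have "continuous_map Z (prod_topology (jmor_top V W) (fobj F V)) (\<lambda>z. (f z, x z))"
    using f x by (simp add: continuous_map_pairwise comp_def)
  from continuous_map_compose[OF this continuous_functorD(3)[OF F V W]] show ?thesis
    by (simp add: comp_def)
qed

lemma fmor_in:
  assumes F: "continuous_functor F" and V: "V \<in> jobj" and W: "W \<in> jobj"
    and f: "f \<in> jmor V W" and x: "x \<in> topspace (fobj F V)"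
  shows "fmor F V W f x \<in> topspace (fobj F W)"
proof -
  have "(f, x) \<in> topspace (prod_topology (jmor_top V W) (fobj F V))"
    using f x by (simp add: topspace_jmor_top)
  then have "(\<lambda>(f, x). fmor F V W f x) (f, x) \<in> topspace (fobj F W)"
    using continuous_functorD(3)[OF F V W] unfolding continuous_map_def by blast
  then show ?thesis
    by simp
qed

subsection \<open>The total space\<close>

text \<open>Treats the real and the complex poset together. The second assumption has content over
  the complex numbers, where the Grassmannian also contains subspaces that are not stable under
  conjugation.\<close>

locale frame_poset =
  fixes m :: nat and P :: "(nat \<Rightarrow> 'k::rc_field) set topology"
  assumes P_sub: "\<exists>S. P = subtopology (Grassmannians m) S"
    and P_jobj: "U \<in> topspace P \<Longrightarrow> U \<in> jobj"
begin

abbreviation frames :: "nat \<Rightarrow> ((nat \<Rightarrow> 'k) \<Rightarrow> (nat \<Rightarrow> 'k)) topology" where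
  "frames k \<equiv> subtopology (jmor_top (std k) (std m)) {g. g ` std k \<in> topspace P}"

lemma topspace_frames: "g \<in> topspace (frames k) \<longleftrightarrow> g \<in> jmor (std k) (std m) \<and> g ` std k \<in> topspace P"
  by (simp add: topspace_jmor_top)

lemma P_frame:
  assumes "U \<in> topspace P"
  obtains k g where "k \<in> {1..m}" "g \<in> topspace (frames k)" "U = g ` std k"
proof -
  have "U \<in> topspace (Grassmannians m)"
    using assms P_sub by auto
  then obtain k g where "k \<in> {1..m}" "g \<in> jmor (std k) (std m)" "U = g ` std k"
    unfolding topspace_Grassmannians by blast
  then show ?thesis
    using that assms topspace_frames by metis
qed

lemma P_std: "U \<in> topspace P \<Longrightarrow> U \<subseteq> std m"
  using P_frame jmorD(1) topspace_frames by (metis image_subsetI)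

lemma P_subspace: "U \<in> topspace P \<Longrightarrow> fs.subspace U"
  using P_jobj jobjD(1) by blast

lemma continuous_map_P_Grassmannians: "continuous_map P (Grassmannians m) (\<lambda>U. U)"
  using P_sub by (auto simp: continuous_map_from_subtopology)

lemma Hausdorff_P: "Hausdorff_space P"
  using P_sub Hausdorff_Grassmannians Hausdorff_space_subtopology by blast

lemma continuous_map_into_P:
  assumes "continuous_map X (Grassmannians m) f" "f \<in> topspace X \<rightarrow> topspace P"
  shows "continuous_map X P f"
proof -
  obtain S where S: "P = subtopology (Grassmannians m) S"
    using P_sub by blast
  have "f \<in> topspace X \<rightarrow> S"
    using assms(2) by (auto simp: S)
  then show ?thesis
    using assms(1) by (simp add: S continuous_map_in_subtopology)
qed

lemma continuous_map_frames_P: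
  assumes "k \<in> {1..m}"
  shows "continuous_map (frames k) P (\<lambda>g. g ` std k)"
  using continuous_map_Grassmannians[OF assms] topspace_frames
  by (intro continuous_map_into_P continuous_map_from_subtopology) auto

lemma openin_P_frame_image:
  assumes B: "openin (frames k) B" and k: "k \<in> {1..m}"
  shows "openin P ((\<lambda>g. g ` std k) ` B)"
proof -
  obtain S where S: "P = subtopology (Grassmannians m) S"
    using P_sub by blast
  obtain A where A: "openin (jmor_top (std k) (std m)) A" "B = A \<inter> {g. g ` std k \<in> topspace P}"
    using B by (auto simp: openin_subtopology)
  have o: "openin (Grassmannians m) ((\<lambda>g. g ` std k) ` A)"
    by (rule openin_frame_image[OF A(1) k])
  have "(\<lambda>g. g ` std k) ` B = (\<lambda>g. g ` std k) ` A \<inter> S"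
    using openin_subset[OF o] by (auto simp: A(2) S)
  then show ?thesis
    using o by (auto simp: S openin_subtopology)
qed

lemma frame_facts:
  assumes "g \<in> topspace (frames k)"
  shows "g \<in> jmor (std k) (std m)" "g ` std k \<in> topspace P" "g \<in> jmor (std k) (g ` std k)"
    "jinv (std k) g \<in> jmor (g ` std k) (std k)"
    "compose (std k) (jinv (std k) g) g = incl (std k)" "compose (g ` std k) g (jinv (std k) g) = incl (g ` std k)"
proof -
  show g: "g \<in> jmor (std k) (std m)" "g ` std k \<in> topspace P"
    using assms unfolding topspace_frames by blast+
  show "g \<in> jmor (std k) (g ` std k)"
    using g by (auto simp: jmor_def PiE_def)
  show "jinv (std k) g \<in> jmor (g ` std k) (std k)"
    "compose (std k) (jinv (std k) g) g = incl (std k)" "compose (g ` std k) g (jinv (std k) g) = incl (g ` std k)"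
    using jinv_std[OF g(1)] by blast+
qed

end

locale holim_data = frame_poset m P for m :: nat and P :: "(nat \<Rightarrow> 'k::rc_field) set topology" +
  fixes F :: "('k, 'a, 'z) tfun_scheme"
  assumes F: "continuous_functor F"
begin

abbreviation D :: "(nat \<Rightarrow> 'k) set \<Rightarrow> (nat \<Rightarrow> 'k) set \<Rightarrow> (nat \<Rightarrow> 'k) set" where
  "D \<equiv> dsum m"

abbreviation comp :: "(nat \<Rightarrow> 'k) set \<Rightarrow> nat \<Rightarrow> (((nat \<Rightarrow> 'k) \<Rightarrow> (nat \<Rightarrow> 'k)) \<times> 'a) topology" where
  "comp V k \<equiv> prod_topology (frames k) (fobj F (D V (std k)))"

abbreviation tot :: "(nat \<Rightarrow> 'k) set \<Rightarrow> ((nat \<Rightarrow> 'k) set \<times> 'a) topology" where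
  "tot V \<equiv> total_space m P F V"

definition shift :: "(nat \<Rightarrow> 'k) set \<Rightarrow> (nat \<Rightarrow> 'k) set \<Rightarrow> (nat \<Rightarrow> 'k) set \<Rightarrow> ((nat \<Rightarrow> 'k) \<Rightarrow> (nat \<Rightarrow> 'k)) \<Rightarrow> 'a \<Rightarrow> 'a" where
  "shift V U U' g = fmor F (D V U) (D V U') (mor_sum m V U (incl V) g)"

definition quot :: "(nat \<Rightarrow> 'k) set \<Rightarrow> nat \<Rightarrow> ((nat \<Rightarrow> 'k) \<Rightarrow> (nat \<Rightarrow> 'k)) \<times> 'a \<Rightarrow> (nat \<Rightarrow> 'k) set \<times> 'a" where
  "quot V k = (\<lambda>(g, y). (g ` std k, shift V (std k) (g ` std k) g y))"

text \<open>Besides the members of \<open>P\<close> this covers the model subspaces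
  \<open>std k\<close>, which need not belong to an abstract \<open>P\<close> but carry the typical
  fibre. Containment in \<open>std m\<close> is what makes the decomposition of a vector of
  \<open>D V U\<close> unique.\<close>

definition fobject :: "(nat \<Rightarrow> 'k) set \<Rightarrow> bool" where
  "fobject U \<longleftrightarrow> U \<in> jobj \<and> U \<subseteq> std m"

lemma fobject_P: "U \<in> topspace P \<Longrightarrow> fobject U"
  by (simp add: fobject_def P_jobj P_std)

lemma fobject_std: "k \<in> {1..m} \<Longrightarrow> fobject (std k)"
  by (simp add: fobject_def std_jobj std_mono)

lemma D_jobj: "V \<in> jobj \<Longrightarrow> fobject U \<Longrightarrow> D V U \<in> jobj"
  by (simp add: fobject_def dsum_jobj)

lemma mor_sum_in:
  assumes "V \<in> jobj" "W \<in> jobj" "fobject U" "fobject U'" "f \<in> jmor V W" "g \<in> jmor U U'"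
  shows "mor_sum m V U f g \<in> jmor (D V U) (D W U')"
  using assms mor_sum_jmor[of f V W g U U' m] jobjD by (auto simp: fobject_def)

lemma incl_in: "V \<in> jobj \<Longrightarrow> incl V \<in> jmor V V"
  by (simp add: incl_jmor jobjD(1))

lemma shift_in:
  assumes "V \<in> jobj" "fobject U" "fobject U'" "g \<in> jmor U U'" "y \<in> topspace (fobj F (D V U))"
  shows "shift V U U' g y \<in> topspace (fobj F (D V U'))"
  unfolding shift_def using assms by (intro fmor_in[OF F] D_jobj mor_sum_in incl_in)

lemma compose_incl: "compose V (incl V) (incl V) = incl V"
  by (auto simp: compose_def incl_def)

lemma shift_compose:
  assumes "V \<in> jobj" "fobject U" "fobject U'" "fobject U''" "g \<in> jmor U U'" "h \<in> jmor U' U''"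
    "y \<in> topspace (fobj F (D V U))"
  shows "shift V U' U'' h (shift V U U' g y) = shift V U U'' (compose U h g) y"
proof -
  have "shift V U' U'' h (shift V U U' g y) = fmor F (D V U) (D V U'')
      (compose (D V U) (mor_sum m V U' (incl V) h) (mor_sum m V U (incl V) g)) y"
    unfolding shift_def using assms by (intro continuous_functorD(6)[OF F] D_jobj mor_sum_in incl_in)
  also have "compose (D V U) (mor_sum m V U' (incl V) h) (mor_sum m V U (incl V) g)
      = mor_sum m V U (incl V) (compose U h g)"
    using compose_mor_sum[OF incl_in[OF assms(1)] assms(5)] assms(2,3) by (simp add: fobject_def compose_incl)
  finally show ?thesis
    by (simp add: shift_def)
qed

lemma shift_incl:
  assumes "V \<in> jobj" "fobject U" "y \<in> topspace (fobj F (D V U))"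
  shows "shift V U U (incl U) y = y"
  using assms continuous_functorD(5)[OF F D_jobj[OF assms(1,2)]]
  by (simp add: shift_def mor_sum_incl fobject_def)

lemma continuous_map_shift:
  assumes "V \<in> jobj" "fobject U" "fobject U'" "continuous_map Z (jmor_top U U') g"
    "continuous_map Z (fobj F (D V U)) y"
  shows "continuous_map Z (fobj F (D V U')) (\<lambda>z. shift V U U' (g z) (y z))"
  unfolding shift_def
proof (rule continuous_map_fmor[OF F D_jobj[OF assms(1,2)] D_jobj[OF assms(1,3)] _ assms(5)])
  have "continuous_map Z (jmor_top V V) (\<lambda>_. incl V)"
    using incl_in[OF assms(1)] by (simp add: topspace_jmor_top)
  then show "continuous_map Z (jmor_top (D V U) (D V U')) (\<lambda>z. mor_sum m V U (incl V) (g z))"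
    using assms(1-4) jobjD by (intro continuous_map_mor_sum) (auto simp: fobject_def)
qed

lemma pull_push:
  assumes "V \<in> jobj" "k \<in> {1..m}" "g \<in> topspace (frames k)" "y \<in> topspace (fobj F (D V (std k)))"
  shows "shift V (g ` std k) (std k) (jinv (std k) g) (shift V (std k) (g ` std k) g y) = y"
  using assms frame_facts[OF assms(3)] fobject_P fobject_std
  by (simp add: shift_compose shift_incl)

lemma push_pull:
  assumes "V \<in> jobj" "k \<in> {1..m}" "g \<in> topspace (frames k)" "e \<in> topspace (fobj F (D V (g ` std k)))"
  shows "shift V (std k) (g ` std k) g (shift V (g ` std k) (std k) (jinv (std k) g) e) = e"
  using assms frame_facts[OF assms(3)] fobject_P fobject_std
  by (simp add: shift_compose shift_incl)

lemma quotient_map_tot: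
  "quotient_map (sum_topology (comp V) {1..m}) (tot V) (\<lambda>(k, q). quot V k q)"
proof -
  have "(\<lambda>(k, g, y). (g ` std k,
        fmor F (D V (std k)) (D V (g ` std k)) (mor_sum m V (std k) (incl V) g) y)) = (\<lambda>(k, q). quot V k q)"
    by (auto simp: quot_def shift_def fun_eq_iff)
  then show ?thesis
    unfolding total_space_def using quotient_map_final_topology by metis
qed

lemma quot_in: "k \<in> {1..m} \<Longrightarrow> q \<in> topspace (comp V k) \<Longrightarrow> quot V k q \<in> topspace (tot V)"
  using quotient_imp_surjective_map[OF quotient_map_tot[of V]] by force

lemma topspace_tot:
  assumes V: "V \<in> jobj"
  shows "topspace (tot V) = {(U, e). U \<in> topspace P \<and> e \<in> topspace (fobj F (D V U))}"
proof (intro equalityI subsetI)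
  fix z assume "z \<in> topspace (tot V)"
  then obtain k g y where "k \<in> {1..m}" "g \<in> topspace (frames k)" "y \<in> topspace (fobj F (D V (std k)))"
      "z = quot V k (g, y)"
    using quotient_imp_surjective_map[OF quotient_map_tot[of V]] by force
  then show "z \<in> {(U, e). U \<in> topspace P \<and> e \<in> topspace (fobj F (D V U))}"
    using frame_facts[of g k] V fobject_P fobject_std by (auto simp: quot_def intro!: shift_in)
next
  fix z assume "z \<in> {(U, e). U \<in> topspace P \<and> e \<in> topspace (fobj F (D V U))}"
  then obtain U e where z: "z = (U, e)" "U \<in> topspace P" "e \<in> topspace (fobj F (D V U))"
    by auto
  obtain k g where g: "k \<in> {1..m}" "g \<in> topspace (frames k)" "U = g ` std k"
    using P_frame[OF z(2)] .
  let ?y = "shift V U (std k) (jinv (std k) g) e"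
  have "?y \<in> topspace (fobj F (D V (std k)))"
    using g z V frame_facts[OF g(2)] fobject_P fobject_std by (intro shift_in) auto
  moreover have "quot V k (g, ?y) = z"
    using push_pull[OF V g(1,2)] z g(3) by (simp add: quot_def)
  ultimately show "z \<in> topspace (tot V)"
    using quot_in[OF g(1), of "(g, ?y)" V] g(2) by simp
qed

lemma continuous_map_quot:
  assumes "k \<in> {1..m}"
  shows "continuous_map (comp V k) (tot V) (quot V k)"
  using continuous_map_compose[OF continuous_map_component_injection[OF assms, of "comp V"]
      quotient_imp_continuous_map[OF quotient_map_tot[of V]]]
  by (simp add: comp_def)

lemma openin_tot:
  "openin (tot V) S \<longleftrightarrow> S \<subseteq> topspace (tot V) \<and>
     (\<forall>k\<in>{1..m}. openin (comp V k) {q \<in> topspace (comp V k). quot V k q \<in> S})"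
proof -
  let ?S = "sum_topology (comp V) {1..m}"
  let ?R = "{p \<in> topspace ?S. (case p of (k, q) \<Rightarrow> quot V k q) \<in> S}"
  have "{q. (k, q) \<in> ?R} = {q \<in> topspace (comp V k). quot V k q \<in> S}" if "k \<in> {1..m}" for k
    using that by auto
  moreover have "?R \<subseteq> Sigma {1..m} (topspace \<circ> comp V)"
    by auto
  ultimately have "openin ?S ?R \<longleftrightarrow> (\<forall>k\<in>{1..m}. openin (comp V k) {q \<in> topspace (comp V k). quot V k q \<in> S})"
    unfolding openin_sum_topology by simp
  then show ?thesis
    using quotient_map_tot[of V] openin_subset[of "tot V" S] unfolding quotient_map_def by blast
qed

lemma closedin_tot:
  "closedin (tot V) S \<longleftrightarrow> S \<subseteq> topspace (tot V) \<and>
     (\<forall>k\<in>{1..m}. closedin (comp V k) {q \<in> topspace (comp V k). quot V k q \<in> S})"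
proof -
  have "{q \<in> topspace (comp V k). quot V k q \<in> topspace (tot V) - S}
    = topspace (comp V k) - {q \<in> topspace (comp V k). quot V k q \<in> S}" if "k \<in> {1..m}" for k
    using quot_in[OF that] by blast
  then show ?thesis
    unfolding closedin_def[of "tot V"] openin_tot closedin_def by auto
qed

lemma continuous_map_from_prod_tot:
  assumes J: "compact_space J" "Hausdorff_space J"
    and f: "\<And>k. k \<in> {1..m} \<Longrightarrow> continuous_map (prod_topology J (comp V k)) Y (\<lambda>(j, q). f (j, quot V k q))"
  shows "continuous_map (prod_topology J (tot V)) Y f"
proof -
  let ?S = "sum_topology (comp V) {1..m}"
  have "quotient_map (prod_topology J ?S) (prod_topology J (tot V)) (\<lambda>(j, p). (j, (\<lambda>(k, q). quot V k q) p))"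
    using J by (intro quotient_map_prod_right quotient_map_tot) (auto simp: compact_imp_locally_compact_space)
  moreover have "continuous_map (prod_topology J ?S) Y (f \<circ> (\<lambda>(j, p). (j, (\<lambda>(k, q). quot V k q) p)))"
    using f by (intro continuous_map_prod_sum_topology) (simp add: comp_def case_prod_unfold)
  ultimately show ?thesis
    using continuous_compose_quotient_map_eq by blast
qed

lemma continuous_map_fst_tot:
  assumes V: "V \<in> jobj"
  shows "continuous_map (tot V) P fst"
  unfolding continuous_map_def
proof (intro conjI allI impI)
  show "fst \<in> topspace (tot V) \<rightarrow> topspace P"
    by (auto simp: topspace_tot[OF V])
  fix S assume S: "openin P S"
  show "openin (tot V) {e \<in> topspace (tot V). fst e \<in> S}"
    unfolding openin_tot
  proof (intro conjI ballI)
    fix k assume k: "k \<in> {1..m}"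
    have "continuous_map (comp V k) P (\<lambda>q. fst q ` std k)"
      using continuous_map_compose[OF continuous_map_fst continuous_map_frames_P[OF k]] by (simp add: comp_def)
    from openin_continuous_map_preimage[OF this S]
    have "openin (comp V k) {q \<in> topspace (comp V k). fst q ` std k \<in> S}" .
    moreover have "{q \<in> topspace (comp V k). quot V k q \<in> {e \<in> topspace (tot V). fst e \<in> S}}
        = {q \<in> topspace (comp V k). fst q ` std k \<in> S}"
      using quot_in[OF k, of _ V] by (auto simp: quot_def simp del: topspace_prod_topology)
    ultimately show "openin (comp V k) {q \<in> topspace (comp V k). quot V k q \<in> {e \<in> topspace (tot V). fst e \<in> S}}"
      by simp
  qed auto
qed

text \<open>The equivalence relation of an associated bundle: two framed points agree precisely when
  the change of frame carries one fibre coordinate to the other. It follows because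
  \<open>shift\<close> along a frame is invertible.\<close>

lemma quot_eq_iff:
  assumes V: "V \<in> jobj" and k: "k \<in> {1..m}" and q: "(g, y) \<in> topspace (comp V k)" and q': "(h, z) \<in> topspace (comp V k)"
  shows "quot V k (g, y) = quot V k (h, z) \<longleftrightarrow>
    g ` std k = h ` std k \<and> y = shift V (std k) (std k) (compose (std k) (jinv (std k) g) h) z"
proof -
  have g: "g \<in> topspace (frames k)" and y: "y \<in> topspace (fobj F (D V (std k)))"
    and h: "h \<in> topspace (frames k)" and z: "z \<in> topspace (fobj F (D V (std k)))"
    using q q' by auto
  have key: "shift V (g ` std k) (std k) (jinv (std k) g) (shift V (std k) (h ` std k) h z)
      = shift V (std k) (std k) (compose (std k) (jinv (std k) g) h) z"
    if im: "g ` std k = h ` std k"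
    unfolding im[symmetric]
    by (rule shift_compose[OF V fobject_std[OF k] fobject_P fobject_std[OF k] _ _ z])
      (use frame_facts[OF g] frame_facts[OF h] im in auto)
  show ?thesis
  proof
    assume "quot V k (g, y) = quot V k (h, z)"
    then have im: "g ` std k = h ` std k"
        and eq: "shift V (std k) (g ` std k) g y = shift V (std k) (h ` std k) h z"
      by (auto simp: quot_def)
    then show "g ` std k = h ` std k \<and> y = shift V (std k) (std k) (compose (std k) (jinv (std k) g) h) z"
      using key pull_push[OF V k g y] by simp
  next
    assume r: "g ` std k = h ` std k \<and> y = shift V (std k) (std k) (compose (std k) (jinv (std k) g) h) z"
    then have im: "g ` std k = h ` std k"
      by simp
    have "shift V (std k) (h ` std k) h z \<in> topspace (fobj F (D V (g ` std k)))"
      unfolding im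
      by (rule shift_in[OF V fobject_std[OF k] fobject_P _ z]) (use frame_facts[OF h] in auto)
    moreover have "y = shift V (g ` std k) (std k) (jinv (std k) g) (shift V (std k) (h ` std k) h z)"
      using key[OF im] r by simp
    ultimately have "shift V (std k) (g ` std k) g y = shift V (std k) (h ` std k) h z"
      using push_pull[OF V k g] by blast
    then show "quot V k (g, y) = quot V k (h, z)"
      using im by (simp add: quot_def)
  qed
qed

lemma quot_rank:
  assumes V: "V \<in> jobj" and "q \<in> topspace (comp V k)" "q' \<in> topspace (comp V l)" "quot V k q = quot V l q'"
  shows "k = l"
  using assms frame_rank_unique[of "fst q" k m "fst q'" l]
  by (auto simp: quot_def topspace_jmor_top)

text \<open>\<open>quot\<close> is the quotient map by an action of the group of isometries of \<open>std k\<close>, hence open.\<close>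

lemma openin_quot_image:
  assumes V: "V \<in> jobj" and k: "k \<in> {1..m}" and S: "openin (comp V k) S"
  shows "openin (tot V) (quot V k ` S)"
  unfolding openin_tot
proof (intro conjI ballI)
  have Sc: "S \<subseteq> topspace (comp V k)"
    by (rule openin_subset[OF S])
  then show "quot V k ` S \<subseteq> topspace (tot V)"
    using quot_in[OF k] by blast
  fix l assume "l \<in> {1..m}"
  show "openin (comp V l) {q \<in> topspace (comp V l). quot V l q \<in> quot V k ` S}"
  proof (cases "l = k")
    case False
    then have "{q \<in> topspace (comp V l). quot V l q \<in> quot V k ` S} = {}"
      using quot_rank[OF V] Sc by blast
    then show ?thesis
      by (simp only: openin_empty)
  next
    case True
    let ?J = "jmor (std k) (std k)"
    \<comment> \<open>\<open>b\<close> stands for the inverse of \<open>a\<close>. Carrying both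
      turns the group action into the plain formula \<open>?m\<close>: the frame is changed by
      \<open>a\<close>, the fibre coordinate by \<open>b\<close>.\<close>
    let ?A = "{(a, b). a \<in> ?J \<and> b \<in> ?J \<and> a ` std k = std k \<and> compose (std k) a b = incl (std k)}"
    let ?m = "\<lambda>(a, b) q. (compose (std k) (fst q) a, shift V (std k) (std k) b (snd q))"
    let ?Q = "\<lambda>ab. {q \<in> topspace (comp V k). ?m ab q \<in> S}"
    have im: "compose (std k) g a ` std k = g ` std k" if "a ` std k = std k" for g a :: "(nat \<Rightarrow> 'k) \<Rightarrow> (nat \<Rightarrow> 'k)"
      using that by (auto simp: compose_def image_image[symmetric])
    have cont: "continuous_map (comp V k) (comp V k) (?m (a, b))" if "(a, b) \<in> ?A" for a b
    proof -
      have a: "a \<in> ?J" "a ` std k = std k" and b: "b \<in> ?J"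
        using that by auto
      have "continuous_map (frames k) (frames k) (\<lambda>g. compose (std k) g a)"
        unfolding continuous_map_in_subtopology
        using continuous_map_from_subtopology[OF continuous_map_precompose[OF a(1) subspace_std]] im[OF a(2)]
        by auto
      moreover have "continuous_map (fobj F (D V (std k))) (fobj F (D V (std k))) (\<lambda>y. shift V (std k) (std k) b y)"
        using b V fobject_std[OF k] by (intro continuous_map_shift) (auto simp: topspace_jmor_top)
      ultimately have "continuous_map (comp V k) (frames k) (\<lambda>q. compose (std k) (fst q) a)"
          "continuous_map (comp V k) (fobj F (D V (std k))) (\<lambda>q. shift V (std k) (std k) b (snd q))"
        using continuous_map_compose[OF continuous_map_fst, of "frames k" "frames k" "\<lambda>g. compose (std k) g a"]
          continuous_map_compose[OF continuous_map_snd, of "fobj F (D V (std k))" "fobj F (D V (std k))"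
            "\<lambda>y. shift V (std k) (std k) b y"]
        by (simp_all add: comp_def)
      then show ?thesis
        by (simp add: continuous_map_pairwise comp_def)
    qed
    have "{q \<in> topspace (comp V k). quot V k q \<in> quot V k ` S} = (\<Union>ab\<in>?A. ?Q ab)"
    proof (intro equalityI subsetI)
      fix q assume "q \<in> {q \<in> topspace (comp V k). quot V k q \<in> quot V k ` S}"
      then obtain g y h z where q: "q = (g, y)" "(g, y) \<in> topspace (comp V k)" and hz: "(h, z) \<in> S"
          "quot V k (g, y) = quot V k (h, z)"
        by (cases q) auto
      have hz': "(h, z) \<in> topspace (comp V k)"
        using hz Sc by blast
      have im: "g ` std k = h ` std k" and z: "z = shift V (std k) (std k) (compose (std k) (jinv (std k) h) g) y"
        using quot_eq_iff[OF V k q(2) hz'] quot_eq_iff[OF V k hz' q(2)] hz(2) by auto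
      have gf: "g \<in> jmor (std k) (std m)" and hf: "h \<in> jmor (std k) (std m)"
        using q hz' by (auto simp: topspace_jmor_top)
      let ?a = "compose (std k) (jinv (std k) g) h" and ?b = "compose (std k) (jinv (std k) h) g"
      note ca = frame_compose_jinv[OF gf hf im] and cb = frame_compose_jinv[OF hf gf im[symmetric]]
      have "compose (std k) ?a ?b = incl (std k)"
      proof
        fix x
        show "compose (std k) ?a ?b x = incl (std k) x"
        proof (cases "x \<in> std k")
          case True
          have bx: "?b x \<in> std k"
            using jmorD(1)[OF cb(1) True] .
          have "h (?b x) = g x"
            using fun_cong[OF cb(2), of x] True by (simp add: compose_def)
          have "compose (std k) ?a ?b x = ?a (?b x)"
            by (rule compose_eq[OF True])
          also have "\<dots> = jinv (std k) g (h (?b x))"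
            by (rule compose_eq[OF bx])
          also have "\<dots> = x"
            unfolding \<open>h (?b x) = g x\<close> by (rule jinv_std(1)[OF gf True])
          finally show ?thesis
            using True by (simp add: incl_def)
        qed (simp add: compose_def incl_def)
      qed
      then have "(?a, ?b) \<in> ?A"
        using ca cb by auto
      moreover have "?m (?a, ?b) q = (h, z)"
        using ca(2) z by (simp add: q)
      ultimately show "q \<in> (\<Union>ab\<in>?A. ?Q ab)"
        using hz(1) q by blast
    next
      fix q assume "q \<in> (\<Union>ab\<in>?A. ?Q ab)"
      then obtain a b where ab: "(a, b) \<in> ?A" "q \<in> topspace (comp V k)" "?m (a, b) q \<in> S"
        by blast
      then obtain g y where q: "q = (g, y)" "g \<in> topspace (frames k)" "y \<in> topspace (fobj F (D V (std k)))"
        by auto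
      have a: "a \<in> ?J" "a ` std k = std k" and b: "b \<in> ?J" "compose (std k) a b = incl (std k)"
        using ab by auto
      have g': "g \<in> jmor (std k) (g ` std k)" "compose (std k) g a \<in> jmor (std k) (g ` std k)" "fobject (g ` std k)"
        using frame_facts[OF q(2)] fobject_P jmor_compose[OF a(1) _ subspace_std] by auto
      have "compose (std k) (compose (std k) g a) b = g"
      proof
        fix x
        show "compose (std k) (compose (std k) g a) b x = g x"
          using fun_cong[OF b(2), of x] jmorD(1)[OF b(1)] jmorD(2)[OF g'(1)]
          by (auto simp: compose_def incl_def extensional_def)
      qed
      then have "shift V (std k) (g ` std k) (compose (std k) g a) (shift V (std k) (std k) b y)
          = shift V (std k) (g ` std k) g y"
        using shift_compose[OF V fobject_std[OF k] fobject_std[OF k] g'(3) b(1) g'(2) q(3)] by simp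
      then have eq: "quot V k (?m (a, b) q) = quot V k q"
        using im[OF a(2)] by (simp add: q quot_def)
      have "quot V k q \<in> quot V k ` S"
        using imageI[OF ab(3), of "quot V k"] unfolding eq .
      then show "q \<in> {q \<in> topspace (comp V k). quot V k q \<in> quot V k ` S}"
        using ab(2) by blast
    qed
    moreover have "openin (comp V k) (\<Union>ab\<in>?A. ?Q ab)"
      using openin_continuous_map_preimage[OF cont S] by (intro openin_Union) auto
    ultimately show ?thesis
      using True by simp
  qed
qed

text \<open>Reads a point of the total space in a frame of its base point. The domain is a subspace
  of a product, to which quotient maps do not restrict in general; openness of \<open>quot\<close>
  replaces the quotient argument by letting neighbourhoods of framed points descend.\<close>

lemma continuous_map_pull:
  assumes V: "V \<in> jobj" and k: "k \<in> {1..m}"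
  shows "continuous_map (subtopology (prod_topology (frames k) (tot V)) {(g, e). g ` std k = fst e})
    (fobj F (D V (std k))) (\<lambda>(g, e). shift V (g ` std k) (std k) (jinv (std k) g) (snd e))"
    (is "continuous_map ?X ?Y ?f")
  unfolding continuous_map_def
proof (intro conjI allI impI)
  have fin: "?f x \<in> topspace ?Y" if "x \<in> topspace ?X" for x
    using that frame_facts[of "fst x" k] V k
    by (auto simp: topspace_tot[OF V] topspace_frames simp del: topspace_subtopology
        intro!: shift_in fobject_P fobject_std)
      (auto simp: topspace_tot[OF V] topspace_jmor_top intro!: shift_in fobject_P fobject_std)
  then show "?f \<in> topspace ?X \<rightarrow> topspace ?Y"
    by blast
  fix S assume S: "openin ?Y S"
  \<comment> \<open>\<open>?N\<close> is the same fibre product before passing to the quotient.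
    There the coordinate in the frame \<open>g\<close> is given by an explicit change of frame
    \<open>?mu\<close>; the point \<open>x\<close> is represented by the diagonal triple
    \<open>(g, g, ?y)\<close>, around which a box is chosen.\<close>
  let ?N = "subtopology (prod_topology (frames k) (comp V k)) {(g, h, y). g ` std k = h ` std k}"
  let ?mu = "\<lambda>(g, h, y). shift V (std k) (std k) (compose (std k) (jinv (std k) g) h) y"
  have mu: "continuous_map ?N ?Y ?mu"
  proof -
    have 1: "continuous_map ?N (jmor_top (std k) (std m)) fst"
      by (intro continuous_map_from_subtopology continuous_map_into_fulltopology[OF continuous_map_fst])
    have 2: "continuous_map ?N (jmor_top (std k) (std m)) (\<lambda>z. fst (snd z))"
      using continuous_map_compose[OF continuous_map_snd continuous_map_into_fulltopology[OF continuous_map_fst],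
          of "frames k" "jmor_top (std k) (std m)" "{g. g ` std k \<in> topspace P}"]
      by (intro continuous_map_from_subtopology) (simp add: comp_def)
    have 3: "continuous_map ?N ?Y (\<lambda>z. snd (snd z))"
      using continuous_map_compose[OF continuous_map_snd continuous_map_snd]
      by (intro continuous_map_from_subtopology) (simp add: comp_def)
    have im: "fst z ` std k = fst (snd z) ` std k" if "z \<in> topspace ?N" for z
      using that by (simp add: case_prod_unfold)
    have "continuous_map ?N ?Y (\<lambda>z. shift V (std k) (std k) (compose (std k) (jinv (std k) (fst z)) (fst (snd z))) (snd (snd z)))"
      by (intro continuous_map_shift V fobject_std k continuous_map_frame_change[OF 1 2 im] 3)
    then show ?thesis
      by (simp add: case_prod_unfold)
  qed
  show "openin ?X {x \<in> topspace ?X. ?f x \<in> S}"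
  proof (subst openin_subopen, intro ballI)
    fix x assume x: "x \<in> {x \<in> topspace ?X. ?f x \<in> S}"
    obtain g U e where ge: "x = (g, U, e)" "g \<in> topspace (frames k)" "(U, e) \<in> topspace (tot V)" "U = g ` std k"
      using x by (cases x) auto
    have e: "e \<in> topspace (fobj F (D V (g ` std k)))"
      using ge by (simp add: topspace_tot[OF V])
    let ?y = "shift V (g ` std k) (std k) (jinv (std k) g) e"
    have y: "?y \<in> topspace ?Y" "?y \<in> S"
      using fin[of x] x ge(1,4) by auto
    have "openin ?N {z \<in> topspace ?N. ?mu z \<in> S}"
      by (rule openin_continuous_map_preimage[OF mu S])
    then obtain R where R: "openin (prod_topology (frames k) (comp V k)) R"
        "{z \<in> topspace ?N. ?mu z \<in> S} = R \<inter> {(g, h, y). g ` std k = h ` std k}"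
      by (auto simp: openin_subtopology)
    have "(g, g, ?y) \<in> {z \<in> topspace ?N. ?mu z \<in> S}"
      using ge y frame_facts(5)[OF ge(2)] shift_incl[OF V fobject_std[OF k] y(1)] by simp
    then have "(g, g, ?y) \<in> R"
      unfolding R(2) by blast
    then obtain A B where AB: "openin (frames k) A" "openin (comp V k) B" "g \<in> A" "(g, ?y) \<in> B" "A \<times> B \<subseteq> R"
      using R(1) unfolding openin_prod_topology_alt by meson
    let ?T = "(A \<times> quot V k ` B) \<inter> {(g, e). g ` std k = fst e}"
    have "openin (prod_topology (frames k) (tot V)) (A \<times> quot V k ` B)"
      using AB openin_quot_image[OF V k] by (simp add: openin_prod_Times_iff)
    then have "openin ?X ?T"
      by (auto simp: openin_subtopology)
    moreover have "quot V k (g, ?y) = (U, e)"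
      using push_pull[OF V k ge(2) e] ge(4) by (simp add: quot_def)
    then have "x \<in> ?T"
      using ge AB by (auto intro: rev_image_eqI)
    moreover have "?T \<subseteq> {x \<in> topspace ?X. ?f x \<in> S}"
    proof
      fix w assume w: "w \<in> ?T"
      then obtain a h z where ahz: "w = (a, quot V k (h, z))" "a \<in> A" "(h, z) \<in> B" "a ` std k = h ` std k"
        by (auto simp: quot_def)
      have top: "w \<in> topspace ?X"
        using w openin_subset[OF \<open>openin ?X ?T\<close>] by blast
      have af: "a \<in> topspace (frames k)" and hz: "(h, z) \<in> topspace (comp V k)"
        using ahz openin_subset[OF AB(1)] openin_subset[OF AB(2)] by blast+
      have "(a, h, z) \<in> R \<inter> {(g, h, y). g ` std k = h ` std k}"
        using ahz AB(5) by blast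
      then have "?mu (a, h, z) \<in> S"
        unfolding R(2)[symmetric] by blast
      moreover have "shift V (a ` std k) (std k) (jinv (std k) a) (shift V (std k) (h ` std k) h z)
          = shift V (std k) (std k) (compose (std k) (jinv (std k) a) h) z"
        unfolding ahz(4)[symmetric]
        by (rule shift_compose[OF V fobject_std[OF k] fobject_P fobject_std[OF k]])
          (use frame_facts[OF af] frame_facts[of h k] hz ahz(4) in auto)
      ultimately have "?f w \<in> S"
        by (simp add: ahz(1) quot_def)
      then show "w \<in> {x \<in> topspace ?X. ?f x \<in> S}"
        using top by blast
    qed
    ultimately show "\<exists>T. openin ?X T \<and> x \<in> T \<and> T \<subseteq> {x \<in> topspace ?X. ?f x \<in> S}"
      by blast
  qed
qed

text \<open>
  A test map \<open>u\<close> into the total space lifts over the compact space of pairs of a point \<open>z\<close> and a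
  frame of the subspace below \<open>u z\<close>.
\<close>

lemma weak_Hausdorff_tot:
  assumes V: "V \<in> jobj"
  shows "weak_Hausdorff (tot V)"
  unfolding weak_Hausdorff_def
proof (intro allI impI)
  fix K :: "((nat \<Rightarrow> 'k) set \<times> 'a) set set topology" and u
  assume Ku: "compact_space K \<and> Hausdorff_space K \<and> continuous_map K (tot V) u"
  then have u: "continuous_map K (tot V) u"
    by simp
  have uK: "u z \<in> topspace (tot V)" if "z \<in> topspace K" for z
    using u that by (auto simp: continuous_map_def)
  show "closedin (tot V) (u ` topspace K)"
    unfolding closedin_tot
  proof (intro conjI ballI)
    show "u ` topspace K \<subseteq> topspace (tot V)"
      using uK by blast
    fix k assume k: "k \<in> {1..m}"
    let ?KS = "prod_topology K (jmor_top (std k) (std m) :: ((nat \<Rightarrow> 'k) \<Rightarrow> (nat \<Rightarrow> 'k)) topology)"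
    \<comment> \<open>Closed in the compact space \<open>?KS\<close> because two continuous maps
      into the Hausdorff Grassmannian agree on it. Compactness of all \<open>k\<close>-frames is
      used here, before it is known that their images belong to \<open>P\<close>.\<close>
    let ?L = "{p \<in> topspace ?KS. snd p ` std k = fst (u (fst p))}"
    have KS: "compact_space ?KS" "Hausdorff_space ?KS"
      using Ku compact_jmor_top[OF std_jobj std_jobj] Hausdorff_jmor_top
      by (auto simp: compact_space_prod_topology Hausdorff_space_prod_topology)
    have cu: "continuous_map ?KS (tot V) (\<lambda>p. u (fst p))"
      using continuous_map_compose[OF continuous_map_fst u] by (simp add: comp_def)
    have "continuous_map ?KS (Grassmannians m) (\<lambda>p. fst (u (fst p)))"
      using continuous_map_compose[OF cu continuous_map_compose[OF continuous_map_fst_tot[OF V] continuous_map_P_Grassmannians]]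
      by (simp add: comp_def)
    moreover have "continuous_map ?KS (Grassmannians m) (\<lambda>p. snd p ` std k)"
      using continuous_map_compose[OF continuous_map_snd continuous_map_Grassmannians[OF k]] by (simp add: comp_def)
    ultimately have L: "closedin ?KS ?L"
      using closedin_continuous_maps_eq[OF Hausdorff_Grassmannians] by blast
    let ?KL = "subtopology ?KS ?L"
    have KL: "compact_space ?KL" "Hausdorff_space ?KL"
      using KS L by (auto simp: closedin_compact_space compact_space_subtopology Hausdorff_space_subtopology)
    have topL: "topspace ?KL = ?L"
      by (simp only: topspace_subtopology) blast
    have frame: "snd p \<in> topspace (frames k)" if "p \<in> ?L" for p
    proof -
      have "fst (u (fst p)) \<in> topspace P"
        using uK[of "fst p"] that by (auto simp: topspace_tot[OF V])
      then show ?thesis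
        using that by (auto simp: topspace_jmor_top)
    qed
    let ?v = "\<lambda>p. (snd p, shift V (snd p ` std k) (std k) (jinv (std k) (snd p)) (snd (u (fst p))))"
    have 1: "continuous_map ?KL (frames k) snd"
      unfolding continuous_map_in_subtopology
    proof
      show "continuous_map ?KL (jmor_top (std k) (std m)) snd"
        by (intro continuous_map_from_subtopology continuous_map_snd)
      show "snd \<in> topspace ?KL \<rightarrow> {g. g ` std k \<in> topspace P}"
        unfolding topL using frame topspace_frames by blast
    qed
    have 2: "continuous_map ?KL (tot V) (\<lambda>p. u (fst p))"
      using cu by (rule continuous_map_from_subtopology)
    have "continuous_map ?KL (subtopology (prod_topology (frames k) (tot V)) {(g, e). g ` std k = fst e})
        (\<lambda>p. (snd p, u (fst p)))"
      unfolding continuous_map_in_subtopology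
    proof
      show "continuous_map ?KL (prod_topology (frames k) (tot V)) (\<lambda>p. (snd p, u (fst p)))"
        using 1 2 by (simp add: continuous_map_pairwise comp_def)
      show "(\<lambda>p. (snd p, u (fst p))) \<in> topspace ?KL \<rightarrow> {(g, e). g ` std k = fst e}"
        unfolding topL by auto
    qed
    from continuous_map_compose[OF this continuous_map_pull[OF V k]]
    have "continuous_map ?KL (fobj F (D V (std k)))
        (\<lambda>p. shift V (snd p ` std k) (std k) (jinv (std k) (snd p)) (snd (u (fst p))))"
      by (simp add: comp_def)
    with 1 have v: "continuous_map ?KL (comp V k) ?v"
      by (simp add: continuous_map_pairwise comp_def)
    have "weak_Hausdorff (comp V k)"
      using continuous_functorD(1)[OF F D_jobj[OF V fobject_std[OF k]]]
        Hausdorff_imp_weak_Hausdorff[OF Hausdorff_space_subtopology[OF Hausdorff_jmor_top]]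
      unfolding cgwh_space_def by (intro weak_Hausdorff_prod) blast+
    then have "closedin (comp V k) (?v ` ?L)"
      using weak_Hausdorff_image_closedin[OF _ KL v] by (simp only: topL)
    moreover have "?v ` ?L = {q \<in> topspace (comp V k). quot V k q \<in> u ` topspace K}"
    proof (intro equalityI subsetI)
      fix q assume "q \<in> ?v ` ?L"
      then obtain p where p: "p \<in> ?L" "q = ?v p"
        by blast
      have pf: "snd p \<in> topspace (frames k)"
        by (rule frame[OF p(1)])
      have fp: "fst p \<in> topspace K" and im: "snd p ` std k = fst (u (fst p))"
        using p(1) by auto
      have e: "snd (u (fst p)) \<in> topspace (fobj F (D V (snd p ` std k)))"
        using uK[OF fp] unfolding im by (auto simp: topspace_tot[OF V])
      have "q \<in> topspace (comp V k)"
        using v p(1) unfolding continuous_map_def topL p(2) by blast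
      moreover have "quot V k q = u (fst p)"
        using push_pull[OF V k pf e] im by (simp add: p(2) quot_def prod_eq_iff)
      ultimately show "q \<in> {q \<in> topspace (comp V k). quot V k q \<in> u ` topspace K}"
        using fp by blast
    next
      fix q assume "q \<in> {q \<in> topspace (comp V k). quot V k q \<in> u ` topspace K}"
      then obtain g y z where q: "q = (g, y)" "g \<in> topspace (frames k)" "y \<in> topspace (fobj F (D V (std k)))"
          and z: "z \<in> topspace K" "quot V k (g, y) = u z"
        by (cases q) auto
      have "u z = (g ` std k, shift V (std k) (g ` std k) g y)"
        using z(2) by (simp add: quot_def)
      then have zg: "(z, g) \<in> ?L" "?v (z, g) = q"
        using q z pull_push[OF V k q(2,3)] by (auto simp: topspace_jmor_top)
      show "q \<in> ?v ` ?L"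
        using imageI[OF zg(1), of ?v] unfolding zg(2) .
    qed
    ultimately show "closedin (comp V k) {q \<in> topspace (comp V k). quot V k q \<in> u ` topspace K}"
      by simp
  qed
qed

subsection \<open>Functoriality of the homotopy limit\<close>

lemma fmor_mor_sum_compose:
  assumes "V \<in> jobj" "W \<in> jobj" "X \<in> jobj" "fobject U" "fobject U'" "fobject U''"
    "f \<in> jmor V W" "f' \<in> jmor W X" "g \<in> jmor U U'" "g' \<in> jmor U' U''" "x \<in> topspace (fobj F (D V U))"
  shows "fmor F (D W U') (D X U'') (mor_sum m W U' f' g') (fmor F (D V U) (D W U') (mor_sum m V U f g) x)
    = fmor F (D V U) (D X U'') (mor_sum m V U (compose V f' f) (compose U g' g)) x"
proof -
  have "compose (D V U) (mor_sum m W U' f' g') (mor_sum m V U f g)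
      = mor_sum m V U (compose V f' f) (compose U g' g)"
    using compose_mor_sum[OF assms(7,9)] assms(4,5) by (simp add: fobject_def)
  then show ?thesis
    using continuous_functorD(6)[OF F D_jobj[OF assms(1,4)] D_jobj[OF assms(2,5)] D_jobj[OF assms(3,6)]
      mor_sum_in[OF assms(1,2,4,5,7,9)] mor_sum_in[OF assms(2,3,5,6,8,10)] assms(11)] by simp
qed

lemma compose_incl_left: "f \<in> jmor V W \<Longrightarrow> compose V (incl W) f = f"
  using jmorD[of f V W] by (auto simp: compose_def incl_def fun_eq_iff extensional_def)

lemma compose_incl_right: "f \<in> jmor V W \<Longrightarrow> compose V f (incl V) = f"
  using jmorD[of f V W] by (auto simp: compose_def incl_def fun_eq_iff extensional_def)

lemma fobject_incl: "fobject U \<Longrightarrow> incl U \<in> jmor U U"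
  by (simp add: fobject_def incl_in)

definition act :: "(nat \<Rightarrow> 'k) set \<Rightarrow> (nat \<Rightarrow> 'k) set \<Rightarrow> ((nat \<Rightarrow> 'k) \<Rightarrow> (nat \<Rightarrow> 'k)) \<Rightarrow>
    (nat \<Rightarrow> 'k) set \<times> 'a \<Rightarrow> (nat \<Rightarrow> 'k) set \<times> 'a" where
  "act V W f = (\<lambda>(U, x). (U, fmor F (D V U) (D W U) (mor_sum m V U f (incl U)) x))"

text \<open>In frames the action is \<open>f\<close> plus the identity on the model fibre, because
  \<open>f\<close> on \<open>V\<close> and a frame \<open>g\<close> on the other summand commute:
  both composites are the isometry \<open>mor_sum m V (std k) f g\<close>. Compactness of the
  isometries lets continuity be tested before the quotient.\<close>

lemma continuous_map_act:
  assumes V: "V \<in> jobj" and W: "W \<in> jobj"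
  shows "continuous_map (prod_topology (jmor_top V W) (tot V)) (tot W) (\<lambda>(f, e). act V W f e)"
proof (rule continuous_map_from_prod_tot[OF compact_jmor_top[OF V W] Hausdorff_jmor_top])
  fix k assume k: "k \<in> {1..m}"
  let ?Z = "prod_topology (jmor_top V W) (comp V k)"
  have fk: "fobject (std k)"
    by (rule fobject_std[OF k])
  have 1: "continuous_map ?Z (jmor_top V W) fst"
    by (rule continuous_map_fst)
  have 2: "continuous_map ?Z (frames k) (\<lambda>z. fst (snd z))" "continuous_map ?Z (fobj F (D V (std k))) (\<lambda>z. snd (snd z))"
    using continuous_map_compose[OF continuous_map_snd continuous_map_fst, of "jmor_top V W" "frames k" "fobj F (D V (std k))"]
      continuous_map_compose[OF continuous_map_snd continuous_map_snd, of "jmor_top V W" "frames k" "fobj F (D V (std k))"]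
    by (simp_all add: comp_def)
  have "continuous_map ?Z (jmor_top (std k :: (nat \<Rightarrow> 'k) set) (std k)) (\<lambda>_. incl (std k))"
    using fobject_incl[OF fk] by (simp add: topspace_jmor_top)
  then have "continuous_map ?Z (jmor_top (D V (std k)) (D W (std k))) (\<lambda>z. mor_sum m V (std k) (fst z) (incl (std k)))"
    using V W fk jobjD by (intro continuous_map_mor_sum 1) (auto simp: fobject_def)
  from continuous_map_fmor[OF F D_jobj[OF V fk] D_jobj[OF W fk] this 2(2)]
  have "continuous_map ?Z (comp W k) (\<lambda>z. (fst (snd z),
      fmor F (D V (std k)) (D W (std k)) (mor_sum m V (std k) (fst z) (incl (std k))) (snd (snd z))))"
    using 2(1) by (simp add: continuous_map_pairwise comp_def)
  from continuous_map_compose[OF this continuous_map_quot[OF k]]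
  have "continuous_map ?Z (tot W) (\<lambda>z. quot W k (fst (snd z),
      fmor F (D V (std k)) (D W (std k)) (mor_sum m V (std k) (fst z) (incl (std k))) (snd (snd z))))"
    by (simp add: comp_def)
  then show "continuous_map ?Z (tot W) (\<lambda>(j, q). case (j, quot V k q) of (f, e) \<Rightarrow> act V W f e)"
  proof (rule continuous_map_eq)
    fix z assume z: "z \<in> topspace ?Z"
    obtain f g y where fgy: "z = (f, g, y)" "f \<in> jmor V W" "g \<in> topspace (frames k)" "y \<in> topspace (fobj F (D V (std k)))"
      using z by (cases z) (auto simp: topspace_jmor_top)
    have fg: "fobject (g ` std k)" "g \<in> jmor (std k) (g ` std k)"
      using frame_facts[OF fgy(3)] fobject_P by auto
    have "fmor F (D V (g ` std k)) (D W (g ` std k)) (mor_sum m V (g ` std k) f (incl (g ` std k))) (shift V (std k) (g ` std k) g y)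
        = fmor F (D V (std k)) (D W (g ` std k)) (mor_sum m V (std k) f g) y"
      unfolding shift_def
      using fmor_mor_sum_compose[OF V V W fk fg(1) fg(1) incl_in[OF V] fgy(2) fg(2) fobject_incl[OF fg(1)] fgy(4)]
      by (simp add: compose_incl_left[OF fg(2)] compose_incl_right[OF fgy(2)])
    also have "\<dots> = shift W (std k) (g ` std k) g (fmor F (D V (std k)) (D W (std k)) (mor_sum m V (std k) f (incl (std k))) y)"
      unfolding shift_def
      using fmor_mor_sum_compose[OF V W W fk fk fg(1) fgy(2) incl_in[OF W] fobject_incl[OF fk] fg(2) fgy(4)]
      by (simp add: compose_incl_left[OF fgy(2)] compose_incl_right[OF fg(2)])
    finally show "quot W k (fst (snd z),
      fmor F (D V (std k)) (D W (std k)) (mor_sum m V (std k) (fst z) (incl (std k))) (snd (snd z)))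
      = (case z of (j, q) \<Rightarrow> case (j, quot V k q) of (f, e) \<Rightarrow> act V W f e)"
      by (simp add: fgy(1) quot_def act_def)
  qed
qed

lemma incl_sum_in: "V \<in> jobj \<Longrightarrow> fobject U \<Longrightarrow> incl_sum m V \<in> jmor V (D V U)"
  using jobjD by (intro incl_sum_jmor) (auto simp: fobject_def)

lemma fmor_mor_sum_incl_sum:
  assumes V: "V \<in> jobj" and W: "W \<in> jobj" and U: "fobject U" and U': "fobject U'"
    and f: "f \<in> jmor V W" and g: "g \<in> jmor U U'" and y: "y \<in> topspace (fobj F V)"
  shows "fmor F (D V U) (D W U') (mor_sum m V U f g) (fmor F V (D V U) (incl_sum m V) y)
    = fmor F W (D W U') (incl_sum m W) (fmor F V W f y)"
proof -
  have "compose V (mor_sum m V U f g) (incl_sum m V) = compose V (incl_sum m W) f"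
    using compose_mor_sum_incl_sum[OF f g] U jobjD(1) by (auto simp: fobject_def)
  then show ?thesis
    using continuous_functorD(6)[OF F V D_jobj[OF V U] D_jobj[OF W U'] incl_sum_in[OF V U] mor_sum_in[OF V W U U' f g] y]
      continuous_functorD(6)[OF F V W D_jobj[OF W U'] f incl_sum_in[OF W U'] y] by simp
qed

text \<open>The space \<open>fobj F V\<close> need not be locally compact, so its product with the
  quotient map from frames to \<open>P\<close> is not treated as a quotient map. Openness of the
  frame map does the work instead: a box around \<open>(y, g)\<close> descends to a box around
  \<open>(y, U)\<close>.\<close>

lemma continuous_map_unit_tot:
  assumes V: "V \<in> jobj"
  shows "continuous_map (prod_topology (fobj F V) P) (tot V) (\<lambda>(y, U). (U, fmor F V (D V U) (incl_sum m V) y))"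
    (is "continuous_map ?X _ ?f")
  unfolding continuous_map_def
proof (intro conjI allI impI)
  show "?f \<in> topspace ?X \<rightarrow> topspace (tot V)"
    using V fobject_P by (auto simp: topspace_tot[OF V] intro!: fmor_in[OF F] D_jobj incl_sum_in)
  fix S assume S: "openin (tot V) S"
  show "openin ?X {x \<in> topspace ?X. ?f x \<in> S}"
    unfolding openin_prod_topology_alt
  proof (intro allI impI)
    fix y U assume yU: "(y, U) \<in> {x \<in> topspace ?X. ?f x \<in> S}"
    then have y: "y \<in> topspace (fobj F V)" and U: "U \<in> topspace P"
      by auto
    obtain k g where g: "k \<in> {1..m}" "g \<in> topspace (frames k)" "U = g ` std k"
      using P_frame[OF U] .
    let ?Z = "prod_topology (fobj F V) (frames k)"
    let ?h = "\<lambda>(y, g). quot V k (g, fmor F V (D V (std k)) (incl_sum m V) y)"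
    have fk: "fobject (std k)"
      by (rule fobject_std[OF g(1)])
    have "continuous_map ?Z (fobj F (D V (std k))) (\<lambda>z. fmor F V (D V (std k)) (incl_sum m V) (fst z))"
      using incl_sum_in[OF V fk]
      by (intro continuous_map_fmor[OF F V D_jobj[OF V fk]] continuous_map_fst) (simp add: topspace_jmor_top)
    then have "continuous_map ?Z (comp V k) (\<lambda>z. (snd z, fmor F V (D V (std k)) (incl_sum m V) (fst z)))"
      by (simp add: continuous_map_pairwise comp_def continuous_map_snd)
    from continuous_map_compose[OF this continuous_map_quot[OF g(1)]]
    have h: "continuous_map ?Z (tot V) ?h"
      by (simp add: comp_def case_prod_unfold)
    have hf: "?h (z, a) = ?f (z, a ` std k)" if "z \<in> topspace (fobj F V)" "a \<in> topspace (frames k)" for z a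
    proof -
      have a: "fobject (a ` std k)" "a \<in> jmor (std k) (a ` std k)"
        using frame_facts[OF that(2)] fobject_P by auto
      show ?thesis
        using fmor_mor_sum_incl_sum[OF V V fk a(1) incl_in[OF V] a(2) that(1)] continuous_functorD(5)[OF F V that(1)]
        by (simp add: quot_def shift_def)
    qed
    have "(y, g) \<in> {z \<in> topspace ?Z. ?h z \<in> S}"
      using y g yU hf[OF y g(2)] by auto
    moreover have "openin ?Z {z \<in> topspace ?Z. ?h z \<in> S}"
      by (rule openin_continuous_map_preimage[OF h S])
    ultimately obtain A B where AB: "openin (fobj F V) A" "openin (frames k) B" "y \<in> A" "g \<in> B"
        "A \<times> B \<subseteq> {z \<in> topspace ?Z. ?h z \<in> S}"
      unfolding openin_prod_topology_alt by meson
    have "openin P ((\<lambda>g. g ` std k) ` B)"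
      by (rule openin_P_frame_image[OF AB(2) g(1)])
    moreover have "A \<times> (\<lambda>g. g ` std k) ` B \<subseteq> {x \<in> topspace ?X. ?f x \<in> S}"
    proof
      fix x assume "x \<in> A \<times> (\<lambda>g. g ` std k) ` B"
      then obtain z a where za: "x = (z, a ` std k)" "z \<in> A" "a \<in> B"
        by blast
      then have "(z, a) \<in> {z \<in> topspace ?Z. ?h z \<in> S}"
        using AB(5) by blast
      then have "z \<in> topspace (fobj F V)" "a \<in> topspace (frames k)" "?h (z, a) \<in> S"
        by auto
      then show "x \<in> {x \<in> topspace ?X. ?f x \<in> S}"
        using hf[of z a] frame_facts(2)[of a k] za(1) by auto
    qed
    ultimately show "\<exists>A B. openin (fobj F V) A \<and> openin P B \<and> y \<in> A \<and> U \<in> B \<and>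
        A \<times> B \<subseteq> {x \<in> topspace ?X. ?f x \<in> S}"
      using AB g(3) by blast
  qed
qed

section \<open>Sections over the nerve\<close>

abbreviation N :: "'k nerve_pt topology" where
  "N \<equiv> nerve_space P"

abbreviation H :: "('k, 'k nerve_pt \<Rightarrow> (nat \<Rightarrow> 'k) set \<times> 'a) tfun" where
  "H \<equiv> holim_functor m P F"

lemma mem_H:
  "s \<in> topspace (fobj H V) \<longleftrightarrow>
    s \<in> extensional (topspace N) \<and> continuous_map N (tot V) s \<and> s \<in> sections m P F V"
  by (auto simp: holim_functor_def topspace_compact_open)

lemma section_fst:
  assumes "s \<in> sections m P F V" "(p, C, t) \<in> topspace N"
  shows "fst (s (p, C, t)) = C p"
proof -
  have "\<forall>(p, C, t) \<in> topspace N. fst (s (p, C, t)) = C p"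
    using assms(1) unfolding sections_def by blast
  then show ?thesis
    using assms(2) by blast
qed

lemma section_compat:
  assumes "s \<in> sections m P F V" "\<theta> \<in> {..q} \<rightarrow> {..p}" "mono_on {..q} \<theta>"
    "C \<in> topspace (chains P p)" "t \<in> standard_simplex q"
  shows "snd (s (p, C, simplex_push q \<theta> t)) = fmor F (D V (C (\<theta> q))) (D V (C p)) (incl (D V (C (\<theta> q))))
     (snd (s (q, restrict (C \<circ> \<theta>) {..q}, t)))"
  using assms unfolding sections_def by blast

lemma section_value:
  assumes V: "V \<in> jobj" and s: "s \<in> topspace (fobj H V)" and d: "(p, C, t) \<in> topspace N"
  obtains x where "s (p, C, t) = (C p, x)" "x \<in> topspace (fobj F (D V (C p)))"
proof -
  have "s (p, C, t) \<in> topspace (tot V)"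
    using s d by (auto simp: mem_H continuous_map_def)
  then show ?thesis
    using that section_fst[of s V p C t] s d by (auto simp: mem_H topspace_tot[OF V])
qed

end

lemma topspace_nerve:
  "(p, C, t) \<in> topspace (nerve_space P) \<longleftrightarrow> C \<in> topspace (chains P p) \<and> t \<in> standard_simplex p"
  by (simp add: nerve_space_def)

lemma mem_chains:
  "C \<in> topspace (chains P p) \<longleftrightarrow> C \<in> extensional {..p} \<and> (\<forall>i\<le>p. C i \<in> topspace P) \<and>
     (\<forall>i j. i \<le> j \<and> j \<le> p \<longrightarrow> C i \<subseteq> C j)"
  by (auto simp: chains_def PiE_def Pi_def)

lemma continuous_map_nerve_last: "continuous_map (nerve_space P) P (\<lambda>(p, C, t). C p)"
proof -
  have "continuous_map (prod_topology (chains P p) X) P (\<lambda>z. fst z p)" for p and X :: "(nat \<Rightarrow> real) topology"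
  proof -
    have "continuous_map (chains P p) P (\<lambda>C. C p)"
      unfolding chains_def by (intro continuous_map_from_subtopology continuous_map_product_coordinates) simp
    from continuous_map_compose[OF continuous_map_fst this] show ?thesis
      by (simp add: comp_def)
  qed
  then show ?thesis
    unfolding nerve_space_def by (intro continuous_map_from_sum_topology) (simp add: case_prod_unfold)
qed

lemma simplex_push_in:
  assumes \<theta>: "\<theta> \<in> {..q} \<rightarrow> {..p}" and t: "t \<in> standard_simplex q"
  shows "simplex_push q \<theta> t \<in> standard_simplex p"
proof -
  have t0: "0 \<le> t i" and t1: "(\<Sum>i\<le>q. t i) = 1" for i
    using t by (auto simp: standard_simplex_def)
  have nn: "0 \<le> simplex_push q \<theta> t j" for j
    by (simp add: simplex_push_def sum_nonneg t0)
  have le: "simplex_push q \<theta> t j \<le> 1" for j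
  proof -
    have "simplex_push q \<theta> t j \<le> (\<Sum>i\<le>q. t i)"
      unfolding simplex_push_def by (intro sum_mono2) (auto simp: t0)
    then show ?thesis
      using t1 by simp
  qed
  have "simplex_push q \<theta> t j = 0" if "p < j" for j
  proof -
    have "{i. i \<le> q \<and> \<theta> i = j} = {}"
      using \<theta> that by (fastforce simp: Pi_def)
    then show ?thesis
      by (simp only: simplex_push_def sum.empty)
  qed
  moreover have "(\<Sum>j\<le>p. simplex_push q \<theta> t j) = 1"
  proof -
    have "(\<Sum>j\<le>p. \<Sum>i | i \<in> {..q} \<and> \<theta> i = j. t i) = (\<Sum>i\<le>q. t i)"
      using \<theta> by (intro sum.group) auto
    then show ?thesis
      using t1 by (simp add: simplex_push_def)
  qed
  ultimately show ?thesis
    using nn le by (simp add: standard_simplex_def)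
qed

lemma restrict_chain:
  assumes "C \<in> topspace (chains P p)" "\<theta> \<in> {..q} \<rightarrow> {..p}" "mono_on {..q} \<theta>"
  shows "restrict (C \<circ> \<theta>) {..q} \<in> topspace (chains P q)"
proof -
  have "\<theta> i \<le> \<theta> j \<and> \<theta> j \<le> p" if "i \<le> j" "j \<le> q" for i j
    using assms(2,3) that by (auto simp: mono_on_def Pi_def)
  then show ?thesis
    using assms(1,2) by (auto simp: mem_chains) (metis subsetD order_trans)+
qed

context holim_data
begin

lemma chain_fobject: "C \<in> topspace (chains P p) \<Longrightarrow> i \<le> p \<Longrightarrow> fobject (C i)"
  using fobject_P by (simp add: mem_chains)

lemma chain_incl:
  assumes "C \<in> topspace (chains P p)" "i \<le> p"
  shows "incl (C i) \<in> jmor (C i) (C p)"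
  using assms P_subspace by (intro incl_jmor) (auto simp: mem_chains)

lemma incl_dsum: "fobject U \<Longrightarrow> incl (D V U) = mor_sum m V U (incl V) (incl U)"
  by (simp add: fobject_def mor_sum_incl)

lemma weak_Hausdorff_H:
  "V \<in> jobj \<Longrightarrow> weak_Hausdorff (subtopology (compact_open N (tot V)) (sections m P F V))"
  by (intro weak_Hausdorff_subtopology weak_Hausdorff_compact_open weak_Hausdorff_tot)

lemma cgwh_H: "V \<in> jobj \<Longrightarrow> cgwh_space (fobj H V)"
  using cgwh_kify[OF weak_Hausdorff_H] by (simp add: holim_functor_def)

lemma continuous_map_into_H:
  assumes V: "V \<in> jobj" and Z: "cgwh_space Z"
    and f: "continuous_map Z (compact_open N (tot V)) f" "\<And>z. z \<in> topspace Z \<Longrightarrow> f z \<in> sections m P F V"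
  shows "continuous_map Z (fobj H V) f"
proof -
  have "continuous_map Z (subtopology (compact_open N (tot V)) (sections m P F V)) f"
    using f by (auto simp: continuous_map_in_subtopology)
  then show ?thesis
    using continuous_map_into_kify[OF Z weak_Hausdorff_H[OF V]] by (simp add: holim_functor_def)
qed

lemma continuous_map_H_compact_open: "continuous_map (fobj H V) (compact_open N (tot V)) (\<lambda>s. s)"
proof -
  have "continuous_map (subtopology (compact_open N (tot V)) (sections m P F V)) (compact_open N (tot V)) (\<lambda>s. s)"
    by (simp add: continuous_map_from_subtopology)
  from continuous_map_from_kify[OF this] show ?thesis
    by (simp add: holim_functor_def)
qed

lemma holim_unit_sections:
  assumes V: "V \<in> jobj" and y: "y \<in> topspace (fobj F V)"
  shows "holim_unit m P F V y \<in> sections m P F V"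
  unfolding sections_def
proof (intro CollectI conjI)
  show "\<forall>(p, C, t)\<in>topspace N. fst (holim_unit m P F V y (p, C, t)) = C p"
    by (auto simp: holim_unit_def)
  show "\<forall>p q. \<forall>\<theta>\<in>{..q} \<rightarrow> {..p}. mono_on {..q} \<theta> \<longrightarrow>
        (\<forall>C\<in>topspace (chains P p). \<forall>t\<in>standard_simplex q.
            snd (holim_unit m P F V y (p, C, simplex_push q \<theta> t)) =
            fmor F (D V (C (\<theta> q))) (D V (C p)) (incl (D V (C (\<theta> q))))
             (snd (holim_unit m P F V y (q, restrict (C \<circ> \<theta>) {..q}, t))))"
  proof (intro allI ballI impI)
    fix p q \<theta> C t
    assume \<theta>: "\<theta> \<in> {..q} \<rightarrow> {..p}" "mono_on {..q} \<theta>" and C: "C \<in> topspace (chains P p)"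
      and t: "t \<in> standard_simplex q"
    have d: "(p, C, simplex_push q \<theta> t) \<in> topspace N" "(q, restrict (C \<circ> \<theta>) {..q}, t) \<in> topspace N"
      using simplex_push_in[OF \<theta>(1) t] restrict_chain[OF C \<theta>] C t by (auto simp: topspace_nerve)
    have q: "\<theta> q \<le> p"
      using \<theta>(1) by auto
    have "fmor F (D V (C (\<theta> q))) (D V (C p)) (incl (D V (C (\<theta> q)))) (fmor F V (D V (C (\<theta> q))) (incl_sum m V) y)
        = fmor F V (D V (C p)) (incl_sum m V) y"
      unfolding incl_dsum[OF chain_fobject[OF C q]]
      using fmor_mor_sum_incl_sum[OF V V chain_fobject[OF C q] chain_fobject[OF C order_refl] incl_in[OF V]
          chain_incl[OF C q] y] continuous_functorD(5)[OF F V y] by simp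
    then show "snd (holim_unit m P F V y (p, C, simplex_push q \<theta> t)) =
            fmor F (D V (C (\<theta> q))) (D V (C p)) (incl (D V (C (\<theta> q))))
             (snd (holim_unit m P F V y (q, restrict (C \<circ> \<theta>) {..q}, t)))"
      using d by (simp add: holim_unit_def)
  qed
qed

text \<open>Currying gives continuity into the compact-open topology; since \<open>fobj F V\<close>
  is compactly generated, the map lifts to the refined topology of the homotopy limit.\<close>

lemma continuous_map_holim_unit:
  assumes V: "V \<in> jobj"
  shows "continuous_map (fobj F V) (fobj H V) (holim_unit m P F V)"
proof (rule continuous_map_into_H[OF V continuous_functorD(1)[OF F V] _ holim_unit_sections[OF V]])
  have "continuous_map (prod_topology (fobj F V) N) (prod_topology (fobj F V) P)
      (\<lambda>z. (fst z, (\<lambda>(p, C, t). C p) (snd z)))"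
    using continuous_map_compose[OF continuous_map_snd continuous_map_nerve_last]
    by (simp add: continuous_map_pairwise comp_def continuous_map_fst)
  from continuous_map_compose[OF this continuous_map_unit_tot[OF V]]
  have "continuous_map (prod_topology (fobj F V) N) (tot V) (\<lambda>(y, d). holim_unit m P F V y d)"
    by (rule continuous_map_eq) (auto simp: holim_unit_def)
  then show "continuous_map (fobj F V) (compact_open N (tot V)) (holim_unit m P F V)"
    by (rule continuous_map_compact_open_curry) (unfold holim_unit_def, rule restrict_extensional)
qed

lemma fbase_H:
  assumes V: "V \<in> jobj"
  shows "holim_unit m P F V (fbase F V) = fbase H V"
proof -
  have "fmor F V (D V (C p)) (incl_sum m V) (fbase F V) = fbase F (D V (C p))"
    if "(p, C, t) \<in> topspace N" for p C and t :: "nat \<Rightarrow> real"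
    using that chain_fobject[of C p p] incl_sum_in[OF V] D_jobj[OF V] V
    by (intro continuous_functorD(4)[OF F]) (auto simp: topspace_nerve)
  then show ?thesis
    unfolding holim_unit_def holim_functor_def by (auto simp: restrict_def fun_eq_iff)
qed

lemma fmor_H: "fmor H V W f s = (\<lambda>d\<in>topspace N. act V W f (s d))"
  unfolding holim_functor_def act_def by (auto simp: restrict_def fun_eq_iff)

lemma act_value:
  assumes V: "V \<in> jobj" and W: "W \<in> jobj" and f: "f \<in> jmor V W" and s: "s \<in> topspace (fobj H V)"
    and d: "(p, C, t) \<in> topspace N"
  shows "fst (act V W f (s (p, C, t))) = C p"
    "snd (act V W f (s (p, C, t))) = fmor F (D V (C p)) (D W (C p)) (mor_sum m V (C p) f (incl (C p))) (snd (s (p, C, t)))"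
    "snd (s (p, C, t)) \<in> topspace (fobj F (D V (C p)))"
proof -
  obtain x where "s (p, C, t) = (C p, x)" "x \<in> topspace (fobj F (D V (C p)))"
    using section_value[OF V s d] .
  then show "fst (act V W f (s (p, C, t))) = C p"
    "snd (act V W f (s (p, C, t))) = fmor F (D V (C p)) (D W (C p)) (mor_sum m V (C p) f (incl (C p))) (snd (s (p, C, t)))"
    "snd (s (p, C, t)) \<in> topspace (fobj F (D V (C p)))"
    by (simp_all add: act_def)
qed

text \<open>The isometry \<open>f\<close> acts on the first summand and the inclusions of a chain on
  the second, so the two orders of applying them both give \<open>mor_sum\<close> of
  \<open>f\<close> with the inclusion.\<close>

lemma fmor_H_sections:
  assumes V: "V \<in> jobj" and W: "W \<in> jobj" and f: "f \<in> jmor V W" and s: "s \<in> topspace (fobj H V)"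
  shows "fmor H V W f s \<in> sections m P F W"
  unfolding sections_def
proof (intro CollectI conjI)
  show "\<forall>(p, C, t)\<in>topspace N. fst (fmor H V W f s (p, C, t)) = C p"
    using act_value(1)[OF V W f s] by (auto simp: fmor_H)
  show "\<forall>p q. \<forall>\<theta>\<in>{..q} \<rightarrow> {..p}. mono_on {..q} \<theta> \<longrightarrow>
        (\<forall>C\<in>topspace (chains P p). \<forall>t\<in>standard_simplex q.
            snd (fmor H V W f s (p, C, simplex_push q \<theta> t)) =
            fmor F (D W (C (\<theta> q))) (D W (C p)) (incl (D W (C (\<theta> q))))
             (snd (fmor H V W f s (q, restrict (C \<circ> \<theta>) {..q}, t))))"
  proof (intro allI ballI impI)
    fix p q \<theta> C t
    assume \<theta>: "\<theta> \<in> {..q} \<rightarrow> {..p}" "mono_on {..q} \<theta>" and C: "C \<in> topspace (chains P p)"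
      and t: "t \<in> standard_simplex q"
    have d: "(p, C, simplex_push q \<theta> t) \<in> topspace N" "(q, restrict (C \<circ> \<theta>) {..q}, t) \<in> topspace N"
      using simplex_push_in[OF \<theta>(1) t] restrict_chain[OF C \<theta>] C t by (auto simp: topspace_nerve)
    have q: "\<theta> q \<le> p"
      using \<theta>(1) by auto
    let ?U = "C (\<theta> q)" and ?U' = "C p"
    have U: "fobject ?U" "fobject ?U'" "incl ?U \<in> jmor ?U ?U'"
      using chain_fobject[OF C q] chain_fobject[OF C order_refl] chain_incl[OF C q] by auto
    let ?x = "snd (s (q, restrict (C \<circ> \<theta>) {..q}, t))"
    have x: "?x \<in> topspace (fobj F (D V ?U))"
      using act_value(3)[OF V W f s d(2)] by simp
    have sx: "snd (s (p, C, simplex_push q \<theta> t)) = fmor F (D V ?U) (D V ?U') (mor_sum m V ?U (incl V) (incl ?U)) ?x"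
      using section_compat[OF _ \<theta> C t, of s V] s by (simp add: mem_H incl_dsum[OF U(1)])
    have "fmor F (D V ?U') (D W ?U') (mor_sum m V ?U' f (incl ?U')) (fmor F (D V ?U) (D V ?U') (mor_sum m V ?U (incl V) (incl ?U)) ?x)
        = fmor F (D V ?U) (D W ?U') (mor_sum m V ?U f (incl ?U)) ?x"
      using fmor_mor_sum_compose[OF V V W U(1,2,2) incl_in[OF V] f U(3) fobject_incl[OF U(2)] x]
      by (simp add: compose_incl_left[OF U(3)] compose_incl_right[OF f])
    also have "\<dots> = fmor F (D W ?U) (D W ?U') (mor_sum m W ?U (incl W) (incl ?U))
        (fmor F (D V ?U) (D W ?U) (mor_sum m V ?U f (incl ?U)) ?x)"
      using fmor_mor_sum_compose[OF V W W U(1,1,2) f incl_in[OF W] fobject_incl[OF U(1)] U(3) x]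
      by (simp add: compose_incl_left[OF f] compose_incl_right[OF U(3)])
    finally show "snd (fmor H V W f s (p, C, simplex_push q \<theta> t)) =
            fmor F (D W ?U) (D W ?U') (incl (D W ?U)) (snd (fmor H V W f s (q, restrict (C \<circ> \<theta>) {..q}, t)))"
      using d act_value(2)[OF V W f s d(1)] act_value(2)[OF V W f s d(2)]
      by (simp add: fmor_H sx incl_dsum[OF U(1)])
  qed
qed

text \<open>The delicate clause is joint continuity. The product of a space of isometries with a
  value of \<open>H\<close> is again compactly generated because the first factor is compact
  Hausdorff, so continuity into the compact-open topology suffices.\<close>

theorem continuous_functor_H: "continuous_functor H"
  unfolding continuous_functor_def based_space_def
proof (intro conjI ballI)
  fix V :: "(nat \<Rightarrow> 'k) set" assume V: "V \<in> jobj"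
  show "cgwh_space (fobj H V)"
    by (rule cgwh_H[OF V])
  show "fbase H V \<in> topspace (fobj H V)"
    unfolding fbase_H[OF V, symmetric]
    using continuous_map_image_subset_topspace[OF continuous_map_holim_unit[OF V]] continuous_functorD(2)[OF F V]
    by blast
  show "fmor H V V (incl V) s = s" if s: "s \<in> topspace (fobj H V)" for s
  proof
    fix d show "fmor H V V (incl V) s d = s d"
    proof (cases "d \<in> topspace N")
      case True
      obtain p C t where d: "d = (p, C, t)"
        by (cases d)
      have dN: "(p, C, t) \<in> topspace N"
        using True d by simp
      obtain x where x: "s (p, C, t) = (C p, x)" "x \<in> topspace (fobj F (D V (C p)))"
        using section_value[OF V s dN] .
      have "fobject (C p)"
        using dN chain_fobject by (auto simp: topspace_nerve)
      then show ?thesis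
        using True x continuous_functorD(5)[OF F D_jobj[OF V]]
        by (simp add: fmor_H d act_def incl_dsum[symmetric])
    next
      case False
      then have "s d = undefined"
        using s extensional_arb[of s "topspace N" d] by (simp add: mem_H)
      then show ?thesis
        using False by (simp add: fmor_H)
    qed
  qed
  fix W :: "(nat \<Rightarrow> 'k) set" assume W: "W \<in> jobj"
  show "fmor H V W f (fbase H V) = fbase H W" if f: "f \<in> jmor V W" for f
  proof -
    have "fmor F (D V (C p)) (D W (C p)) (mor_sum m V (C p) f (incl (C p))) (fbase F (D V (C p))) = fbase F (D W (C p))"
      if "(p, C, t) \<in> topspace N" for p C and t :: "nat \<Rightarrow> real"
      using that chain_fobject[of C p p] V W f D_jobj mor_sum_in fobject_incl
      by (intro continuous_functorD(4)[OF F]) (auto simp: topspace_nerve)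
    then show ?thesis
      unfolding fmor_H by (auto simp: holim_functor_def act_def restrict_def fun_eq_iff)
  qed
  show "continuous_map (prod_topology (jmor_top V W) (fobj H V)) (fobj H W) (\<lambda>(f, s). fmor H V W f s)"
  proof (rule continuous_map_into_H[OF W cgwh_prod_compact[OF compact_jmor_top[OF V W] Hausdorff_jmor_top cgwh_H[OF V]]])
    have "continuous_map (prod_topology (jmor_top V W) (fobj H V)) (prod_topology (jmor_top V W) (compact_open N (tot V)))
        (\<lambda>z. (fst z, snd z))"
      using continuous_map_compose[OF continuous_map_snd continuous_map_H_compact_open]
      by (simp add: continuous_map_pairwise comp_def continuous_map_fst)
    from continuous_map_compose[OF this continuous_map_compact_open_postcompose[OF continuous_map_act[OF V W]]]
    show "continuous_map (prod_topology (jmor_top V W) (fobj H V)) (compact_open N (tot W)) (\<lambda>(f, s). fmor H V W f s)"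
      by (rule continuous_map_eq) (auto simp: fmor_H)
    show "(case z of (f, s) \<Rightarrow> fmor H V W f s) \<in> sections m P F W"
      if "z \<in> topspace (prod_topology (jmor_top V W) (fobj H V))" for z
      using that fmor_H_sections[OF V W] by (auto simp: topspace_jmor_top)
  qed
  fix X :: "(nat \<Rightarrow> 'k) set" and f g s
  assume X: "X \<in> jobj" and f: "f \<in> jmor V W" and g: "g \<in> jmor W X" and s: "s \<in> topspace (fobj H V)"
  show "fmor H V X (compose V g f) s = fmor H W X g (fmor H V W f s)"
  proof
    fix d show "fmor H V X (compose V g f) s d = fmor H W X g (fmor H V W f s) d"
    proof (cases "d \<in> topspace N")
      case True
      obtain p C t where d: "d = (p, C, t)"
        by (cases d)
      have dN: "(p, C, t) \<in> topspace N"
        using True d by simp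
      obtain x where x: "s (p, C, t) = (C p, x)" "x \<in> topspace (fobj F (D V (C p)))"
        using section_value[OF V s dN] .
      have U: "fobject (C p)"
        using dN chain_fobject by (auto simp: topspace_nerve)
      show ?thesis
        using dN x fmor_mor_sum_compose[OF V W X U U U f g fobject_incl[OF U] fobject_incl[OF U] x(2)]
        by (simp add: fmor_H d act_def compose_incl)
    qed (simp add: fmor_H)
  qed
qed

lemma holim_unit_natural:
  assumes V: "V \<in> jobj" and W: "W \<in> jobj" and f: "f \<in> jmor V W" and y: "y \<in> topspace (fobj F V)"
  shows "fmor H V W f (holim_unit m P F V y) = holim_unit m P F W (fmor F V W f y)"
proof
  fix d show "fmor H V W f (holim_unit m P F V y) d = holim_unit m P F W (fmor F V W f y) d"
  proof (cases "d \<in> topspace N")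
    case True
    obtain p C t where d: "d = (p, C, t)"
      by (cases d)
    have U: "fobject (C p)"
      using True d chain_fobject by (auto simp: topspace_nerve)
    show ?thesis
      using True fmor_mor_sum_incl_sum[OF V W U U f fobject_incl[OF U] y]
      by (simp add: fmor_H d act_def holim_unit_def)
  qed (simp add: fmor_H holim_unit_def)
qed

end

section \<open>Iterates and telescopes\<close>

text \<open>The complex stages carry an extra conjugation field and are never equal as records to
  the plain functors they come from; agreement of these three fields lets continuity pass between
  the two record types.\<close>

lemma continuous_functor_cong:
  assumes "fobj F = fobj G" "fbase F = fbase G" "fmor F = fmor G"
  shows "continuous_functor F \<longleftrightarrow> continuous_functor G"
  unfolding continuous_functor_def assms ..

text \<open>Serves both the relabelling along tree constructors and, at the end, the passage from
  the real approximation to the fixed points of the complex one. Continuity of \<open>B\<close> is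
  that of \<open>A\<close> conjugated by the homeomorphisms \<open>\<iota>\<close>.\<close>

lemma continuous_functor_transport:
  fixes A :: "('k::rc_field, 'a, 'z) tfun_scheme" and B :: "('k, 'b, 'y) tfun_scheme"
  assumes A: "continuous_functor A"
    and hom: "\<And>V. V \<in> jobj \<Longrightarrow> homeomorphic_map (fobj A V) (fobj B V) (\<iota> V)"
    and base: "\<And>V. V \<in> jobj \<Longrightarrow> \<iota> V (fbase A V) = fbase B V"
    and nat: "\<And>V W f x. V \<in> jobj \<Longrightarrow> W \<in> jobj \<Longrightarrow> f \<in> jmor V W \<Longrightarrow> x \<in> topspace (fobj A V) \<Longrightarrow>
      fmor B V W f (\<iota> V x) = \<iota> W (fmor A V W f x)"
  shows "continuous_functor B"
  unfolding continuous_functor_def based_space_def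
proof (intro conjI ballI)
  have im: "\<iota> V ` topspace (fobj A V) = topspace (fobj B V)" if "V \<in> jobj" for V
    using homeomorphic_imp_surjective_map[OF hom[OF that]] .
  fix V :: "(nat \<Rightarrow> 'k) set" assume V: "V \<in> jobj"
  show "cgwh_space (fobj B V)"
    using cgwh_homeomorphic[OF continuous_functorD(1)[OF A V] hom[OF V]] .
  show "fbase B V \<in> topspace (fobj B V)"
    using imageI[OF continuous_functorD(2)[OF A V], of "\<iota> V"] unfolding base[OF V] im[OF V] .
  show "fmor B V V (incl V) y = y" if y: "y \<in> topspace (fobj B V)" for y
  proof -
    obtain x where x: "x \<in> topspace (fobj A V)" "y = \<iota> V x"
      using y im[OF V] by blast
    show ?thesis
      using nat[OF V V incl_jmor[OF order_refl jobjD(1)[OF V]] x(1)] continuous_functorD(5)[OF A V x(1)] by (simp add: x(2))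
  qed
  fix W :: "(nat \<Rightarrow> 'k) set" assume W: "W \<in> jobj"
  show "fmor B V W f (fbase B V) = fbase B W" if f: "f \<in> jmor V W" for f
    using nat[OF V W f continuous_functorD(2)[OF A V]] continuous_functorD(4)[OF A V W f] base[OF V] base[OF W] by simp
  obtain g where g: "homeomorphic_maps (fobj A V) (fobj B V) (\<iota> V) g"
    using hom[OF V] homeomorphic_map_maps by blast
  then have gc: "continuous_map (fobj B V) (fobj A V) g"
    by (simp add: homeomorphic_maps_def)
  have "continuous_map (prod_topology (jmor_top V W) (fobj B V)) (fobj A W) (\<lambda>z. fmor A V W (fst z) (g (snd z)))"
    using continuous_map_compose[OF continuous_map_snd gc]
    by (intro continuous_map_fmor[OF A V W] continuous_map_fst) (simp add: comp_def)
  from continuous_map_compose[OF this homeomorphic_imp_continuous_map[OF hom[OF W]]]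
  show "continuous_map (prod_topology (jmor_top V W) (fobj B V)) (fobj B W) (\<lambda>(f, y). fmor B V W f y)"
  proof (rule continuous_map_eq)
    fix z assume "z \<in> topspace (prod_topology (jmor_top V W) (fobj B V))"
    then obtain f y where z: "z = (f, y)" "f \<in> jmor V W" "y \<in> topspace (fobj B V)"
      by (auto simp: topspace_jmor_top)
    then have "g y \<in> topspace (fobj A V)" "\<iota> V (g y) = y"
      using g gc by (auto simp: homeomorphic_maps_def continuous_map_def)
    then show "(\<iota> W \<circ> (\<lambda>z. fmor A V W (fst z) (g (snd z)))) z = (case z of (f, y) \<Rightarrow> fmor B V W f y)"
      using nat[OF V W z(2)] z(1) by force
  qed
  fix X :: "(nat \<Rightarrow> 'k) set" and f g y
  assume X: "X \<in> jobj" and f: "f \<in> jmor V W" and g: "g \<in> jmor W X" and y: "y \<in> topspace (fobj B V)"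
  obtain x where x: "x \<in> topspace (fobj A V)" "y = \<iota> V x"
    using y im[OF V] by blast
  show "fmor B V X (compose V g f) y = fmor B W X g (fmor B V W f y)"
    unfolding x(2) nat[OF V W f x(1)] nat[OF W X g fmor_in[OF A V W f x(1)]]
      nat[OF V X jmor_compose[OF f g jobjD(1)[OF V]] x(1)] continuous_functorD(6)[OF A V W X f g x(1)] ..
qed

lemma continuous_functor_relabel:
  assumes e: "inj e" and F: "continuous_functor F"
  shows "continuous_functor (relabel e F)"
proof (rule continuous_functor_transport[OF F, where \<iota> = "\<lambda>_. e"])
  show "homeomorphic_map (fobj F V) (fobj (relabel e F) V) e" for V
    using e by (simp add: relabel_def homeomorphic_map_final_topology inj_on_def)
qed (simp_all add: relabel_def inv_f_f[OF e])

section \<open>Telescopes of continuous functors\<close>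

locale telescope_data =
  fixes S :: "nat \<Rightarrow> ('k::rc_field, 'a, 'z) tfun_scheme"
    and r :: "(nat \<Rightarrow> 'k) set \<Rightarrow> nat \<Rightarrow> 'a \<Rightarrow> 'a"
  assumes S: "continuous_functor (S k)"
    and r_cont: "V \<in> jobj \<Longrightarrow> continuous_map (fobj (S k) V) (fobj (S (Suc k)) V) (r V k)"
    and r_base: "V \<in> jobj \<Longrightarrow> r V k (fbase (S k) V) = fbase (S (Suc k)) V"
    and r_nat: "V \<in> jobj \<Longrightarrow> W \<in> jobj \<Longrightarrow> f \<in> jmor V W \<Longrightarrow> x \<in> topspace (fobj (S k) V) \<Longrightarrow>
      fmor (S (Suc k)) V W f (r V k x) = r W k (fmor (S k) V W f x)"
begin

abbreviation tele :: "(nat \<Rightarrow> 'k) set \<Rightarrow> (nat \<times> real \<times> 'a) topology" where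
  "tele V \<equiv> telescope (\<lambda>k. fobj (S k) V) (\<lambda>k. fbase (S k) V) (r V)"

lemma telescope_system: "V \<in> jobj \<Longrightarrow> telescope_system (\<lambda>k. fobj (S k) V) (\<lambda>k. fbase (S k) V) (r V)"
  using continuous_functorD(1,2)[OF S] r_cont r_base by unfold_locales

lemma telescope_functor_simps:
  "fobj (telescope_functor S r) V = tele V"
  "fbase (telescope_functor S r) V = telescope_base (\<lambda>k. fbase (S k) V)"
  "fmor (telescope_functor S r) V W f = telescope_map (\<lambda>k. fbase (S k) W) (r W) (\<lambda>k. fmor (S k) V W f)"
  by (simp_all add: telescope_functor_def)

lemma fmor_pt:
  assumes V: "V \<in> jobj" and W: "W \<in> jobj" and f: "f \<in> jmor V W" and x: "x \<in> topspace (fobj (S k) V)"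
  shows "fmor (telescope_functor S r) V W f (telescope_pt (\<lambda>k. fbase (S k) V) (r V) (k, s, x))
    = telescope_pt (\<lambda>k. fbase (S k) W) (r W) (k, s, fmor (S k) V W f x)"
  unfolding telescope_functor_simps
  by (rule telescope_system.telescope_map_pt[OF telescope_system[OF V]])
    (simp_all add: continuous_functorD(4)[OF S V W f] r_base[OF W] r_nat[OF V W f x])

lemma tele_cases:
  assumes V: "V \<in> jobj" and p: "p \<in> topspace (tele V)"
  obtains k s x where "x \<in> topspace (fobj (S k) V)" "p = telescope_pt (\<lambda>k. fbase (S k) V) (r V) (k, s, x)"
  using telescope_system.tel_cases[OF telescope_system[OF V] p] by metis

theorem continuous_functor_telescope: "continuous_functor (telescope_functor S r)"
  unfolding continuous_functor_def based_space_def
proof (intro conjI ballI)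
  let ?T = "telescope_functor S r"
  fix V :: "(nat \<Rightarrow> 'k) set" assume V: "V \<in> jobj"
  show "cgwh_space (fobj ?T V)" "fbase ?T V \<in> topspace (fobj ?T V)"
    unfolding telescope_functor_simps
    using telescope_system.cgwh_tel[OF telescope_system[OF V]] telescope_system.base_in_tel[OF telescope_system[OF V]]
    by blast+
  show "fmor ?T V V (incl V) p = p" if p: "p \<in> topspace (fobj ?T V)" for p
  proof -
    obtain k s x where x: "x \<in> topspace (fobj (S k) V)" "p = telescope_pt (\<lambda>k. fbase (S k) V) (r V) (k, s, x)"
      using tele_cases[OF V] p by (metis telescope_functor_simps(1))
    show ?thesis
      using fmor_pt[OF V V incl_jmor[OF order_refl jobjD(1)[OF V]] x(1)] continuous_functorD(5)[OF S V x(1)]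
      by (simp add: x(2))
  qed
  fix W :: "(nat \<Rightarrow> 'k) set" assume W: "W \<in> jobj"
  have base_pt: "telescope_pt (\<lambda>k. fbase (S k) V) (r V) (0, 0, fbase (S 0) V) = telescope_base (\<lambda>k. fbase (S k) V)" for V
    by (simp add: telescope_pt_def)
  show "fmor ?T V W f (fbase ?T V) = fbase ?T W" if f: "f \<in> jmor V W" for f
    using fmor_pt[OF V W f continuous_functorD(2)[OF S V], of 0 0] continuous_functorD(4)[OF S V W f, of 0]
    by (simp add: base_pt telescope_functor_simps(2))
  show "continuous_map (prod_topology (jmor_top V W) (fobj ?T V)) (fobj ?T W) (\<lambda>(f, x). fmor ?T V W f x)"
    unfolding telescope_functor_simps
    using continuous_functorD(3)[OF S V W] continuous_functorD(4)[OF S V W] r_nat[OF V W]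
    by (intro continuous_map_telescope_map telescope_system V W compact_jmor_top Hausdorff_jmor_top)
      (auto simp: topspace_jmor_top)
  fix X :: "(nat \<Rightarrow> 'k) set" and f g p
  assume X: "X \<in> jobj" and f: "f \<in> jmor V W" and g: "g \<in> jmor W X" and p: "p \<in> topspace (fobj ?T V)"
  obtain k s x where x: "x \<in> topspace (fobj (S k) V)" "p = telescope_pt (\<lambda>k. fbase (S k) V) (r V) (k, s, x)"
    using tele_cases[OF V] p by (metis telescope_functor_simps(1))
  show "fmor ?T V X (compose V g f) p = fmor ?T W X g (fmor ?T V W f p)"
    unfolding x(2) fmor_pt[OF V W f x(1)] fmor_pt[OF W X g fmor_in[OF S V W f x(1)]]
      fmor_pt[OF V X jmor_compose[OF f g jobjD(1)[OF V]] x(1)]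
    using continuous_functorD(6)[OF S V W X f g x(1)] by simp
qed

end

lemma inj_Base: "inj Base"
  by (simp add: inj_def)

lemma inj_Node: "inj Node"
  by (simp add: inj_def)

text \<open>The recursion is stated field by field so that it covers both towers, the complex stages
  being records with an additional component.\<close>

locale holim_tower = frame_poset m P for m :: nat and P :: "(nat \<Rightarrow> 'k::rc_field) set topology" +
  fixes S :: "nat \<Rightarrow> ('k, ('k, 'a) tower, 'z) tfun_scheme"
  assumes S_0: "continuous_functor (S 0)"
    and S_Suc: "fobj (S (Suc k)) = fobj (relabel Node (holim_functor m P (S k)))"
      "fbase (S (Suc k)) = fbase (relabel Node (holim_functor m P (S k)))"
      "fmor (S (Suc k)) = fmor (relabel Node (holim_functor m P (S k)))"
begin

lemma continuous_functor_S: "continuous_functor (S k)"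
proof (induction k)
  case (Suc k)
  then interpret H: holim_data m P "S k"
    by unfold_locales
  show ?case
    using continuous_functor_relabel[OF inj_Node H.continuous_functor_H] continuous_functor_cong[OF S_Suc] by blast
qed (rule S_0)

lemma holim_data_S: "holim_data m P (S k)"
  using continuous_functor_S by unfold_locales

sublocale telescope_data S "stage_map m P S"
proof
  fix k
  interpret H: holim_data m P "S k"
    by (rule holim_data_S)
  show "continuous_functor (S k)"
    by (rule continuous_functor_S)
  fix V :: "(nat \<Rightarrow> 'k) set" assume V: "V \<in> jobj"
  have "continuous_map (fobj H.H V) (final_topology Node (fobj H.H V)) Node"
    by (intro quotient_imp_continuous_map quotient_map_final_topology)
  from continuous_map_compose[OF H.continuous_map_holim_unit[OF V] this]
  show "continuous_map (fobj (S k) V) (fobj (S (Suc k)) V) (stage_map m P S V k)"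
    unfolding S_Suc by (simp add: relabel_def comp_def stage_map_def[abs_def])
  show "stage_map m P S V k (fbase (S k) V) = fbase (S (Suc k)) V"
    unfolding S_Suc by (simp add: relabel_def stage_map_def H.fbase_H[OF V])
  fix W :: "(nat \<Rightarrow> 'k) set" and f x
  assume W: "W \<in> jobj" and f: "f \<in> jmor V W" and x: "x \<in> topspace (fobj (S k) V)"
  show "fmor (S (Suc k)) V W f (stage_map m P S V k x) = stage_map m P S W k (fmor (S k) V W f x)"
    unfolding S_Suc
    by (simp add: relabel_def stage_map_def inv_f_f[OF inj_Node] H.holim_unit_natural[OF V W f x])
qed

end


section \<open>Complexification\<close>

abbreviation re_part :: "(nat \<Rightarrow> complex) \<Rightarrow> (nat \<Rightarrow> real)" where
  "re_part z \<equiv> (\<lambda>i. Re (z i))"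

abbreviation im_part :: "(nat \<Rightarrow> complex) \<Rightarrow> (nat \<Rightarrow> real)" where
  "im_part z \<equiv> (\<lambda>i. Im (z i))"

abbreviation cpx :: "(nat \<Rightarrow> real) \<Rightarrow> (nat \<Rightarrow> real) \<Rightarrow> (nat \<Rightarrow> complex)" where
  "cpx x y \<equiv> (\<lambda>i. Complex (x i) (y i))"

lemma mem_complexify: "z \<in> complexify V \<longleftrightarrow> re_part z \<in> V \<and> im_part z \<in> V"
proof
  assume "re_part z \<in> V \<and> im_part z \<in> V"
  then show "z \<in> complexify V"
    unfolding complexify_def by (intro CollectI exI[of _ "re_part z"] exI[of _ "im_part z"] conjI) auto
qed (auto simp: complexify_def)

lemma cpx_in_complexify: "x \<in> V \<Longrightarrow> y \<in> V \<Longrightarrow> cpx x y \<in> complexify V"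
  by (simp add: mem_complexify)

lemma complexify_inj: "complexify U = complexify U' \<longleftrightarrow> U = U'"
proof
  assume eq: "complexify U = complexify U'"
  have "x \<in> U \<longleftrightarrow> cpx x x \<in> complexify U" for x and U :: "(nat \<Rightarrow> real) set"
    by (simp add: mem_complexify)
  then show "U = U'"
    using eq by blast
qed simp

lemma complexify_std [simp]: "complexify (std k) = std k"
  by (auto simp: mem_complexify std_def complex_eq_iff)

lemma re_im_scale:
  "re_part (scale_fun c z) = scale_fun (Re c) (re_part z) - scale_fun (Im c) (im_part z)"
  "im_part (scale_fun c z) = scale_fun (Re c) (im_part z) + scale_fun (Im c) (re_part z)"
  by (auto simp: scale_fun_def)

lemma re_im_add: "re_part (z + w) = re_part z + re_part w" "im_part (z + w) = im_part z + im_part w"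
  by auto

lemma subspace_complexify:
  assumes V: "fs.subspace V"
  shows "fs.subspace (complexify V)"
  unfolding fs.subspace_def
proof (intro conjI ballI allI)
  have "re_part 0 = 0" "im_part 0 = 0"
    by auto
  then show "0 \<in> complexify V"
    using fs.subspace_0[OF V] unfolding mem_complexify by simp
  fix x assume x: "x \<in> complexify V"
  show "scale_fun c x \<in> complexify V" for c
    using x V unfolding mem_complexify re_im_scale
    by (auto intro: fs.subspace_diff fs.subspace_add fs.subspace_scale)
  fix y assume "y \<in> complexify V"
  then show "x + y \<in> complexify V"
    using x V unfolding mem_complexify re_im_add by (auto intro: fs.subspace_add)
qed

lemma fin_supp_complexify:
  assumes "\<And>x. x \<in> V \<Longrightarrow> fin_supp x" "z \<in> complexify V"
  shows "fin_supp z"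
proof -
  have "finite ({i. Re (z i) \<noteq> 0} \<union> {i. Im (z i) \<noteq> 0})"
    using assms by (auto simp: mem_complexify fin_supp_def)
  then show ?thesis
    unfolding fin_supp_def by (rule finite_subset[rotated]) (auto simp: complex_eq_iff)
qed

lemma complexify_jobj:
  assumes V: "V \<in> jobj"
  shows "complexify V \<in> jobj"
proof -
  obtain B where B: "finite B" "V = fs.span B"
    using jobjD(4)[OF V] by blast
  let ?B = "(\<lambda>b. cpx b 0) ` B"
  have 1: "cpx x 0 \<in> fs.span ?B" if "x \<in> fs.span B" for x
    using that
  proof (induction rule: fs.span_induct_alt)
    case base
    have "cpx 0 0 = 0"
      by (auto simp: complex_eq_iff)
    then show ?case
      by (simp only: fs.span_zero)
  next
    case (step c x y)
    have "cpx (scale_fun c x + y) 0 = scale_fun (complex_of_real c) (cpx x 0) + cpx y 0"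
      by (auto simp: scale_fun_def complex_eq_iff)
    moreover have "cpx x 0 \<in> fs.span ?B"
      using step by (intro fs.span_base) auto
    ultimately show ?case
      using step by (simp only: fs.span_add fs.span_scale)
  qed
  have sub: "fs.subspace (complexify V)"
    using subspace_complexify jobjD(1)[OF V] by blast
  have "complexify V = fs.span ?B"
  proof
    show "complexify V \<subseteq> fs.span ?B"
    proof
      fix z assume z: "z \<in> complexify V"
      have "z = cpx (re_part z) 0 + scale_fun \<i> (cpx (im_part z) 0)"
        by (auto simp: scale_fun_def complex_eq_iff)
      moreover have "cpx (re_part z) 0 + scale_fun \<i> (cpx (im_part z) 0) \<in> fs.span ?B"
        using z B 1 by (intro fs.span_add fs.span_scale) (auto simp: mem_complexify)
      ultimately show "z \<in> fs.span ?B"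
        by (simp only:)
    qed
    have "cpx b 0 \<in> complexify V" if "b \<in> B" for b
      using that fs.span_base B(2) fs.subspace_0[OF jobjD(1)[OF V]] by (intro cpx_in_complexify) (auto simp: zero_fun_def)
    then show "fs.span ?B \<subseteq> complexify V"
      using sub by (intro fs.span_minimal) auto
  qed
  moreover have "vconj z \<in> complexify V" if "z \<in> complexify V" for z
  proof -
    have "re_part (vconj z) = re_part z" "im_part (vconj z) = - im_part z"
      by (auto simp: vconj_def cconj_complex_def)
    then show ?thesis
      using that fs.subspace_neg[OF jobjD(1)[OF V]] unfolding mem_complexify by simp
  qed
  ultimately show ?thesis
    using sub B(1) fin_supp_complexify[OF jobjD(2)[OF V]] unfolding jobj_def fin_supp_def by blast
qed

lemma mor_complexify_apply:
  "z \<in> complexify V \<Longrightarrow> mor_complexify V f z = cpx (f (re_part z)) (f (im_part z))"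
  by (simp add: mor_complexify_def)

lemma hinner_complex:
  assumes "fin_supp z"
  shows "hinner z w = Complex (hinner (re_part z) (re_part w) + hinner (im_part z) (im_part w))
    (hinner (re_part z) (im_part w) - hinner (im_part z) (re_part w))"
proof -
  obtain N where N: "z \<in> std N"
    using fin_supp_in_std[OF assms] .
  then have "re_part z \<in> std N" "im_part z \<in> std N"
    by (auto simp: std_def)
  then show ?thesis
    unfolding hinner_std[OF N]
    by (simp add: hinner_std[of _ N] complex_eq_iff cconj_complex_def cconj_real_def sum.distrib sum_subtractf)
qed

lemma mor_complexify_jmor:
  assumes f: "f \<in> jmor V W" and V: "V \<in> jobj" and W: "W \<in> jobj"
  shows "mor_complexify V f \<in> jmor (complexify V) (complexify W)"
proof (rule jmorI)
  show "mor_complexify V f \<in> extensional (complexify V)"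
    by (simp add: mor_complexify_def)
  fix z assume z: "z \<in> complexify V"
  then have zV: "re_part z \<in> V" "im_part z \<in> V"
    by (auto simp: mem_complexify)
  note V' = jobjD(1)[OF V]
  show fz: "mor_complexify V f z \<in> complexify W"
    using z zV jmorD(1)[OF f] by (simp add: mor_complexify_apply cpx_in_complexify)
  show "mor_complexify V f (scale_fun c z) = scale_fun c (mor_complexify V f z)" for c
  proof -
    have "f (re_part (scale_fun c z)) = scale_fun (Re c) (f (re_part z)) - scale_fun (Im c) (f (im_part z))"
      "f (im_part (scale_fun c z)) = scale_fun (Re c) (f (im_part z)) + scale_fun (Im c) (f (re_part z))"
      unfolding re_im_scale
      using jmor_diff[OF f V' fs.subspace_scale[OF V' zV(1)] fs.subspace_scale[OF V' zV(2)]]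
        jmorD(3)[OF f fs.subspace_scale[OF V' zV(2)] fs.subspace_scale[OF V' zV(1)]]
        jmorD(4)[OF f zV(1)] jmorD(4)[OF f zV(2)] by simp_all
    moreover have "scale_fun c z \<in> complexify V"
      using fs.subspace_scale[OF subspace_complexify[OF V'] z] .
    ultimately show ?thesis
      using z by (simp add: mor_complexify_apply scale_fun_def complex_eq_iff fun_eq_iff)
  qed
  fix w assume w: "w \<in> complexify V"
  then have wV: "re_part w \<in> V" "im_part w \<in> V"
    by (auto simp: mem_complexify)
  show "mor_complexify V f (z + w) = mor_complexify V f z + mor_complexify V f w"
  proof -
    have "f (re_part (z + w)) = f (re_part z) + f (re_part w)" "f (im_part (z + w)) = f (im_part z) + f (im_part w)"
      unfolding re_im_add using jmorD(3)[OF f zV(1) wV(1)] jmorD(3)[OF f zV(2) wV(2)] by simp_all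
    moreover have "z + w \<in> complexify V"
      using fs.subspace_add[OF subspace_complexify[OF V'] z w] .
    ultimately show ?thesis
      using z w by (simp add: mor_complexify_apply complex_eq_iff fun_eq_iff)
  qed
  have "hinner (mor_complexify V f z) (mor_complexify V f w) =
    Complex (hinner (f (re_part z)) (f (re_part w)) + hinner (f (im_part z)) (f (im_part w)))
      (hinner (f (re_part z)) (f (im_part w)) - hinner (f (im_part z)) (f (re_part w)))"
    using z w hinner_complex[OF fin_supp_complexify[OF jobjD(2)[OF W] fz]] by (simp add: mor_complexify_apply)
  also have "\<dots> = hinner z w"
    using hinner_complex[OF fin_supp_complexify[OF jobjD(2)[OF V] z], of w] zV wV by (simp add: jmorD(5)[OF f])
  finally show "hinner (mor_complexify V f z) (mor_complexify V f w) = hinner z w" .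
qed

lemma mor_complexify_incl: "mor_complexify V (incl V) = incl (complexify V)"
  by (auto simp: mor_complexify_def incl_def mem_complexify fun_eq_iff)

lemma mor_complexify_compose:
  assumes "f \<in> jmor U V"
  shows "mor_complexify U (compose U g f) = compose (complexify U) (mor_complexify V g) (mor_complexify U f)"
proof
  fix z
  show "mor_complexify U (compose U g f) z = compose (complexify U) (mor_complexify V g) (mor_complexify U f) z"
  proof (cases "z \<in> complexify U")
    case True
    then have "f (re_part z) \<in> V" "f (im_part z) \<in> V"
      using jmorD(1)[OF assms] by (auto simp: mem_complexify)
    then show ?thesis
      using True by (simp add: compose_def mor_complexify_def cpx_in_complexify) (simp add: mem_complexify)
  qed (simp add: compose_def mor_complexify_def)
qed

lemma complexify_dsum: "U \<subseteq> std m \<Longrightarrow> complexify (dsum m V U) = dsum m (complexify V) (complexify U)"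
proof -
  assume U: "U \<subseteq> std m"
  have cU: "complexify U \<subseteq> std m"
    using U by (auto simp: mem_complexify std_def complex_eq_iff subset_eq)
  have "tail_part m (re_part z) = re_part (tail_part m z)" "tail_part m (im_part z) = im_part (tail_part m z)"
    "head_part m (re_part z) = re_part (head_part m z)" "head_part m (im_part z) = im_part (head_part m z)" for z
    by (auto simp: tail_part_def head_part_def)
  then show ?thesis
    by (auto simp: mem_complexify mem_dsum_iff[OF U] mem_dsum_iff[OF cU])
qed

lemma complexify_std_subset: "U \<subseteq> std m \<Longrightarrow> complexify U \<subseteq> std m"
  by (auto simp: mem_complexify std_def complex_eq_iff subset_eq)

lemma mor_complexify_mor_sum:
  assumes U: "U \<subseteq> std m"
  shows "mor_complexify (dsum m V U) (mor_sum m V U f g)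
    = mor_sum m (complexify V) (complexify U) (mor_complexify V f) (mor_complexify U g)"
proof
  fix z
  show "mor_complexify (dsum m V U) (mor_sum m V U f g) z
    = mor_sum m (complexify V) (complexify U) (mor_complexify V f) (mor_complexify U g) z"
  proof (cases "z \<in> complexify (dsum m V U)")
    case True
    then have z: "z \<in> dsum m (complexify V) (complexify U)"
      by (simp add: complexify_dsum[OF U])
    then have ht: "tail_part m z \<in> complexify V" "head_part m z \<in> complexify U"
      using complexify_std_subset[OF U] by (auto simp: mem_dsum_iff)
    have eq: "tail_part m (re_part z) = re_part (tail_part m z)" "tail_part m (im_part z) = im_part (tail_part m z)"
      "head_part m (re_part z) = re_part (head_part m z)" "head_part m (im_part z) = im_part (head_part m z)"
      by (auto simp: tail_part_def head_part_def)
    have ri: "re_part z \<in> dsum m V U" "im_part z \<in> dsum m V U"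
      using True by (auto simp: mem_complexify)
    have "mor_complexify (dsum m V U) (mor_sum m V U f g) z = cpx (mor_sum m V U f g (re_part z)) (mor_sum m V U f g (im_part z))"
      by (rule mor_complexify_apply[OF True])
    also have "\<dots> = join m (mor_complexify V f (tail_part m z)) (mor_complexify U g (head_part m z))"
      using ri unfolding mor_sum_def mor_complexify_apply[OF ht(1)] mor_complexify_apply[OF ht(2)]
      by (auto simp: eq join_def)
    also have "\<dots> = mor_sum m (complexify V) (complexify U) (mor_complexify V f) (mor_complexify U g) z"
      using z by (simp add: mor_sum_def)
    finally show ?thesis .
  next
    case False
    then show ?thesis
      by (simp add: mor_complexify_def mor_sum_def complexify_dsum[OF U])
  qed
qed

lemma mor_complexify_incl_sum: "mor_complexify V (incl_sum m V) = incl_sum m (complexify V)"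
proof
  fix z
  show "mor_complexify V (incl_sum m V) z = incl_sum m (complexify V) z"
  proof (cases "z \<in> complexify V")
    case True
    then have "re_part z \<in> V" "im_part z \<in> V"
      by (auto simp: mem_complexify)
    then show ?thesis
      using True unfolding mor_complexify_apply[OF True] by (auto simp: incl_sum_def join_def complex_eq_iff)
  qed (simp add: mor_complexify_def incl_sum_def)
qed

lemma mor_complexify_image:
  assumes f: "f \<in> jmor V W" and V: "fs.subspace V"
  shows "mor_complexify V f ` complexify V = complexify (f ` V)"
proof (intro equalityI subsetI)
  fix w assume "w \<in> mor_complexify V f ` complexify V"
  then obtain z where "z \<in> complexify V" "w = cpx (f (re_part z)) (f (im_part z))"
    using mor_complexify_apply by blast
  then show "w \<in> complexify (f ` V)"
    by (auto simp: mem_complexify)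
next
  fix w assume "w \<in> complexify (f ` V)"
  then obtain x y where xy: "x \<in> V" "y \<in> V" "re_part w = f x" "im_part w = f y"
    by (auto simp: mem_complexify)
  have "mor_complexify V f (cpx x y) = cpx (f x) (f y)"
    using mor_complexify_apply[OF cpx_in_complexify[OF xy(1,2)]] by simp
  also have "\<dots> = w"
    unfolding xy(3,4)[symmetric] by simp
  finally show "w \<in> mor_complexify V f ` complexify V"
    using imageI[OF cpx_in_complexify[OF xy(1,2)], of "mor_complexify V f"] by simp
qed

lemma continuous_map_Complex:
  assumes "continuous_map X euclidean f" "continuous_map X euclidean g"
  shows "continuous_map X euclidean (\<lambda>z. Complex (f z) (g z))"
proof -
  have of_real: "continuous_map X euclidean (\<lambda>z. complex_of_real (h z))" if "continuous_map X euclidean h" for h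
    using continuous_map_compose[OF that, of euclidean complex_of_real] by (simp add: comp_def continuous_on_of_real_id)
  show ?thesis
    unfolding Complex_eq
    using assms by (intro continuous_map_add continuous_map_field_mult of_real) auto
qed

lemma continuous_map_mor_complexify:
  assumes h: "continuous_map X (jmor_top V W) h" and V: "V \<in> jobj" and W: "W \<in> jobj"
  shows "continuous_map X (jmor_top (complexify V) (complexify W)) (\<lambda>z. mor_complexify V (h z))"
  unfolding continuous_map_into_jmor_top
proof (intro conjI ballI allI)
  show "mor_complexify V (h z) \<in> jmor (complexify V) (complexify W)" if "z \<in> topspace X" for z
    using h that V W mor_complexify_jmor by (auto simp: continuous_map_into_jmor_top)
  fix x i assume x: "x \<in> complexify V"
  then have "re_part x \<in> V" "im_part x \<in> V"
    by (auto simp: mem_complexify)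
  then show "continuous_map X euclidean (\<lambda>z. mor_complexify V (h z) x i)"
    unfolding mor_complexify_apply[OF x]
    by (intro continuous_map_Complex continuous_map_jmor_coordinate[OF h])
qed

section \<open>The two posets and their nerves\<close>

lemma frame_poset_O: "frame_poset m (O_poset m)"
proof
  show "\<exists>S. O_poset m = subtopology (Grassmannians m) S"
    unfolding O_poset_def by (metis subtopology_UNIV)
  fix U assume "U \<in> topspace (O_poset m)"
  then obtain k g where g: "g \<in> jmor (std k) (std m :: (nat \<Rightarrow> real) set)" "U = g ` std k"
    unfolding O_poset_def topspace_Grassmannians by blast
  have sub: "fs.subspace U"
    unfolding g(2) by (rule subspace_jmor_image[OF g(1) subspace_std])
  have "U = fs.span (g ` basis_vec ` {..<k})"
  proof
    show "fs.span (g ` basis_vec ` {..<k}) \<subseteq> U"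
      using sub basis_vec_in_std by (intro fs.span_minimal) (auto simp: g(2))
    show "U \<subseteq> fs.span (g ` basis_vec ` {..<k})"
    proof
      fix u assume "u \<in> U"
      then obtain x where x: "x \<in> std k" "u = g x"
        using g(2) by blast
      have "u = (\<Sum>l<k. scale_fun (x l) (g (basis_vec l)))"
        using jmor_frame_expand[OF g(1) x(1)] x(2) by (auto simp: fun_eq_iff scale_fun_def sum_fun_apply)
      then show "u \<in> fs.span (g ` basis_vec ` {..<k})"
        by (simp only:) (auto intro!: fs.span_sum fs.span_scale intro: fs.span_base)
    qed
  qed
  then have "\<exists>B. finite B \<and> U = fs.span B"
    by (intro exI[of _ "g ` basis_vec ` {..<k}"] conjI) simp_all
  moreover have "fin_supp u" if "u \<in> U" for u
    using that jmorD(1)[OF g(1)] fin_supp_std g(2) by blast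
  moreover have "vconj u = u" for u :: "nat \<Rightarrow> real"
    by (simp add: vconj_def cconj_real_def)
  ultimately show "U \<in> jobj"
    using sub unfolding jobj_def fin_supp_def by simp
qed

lemma complexify_Grassmannian:
  assumes "k \<in> {1..m}" "g \<in> jmor (std k) (std m)"
  shows "mor_complexify (std k) g \<in> jmor (std k) (std m)"
    "mor_complexify (std k) g ` std k = complexify (g ` std k)"
  using mor_complexify_jmor[OF assms(2) std_jobj std_jobj] mor_complexify_image[OF assms(2) subspace_std] by simp_all

lemma topspace_R_poset: "topspace (R_poset m) = complexify ` topspace (O_poset m)"
proof -
  have "complexify U \<in> topspace (Grassmannians m)" if "U \<in> topspace (O_poset m)" for U
    using that complexify_Grassmannian unfolding O_poset_def topspace_Grassmannians by blast
  then show ?thesis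
    unfolding R_poset_def by auto
qed

lemma frame_poset_R: "frame_poset m (R_poset m)"
proof
  show "\<exists>S. R_poset m = subtopology (Grassmannians m) S"
    unfolding R_poset_def by blast
  fix U assume "U \<in> topspace (R_poset m)"
  then show "U \<in> jobj"
    using complexify_jobj frame_poset.P_jobj[OF frame_poset_O] unfolding topspace_R_poset by blast
qed

text \<open>The real side is a quotient of real frames, the complex side a subspace of a quotient of
  complex frames, so the inverse has no direct description on frames. A continuous bijection from a
  compact to a Hausdorff space settles it.\<close>

lemma homeomorphic_map_complexify: "homeomorphic_map (O_poset m) (R_poset m) complexify"
proof (rule continuous_imp_homeomorphic_map)
  show "compact_space (O_poset m)"
    unfolding O_poset_def by (rule compact_Grassmannians)
  show "Hausdorff_space (R_poset m)"
    using frame_poset.Hausdorff_P[OF frame_poset_R] .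
  show "complexify ` topspace (O_poset m) = topspace (R_poset m)"
    by (simp add: topspace_R_poset)
  show "inj_on complexify (topspace (O_poset m))"
    by (simp add: inj_on_def complexify_inj)
  show "continuous_map (O_poset m) (R_poset m) complexify"
  proof (rule frame_poset.continuous_map_into_P[OF frame_poset_R])
    show "continuous_map (O_poset m) (Grassmannians m) complexify"
      unfolding O_poset_def
    proof (rule continuous_map_from_Grassmannians)
      fix k assume k: "k \<in> {1..m}"
      have "continuous_map (jmor_top (std k) (std m)) (jmor_top (std k) (std m)) (mor_complexify (std k))"
        using continuous_map_mor_complexify[of "jmor_top (std k) (std m)" "std k" "std m" "\<lambda>g. g"]
        by (simp add: std_jobj)
      from continuous_map_compose[OF this continuous_map_Grassmannians[OF k]]
      show "continuous_map (jmor_top (std k) (std m)) (Grassmannians m) (\<lambda>g. complexify (g ` std k))"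
        by (rule continuous_map_eq) (simp add: topspace_jmor_top complexify_Grassmannian[OF k])
    qed
    show "complexify \<in> topspace (O_poset m) \<rightarrow> topspace (R_poset m)"
      by (simp add: topspace_R_poset)
  qed
qed

definition nerve_map :: "((nat \<Rightarrow> 'k) set \<Rightarrow> (nat \<Rightarrow> 'l) set) \<Rightarrow> 'k nerve_pt \<Rightarrow> 'l nerve_pt" where
  "nerve_map h = (\<lambda>(p, C, t). (p, restrict (h \<circ> C) {..p}, t))"

lemma continuous_map_nerve_map:
  assumes h: "continuous_map P Q h"
    and mono: "\<And>U U'. U \<in> topspace P \<Longrightarrow> U' \<in> topspace P \<Longrightarrow> U \<subseteq> U' \<Longrightarrow> h U \<subseteq> h U'"
  shows "continuous_map (nerve_space P) (nerve_space Q) (nerve_map h)"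
proof -
  let ?D = "\<lambda>p. subtopology (powertop_real UNIV) (standard_simplex p)"
  have "continuous_map (prod_topology (chains P p) (?D p)) (nerve_space Q) (\<lambda>z. (p, restrict (h \<circ> fst z) {..p}, snd z))" for p
  proof -
    have "continuous_map (chains P p) (chains Q p) (\<lambda>C. restrict (h \<circ> C) {..p})"
      unfolding chains_def[of Q] continuous_map_in_subtopology
    proof
      have "continuous_map (chains P p) Q (\<lambda>C. restrict (h \<circ> C) {..p} i)" if "i \<in> {..p}" for i
      proof -
        have "continuous_map (chains P p) P (\<lambda>C. C i)"
          unfolding chains_def using that by (intro continuous_map_from_subtopology continuous_map_product_coordinates)
        from continuous_map_compose[OF this h] show ?thesis
          using that by (simp add: comp_def)
      qed
      then show "continuous_map (chains P p) (product_topology (\<lambda>_. Q) {..p}) (\<lambda>C. restrict (h \<circ> C) {..p})"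
        by (auto simp: continuous_map_componentwise)
      show "(\<lambda>C. restrict (h \<circ> C) {..p}) \<in> topspace (chains P p) \<rightarrow> {C. \<forall>i j. i \<le> j \<and> j \<le> p \<longrightarrow> C i \<subseteq> C j}"
      proof (intro funcsetI CollectI allI impI)
        fix C i j assume C: "C \<in> topspace (chains P p)" and ij: "i \<le> j \<and> j \<le> p"
        then have "C i \<in> topspace P" "C j \<in> topspace P" "C i \<subseteq> C j"
          by (auto simp: mem_chains)
        then show "restrict (h \<circ> C) {..p} i \<subseteq> restrict (h \<circ> C) {..p} j"
          using mono[of "C i" "C j"] ij by simp
      qed
    qed
    from continuous_map_compose[OF continuous_map_fst this]
    have "continuous_map (prod_topology (chains P p) (?D p)) (prod_topology (chains Q p) (?D p))
        (\<lambda>z. (restrict (h \<circ> fst z) {..p}, snd z))"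
      by (simp add: continuous_map_pairwise comp_def continuous_map_snd)
    from continuous_map_compose[OF this continuous_map_component_injection[of p UNIV "\<lambda>p. prod_topology (chains Q p) (?D p)"]]
    show ?thesis
      by (simp add: comp_def nerve_space_def)
  qed
  then show ?thesis
    unfolding nerve_space_def[of P] nerve_map_def
    by (intro continuous_map_from_sum_topology) (simp add: case_prod_unfold)
qed

section \<open>Comparing the real and the complex homotopy limits\<close>

lemma (in holim_data) continuous_map_from_tot:
  assumes "\<And>k. k \<in> {1..m} \<Longrightarrow> continuous_map (comp V k) Y (\<lambda>q. f (quot V k q))"
  shows "continuous_map (tot V) Y f"
proof -
  have "continuous_map (sum_topology (comp V) {1..m}) Y (f \<circ> (\<lambda>(k, q). quot V k q))"
    using assms by (intro continuous_map_from_sum_topology) (simp add: comp_def)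
  then show ?thesis
    using continuous_compose_quotient_map_eq[OF quotient_map_tot] by blast
qed

definition realify :: "(nat \<Rightarrow> complex) set \<Rightarrow> (nat \<Rightarrow> real) set" where
  "realify U = re_part ` U"

lemma realify_complexify [simp]: "realify (complexify U) = U"
proof
  show "U \<subseteq> realify (complexify U)"
  proof
    fix x assume "x \<in> U"
    then have "cpx x x \<in> complexify U"
      by (simp add: mem_complexify)
    from imageI[OF this, of re_part] show "x \<in> realify (complexify U)"
      by (simp add: realify_def)
  qed
qed (auto simp: realify_def mem_complexify)

lemma complexify_realify:
  assumes "U \<in> topspace (R_poset m)"
  shows "complexify (realify U) = U"
  using assms unfolding topspace_R_poset by (elim imageE) simp

lemma continuous_map_realify: "continuous_map (R_poset m) (O_poset m) realify"
proof -
  obtain g where g: "homeomorphic_maps (O_poset m) (R_poset m) complexify g"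
    using homeomorphic_map_complexify homeomorphic_map_maps by blast
  then have "continuous_map (R_poset m) (O_poset m) g"
    by (simp add: homeomorphic_maps_def)
  then show ?thesis
  proof (rule continuous_map_eq)
    fix U assume "U \<in> topspace (R_poset m)"
    then show "g U = realify U"
      using g by (auto simp: topspace_R_poset homeomorphic_maps_def)
  qed
qed

lemma continuous_map_nerve_complexify:
  "continuous_map (nerve_space (O_poset m)) (nerve_space (R_poset m)) (nerve_map complexify)"
  using homeomorphic_imp_continuous_map[OF homeomorphic_map_complexify]
  by (rule continuous_map_nerve_map) (auto simp: mem_complexify)

lemma continuous_map_nerve_realify:
  "continuous_map (nerve_space (R_poset m)) (nerve_space (O_poset m)) (nerve_map realify)"
  using continuous_map_realify by (rule continuous_map_nerve_map) (auto simp: realify_def)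

lemma nerve_realify_complexify:
  assumes "d \<in> topspace (nerve_space (O_poset m))"
  shows "nerve_map realify (nerve_map complexify d) = d"
proof -
  obtain p C t where d: "d = (p, C, t)"
    by (cases d)
  then have "C \<in> extensional {..p}"
    using assms by (simp add: topspace_nerve mem_chains)
  then show ?thesis
    by (auto simp: d nerve_map_def fun_eq_iff restrict_def extensional_def)
qed

lemma nerve_complexify_realify:
  assumes "d \<in> topspace (nerve_space (R_poset m))"
  shows "nerve_map complexify (nerve_map realify d) = d"
proof -
  obtain p C t where d: "d = (p, C, t)"
    by (cases d)
  then have C: "C \<in> extensional {..p}" "\<And>i. i \<le> p \<Longrightarrow> C i \<in> topspace (R_poset m)"
    using assms by (auto simp: topspace_nerve mem_chains)
  have "complexify (realify (C i)) = C i" if "i \<le> p" for i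
    using complexify_realify C(2)[OF that] .
  then show ?thesis
    using C(1) by (auto simp: d nerve_map_def fun_eq_iff restrict_def extensional_def)
qed

text \<open>Kept outside the locale below because \<open>stage_compare\<close> recurses through it;
  inside the locale it reappears as \<open>\<Phi>\<close>.\<close>

definition holim_compare ::
    "nat \<Rightarrow> ((nat \<Rightarrow> real) set \<Rightarrow> 'a \<Rightarrow> 'b) \<Rightarrow> (nat \<Rightarrow> real) set \<Rightarrow>
     (real nerve_pt \<Rightarrow> (nat \<Rightarrow> real) set \<times> 'a) \<Rightarrow> (complex nerve_pt \<Rightarrow> (nat \<Rightarrow> complex) set \<times> 'b)" where
  "holim_compare m \<phi> V s = (\<lambda>d\<in>topspace (nerve_space (R_poset m)).
     case s (nerve_map realify d) of (U, y) \<Rightarrow> (complexify U, \<phi> (dsum m V U) y))"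

text \<open>What one stage of the real and complex towers must provide for the next. Conjugation
  does not occur here: naturality is asked for complexified isometries, and the identification of
  the image with the fixed points is carried separately by \<open>stage_comparable\<close>.\<close>

locale comparison =
  fixes m :: nat and E :: "(real, 'a, 'z) tfun_scheme" and G :: "(complex, 'b, 'y) tfun_scheme"
    and \<phi> :: "(nat \<Rightarrow> real) set \<Rightarrow> 'a \<Rightarrow> 'b"
  assumes E: "continuous_functor E" and G: "continuous_functor G"
    and \<phi>_emb: "V \<in> jobj \<Longrightarrow> closed_embedding (fobj E V) (fobj G (complexify V)) (\<phi> V)"
    and \<phi>_base: "V \<in> jobj \<Longrightarrow> \<phi> V (fbase E V) = fbase G (complexify V)"
    and \<phi>_nat: "V \<in> jobj \<Longrightarrow> W \<in> jobj \<Longrightarrow> f \<in> jmor V W \<Longrightarrow> x \<in> topspace (fobj E V) \<Longrightarrow>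
      \<phi> W (fmor E V W f x) = fmor G (complexify V) (complexify W) (mor_complexify V f) (\<phi> V x)"
begin

sublocale O: holim_data m "O_poset m" E
  using frame_poset_O E by (simp add: holim_data_def holim_data_axioms_def)

sublocale R: holim_data m "R_poset m" G
  using frame_poset_R G by (simp add: holim_data_def holim_data_axioms_def)

lemma fobject_complexify: "O.fobject U \<Longrightarrow> R.fobject (complexify U)"
  using complexify_std_subset complexify_jobj by (auto simp: O.fobject_def R.fobject_def)

lemma complexify_D: "O.fobject U \<Longrightarrow> complexify (dsum m V U) = dsum m (complexify V) (complexify U)"
  by (simp add: O.fobject_def complexify_dsum)

lemma \<phi>_inj: "V \<in> jobj \<Longrightarrow> x \<in> topspace (fobj E V) \<Longrightarrow> y \<in> topspace (fobj E V) \<Longrightarrow> \<phi> V x = \<phi> V y \<Longrightarrow> x = y"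
  using \<phi>_emb[of V] by (auto simp: closed_embedding_def inj_on_def)

lemma \<phi>_mor_sum:
  assumes V: "V \<in> jobj" and W: "W \<in> jobj" and U: "O.fobject U" and U': "O.fobject U'"
    and f: "f \<in> jmor V W" and g: "g \<in> jmor U U'" and x: "x \<in> topspace (fobj E (dsum m V U))"
  shows "\<phi> (dsum m W U') (fmor E (dsum m V U) (dsum m W U') (mor_sum m V U f g) x)
    = fmor G (dsum m (complexify V) (complexify U)) (dsum m (complexify W) (complexify U'))
        (mor_sum m (complexify V) (complexify U) (mor_complexify V f) (mor_complexify U g)) (\<phi> (dsum m V U) x)"
  using \<phi>_nat[OF O.D_jobj[OF V U] O.D_jobj[OF W U'] O.mor_sum_in[OF V W U U' f g] x]
  using U by (simp add: complexify_D[OF U] complexify_D[OF U'] mor_complexify_mor_sum O.fobject_def)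

definition \<Psi> :: "(nat \<Rightarrow> real) set \<Rightarrow> (nat \<Rightarrow> real) set \<times> 'a \<Rightarrow> (nat \<Rightarrow> complex) set \<times> 'b" where
  "\<Psi> V = (\<lambda>(U, y). (complexify U, \<phi> (dsum m V U) y))"

text \<open>The real poset is the whole Grassmannian, so its frames form the full compact space of
  isometries. This is the compact factor along which \<open>closed_embedding_\<Psi>\<close>
  projects.\<close>

lemma frames_O: "k \<in> {1..m} \<Longrightarrow> O.frames k = jmor_top (std k) (std m)"
proof -
  assume k: "k \<in> {1..m}"
  have "topspace (jmor_top (std k) (std m)) \<subseteq> {g. g ` std k \<in> topspace (O_poset m)}"
    using k unfolding O_poset_def topspace_Grassmannians topspace_jmor_top by blast
  then show ?thesis
    by (rule subtopology_superset)
qed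

lemma frame_complexify:
  assumes "k \<in> {1..m}" "g \<in> topspace (O.frames k)"
  shows "mor_complexify (std k) g \<in> topspace (R.frames k)"
    "mor_complexify (std k) g ` std k = complexify (g ` std k)"
  using assms complexify_Grassmannian[of k m g] unfolding O.topspace_frames R.topspace_frames by (auto simp: topspace_R_poset)

lemma \<Psi>_quot:
  assumes V: "V \<in> jobj" and k: "k \<in> {1..m}" and q: "(g, y) \<in> topspace (O.comp V k)"
  shows "\<Psi> V (O.quot V k (g, y)) = R.quot (complexify V) k (mor_complexify (std k) g, \<phi> (dsum m V (std k)) y)"
proof -
  have g: "g \<in> topspace (O.frames k)" and y: "y \<in> topspace (fobj E (dsum m V (std k)))"
    using q by auto
  show ?thesis
    using \<phi>_mor_sum[OF V V O.fobject_std[OF k] O.fobject_P[OF O.frame_facts(2)[OF g]] O.incl_in[OF V] O.frame_facts(3)[OF g] y]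
    by (simp add: \<Psi>_def O.quot_def R.quot_def O.shift_def R.shift_def mor_complexify_incl frame_complexify[OF k g])
qed

lemma \<phi>_emb_std:
  assumes V: "V \<in> jobj" and k: "k \<in> {1..m}"
  shows "closed_embedding (fobj E (dsum m V (std k))) (fobj G (dsum m (complexify V) (std k))) (\<phi> (dsum m V (std k)))"
  using \<phi>_emb[OF O.D_jobj[OF V O.fobject_std[OF k]]] complexify_D[OF O.fobject_std[OF k], of V] by simp

lemma \<phi>_std_in:
  "V \<in> jobj \<Longrightarrow> k \<in> {1..m} \<Longrightarrow> y \<in> topspace (fobj E (dsum m V (std k))) \<Longrightarrow>
    \<phi> (dsum m V (std k)) y \<in> topspace (fobj G (dsum m (complexify V) (std k)))"
  using \<phi>_emb_std[of V k] by (auto simp: closed_embedding_def continuous_map_def)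

lemma continuous_map_\<Psi>:
  assumes V: "V \<in> jobj"
  shows "continuous_map (O.tot V) (R.tot (complexify V)) (\<Psi> V)"
proof (rule O.continuous_map_from_tot)
  fix k assume k: "k \<in> {1..m}"
  have c: "continuous_map (O.frames k) (R.frames k) (mor_complexify (std k))"
    unfolding continuous_map_in_subtopology
  proof
    show "continuous_map (O.frames k) (jmor_top (std k) (std m)) (mor_complexify (std k))"
      using continuous_map_mor_complexify[of "O.frames k" "std k" "std m" "\<lambda>g. g"] std_jobj[where 'a = real]
      by (simp add: continuous_map_from_subtopology)
    show "mor_complexify (std k) \<in> topspace (O.frames k) \<rightarrow> {g. g ` std k \<in> topspace (R_poset m)}"
      using frame_complexify(1)[OF k] R.topspace_frames by blast
  qed
  have p: "continuous_map (fobj E (dsum m V (std k))) (fobj G (dsum m (complexify V) (std k))) (\<phi> (dsum m V (std k)))"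
    using \<phi>_emb_std[OF V k] by (simp add: closed_embedding_def)
  have "continuous_map (O.comp V k) (R.comp (complexify V) k)
      (\<lambda>q. (mor_complexify (std k) (fst q), \<phi> (dsum m V (std k)) (snd q)))"
    by (rule continuous_map_pairedI)
      (rule continuous_map_compose[OF continuous_map_fst c, unfolded comp_def]
        continuous_map_compose[OF continuous_map_snd p, unfolded comp_def])+
  from continuous_map_compose[OF this R.continuous_map_quot[OF k]]
  show "continuous_map (O.comp V k) (R.tot (complexify V)) (\<lambda>q. \<Psi> V (O.quot V k q))"
  proof (rule continuous_map_eq)
    fix q assume q: "q \<in> topspace (O.comp V k)"
    obtain g y where gy: "q = (g, y)"
      by fastforce
    show "(R.quot (complexify V) k \<circ> (\<lambda>q. (mor_complexify (std k) (fst q), \<phi> (dsum m V (std k)) (snd q)))) q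
        = \<Psi> V (O.quot V k q)"
      using \<Psi>_quot[OF V k, of g y] q by (simp add: gy)
  qed
qed

text \<open>
  Over a fixed complex frame \<open>h\<close> the real frames of the same subspace form a compact space, so the
  preimage of a closed set of the real total space is a projection along a compact factor.
\<close>

lemma closed_embedding_\<Psi>:
  assumes V: "V \<in> jobj"
  shows "closed_embedding (O.tot V) (R.tot (complexify V)) (\<Psi> V)"
  unfolding closed_embedding_def closed_map_def
proof (intro conjI allI impI)
  let ?W = "complexify V"
  have W: "?W \<in> jobj"
    by (rule complexify_jobj[OF V])
  show "continuous_map (O.tot V) (R.tot ?W) (\<Psi> V)"
    by (rule continuous_map_\<Psi>[OF V])
  show "inj_on (\<Psi> V) (topspace (O.tot V))"
  proof (rule inj_onI)
    fix a b assume a: "a \<in> topspace (O.tot V)" and b: "b \<in> topspace (O.tot V)" and eq: "\<Psi> V a = \<Psi> V b"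
    obtain U x where ax: "a = (U, x)" "U \<in> topspace (O_poset m)" "x \<in> topspace (fobj E (dsum m V U))"
      using a by (auto simp: O.topspace_tot[OF V])
    obtain U' y where bx: "b = (U', y)" "U' \<in> topspace (O_poset m)" "y \<in> topspace (fobj E (dsum m V U'))"
      using b by (auto simp: O.topspace_tot[OF V])
    have "U = U'"
      using eq by (simp add: ax bx \<Psi>_def complexify_inj)
    then show "a = b"
      using eq \<phi>_inj[OF O.D_jobj[OF V O.fobject_P[OF ax(2)]] ax(3)] bx(3) by (simp add: ax(1) bx(1) \<Psi>_def)
  qed
  fix A assume A: "closedin (O.tot V) A"
  have AV: "A \<subseteq> topspace (O.tot V)"
    by (rule closedin_subset[OF A])
  show "closedin (R.tot ?W) (\<Psi> V ` A)"
    unfolding R.closedin_tot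
  proof (intro conjI ballI)
    show "\<Psi> V ` A \<subseteq> topspace (R.tot ?W)"
      using AV continuous_map_image_subset_topspace[OF continuous_map_\<Psi>[OF V]] by blast
    fix k assume k: "k \<in> {1..m}"
    let ?X = "prod_topology (O.frames k) (R.comp ?W k)"
    let ?c = "mor_complexify (std k)"
    let ?S = "{x \<in> topspace ?X. ?c (fst x) ` std k = fst (snd x) ` std k}"
    let ?FE = "fobj E (dsum m V (std k))" and ?FG = "fobj G (dsum m ?W (std k))"
    have c1: "continuous_map ?X (jmor_top (std k) (std m)) (\<lambda>x. ?c (fst x))"
    proof -
      have "continuous_map (O.frames k) (jmor_top (std k) (std m)) ?c"
        using continuous_map_mor_complexify[of "O.frames k" "std k" "std m" "\<lambda>g. g"] std_jobj[where 'a = real]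
        by (simp add: continuous_map_from_subtopology)
      from continuous_map_compose[OF continuous_map_fst this] show ?thesis
        by (simp add: comp_def)
    qed
    have c2: "continuous_map ?X (jmor_top (std k) (std m)) (\<lambda>x. fst (snd x))"
      using continuous_map_compose[OF continuous_map_snd continuous_map_into_fulltopology[OF continuous_map_fst],
          of "O.frames k" "jmor_top (std k) (std m)" "{g. g ` std k \<in> topspace (R_poset m)}" ?FG]
      by (simp add: comp_def)
    have c3: "continuous_map ?X ?FG (\<lambda>x. snd (snd x))"
      using continuous_map_compose[OF continuous_map_snd continuous_map_snd] by (simp add: comp_def)
    have S: "closedin ?X ?S"
      using continuous_map_compose[OF c1 continuous_map_Grassmannians[OF k]]
        continuous_map_compose[OF c2 continuous_map_Grassmannians[OF k]]
      by (intro closedin_continuous_maps_eq[OF Hausdorff_Grassmannians]) (simp_all add: comp_def)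
    let ?XS = "subtopology ?X ?S"
    have topS: "topspace ?XS = ?S"
      by (simp only: topspace_subtopology) blast
    \<comment> \<open>For \<open>x = (g, h, z)\<close> this rewrites \<open>z\<close> from the
      complex frame \<open>h\<close> into the complexified real frame \<open>?c g\<close>. The class
      of \<open>(h, z)\<close> comes from \<open>A\<close> exactly when, for some real frame
      \<open>g\<close> of the same subspace, the rewritten coordinate is \<open>\<phi>\<close> of a
      real one representing a point of \<open>A\<close>.\<close>
    let ?l = "\<lambda>x. (fst x, R.shift ?W (std k) (std k) (compose (std k) (jinv (std k) (?c (fst x))) (fst (snd x))) (snd (snd x)))"
    have "continuous_map ?XS (jmor_top (std k) (std k))
        (\<lambda>x. compose (std k) (jinv (std k) (?c (fst x))) (fst (snd x)))"
      by (rule continuous_map_frame_change[OF continuous_map_from_subtopology[OF c1] continuous_map_from_subtopology[OF c2]])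
        (simp only: topS mem_Collect_eq)
    from R.continuous_map_shift[OF W R.fobject_std[OF k] R.fobject_std[OF k] this continuous_map_from_subtopology[OF c3]]
    have l: "continuous_map ?XS (prod_topology (O.frames k) ?FG) ?l"
      by (simp add: continuous_map_pairwise comp_def continuous_map_from_subtopology continuous_map_fst)
    let ?A = "{q \<in> topspace (O.comp V k). O.quot V k q \<in> A}"
    let ?\<phi> = "\<lambda>q. (fst q, \<phi> (dsum m V (std k)) (snd q))"
    have "closedin (O.comp V k) ?A"
      using A k unfolding O.closedin_tot by blast
    then have "closedin (prod_topology (O.frames k) ?FG) (?\<phi> ` ?A)"
      using closed_embedding_prod[OF \<phi>_emb_std[OF V k], of "O.frames k"]
      unfolding closed_embedding_def closed_map_def by blast
    from closedin_continuous_map_preimage[OF l this]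
    have "closedin ?X {x \<in> ?S. ?l x \<in> ?\<phi> ` ?A}"
      unfolding topS using S closedin_trans_full by blast
    moreover have "compact_space (O.frames k)"
      unfolding frames_O[OF k] by (rule compact_jmor_top[OF std_jobj std_jobj])
    ultimately have cl: "closedin (R.comp ?W k) (snd ` {x \<in> ?S. ?l x \<in> ?\<phi> ` ?A})"
      using closed_map_snd unfolding closed_map_def by blast
    have key: "\<Psi> V (O.quot V k (g, y)) = R.quot ?W k (h, z) \<longleftrightarrow> ?c g ` std k = h ` std k \<and>
        \<phi> (dsum m V (std k)) y = R.shift ?W (std k) (std k) (compose (std k) (jinv (std k) (?c g)) h) z"
      if gy: "(g, y) \<in> topspace (O.comp V k)" and hz: "(h, z) \<in> topspace (R.comp ?W k)" for g y h z
    proof -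
      have "(?c g, \<phi> (dsum m V (std k)) y) \<in> topspace (R.comp ?W k)"
        using gy frame_complexify(1)[OF k, of g] \<phi>_std_in[OF V k, of y] by auto
      then show ?thesis
        unfolding \<Psi>_quot[OF V k gy] using R.quot_eq_iff[OF W k _ hz] by blast
    qed
    have "{q \<in> topspace (R.comp ?W k). R.quot ?W k q \<in> \<Psi> V ` A} = snd ` {x \<in> ?S. ?l x \<in> ?\<phi> ` ?A}"
    proof (intro equalityI subsetI)
      fix q assume q: "q \<in> {q \<in> topspace (R.comp ?W k). R.quot ?W k q \<in> \<Psi> V ` A}"
      then obtain h z where hz: "q = (h, z)" "(h, z) \<in> topspace (R.comp ?W k)"
        by (cases q) auto
      obtain a where a: "a \<in> A" "R.quot ?W k (h, z) = \<Psi> V a"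
        using q hz(1) by blast
      \<comment> \<open>A point of \<open>A\<close> is given with a real frame of unknown rank
        \<open>l\<close>; comparing ranks after complexification shows that \<open>l\<close> is
        \<open>k\<close>.\<close>
      have "a \<in> (\<lambda>(k, q). O.quot V k q) ` topspace (sum_topology (O.comp V) {1..m})"
        using subsetD[OF AV a(1)] by (simp only: quotient_imp_surjective_map[OF O.quotient_map_tot])
      then obtain l g y where gy: "l \<in> {1..m}" "(g, y) \<in> topspace (O.comp V l)" "a = O.quot V l (g, y)"
        unfolding topspace_sum_topology by (elim imageE SigmaE) auto
      have "(mor_complexify (std l) g, \<phi> (dsum m V (std l)) y) \<in> topspace (R.comp ?W l)"
        using gy frame_complexify(1)[OF gy(1), of g] \<phi>_std_in[OF V gy(1), of y] by auto
      then have "k = l"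
        using R.quot_rank[OF W hz(2)] a(2) \<Psi>_quot[OF V gy(1,2)] gy(3) by metis
      then have gy': "(g, y) \<in> topspace (O.comp V k)" "a = O.quot V k (g, y)"
        using gy by auto
      have im: "?c g ` std k = h ` std k"
          and eq: "\<phi> (dsum m V (std k)) y = R.shift ?W (std k) (std k) (compose (std k) (jinv (std k) (?c g)) h) z"
        using key[OF gy'(1) hz(2)] a(2) gy'(2) by auto
      have "(g, h, z) \<in> ?S"
        using gy'(1) hz(2) im by auto
      moreover have "?l (g, h, z) = ?\<phi> (g, y)"
        by (simp add: eq)
      moreover have "(g, y) \<in> ?A"
        using gy' a(1) by blast
      ultimately have "(g, h, z) \<in> {x \<in> ?S. ?l x \<in> ?\<phi> ` ?A}"
        by blast
      from imageI[OF this, of snd] show "q \<in> snd ` {x \<in> ?S. ?l x \<in> ?\<phi> ` ?A}"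
        by (simp add: hz(1))
    next
      fix q assume "q \<in> snd ` {x \<in> ?S. ?l x \<in> ?\<phi> ` ?A}"
      then obtain x where x: "x \<in> ?S" "?l x \<in> ?\<phi> ` ?A" "q = snd x"
        by blast
      obtain g h z where ghz: "x = (g, h, z)"
        by (cases x) auto
      obtain q' where q': "q' \<in> ?A" "?l x = ?\<phi> q'"
        using x(2) by blast
      obtain g' y where "q' = (g', y)"
        by (rule prod.exhaust)
      with q' have gy': "(g', y) \<in> ?A" "?l x = ?\<phi> (g', y)"
        by (simp_all only:)
      then have gy: "(g, y) \<in> ?A" "R.shift ?W (std k) (std k) (compose (std k) (jinv (std k) (?c g)) h) z = \<phi> (dsum m V (std k)) y"
        by (auto simp: ghz)
      have hz: "(h, z) \<in> topspace (R.comp ?W k)" and im: "?c g ` std k = h ` std k"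
        using x(1) by (auto simp: ghz)
      have "\<Psi> V (O.quot V k (g, y)) = R.quot ?W k (h, z)"
        using key[of g y h z] gy hz im by auto
      then have "R.quot ?W k (h, z) \<in> \<Psi> V ` A"
        using imageI[of "O.quot V k (g, y)" A "\<Psi> V"] gy(1) by simp
      then show "q \<in> {q \<in> topspace (R.comp ?W k). R.quot ?W k q \<in> \<Psi> V ` A}"
        using hz x(3) ghz by simp
    qed
    then show "closedin (R.comp ?W k) {q \<in> topspace (R.comp ?W k). R.quot ?W k q \<in> \<Psi> V ` A}"
      using cl by simp
  qed
qed

section \<open>The comparison on sections\<close>

abbreviation \<Phi> :: "(nat \<Rightarrow> real) set \<Rightarrow> (real nerve_pt \<Rightarrow> (nat \<Rightarrow> real) set \<times> 'a) \<Rightarrow>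
    (complex nerve_pt \<Rightarrow> (nat \<Rightarrow> complex) set \<times> 'b)" where
  "\<Phi> \<equiv> holim_compare m \<phi>"

lemma \<Phi>_eq: "\<Phi> V s = (\<lambda>d\<in>topspace R.N. \<Psi> V (s (nerve_map realify d)))"
  unfolding holim_compare_def \<Psi>_def by (auto simp: fun_eq_iff restrict_def)

lemma nerve_realify_in: "d \<in> topspace R.N \<Longrightarrow> nerve_map realify d \<in> topspace O.N"
  using continuous_map_nerve_realify[of m] by (auto simp: continuous_map_def)

lemma nerve_complexify_in: "d \<in> topspace O.N \<Longrightarrow> nerve_map complexify d \<in> topspace R.N"
  using continuous_map_nerve_complexify[of m] by (auto simp: continuous_map_def)

lemma incl_fmor:
  assumes V: "V \<in> jobj" and C: "C \<in> topspace (chains (O_poset m) p)" and i: "i \<le> p"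
    and x: "x \<in> topspace (fobj E (dsum m V (C i)))"
  shows "\<phi> (dsum m V (C p)) (fmor E (dsum m V (C i)) (dsum m V (C p)) (incl (dsum m V (C i))) x)
    = fmor G (dsum m (complexify V) (complexify (C i))) (dsum m (complexify V) (complexify (C p)))
       (incl (dsum m (complexify V) (complexify (C i)))) (\<phi> (dsum m V (C i)) x)"
proof -
  have U: "O.fobject (C i)" "O.fobject (C p)"
    using O.chain_fobject[OF C] i by auto
  show ?thesis
    unfolding O.incl_dsum[OF U(1)] R.incl_dsum[OF fobject_complexify[OF U(1)]]
    using \<phi>_mor_sum[OF V V U O.incl_in[OF V] O.chain_incl[OF C i] x] by (simp add: mor_complexify_incl)
qed

lemma \<Phi>_in:
  assumes V: "V \<in> jobj" and s: "s \<in> topspace (fobj O.H V)"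
  shows "\<Phi> V s \<in> topspace (fobj R.H (complexify V))"
  unfolding R.mem_H
proof (intro conjI)
  show "\<Phi> V s \<in> extensional (topspace R.N)"
    by (simp add: \<Phi>_eq)
  have sc: "continuous_map O.N (O.tot V) s"
    using s by (simp add: O.mem_H)
  from continuous_map_compose[OF continuous_map_compose[OF continuous_map_nerve_realify sc] continuous_map_\<Psi>[OF V]]
  show "continuous_map R.N (R.tot (complexify V)) (\<Phi> V s)"
    by (rule continuous_map_eq) (simp add: \<Phi>_eq)
  have val: "\<Phi> V s (p, C, t) = (C p, \<phi> (dsum m V (realify (C p))) (snd (s (p, restrict (realify \<circ> C) {..p}, t))))"
    if d: "(p, C, t) \<in> topspace R.N" for p C t
  proof -
    have d': "(p, restrict (realify \<circ> C) {..p}, t) \<in> topspace O.N"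
      using nerve_realify_in[OF d] by (simp add: nerve_map_def)
    obtain x where x: "s (p, restrict (realify \<circ> C) {..p}, t) = (restrict (realify \<circ> C) {..p} p, x)"
      using O.section_value[OF V s d'] .
    have "C p \<in> topspace (R_poset m)"
      using d by (simp add: topspace_nerve mem_chains)
    then have "complexify (realify (C p)) = C p"
      by (rule complexify_realify)
    then show ?thesis
      using d x by (simp add: \<Phi>_eq \<Psi>_def nerve_map_def)
  qed
  show "\<Phi> V s \<in> sections m (R_poset m) G (complexify V)"
    unfolding sections_def
  proof (intro CollectI conjI)
    show "\<forall>(p, C, t)\<in>topspace R.N. fst (\<Phi> V s (p, C, t)) = C p"
      using val by auto
    show "\<forall>p q. \<forall>\<theta>\<in>{..q} \<rightarrow> {..p}. mono_on {..q} \<theta> \<longrightarrow>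
        (\<forall>C\<in>topspace (chains (R_poset m) p). \<forall>t\<in>standard_simplex q.
            snd (\<Phi> V s (p, C, simplex_push q \<theta> t)) =
            fmor G (dsum m (complexify V) (C (\<theta> q))) (dsum m (complexify V) (C p)) (incl (dsum m (complexify V) (C (\<theta> q))))
             (snd (\<Phi> V s (q, restrict (C \<circ> \<theta>) {..q}, t))))"
    proof (intro allI ballI impI)
      fix p q \<theta> C t
      assume \<theta>: "\<theta> \<in> {..q} \<rightarrow> {..p}" "mono_on {..q} \<theta>" and C: "C \<in> topspace (chains (R_poset m) p)"
        and t: "t \<in> standard_simplex q"
      have d: "(p, C, simplex_push q \<theta> t) \<in> topspace R.N" "(q, restrict (C \<circ> \<theta>) {..q}, t) \<in> topspace R.N"
        using simplex_push_in[OF \<theta>(1) t] restrict_chain[OF C \<theta>] C t by (auto simp: topspace_nerve)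
      define C' where "C' = restrict (realify \<circ> C) {..p}"
      have C': "C' \<in> topspace (chains (O_poset m) p)"
        using nerve_realify_in[OF d(1)] by (simp add: nerve_map_def C'_def topspace_nerve)
      have q: "\<theta> q \<le> p"
        using \<theta>(1) by auto
      have CC: "C i = complexify (C' i)" if "i \<le> p" for i
      proof -
        have "C i \<in> topspace (R_poset m)"
          using C that by (simp add: mem_chains)
        then show ?thesis
          using that complexify_realify[of "C i" m] by (simp add: C'_def)
      qed
      have re: "restrict (realify \<circ> restrict (C \<circ> \<theta>) {..q}) {..q} = restrict (C' \<circ> \<theta>) {..q}"
        using \<theta>(1) by (auto simp: C'_def fun_eq_iff restrict_def Pi_iff)
      have d2: "(q, restrict (C' \<circ> \<theta>) {..q}, t) \<in> topspace O.N"
        using restrict_chain[OF C' \<theta>] t by (simp add: topspace_nerve)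
      let ?x = "snd (s (q, restrict (C' \<circ> \<theta>) {..q}, t))"
      have x: "?x \<in> topspace (fobj E (dsum m V (C' (\<theta> q))))"
        using O.section_value[OF V s d2] by (metis atMost_iff comp_apply order_refl restrict_apply' snd_conv)
      have "snd (\<Phi> V s (p, C, simplex_push q \<theta> t)) = \<phi> (dsum m V (C' p)) (snd (s (p, C', simplex_push q \<theta> t)))"
        using val[OF d(1)] by (simp add: C'_def)
      also have "snd (s (p, C', simplex_push q \<theta> t))
          = fmor E (dsum m V (C' (\<theta> q))) (dsum m V (C' p)) (incl (dsum m V (C' (\<theta> q)))) ?x"
        using O.section_compat[OF _ \<theta> C' t] s by (simp add: O.mem_H)
      also have "\<phi> (dsum m V (C' p)) \<dots> = fmor G (dsum m (complexify V) (C (\<theta> q))) (dsum m (complexify V) (C p))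
          (incl (dsum m (complexify V) (C (\<theta> q)))) (\<phi> (dsum m V (C' (\<theta> q))) ?x)"
        using incl_fmor[OF V C' q x] CC[OF q] CC[OF order_refl] by simp
      also have "\<phi> (dsum m V (C' (\<theta> q))) ?x = snd (\<Phi> V s (q, restrict (C \<circ> \<theta>) {..q}, t))"
        using val[OF d(2)] q by (simp add: re) (simp add: C'_def)
      finally show "snd (\<Phi> V s (p, C, simplex_push q \<theta> t)) =
            fmor G (dsum m (complexify V) (C (\<theta> q))) (dsum m (complexify V) (C p)) (incl (dsum m (complexify V) (C (\<theta> q))))
             (snd (\<Phi> V s (q, restrict (C \<circ> \<theta>) {..q}, t)))" .
    qed
  qed
qed

text \<open>The values are lifted one by one through the inverse of the closed embedding
  \<open>\<Psi> V\<close>, whose continuity on the image keeps the lifted section continuous. The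
  simplicial compatibility of the lift follows from that of \<open>s'\<close> because
  \<open>\<phi>\<close> is injective.\<close>

lemma \<Phi>_lift:
  assumes V: "V \<in> jobj" and s': "s' \<in> topspace (fobj R.H (complexify V))"
    and val: "\<And>d. d \<in> topspace R.N \<Longrightarrow> s' d \<in> \<Psi> V ` topspace (O.tot V)"
  shows "\<exists>s \<in> topspace (fobj O.H V). \<Phi> V s = s'"
proof -
  obtain \<psi> where \<psi>: "continuous_map (subtopology (R.tot (complexify V)) (\<Psi> V ` topspace (O.tot V))) (O.tot V) \<psi>"
      and \<psi>\<Psi>: "\<And>e. e \<in> topspace (O.tot V) \<Longrightarrow> \<psi> (\<Psi> V e) = e"
    using closed_embedding_inverse[OF closed_embedding_\<Psi>[OF V]] by metis
  have \<Psi>\<psi>: "\<Psi> V (\<psi> (s' d)) = s' d" if "d \<in> topspace R.N" for d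
    using val[OF that] \<psi>\<Psi> by auto
  define s where "s = (\<lambda>d\<in>topspace O.N. \<psi> (s' (nerve_map complexify d)))"
  have \<Psi>s: "\<Psi> V (s d) = s' (nerve_map complexify d)" if "d \<in> topspace O.N" for d
    using that \<Psi>\<psi>[OF nerve_complexify_in[OF that]] by (simp add: s_def)
  have "\<Phi> V s = s'"
  proof
    fix d show "\<Phi> V s d = s' d"
    proof (cases "d \<in> topspace R.N")
      case True
      then show ?thesis
        using \<Psi>s[OF nerve_realify_in[OF True]] by (simp add: \<Phi>_eq nerve_complexify_realify)
    next
      case False
      then show ?thesis
        using s' extensional_arb[of s' "topspace R.N" d] by (simp add: \<Phi>_eq R.mem_H)
    qed
  qed
  moreover have "s \<in> topspace (fobj O.H V)"
    unfolding O.mem_H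
  proof (intro conjI)
    show "s \<in> extensional (topspace O.N)"
      by (simp add: s_def)
    have "continuous_map R.N (R.tot (complexify V)) s'"
      using s' by (simp add: R.mem_H)
    then have "continuous_map R.N (subtopology (R.tot (complexify V)) (\<Psi> V ` topspace (O.tot V))) s'"
      using val by (auto simp: continuous_map_in_subtopology)
    from continuous_map_compose[OF continuous_map_compose[OF continuous_map_nerve_complexify this] \<psi>]
    show sc: "continuous_map O.N (O.tot V) s"
      by (rule continuous_map_eq) (simp add: s_def)
    have sval: "fst (s (p, C, t)) = C p \<and> snd (s (p, C, t)) \<in> topspace (fobj E (dsum m V (C p))) \<and>
        \<phi> (dsum m V (C p)) (snd (s (p, C, t))) = snd (s' (p, restrict (complexify \<circ> C) {..p}, t))"
      if d: "(p, C, t) \<in> topspace O.N" for p C t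
    proof -
      have d': "(p, restrict (complexify \<circ> C) {..p}, t) \<in> topspace R.N"
        using nerve_complexify_in[OF d] by (simp add: nerve_map_def)
      have "s (p, C, t) \<in> topspace (O.tot V)"
        using sc d by (auto simp: continuous_map_def)
      then obtain U x where Ux: "s (p, C, t) = (U, x)" "x \<in> topspace (fobj E (dsum m V U))"
        by (auto simp: O.topspace_tot[OF V])
      have eq: "(complexify U, \<phi> (dsum m V U) x) = s' (p, restrict (complexify \<circ> C) {..p}, t)"
        using \<Psi>s[OF d] by (simp add: Ux \<Psi>_def nerve_map_def)
      moreover have "fst (s' (p, restrict (complexify \<circ> C) {..p}, t)) = complexify (C p)"
      proof -
        have "s' \<in> sections m (R_poset m) G (complexify V)"
          using s' by (simp add: R.mem_H)
        from R.section_fst[OF this d'] show ?thesis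
          by simp
      qed
      ultimately have "U = C p"
        by (metis complexify_inj fst_conv)
      then show ?thesis
        using Ux eq by (metis fst_conv snd_conv)
    qed
    show "s \<in> sections m (O_poset m) E V"
      unfolding sections_def
    proof (intro CollectI conjI)
      show "\<forall>(p, C, t)\<in>topspace O.N. fst (s (p, C, t)) = C p"
        using sval by auto
      show "\<forall>p q. \<forall>\<theta>\<in>{..q} \<rightarrow> {..p}. mono_on {..q} \<theta> \<longrightarrow>
        (\<forall>C\<in>topspace (chains (O_poset m) p). \<forall>t\<in>standard_simplex q.
            snd (s (p, C, simplex_push q \<theta> t)) =
            fmor E (dsum m V (C (\<theta> q))) (dsum m V (C p)) (incl (dsum m V (C (\<theta> q))))
             (snd (s (q, restrict (C \<circ> \<theta>) {..q}, t))))"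
      proof (intro allI ballI impI)
        fix p q \<theta> C t
        assume \<theta>: "\<theta> \<in> {..q} \<rightarrow> {..p}" "mono_on {..q} \<theta>" and C: "C \<in> topspace (chains (O_poset m) p)"
          and t: "t \<in> standard_simplex q"
        have d: "(p, C, simplex_push q \<theta> t) \<in> topspace O.N" "(q, restrict (C \<circ> \<theta>) {..q}, t) \<in> topspace O.N"
          using simplex_push_in[OF \<theta>(1) t] restrict_chain[OF C \<theta>] C t by (auto simp: topspace_nerve)
        have q: "\<theta> q \<le> p"
          using \<theta>(1) by auto
        define C' where "C' = restrict (complexify \<circ> C) {..p}"
        have C': "C' \<in> topspace (chains (R_poset m) p)"
          using nerve_complexify_in[OF d(1)] by (simp add: nerve_map_def C'_def topspace_nerve)
        have re: "restrict (complexify \<circ> restrict (C \<circ> \<theta>) {..q}) {..q} = restrict (C' \<circ> \<theta>) {..q}"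
          using \<theta>(1) by (auto simp: C'_def fun_eq_iff restrict_def Pi_iff)
        have U: "O.fobject (C (\<theta> q))" "O.fobject (C p)"
          using O.chain_fobject[OF C] q by auto
        let ?x = "snd (s (q, restrict (C \<circ> \<theta>) {..q}, t))"
        have x: "?x \<in> topspace (fobj E (dsum m V (C (\<theta> q))))"
          using sval[OF d(2)] by simp
        have "\<phi> (dsum m V (C p)) (snd (s (p, C, simplex_push q \<theta> t))) = snd (s' (p, C', simplex_push q \<theta> t))"
          using sval[OF d(1)] by (simp add: C'_def)
        also have "\<dots> = fmor G (dsum m (complexify V) (C' (\<theta> q))) (dsum m (complexify V) (C' p))
            (incl (dsum m (complexify V) (C' (\<theta> q)))) (snd (s' (q, restrict (C' \<circ> \<theta>) {..q}, t)))"
          using R.section_compat[OF _ \<theta> C' t] s' by (simp add: R.mem_H)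
        also have "snd (s' (q, restrict (C' \<circ> \<theta>) {..q}, t)) = \<phi> (dsum m V (C (\<theta> q))) ?x"
          using sval[OF d(2)] by (simp add: re)
        also have "fmor G (dsum m (complexify V) (C' (\<theta> q))) (dsum m (complexify V) (C' p))
            (incl (dsum m (complexify V) (C' (\<theta> q)))) (\<phi> (dsum m V (C (\<theta> q))) ?x)
            = \<phi> (dsum m V (C p)) (fmor E (dsum m V (C (\<theta> q))) (dsum m V (C p)) (incl (dsum m V (C (\<theta> q)))) ?x)"
          using incl_fmor[OF V C q x] q by (simp add: C'_def)
        finally show "snd (s (p, C, simplex_push q \<theta> t)) =
            fmor E (dsum m V (C (\<theta> q))) (dsum m V (C p)) (incl (dsum m V (C (\<theta> q)))) ?x"
        proof (rule \<phi>_inj[OF O.D_jobj[OF V U(2)], rotated 2])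
          show "snd (s (p, C, simplex_push q \<theta> t)) \<in> topspace (fobj E (dsum m V (C p)))"
            using sval[OF d(1)] by simp
          show "fmor E (dsum m V (C (\<theta> q))) (dsum m V (C p)) (incl (dsum m V (C (\<theta> q)))) ?x \<in> topspace (fobj E (dsum m V (C p)))"
            unfolding O.incl_dsum[OF U(1)]
            by (rule fmor_in[OF E O.D_jobj[OF V U(1)] O.D_jobj[OF V U(2)]
                  O.mor_sum_in[OF V V U O.incl_in[OF V] O.chain_incl[OF C q]] x])
        qed
      qed
    qed
  qed
  ultimately show ?thesis
    by blast
qed

text \<open>Membership in the image becomes a condition on each value. This serves both to show that
  the image is closed and to recognise it later as the set of sections fixed by conjugation.\<close>

lemma \<Phi>_image:
  assumes V: "V \<in> jobj"
  shows "\<Phi> V ` topspace (fobj O.H V)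
    = {s' \<in> topspace (fobj R.H (complexify V)). \<forall>d\<in>topspace R.N. s' d \<in> \<Psi> V ` topspace (O.tot V)}"
proof (intro equalityI subsetI)
  fix s' assume "s' \<in> \<Phi> V ` topspace (fobj O.H V)"
  then obtain s where s: "s \<in> topspace (fobj O.H V)" "s' = \<Phi> V s"
    by blast
  have "s d \<in> topspace (O.tot V)" if "d \<in> topspace O.N" for d
    using s(1) that by (auto simp: O.mem_H continuous_map_def)
  then show "s' \<in> {s' \<in> topspace (fobj R.H (complexify V)). \<forall>d\<in>topspace R.N. s' d \<in> \<Psi> V ` topspace (O.tot V)}"
    using s \<Phi>_in[OF V s(1)] nerve_realify_in by (auto simp: \<Phi>_eq)
next
  fix s' assume "s' \<in> {s' \<in> topspace (fobj R.H (complexify V)). \<forall>d\<in>topspace R.N. s' d \<in> \<Psi> V ` topspace (O.tot V)}"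
  then show "s' \<in> \<Phi> V ` topspace (fobj O.H V)"
    using \<Phi>_lift[OF V, of s'] by blast
qed

text \<open>The argument is first made for the compact-open topology: the inverse is composition
  with the inverse of \<open>\<Psi>\<close> and with the homeomorphism of nerves, and the image is
  an intersection of preimages of a closed set under evaluations. Only then is
  \<open>closed_embedding_kify\<close> applied.\<close>

lemma closed_embedding_\<Phi>:
  assumes V: "V \<in> jobj"
  shows "closed_embedding (fobj O.H V) (fobj R.H (complexify V)) (\<Phi> V)"
proof -
  let ?W = "complexify V"
  have W: "?W \<in> jobj"
    by (rule complexify_jobj[OF V])
  let ?X = "subtopology (compact_open O.N (O.tot V)) (sections m (O_poset m) E V)"
  let ?Y = "subtopology (compact_open R.N (R.tot ?W)) (sections m (R_poset m) G ?W)"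
  let ?T = "\<Psi> V ` topspace (O.tot V)"
  have topX: "topspace ?X = topspace (fobj O.H V)" and topY: "topspace ?Y = topspace (fobj R.H ?W)"
    by (simp_all add: holim_functor_def)
  have im: "\<Phi> V ` topspace ?X = {s' \<in> topspace ?Y. \<forall>d\<in>topspace R.N. s' d \<in> ?T}"
    unfolding topX topY by (rule \<Phi>_image[OF V])
  obtain \<psi> where \<psi>: "continuous_map (subtopology (R.tot ?W) ?T) (O.tot V) \<psi>"
      and \<psi>\<Psi>: "\<And>e. e \<in> topspace (O.tot V) \<Longrightarrow> \<psi> (\<Psi> V e) = e"
    using closed_embedding_inverse[OF closed_embedding_\<Psi>[OF V]] by metis
  let ?g = "\<lambda>s'. \<lambda>d\<in>topspace O.N. \<psi> (s' (nerve_map complexify d))"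
  have gf: "?g (\<Phi> V s) = s" if "s \<in> topspace ?X" for s
  proof
    fix d
    have s: "s \<in> extensional (topspace O.N)" "\<And>d. d \<in> topspace O.N \<Longrightarrow> s d \<in> topspace (O.tot V)"
      using that unfolding topX by (auto simp: O.mem_H continuous_map_def)
    show "?g (\<Phi> V s) d = s d"
    proof (cases "d \<in> topspace O.N")
      case True
      then show ?thesis
        using nerve_complexify_in[OF True] nerve_realify_complexify[OF True] \<psi>\<Psi>[OF s(2)[OF True]] by (simp add: \<Phi>_eq)
    next
      case False
      then show ?thesis
        using extensional_arb[OF s(1) False] by simp
    qed
  qed
  have "closed_embedding ?X ?Y (\<Phi> V)"
  proof (rule closed_embeddingI[where g = ?g])
    have "continuous_map (compact_open O.N (O.tot V)) (compact_open R.N (R.tot ?W)) (\<Phi> V)"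
    proof -
      have "subtopology (compact_open O.N (O.tot V)) {s. s ` topspace O.N \<subseteq> UNIV} = compact_open O.N (O.tot V)"
        by simp
      moreover have "continuous_map (subtopology (O.tot V) UNIV) (R.tot ?W) (\<Psi> V)"
        using continuous_map_\<Psi>[OF V] by simp
      ultimately have "continuous_map (compact_open O.N (O.tot V)) (compact_open R.N (R.tot ?W))
          (\<lambda>s. \<lambda>d\<in>topspace R.N. \<Psi> V (s (nerve_map realify d)))"
        using continuous_map_compact_open_compose[OF continuous_map_nerve_realify, of "O.tot V" UNIV "R.tot ?W" "\<Psi> V"]
        by metis
      then show ?thesis
        by (simp add: \<Phi>_eq[abs_def])
    qed
    moreover have "\<Phi> V \<in> topspace ?X \<rightarrow> sections m (R_poset m) G ?W"
      using \<Phi>_in[OF V] unfolding topX by (auto simp: R.mem_H)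
    ultimately show "continuous_map ?X ?Y (\<Phi> V)"
      by (simp only: continuous_map_in_subtopology continuous_map_from_subtopology simp_thms)
    let ?Y' = "subtopology (compact_open R.N (R.tot ?W)) {s. s ` topspace R.N \<subseteq> ?T}"
    have g: "continuous_map ?Y' (compact_open O.N (O.tot V)) ?g"
      by (rule continuous_map_compact_open_compose[OF continuous_map_nerve_complexify \<psi>])
    have "subtopology ?Y (\<Phi> V ` topspace ?X) = subtopology ?Y' (\<Phi> V ` topspace ?X)"
    proof -
      have "sections m (R_poset m) G ?W \<inter> \<Phi> V ` topspace ?X = \<Phi> V ` topspace ?X"
        "{s. s ` topspace R.N \<subseteq> ?T} \<inter> \<Phi> V ` topspace ?X = \<Phi> V ` topspace ?X"
        unfolding im by auto
      then show ?thesis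
        by (simp only: subtopology_subtopology)
    qed
    then have "continuous_map (subtopology ?Y (\<Phi> V ` topspace ?X)) (compact_open O.N (O.tot V)) ?g"
      using continuous_map_from_subtopology[OF g] by metis
    moreover have "?g s' \<in> sections m (O_poset m) E V" if s': "s' \<in> topspace (subtopology ?Y (\<Phi> V ` topspace ?X))" for s'
    proof -
      obtain s where "s \<in> topspace ?X" "s' = \<Phi> V s"
        using s' by auto
      then show ?thesis
        using gf[of s] by simp
    qed
    ultimately show "continuous_map (subtopology ?Y (\<Phi> V ` topspace ?X)) ?X ?g"
      unfolding continuous_map_in_subtopology by blast
    show "closedin ?Y (\<Phi> V ` topspace ?X)"
    \<comment> \<open>The locale also allows \<open>m = 0\<close>, where the nerve is empty; an
      intersection over the empty family would be all of the type instead of the space.\<close>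
    proof (cases "topspace R.N = {}")
      case True
      then have "{s' \<in> topspace ?Y. \<forall>d\<in>topspace R.N. s' d \<in> ?T} = topspace ?Y"
        by blast
      then show ?thesis
        by (simp only: im closedin_topspace)
    next
      case False
      have "closedin ?Y {s' \<in> topspace ?Y. s' d \<in> ?T}" if "d \<in> topspace R.N" for d
        by (rule closedin_continuous_map_preimage[OF continuous_map_from_subtopology[OF
              continuous_map_compact_open_eval[OF that]] closed_embedding_image_closedin[OF closed_embedding_\<Psi>[OF V]]])
      then have "closedin ?Y (\<Inter>d\<in>topspace R.N. {s' \<in> topspace ?Y. s' d \<in> ?T})"
        using False by (intro closedin_Inter) auto
      moreover have "(\<Inter>d\<in>topspace R.N. {s' \<in> topspace ?Y. s' d \<in> ?T}) = \<Phi> V ` topspace ?X"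
        unfolding im using False by blast
      ultimately show ?thesis
        by simp
    qed
  qed (rule gf)
  from closed_embedding_kify[OF this R.weak_Hausdorff_H[OF W]] show ?thesis
    by (simp add: holim_functor_def)
qed

text \<open>Makes the stagewise comparisons commute with the structure maps of the telescopes. It is
  naturality of \<open>\<phi>\<close> for the inclusion of \<open>V\<close> into the direct sum,
  whose complexification is again such an inclusion.\<close>

lemma \<Phi>_unit:
  assumes V: "V \<in> jobj" and y: "y \<in> topspace (fobj E V)"
  shows "\<Phi> V (holim_unit m (O_poset m) E V y) = holim_unit m (R_poset m) G (complexify V) (\<phi> V y)"
proof
  fix d show "\<Phi> V (holim_unit m (O_poset m) E V y) d = holim_unit m (R_poset m) G (complexify V) (\<phi> V y) d"
  proof (cases "d \<in> topspace R.N")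
    case True
    obtain p C t where d: "d = (p, C, t)"
      by (cases d)
    have r: "(p, restrict (realify \<circ> C) {..p}, t) \<in> topspace O.N"
      using nerve_realify_in[OF True] by (simp add: d nerve_map_def)
    have "C p \<in> topspace (R_poset m)"
      using True by (simp add: d topspace_nerve mem_chains)
    then obtain U where U: "U \<in> topspace (O_poset m)" "C p = complexify U"
      by (auto simp: topspace_R_poset)
    have "\<phi> (dsum m V U) (fmor E V (dsum m V U) (incl_sum m V) y)
        = fmor G (complexify V) (dsum m (complexify V) (complexify U)) (incl_sum m (complexify V)) (\<phi> V y)"
      using \<phi>_nat[OF V O.D_jobj[OF V O.fobject_P[OF U(1)]] O.incl_sum_in[OF V O.fobject_P[OF U(1)]] y]
      by (simp add: mor_complexify_incl_sum complexify_D[OF O.fobject_P[OF U(1)]])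
    then show ?thesis
      using True r U(2) by (simp add: \<Phi>_eq \<Psi>_def d holim_unit_def nerve_map_def)
  qed (simp add: \<Phi>_eq holim_unit_def)
qed

lemma \<Phi>_base: "V \<in> jobj \<Longrightarrow> \<Phi> V (fbase O.H V) = fbase R.H (complexify V)"
  using \<Phi>_unit[of V "fbase E V"] continuous_functorD(2)[OF E, of V] O.fbase_H[of V] R.fbase_H[of "complexify V"]
    \<phi>_base[of V] complexify_jobj[of V] by simp

lemma \<Phi>_nat:
  assumes V: "V \<in> jobj" and W: "W \<in> jobj" and f: "f \<in> jmor V W" and s: "s \<in> topspace (fobj O.H V)"
  shows "\<Phi> W (fmor O.H V W f s) = fmor R.H (complexify V) (complexify W) (mor_complexify V f) (\<Phi> V s)"
proof
  fix d show "\<Phi> W (fmor O.H V W f s) d = fmor R.H (complexify V) (complexify W) (mor_complexify V f) (\<Phi> V s) d"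
  proof (cases "d \<in> topspace R.N")
    case True
    have r: "nerve_map realify d \<in> topspace O.N"
      by (rule nerve_realify_in[OF True])
    have "s (nerve_map realify d) \<in> topspace (O.tot V)"
      using s r by (auto simp: O.mem_H continuous_map_def)
    then obtain U x where Ux: "s (nerve_map realify d) = (U, x)" "U \<in> topspace (O_poset m)" "x \<in> topspace (fobj E (dsum m V U))"
      by (auto simp: O.topspace_tot[OF V])
    have U: "O.fobject U"
      by (rule O.fobject_P[OF Ux(2)])
    show ?thesis
      using True r \<phi>_mor_sum[OF V W U U f O.fobject_incl[OF U] Ux(3)]
      by (simp add: \<Phi>_eq O.fmor_H R.fmor_H Ux(1) \<Psi>_def O.act_def R.act_def mor_complexify_incl)
  qed (simp add: \<Phi>_eq R.fmor_H)
qed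

end

lemma closed_embedding_relabel:
  assumes f: "closed_embedding X Y f" and e: "inj e" and e': "inj e'"
  shows "closed_embedding (final_topology e X) (final_topology e' Y) (\<lambda>x. e' (f (inv_into UNIV e x)))"
proof -
  have "homeomorphic_maps X (final_topology e X) e (inv_into UNIV e)"
  proof -
    obtain g where g: "homeomorphic_maps X (final_topology e X) e g"
      using homeomorphic_map_final_topology[of e X] e homeomorphic_map_maps by (metis inj_on_subset subset_UNIV)
    have "continuous_map (final_topology e X) X (inv_into UNIV e)"
    proof (rule continuous_map_eq)
      show "continuous_map (final_topology e X) X g"
        using g by (simp add: homeomorphic_maps_def)
      fix y assume "y \<in> topspace (final_topology e X)"
      then obtain x where "x \<in> topspace X" "y = e x"
        by auto
      then show "g y = inv_into UNIV e y"
        using g by (simp add: homeomorphic_maps_def inv_f_f[OF e])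
    qed
    then show ?thesis
      using g by (auto simp: homeomorphic_maps_def inv_f_f[OF e])
  qed
  then have "closed_embedding (final_topology e X) X (inv_into UNIV e)"
    by (intro homeomorphic_map_closed_embedding) (simp add: homeomorphic_maps_map)
  moreover have "closed_embedding Y (final_topology e' Y) e'"
    using e' by (intro homeomorphic_map_closed_embedding homeomorphic_map_final_topology) (auto simp: inj_on_def)
  ultimately show ?thesis
    using closed_embedding_compose[OF closed_embedding_compose[OF _ f]] unfolding comp_def by blast
qed


section \<open>The comparison of the Taylor approximations\<close>

text \<open>Conjugation negates the imaginary part, and \<open>f\<close> commutes with the scalar
  -1. Hence equivariance makes complexified isometries carry fixed points to fixed points.\<close>

lemma mor_conj_complexify:
  assumes "V \<in> jobj" and f: "f \<in> jmor V W"
  shows "mor_conj (complexify V) (mor_complexify V f) = mor_complexify V f"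
proof
  fix z
  show "mor_conj (complexify V) (mor_complexify V f) z = mor_complexify V f z"
  proof (cases "z \<in> complexify V")
    case True
    have im: "im_part z \<in> V" "re_part z \<in> V"
      using True by (auto simp: mem_complexify)
    have vz: "vconj z \<in> complexify V"
      using jobjD(3)[OF complexify_jobj[OF assms(1)] True] .
    have parts: "re_part (vconj z) = re_part z" "im_part (vconj z) = scale_fun (-1) (im_part z)"
      by (auto simp: vconj_def cconj_complex_def scale_fun_def)
    have "mor_complexify V f (vconj z) = cpx (f (re_part z)) (scale_fun (-1) (f (im_part z)))"
      unfolding mor_complexify_apply[OF vz] parts jmorD(4)[OF f im(1)] ..
    then show ?thesis
      using True by (auto simp: mor_conj_def mor_complexify_apply[OF True] vconj_def cconj_complex_def scale_fun_def complex_eq_iff)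
  qed (simp add: mor_conj_def mor_complexify_def)
qed

lemma reality_functorD:
  assumes "reality_functor F"
  shows "continuous_functor F" "V \<in> jobj \<Longrightarrow> continuous_map (fobj F V) (fobj F V) (conj_act F V)"
    "V \<in> jobj \<Longrightarrow> conj_act F V (fbase F V) = fbase F V"
    "V \<in> jobj \<Longrightarrow> W \<in> jobj \<Longrightarrow> f \<in> jmor V W \<Longrightarrow> x \<in> topspace (fobj F V) \<Longrightarrow>
      conj_act F W (fmor F V W f x) = fmor F V W (mor_conj V f) (conj_act F V x)"
  using assms by (auto simp: reality_functor_def C2_space_def)

lemma real_fixed_points_simps:
  "fobj (real_fixed_points F) V = fixed_points (fobj F (complexify V)) (conj_act F (complexify V))"
  "fbase (real_fixed_points F) V = fbase F (complexify V)"
  "fmor (real_fixed_points F) V W f = fmor F (complexify V) (complexify W) (mor_complexify V f)"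
  by (simp_all add: real_fixed_points_def)

lemma topspace_fixed_points: "topspace (fixed_points X \<sigma>) = {x \<in> topspace X. \<sigma> x = x}"
  by (auto simp: fixed_points_def)

lemma fixed_points_eq: "fixed_points X \<sigma> = subtopology X {x \<in> topspace X. \<sigma> x = x}"
proof -
  have "topspace X \<inter> {x. \<sigma> x = x} = {x \<in> topspace X. \<sigma> x = x}"
    by blast
  then show ?thesis
    using subtopology_restrict[of X "{x. \<sigma> x = x}"] by (simp only: fixed_points_def)
qed

text \<open>The base case of the comparison: at stage 0 the embedding is this inclusion, up to
  relabelling.\<close>

lemma closed_embedding_fixed_points:
  assumes "cgwh_space X" "continuous_map X X \<sigma>"
  shows "closed_embedding (fixed_points X \<sigma>) X (\<lambda>x. x)"
proof -
  have "closedin X {x \<in> topspace X. \<sigma> x = x}"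
    by (rule cgwh_closedin_fixed_points[OF assms])
  then show ?thesis
    unfolding closed_embedding_def fixed_points_eq
    by (auto simp: continuous_map_from_subtopology closed_map_def intro: closedin_trans_full)
qed

lemma continuous_functor_real_fixed_points:
  assumes F: "reality_functor F"
  shows "continuous_functor (real_fixed_points F)"
  unfolding continuous_functor_def based_space_def real_fixed_points_simps
proof (intro conjI ballI)
  note cF = reality_functorD(1)[OF F]
  fix V :: "(nat \<Rightarrow> real) set" assume V: "V \<in> jobj"
  note cV = complexify_jobj[OF V]
  let ?X = "\<lambda>V. fixed_points (fobj F (complexify V)) (conj_act F (complexify V))"
  show "cgwh_space (?X V)"
    using cgwh_closed_embedding_domain[OF closed_embedding_fixed_points] continuous_functorD(1)[OF cF cV]
      reality_functorD(2)[OF F cV] by blast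
  show "fbase F (complexify V) \<in> topspace (?X V)"
    using continuous_functorD(2)[OF cF cV] reality_functorD(3)[OF F cV] by (simp add: topspace_fixed_points)
  show "fmor F (complexify V) (complexify V) (mor_complexify V (incl V)) x = x" if "x \<in> topspace (?X V)" for x
    using that continuous_functorD(5)[OF cF cV] by (simp add: topspace_fixed_points mor_complexify_incl)
  fix W :: "(nat \<Rightarrow> real) set" assume W: "W \<in> jobj"
  note cW = complexify_jobj[OF W]
  show "fmor F (complexify V) (complexify W) (mor_complexify V f) (fbase F (complexify V)) = fbase F (complexify W)"
    if "f \<in> jmor V W" for f
    using continuous_functorD(4)[OF cF cV cW mor_complexify_jmor[OF that V W]] .
  let ?P = "prod_topology (jmor_top V W) (?X V)"
  have fixed: "conj_act F (complexify W) (fmor F (complexify V) (complexify W) (mor_complexify V f) x)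
      = fmor F (complexify V) (complexify W) (mor_complexify V f) x"
    if "f \<in> jmor V W" "x \<in> topspace (?X V)" for f x
    using reality_functorD(4)[OF F cV cW mor_complexify_jmor[OF that(1) V W]] that mor_conj_complexify[OF V that(1)]
    by (simp add: topspace_fixed_points)
  show "continuous_map ?P (?X W) (\<lambda>(f, x). fmor F (complexify V) (complexify W) (mor_complexify V f) x)"
    unfolding fixed_points_def[of "fobj F (complexify W)"] continuous_map_in_subtopology
  proof
    have "continuous_map ?P (fobj F (complexify W)) (\<lambda>z. fmor F (complexify V) (complexify W) (mor_complexify V (fst z)) (snd z))"
    proof (rule continuous_map_fmor[OF cF cV cW])
      show "continuous_map ?P (jmor_top (complexify V) (complexify W)) (\<lambda>z. mor_complexify V (fst z))"
        by (rule continuous_map_mor_complexify[OF continuous_map_fst V W])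
      show "continuous_map ?P (fobj F (complexify V)) snd"
        unfolding fixed_points_def by (rule continuous_map_into_fulltopology[OF continuous_map_snd])
    qed
    then show "continuous_map ?P (fobj F (complexify W)) (\<lambda>(f, x). fmor F (complexify V) (complexify W) (mor_complexify V f) x)"
      by (simp add: case_prod_unfold)
    show "(\<lambda>(f, x). fmor F (complexify V) (complexify W) (mor_complexify V f) x) \<in> topspace ?P \<rightarrow> {x. conj_act F (complexify W) x = x}"
      using fixed by (auto simp: topspace_jmor_top)
  qed
  fix X :: "(nat \<Rightarrow> real) set" and f g x
  assume X: "X \<in> jobj" and f: "f \<in> jmor V W" and g: "g \<in> jmor W X" and x: "x \<in> topspace (?X V)"
  show "fmor F (complexify V) (complexify X) (mor_complexify V (compose V g f)) x
      = fmor F (complexify W) (complexify X) (mor_complexify W g) (fmor F (complexify V) (complexify W) (mor_complexify V f) x)"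
    using continuous_functorD(6)[OF cF cV cW complexify_jobj[OF X] mor_complexify_jmor[OF f V W] mor_complexify_jmor[OF g W X]] x
    by (simp add: mor_complexify_compose[OF f] topspace_fixed_points)
qed

text \<open>At stage 0 the real functor already consists of points of \<open>F\<close>, so only the
  tree constructor changes type. Later stages unpack a section, compare it using the preceding stage
  on its values, and pack it again.\<close>

primrec stage_compare ::
    "nat \<Rightarrow> nat \<Rightarrow> (nat \<Rightarrow> real) set \<Rightarrow> (real, 'a) tower \<Rightarrow> (complex, 'a) tower" where
  "stage_compare m 0 = (\<lambda>V y. Base (inv_into UNIV Base y))"
| "stage_compare m (Suc k) = (\<lambda>V y. Node (holim_compare m (stage_compare m k) V (inv_into UNIV Node y)))"

lemma stage_R_simps:
  "fobj (stage_R n F 0) = fobj (relabel Base F)" "fbase (stage_R n F 0) = fbase (relabel Base F)"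
  "fmor (stage_R n F 0) = fmor (relabel Base F)"
  "conj_act (stage_R n F 0) = (\<lambda>V x. Base (conj_act F V (inv_into UNIV Base x)))"
  "fobj (stage_R n F (Suc k)) = fobj (relabel Node (holim_functor (n + 1) (R_poset (n + 1)) (stage_R n F k)))"
  "fbase (stage_R n F (Suc k)) = fbase (relabel Node (holim_functor (n + 1) (R_poset (n + 1)) (stage_R n F k)))"
  "fmor (stage_R n F (Suc k)) = fmor (relabel Node (holim_functor (n + 1) (R_poset (n + 1)) (stage_R n F k)))"
  by (simp_all add: relabel_C2_def tau_R_def relabel_def tfun.defs c2fun.defs)

lemma conj_act_stage_R_Suc:
  "conj_act (stage_R n F (Suc k)) V (Node s) = Node (\<lambda>d \<in> topspace (nerve_space (R_poset (n + 1))).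
     case s d of (U, x) \<Rightarrow> (U, conj_act (stage_R n F k) (dsum (n + 1) V U) x))"
  by (simp add: relabel_C2_def tau_R_def tfun.defs c2fun.defs inv_f_f[OF inj_Node])

locale reality_comparison =
  fixes n :: nat and F :: "(complex, 'a) c2fun"
  assumes F: "reality_functor F"
begin

abbreviation m :: nat where "m \<equiv> n + 1"
abbreviation SO :: "nat \<Rightarrow> (real, (real, 'a) tower) tfun" where "SO \<equiv> stage_O n (real_fixed_points F)"
abbreviation SR :: "nat \<Rightarrow> (complex, (complex, 'a) tower) c2fun" where "SR \<equiv> stage_R n F"
abbreviation \<phi> :: "nat \<Rightarrow> (nat \<Rightarrow> real) set \<Rightarrow> (real, 'a) tower \<Rightarrow> (complex, 'a) tower" where
  "\<phi> \<equiv> stage_compare m"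

sublocale O: holim_tower m "O_poset m" SO
  using frame_poset_O continuous_functor_relabel[OF inj_Base continuous_functor_real_fixed_points[OF F]]
  by (simp add: holim_tower_def holim_tower_axioms_def tau_O_def)

sublocale R: holim_tower m "R_poset m" SR
proof -
  have "continuous_functor (SR 0)"
    using continuous_functor_relabel[OF inj_Base reality_functorD(1)[OF F]]
      continuous_functor_cong[OF stage_R_simps(1-3)] by blast
  then show "holim_tower m (R_poset m) SR"
    unfolding holim_tower_def holim_tower_axioms_def using frame_poset_R stage_R_simps(5-7) by blast
qed

text \<open>The clause about images has to be part of the induction: a section at the next stage is
  fixed when all its values are, and these are points of the present stage.\<close>

definition stage_comparable :: "nat \<Rightarrow> bool" where
  "stage_comparable k \<longleftrightarrow> comparison (SO k) (SR k) (\<phi> k) \<and>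
    (\<forall>V \<in> jobj. \<phi> k V ` topspace (fobj (SO k) V)
      = {x \<in> topspace (fobj (SR k) (complexify V)). conj_act (SR k) (complexify V) x = x})"

lemma stage_comparable_0: "stage_comparable 0"
  unfolding stage_comparable_def
proof (intro conjI ballI)
  note cF = reality_functorD(1)[OF F]
  have \<phi>: "\<phi> 0 V (Base x) = Base x" for V x
    by (simp add: inv_f_f[OF inj_Base])
  show "comparison (SO 0) (SR 0) (\<phi> 0)"
  proof
    show "continuous_functor (SO 0)" "continuous_functor (SR 0)"
      by (rule O.continuous_functor_S R.continuous_functor_S)+
    fix V :: "(nat \<Rightarrow> real) set" assume V: "V \<in> jobj"
    note cV = complexify_jobj[OF V]
    have "closed_embedding (fixed_points (fobj F (complexify V)) (conj_act F (complexify V))) (fobj F (complexify V)) (\<lambda>x. x)"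
      by (rule closed_embedding_fixed_points[OF continuous_functorD(1)[OF cF cV] reality_functorD(2)[OF F cV]])
    from closed_embedding_relabel[OF this inj_Base inj_Base]
    show "closed_embedding (fobj (SO 0) V) (fobj (SR 0) (complexify V)) (\<phi> 0 V)"
      unfolding stage_R_simps by (simp add: relabel_def real_fixed_points_simps)
    show "\<phi> 0 V (fbase (SO 0) V) = fbase (SR 0) (complexify V)"
      unfolding stage_R_simps by (simp add: relabel_def real_fixed_points_simps inv_f_f[OF inj_Base])
    fix W :: "(nat \<Rightarrow> real) set" and f x
    assume "x \<in> topspace (fobj (SO 0) V)"
    then obtain y where "x = Base y"
      by (auto simp: relabel_def)
    then show "\<phi> 0 W (fmor (SO 0) V W f x) = fmor (SR 0) (complexify V) (complexify W) (mor_complexify V f) (\<phi> 0 V x)"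
      unfolding stage_R_simps by (simp add: relabel_def real_fixed_points_simps inv_f_f[OF inj_Base])
  qed
  fix V :: "(nat \<Rightarrow> real) set" assume "V \<in> jobj"
  show "\<phi> 0 V ` topspace (fobj (SO 0) V)
      = {x \<in> topspace (fobj (SR 0) (complexify V)). conj_act (SR 0) (complexify V) x = x}"
    unfolding stage_R_simps
    by (auto simp: relabel_def real_fixed_points_simps topspace_fixed_points inv_f_f[OF inj_Base] image_iff)
qed

text \<open>Conjugation acts on a section through its values and leaves the subspaces in place. A
  section is thus fixed exactly when each value is, which by the hypothesis at
  \<open>dsum m V U\<close> says that each value lies in the image of \<open>\<Psi>\<close>;
  \<open>\<Phi>_image\<close> then identifies these sections.\<close>

lemma stage_comparable_Suc:
  assumes k: "stage_comparable k"
  shows "stage_comparable (Suc k)"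
proof -
  interpret C: comparison m "SO k" "SR k" "\<phi> k"
    using k by (simp add: stage_comparable_def)
  have fixk: "\<phi> k V ` topspace (fobj (SO k) V)
      = {x \<in> topspace (fobj (SR k) (complexify V)). conj_act (SR k) (complexify V) x = x}" if "V \<in> jobj" for V
    using k that by (simp add: stage_comparable_def)
  have \<phi>: "\<phi> (Suc k) V (Node s) = Node (C.\<Phi> V s)" for V s
    by (simp add: inv_f_f[OF inj_Node])
  have SO_Suc: "fobj (SO (Suc k)) V = final_topology Node (fobj C.O.H V)"
      "fbase (SO (Suc k)) V = Node (fbase C.O.H V)"
      "fmor (SO (Suc k)) V W f (Node s) = Node (fmor C.O.H V W f s)" for V W f s
    unfolding O.S_Suc by (simp_all add: relabel_def inv_f_f[OF inj_Node])
  have SR_Suc: "fobj (SR (Suc k)) V = final_topology Node (fobj C.R.H V)"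
      "fbase (SR (Suc k)) V = Node (fbase C.R.H V)"
      "fmor (SR (Suc k)) V W f (Node s) = Node (fmor C.R.H V W f s)" for V W f s
    unfolding R.S_Suc by (simp_all add: relabel_def inv_f_f[OF inj_Node])
  show ?thesis
    unfolding stage_comparable_def
  proof (intro conjI ballI)
    show "comparison (SO (Suc k)) (SR (Suc k)) (\<phi> (Suc k))"
    proof
      show "continuous_functor (SO (Suc k))" "continuous_functor (SR (Suc k))"
        by (rule O.continuous_functor_S R.continuous_functor_S)+
      fix V :: "(nat \<Rightarrow> real) set" assume V: "V \<in> jobj"
      show "closed_embedding (fobj (SO (Suc k)) V) (fobj (SR (Suc k)) (complexify V)) (\<phi> (Suc k) V)"
        unfolding SO_Suc SR_Suc
        using closed_embedding_relabel[OF C.closed_embedding_\<Phi>[OF V] inj_Node inj_Node] by simp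
      show "\<phi> (Suc k) V (fbase (SO (Suc k)) V) = fbase (SR (Suc k)) (complexify V)"
        unfolding SO_Suc SR_Suc \<phi> C.\<Phi>_base[OF V] ..
      fix W :: "(nat \<Rightarrow> real) set" and f x
      assume W: "W \<in> jobj" and f: "f \<in> jmor V W" and x: "x \<in> topspace (fobj (SO (Suc k)) V)"
      obtain s where s: "s \<in> topspace (fobj C.O.H V)" "x = Node s"
        using x unfolding SO_Suc topspace_final_topology by blast
      show "\<phi> (Suc k) W (fmor (SO (Suc k)) V W f x)
          = fmor (SR (Suc k)) (complexify V) (complexify W) (mor_complexify V f) (\<phi> (Suc k) V x)"
        unfolding s(2) SO_Suc SR_Suc \<phi> C.\<Phi>_nat[OF V W f s(1)] ..
    qed
    fix V :: "(nat \<Rightarrow> real) set" assume V: "V \<in> jobj"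
    note cV = complexify_jobj[OF V]
    have fixed: "(\<forall>d\<in>topspace C.R.N. s d \<in> C.\<Psi> V ` topspace (C.O.tot V)) \<longleftrightarrow>
        conj_act (SR (Suc k)) (complexify V) (Node s) = Node s" if s: "s \<in> topspace (fobj C.R.H (complexify V))" for s
    proof -
      have pt: "s d \<in> C.\<Psi> V ` topspace (C.O.tot V) \<longleftrightarrow>
          (case s d of (U, x) \<Rightarrow> (U, conj_act (SR k) (dsum m (complexify V) U) x)) = s d"
        if d: "d \<in> topspace C.R.N" for d
      proof -
        have "s d \<in> topspace (C.R.tot (complexify V))"
          using s d unfolding C.R.mem_H continuous_map_def by blast
        then obtain U x where Ux: "s d = (complexify U, x)" "U \<in> topspace (O_poset m)"
            "x \<in> topspace (fobj (SR k) (dsum m (complexify V) (complexify U)))"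
          unfolding C.R.topspace_tot[OF cV] topspace_R_poset by blast
        have D: "dsum m V U \<in> jobj" "complexify (dsum m V U) = dsum m (complexify V) (complexify U)"
          using C.O.D_jobj[OF V C.O.fobject_P[OF Ux(2)]] C.complexify_D[OF C.O.fobject_P[OF Ux(2)]] by auto
        have "s d \<in> C.\<Psi> V ` topspace (C.O.tot V) \<longleftrightarrow> x \<in> \<phi> k (dsum m V U) ` topspace (fobj (SO k) (dsum m V U))"
        proof
          assume "s d \<in> C.\<Psi> V ` topspace (C.O.tot V)"
          then obtain U' y where y: "y \<in> topspace (fobj (SO k) (dsum m V U'))" "(complexify U, x) = C.\<Psi> V (U', y)"
            unfolding C.O.topspace_tot[OF V] Ux(1) by blast
          have "U' = U" "x = \<phi> k (dsum m V U') y"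
            using y(2) unfolding C.\<Psi>_def by (simp_all add: complexify_inj)
          then show "x \<in> \<phi> k (dsum m V U) ` topspace (fobj (SO k) (dsum m V U))"
            using y(1) by blast
        next
          assume "x \<in> \<phi> k (dsum m V U) ` topspace (fobj (SO k) (dsum m V U))"
          then obtain y where y: "y \<in> topspace (fobj (SO k) (dsum m V U))" "x = \<phi> k (dsum m V U) y"
            by blast
          then have "(U, y) \<in> topspace (C.O.tot V)" "s d = C.\<Psi> V (U, y)"
            unfolding C.O.topspace_tot[OF V] C.\<Psi>_def using Ux by auto
          then show "s d \<in> C.\<Psi> V ` topspace (C.O.tot V)"
            by blast
        qed
        also have "\<dots> \<longleftrightarrow> conj_act (SR k) (dsum m (complexify V) (complexify U)) x = x"
          using Ux(3) unfolding fixk[OF D(1)] D(2) by simp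
        finally show ?thesis
          by (simp add: Ux(1))
      qed
      have "conj_act (SR (Suc k)) (complexify V) (Node s) = Node s \<longleftrightarrow>
          (\<forall>d\<in>topspace C.R.N. (case s d of (U, x) \<Rightarrow> (U, conj_act (SR k) (dsum m (complexify V) U) x)) = s d)"
        unfolding conj_act_stage_R_Suc tower.inject
      proof
        assume eq: "(\<lambda>d\<in>topspace C.R.N. case s d of (U, x) \<Rightarrow> (U, conj_act (SR k) (dsum m (complexify V) U) x)) = s"
        show "\<forall>d\<in>topspace C.R.N. (case s d of (U, x) \<Rightarrow> (U, conj_act (SR k) (dsum m (complexify V) U) x)) = s d"
          using fun_cong[OF eq] by (metis (no_types, lifting) restrict_apply')
      next
        assume "\<forall>d\<in>topspace C.R.N. (case s d of (U, x) \<Rightarrow> (U, conj_act (SR k) (dsum m (complexify V) U) x)) = s d"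
        then show "(\<lambda>d\<in>topspace C.R.N. case s d of (U, x) \<Rightarrow> (U, conj_act (SR k) (dsum m (complexify V) U) x)) = s"
          \<comment> \<open>The conjugated section is a \<open>restrict\<close>, so equality with
            \<open>s\<close> also relies on \<open>s\<close> being extensional on the nerve.\<close>
          using s unfolding C.R.mem_H by (intro extensionalityI[of _ "topspace C.R.N"]) auto
      qed
      then show ?thesis
        using pt by blast
    qed
    have "\<phi> (Suc k) V ` topspace (fobj (SO (Suc k)) V) = Node ` C.\<Phi> V ` topspace (fobj C.O.H V)"
      unfolding SO_Suc by (simp add: image_image inv_f_f[OF inj_Node])
    also have "\<dots> = {x \<in> topspace (fobj (SR (Suc k)) (complexify V)). conj_act (SR (Suc k)) (complexify V) x = x}"
      unfolding C.\<Phi>_image[OF V] SR_Suc topspace_final_topology using fixed by blast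
    finally show "\<phi> (Suc k) V ` topspace (fobj (SO (Suc k)) V)
      = {x \<in> topspace (fobj (SR (Suc k)) (complexify V)). conj_act (SR (Suc k)) (complexify V) x = x}" .
  qed
qed

lemma stage_comparable: "stage_comparable k"
  by (induction k) (rule stage_comparable_0, rule stage_comparable_Suc)

lemma comparison_stage: "comparison (SO k) (SR k) (\<phi> k)"
  using stage_comparable by (simp add: stage_comparable_def)

lemma stage_image:
  "V \<in> jobj \<Longrightarrow> \<phi> k V ` topspace (fobj (SO k) V)
      = {x \<in> topspace (fobj (SR k) (complexify V)). conj_act (SR k) (complexify V) x = x}"
  using stage_comparable by (simp add: stage_comparable_def)

lemma stage_compare_map:
  assumes V: "V \<in> jobj" and x: "x \<in> topspace (fobj (SO k) V)"
  shows "\<phi> (Suc k) V (stage_map m (O_poset m) SO V k x) = stage_map m (R_poset m) SR (complexify V) k (\<phi> k V x)"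
proof -
  interpret C: comparison m "SO k" "SR k" "\<phi> k"
    by (rule comparison_stage)
  show ?thesis
    using C.\<Phi>_unit[OF V x] by (simp add: stage_map_def inv_f_f[OF inj_Node])
qed

section \<open>The comparison on telescopes\<close>

definition \<iota> :: "(nat \<Rightarrow> real) set \<Rightarrow> nat \<times> real \<times> (real, 'a) tower \<Rightarrow> nat \<times> real \<times> (complex, 'a) tower" where
  "\<iota> V = (\<lambda>(k, s, x). (k, s, \<phi> k V x))"

lemma T_O_eq: "T_O n (real_fixed_points F) = telescope_functor SO (stage_map m (O_poset m) SO)"
  by (simp add: T_O_def)

lemma T_R_simps:
  "fobj (T_R n F) V = R.tele V" "fbase (T_R n F) V = telescope_base (\<lambda>k. fbase (SR k) V)"
  "fmor (T_R n F) V W f = fmor (telescope_functor SR (stage_map m (R_poset m) SR)) V W f"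
  "conj_act (T_R n F) V = telescope_map (\<lambda>k. fbase (SR k) V) (stage_map m (R_poset m) SR V) (\<lambda>k. conj_act (SR k) V)"
  by (simp_all add: T_R_def Let_def tfun.defs c2fun.defs telescope_functor_def)

lemma stage_embedding:
  assumes "V \<in> jobj"
  shows "closed_embedding (fobj (SO k) V) (fobj (SR k) (complexify V)) (\<phi> k V)"
    "\<phi> k V (fbase (SO k) V) = fbase (SR k) (complexify V)"
  using comparison.\<phi>_emb[OF comparison_stage assms] comparison.\<phi>_base[OF comparison_stage assms] by auto

lemma closed_embedding_\<iota>:
  assumes V: "V \<in> jobj"
  shows "closed_embedding (O.tele V) (R.tele (complexify V)) (\<iota> V)"
    "\<iota> V ` topspace (O.tele V)
      = {p \<in> topspace (R.tele (complexify V)). snd (snd p) \<in> \<phi> (fst p) V ` topspace (fobj (SO (fst p)) V)}"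
  unfolding \<iota>_def
  by (rule closed_embedding_telescope[OF O.telescope_system[OF V] R.telescope_system[OF complexify_jobj[OF V]],
        of "\<lambda>k. \<phi> k V", OF stage_embedding[OF V] stage_compare_map[OF V]], assumption)+

lemma \<iota>_pt:
  assumes V: "V \<in> jobj" and x: "x \<in> topspace (fobj (SO k) V)"
  shows "\<iota> V (telescope_pt (\<lambda>k. fbase (SO k) V) (stage_map m (O_poset m) SO V) (k, s, x))
    = telescope_pt (\<lambda>k. fbase (SR k) (complexify V)) (stage_map m (R_poset m) SR (complexify V)) (k, s, \<phi> k V x)"
  unfolding \<iota>_def
  by (rule telescope_embedding_pt[OF O.telescope_system[OF V] R.telescope_system[OF complexify_jobj[OF V]],
        of "\<lambda>k. \<phi> k V", OF _ stage_embedding(2)[OF V] stage_compare_map[OF V] x])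
    (use stage_embedding(1)[OF V] in \<open>simp add: closed_embedding_def\<close>)

lemma \<iota>_base: "V \<in> jobj \<Longrightarrow> \<iota> V (telescope_base (\<lambda>k. fbase (SO k) V)) = telescope_base (\<lambda>k. fbase (SR k) (complexify V))"
  by (simp only: \<iota>_def telescope_base_def prod.case stage_embedding(2))

text \<open>Conjugation changes neither level nor height, so a normal form away from the base point
  is fixed exactly when its last entry is, and \<open>stage_image\<close> applies at that level. The
  base point is fixed because it is the image of the real base point.\<close>

lemma \<iota>_fixed:
  assumes V: "V \<in> jobj"
  shows "\<iota> V ` topspace (O.tele V) = {p \<in> topspace (R.tele (complexify V)). conj_act (T_R n F) (complexify V) p = p}"
proof -
  note cV = complexify_jobj[OF V]
  interpret Y: telescope_system "\<lambda>k. fobj (SR k) (complexify V)" "\<lambda>k. fbase (SR k) (complexify V)"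
      "stage_map m (R_poset m) SR (complexify V)"
    by (rule R.telescope_system[OF cV])
  let ?\<sigma> = "\<lambda>k. conj_act (SR k) (complexify V)" and ?b = "\<lambda>k. fbase (SR k) (complexify V)"
  have base_fixed: "?\<sigma> k (?b k) = ?b k" "?b k \<in> \<phi> k V ` topspace (fobj (SO k) V)" for k
  proof -
    show "?b k \<in> \<phi> k V ` topspace (fobj (SO k) V)"
      using continuous_functorD(2)[OF O.continuous_functor_S V, of k] stage_embedding(2)[OF V, of k] by (metis image_eqI)
    then show "?\<sigma> k (?b k) = ?b k"
      using stage_image[OF V, of k] by blast
  qed
  have "conj_act (T_R n F) (complexify V) p = p \<longleftrightarrow> snd (snd p) \<in> \<phi> (fst p) V ` topspace (fobj (SO (fst p)) V)"
    if p: "p \<in> topspace Y.tel" for p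
  proof (cases "p = telescope_base ?b")
    case True
    then show ?thesis
      using base_fixed[of 0] by (simp add: T_R_simps telescope_map_def telescope_base_def telescope_pt_def del: stage_R.simps)
  next
    case False
    then obtain k s x where ksx: "p = (k, s, x)" "0 \<le> s" "s < 1" "x \<in> topspace (fobj (SR k) (complexify V))" "x \<noteq> ?b k"
      using p[unfolded Y.mem_tel_iff] by blast
    have "conj_act (T_R n F) (complexify V) p = p \<longleftrightarrow> ?\<sigma> k x = x"
      using ksx by (auto simp: T_R_simps telescope_map_def telescope_pt_def telescope_base_def)
    then show ?thesis
      using ksx unfolding stage_image[OF V] by simp
  qed
  then show ?thesis
    unfolding closed_embedding_\<iota>(2)[OF V] by blast
qed

lemma \<iota>_nat:
  assumes V: "V \<in> jobj" and W: "W \<in> jobj" and f: "f \<in> jmor V W" and p: "p \<in> topspace (O.tele V)"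
  shows "fmor (T_R n F) (complexify V) (complexify W) (mor_complexify V f) (\<iota> V p)
    = \<iota> W (fmor (T_O n (real_fixed_points F)) V W f p)"
proof -
  obtain k s x where x: "x \<in> topspace (fobj (SO k) V)"
      "p = telescope_pt (\<lambda>k. fbase (SO k) V) (stage_map m (O_poset m) SO V) (k, s, x)"
    using O.tele_cases[OF V p] .
  have \<phi>x: "\<phi> k V x \<in> topspace (fobj (SR k) (complexify V))"
    using stage_embedding(1)[OF V, of k] x(1) by (auto simp: closed_embedding_def continuous_map_def)
  have "\<phi> k W (fmor (SO k) V W f x) = fmor (SR k) (complexify V) (complexify W) (mor_complexify V f) (\<phi> k V x)"
    by (rule comparison.\<phi>_nat[OF comparison_stage V W f x(1)])
  then show ?thesis
    unfolding x(2) \<iota>_pt[OF V x(1)] T_R_simps T_O_eq O.fmor_pt[OF V W f x(1)]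
      R.fmor_pt[OF complexify_jobj[OF V] complexify_jobj[OF W] mor_complexify_jmor[OF f V W] \<phi>x]
      \<iota>_pt[OF W fmor_in[OF O.continuous_functor_S V W f x(1)]]
    by simp
qed

lemma homeomorphic_map_\<iota>:
  assumes V: "V \<in> jobj"
  shows "homeomorphic_map (fobj (T_O n (real_fixed_points F)) V) (fobj (real_fixed_points (T_R n F)) V) (\<iota> V)"
proof -
  have "subtopology (R.tele (complexify V)) (\<iota> V ` topspace (O.tele V))
      = fixed_points (R.tele (complexify V)) (conj_act (T_R n F) (complexify V))"
    unfolding fixed_points_eq \<iota>_fixed[OF V] ..
  then show ?thesis
    using closed_embedding_homeomorphic_map[OF closed_embedding_\<iota>(1)[OF V]]
    by (simp only: real_fixed_points_simps T_R_simps(1) T_O_eq O.telescope_functor_simps(1))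
qed

theorem levelwise_weak_equivalence_\<iota>_inverse:
  "levelwise_weak_equivalence (real_fixed_points (T_R n F)) (T_O n (real_fixed_points F))
     (\<lambda>V. inv_into (topspace (O.tele V)) (\<iota> V))"
proof -
  let ?A = "T_O n (real_fixed_points F)" and ?B = "real_fixed_points (T_R n F)"
  let ?\<eta> = "\<lambda>V. inv_into (topspace (O.tele V)) (\<iota> V)"
  have A: "continuous_functor ?A"
    unfolding T_O_eq by (rule O.continuous_functor_telescope)
  have nat: "fmor ?B V W f (\<iota> V x) = \<iota> W (fmor ?A V W f x)"
    if "V \<in> jobj" "W \<in> jobj" "f \<in> jmor V W" "x \<in> topspace (fobj ?A V)" for V W f x
    unfolding real_fixed_points_simps
    by (rule \<iota>_nat[OF that(1-3)]) (use that(4) in \<open>simp only: T_O_eq O.telescope_functor_simps\<close>)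
  have base: "\<iota> V (fbase ?A V) = fbase ?B V" if "V \<in> jobj" for V
    unfolding real_fixed_points_simps T_R_simps(2) T_O_eq O.telescope_functor_simps(2) by (rule \<iota>_base[OF that])
  \<comment> \<open>Continuity of the fixed point functor is obtained from the real approximation
    along \<open>\<iota>\<close>, whose values on fixed points are homeomorphisms.\<close>
  have B: "continuous_functor ?B"
    by (rule continuous_functor_transport[OF A homeomorphic_map_\<iota> base nat])
  have topA: "topspace (fobj ?A V) = topspace (O.tele V)" for V
    by (simp only: T_O_eq O.telescope_functor_simps)
  have inj: "inj_on (\<iota> V) (topspace (fobj ?A V))" and im: "\<iota> V ` topspace (fobj ?A V) = topspace (fobj ?B V)"
    if "V \<in> jobj" for V
    using homeomorphic_map_\<iota>[OF that] by (auto simp: homeomorphic_eq_everything_map)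
  have \<eta>\<iota>: "?\<eta> V (\<iota> V x) = x" if "V \<in> jobj" "x \<in> topspace (fobj ?A V)" for V x
    using inv_into_f_f[OF inj[OF that(1)] that(2)] by (simp add: topA)
  have hom: "homeomorphic_map (fobj ?B V) (fobj ?A V) (?\<eta> V)" if V: "V \<in> jobj" for V
  proof -
    obtain g where g: "homeomorphic_maps (fobj ?A V) (fobj ?B V) (\<iota> V) g"
      using homeomorphic_map_\<iota>[OF V] homeomorphic_map_maps by blast
    then have "homeomorphic_map (fobj ?B V) (fobj ?A V) g"
      by (simp only: homeomorphic_maps_map)
    \<comment> \<open>The homeomorphism provides some inverse \<open>g\<close>; on the fixed points
      it agrees with \<open>inv_into\<close>, which is the form that can be written uniformly in
      \<open>V\<close>.\<close>
    moreover have "g y = ?\<eta> V y" if y: "y \<in> topspace (fobj ?B V)" for y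
    proof -
      obtain x where x: "x \<in> topspace (fobj ?A V)" "y = \<iota> V x"
        using y unfolding im[OF V, symmetric] by (rule imageE) (rule that)
      then have "g y = x"
        using g unfolding homeomorphic_maps_def by blast
      then show ?thesis
        using \<eta>\<iota>[OF V x(1)] unfolding x(2) by (rule trans[OF _ sym])
    qed
    ultimately show ?thesis
      by (rule homeomorphic_map_eq)
  qed
  have "?\<eta> V (fbase ?B V) = fbase ?A V" if V: "V \<in> jobj" for V
    using \<eta>\<iota>[OF V continuous_functorD(2)[OF A V]] base[OF V] by simp
  moreover have "?\<eta> W (fmor ?B V W f y) = fmor ?A V W f (?\<eta> V y)"
    if V: "V \<in> jobj" and W: "W \<in> jobj" and f: "f \<in> jmor V W" and y: "y \<in> topspace (fobj ?B V)" for V W f y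
  proof -
    obtain x where x: "x \<in> topspace (fobj ?A V)" "y = \<iota> V x"
      using y unfolding im[OF V, symmetric] by (rule imageE) (rule that)
    show ?thesis
      unfolding x(2) nat[OF V W f x(1)] \<eta>\<iota>[OF V x(1)] by (rule \<eta>\<iota>[OF W fmor_in[OF A V W f x(1)]])
  qed
  ultimately show ?thesis
    using A B hom homeomorphic_imp_continuous_map homeomorphic_map_imp_weak_equivalence
    unfolding levelwise_weak_equivalence_def orthogonal_transformation_def by blast
qed

end

theorem theorem3p3p2:
  fixes n :: nat and F :: "(complex, 'a) c2fun"
  assumes "reality_functor F" and "cofree_fibrant F"
  shows "\<exists>\<eta>. levelwise_weak_equivalence
           (real_fixed_points (T_R n F)) (T_O n (real_fixed_points F)) \<eta>"
proof -
  interpret reality_comparison n F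
    using assms(1) by unfold_locales
  show ?thesis
    using levelwise_weak_equivalence_\<iota>_inverse by blast
qed

end
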